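(* Let $c>0$, let $\varphi(x)=e^{-|x|}$ for $x\in\mathbb{R}$, and let $0<\varepsilon<\frac12$. Let $u_0\in H^s(\mathbb{R})$ for some $s>3/2$, and suppose that $y_0=u_0-\partial_x^2u_0$ is a nonnegative Radon measure of finite total mass on $\mathbb{R}$ and that $$\|u_0-c\varphi\|_X<c\,\varepsilon,\qquad |E_3(u_0)-E_3(c\varphi)|<c^3\varepsilon .$$ Let $u(t)$ be the corresponding solution of the Degasperis-Procesi equation with $u(0)=u_0$, and put $v(t,\cdot)=(4-\partial_x^2)^{-1}u(t,\cdot)$. Then $$\sup_{t\ge 0}\|u(t,\cdot)-c\varphi(\cdot-\xi_1(t))\|_X<3c\,\varepsilon^{1/4},$$ where $\xi_1(t)\in\mathbb{R}$ is the point at which the function $v(t,\cdot)$ attains its maximum. Moreover, for $t\ge0$ let $$M_1(t)=v(t,\xi_1(t))\ge M_2(t)\ge\cdots\ge M_n(t)\ge0\quad\text{and}\quad m_1(t)\ge\cdots\ge m_{n-1}(t)\ge0$$ be all local maxima and all local minima, respectively, of the nonnegative function $v(t,\cdot)$. Then $$\left|M_1(t)-\frac c6\right|\le c\sqrt{2\varepsilon}$$ and $$\sum_{i=2}^{n}\left(M_i^2(t)-m_{i-1}^2(t)\right)<2c^2\sqrt{\varepsilon}.$$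
   Context: The Degasperis-Procesi (DP) equation is $u_t-u_{txx}+4uu_x=3u_xu_{xx}+uu_{xxx}$ for $t>0$, $x\in\mathbb{R}$, understood in the form $$u_t+uu_x+\partial_x p*\left(\tfrac32u^2\right)=0,\qquad p(x)=\tfrac12e^{-|x|},$$ where $*$ denotes convolution in $x$. For $u_0\in H^s(\mathbb{R})$, $s>3/2$, with $u_0-\partial_x^2u_0\ge0$, it is known that there is a unique global solution $u\in C([0,\infty);H^s(\mathbb{R}))\cap C^1([0,\infty);H^{s-1}(\mathbb{R}))$ with $u(0)=u_0$; this is "the corresponding solution". $(4-\partial_x^2)^{-1}f=\frac14e^{-2|\cdot|}*f$ for $f\in L^2(\mathbb{R})$. For $f\in L^2(\mathbb{R})$, $\|f\|_X\ge0$ is defined by $$\|f\|_X^2=E_2(f)=\int_{\mathbb{R}}\big[(1-\partial_x^2)f\big]\,\big[(4-\partial_x^2)^{-1}f\big]\,dx=\int_{\mathbb{R}}\frac{1+\xi^2}{4+\xi^2}|\hat f(\xi)|^2\,d\xi,$$ with $\hat f$ the unitary Fourier transform. Also $E_3(f)=\int_{\mathbb{R}}f^3\,dx$. Convention on local extrema: for each $t$, the positive $C^2$ function $v(t,\cdot)$, which decays at $\pm\infty$, is taken to have a finite number $n=n(t)\ge1$ of local maximum points and $n-1$ local minimum points, which alternate along the line (starting and ending with a local maximum point). The values at the local maximum points, listed in nonincreasing order, are $M_1(t)\ge\cdots\ge M_n(t)$, and the values at the local minimum points, listed in nonincreasing order, are $m_1(t)\ge\cdots\ge m_{n-1}(t)$.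 When $n=1$ the sum in the last inequality is empty. The finiteness of $n$ is only relevant to the listing of the $M_i,m_i$. *)

theory Defs
  imports "HOL-Analysis.Analysis"
begin

text \<open>
  Elements of \<open>L\<^sup>2(\<real>)\<close> and of the Sobolev spaces are represented by Borel functions. All notions
  below depend only on the almost-everywhere class of the representative.
\<close>

definition L2 :: "(real \<Rightarrow> 'a::{real_normed_vector, second_countable_topology}) set" where
  "L2 = {f. f \<in> borel_measurable lborel \<and> integrable lborel (\<lambda>x. (norm (f x))\<^sup>2)}"

text \<open>
  The unitary Fourier transform on \<open>L\<^sup>2(\<real>)\<close>, as the \<open>L\<^sup>2\<close>-limit of the truncated integrals
  \<open>(2\<pi>)\<^bsup>-1/2\<^esup> \<integral>\<^bsub>-R\<^esub>\<^bsup>R\<^esup> e\<^bsup>-ix\<xi>\<^esup> f(x) dx\<close>. The limit is unique up to null sets. The distance is measured by a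
  nonnegative Lebesgue integral, so that it is infinite when the difference is not square integrable.
\<close>

definition truncated_fourier :: "real \<Rightarrow> (real \<Rightarrow> real) \<Rightarrow> real \<Rightarrow> complex" where
  "truncated_fourier R f \<xi> =
     complex_of_real (1 / sqrt (2 * pi)) * (CLINT x:{-R..R}|lborel. cis (- (x * \<xi>)) * complex_of_real (f x))"

definition is_fourier :: "(real \<Rightarrow> real) \<Rightarrow> (real \<Rightarrow> complex) \<Rightarrow> bool" where
  "is_fourier f g \<longleftrightarrow> g \<in> L2 \<and>
     ((\<lambda>R. \<integral>\<^sup>+ \<xi>. ennreal ((cmod (truncated_fourier R f \<xi> - g \<xi>))\<^sup>2) \<partial>lborel) \<longlongrightarrow> 0) at_top"

definition fourier :: "(real \<Rightarrow> real) \<Rightarrow> real \<Rightarrow> complex" where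
  "fourier f = (SOME g. is_fourier f g)"

text \<open>
  The space \<open>H\<^sup>s(\<real>)\<close>. As a set of square integrable functions this is the usual space for \<open>s \<ge> 0\<close>,
  the only range needed: it is used for \<open>s > 3/2\<close> and for \<open>s - 1 > 1/2\<close>.
\<close>

definition Hs :: "real \<Rightarrow> (real \<Rightarrow> real) set" where
  "Hs s = {f \<in> L2. integrable lborel (\<lambda>\<xi>. (1 + \<xi>\<^sup>2) powr s * (cmod (fourier f \<xi>))\<^sup>2)}"

definition Hs_norm :: "real \<Rightarrow> (real \<Rightarrow> real) \<Rightarrow> real" where
  "Hs_norm s f = sqrt (\<integral>\<xi>. (1 + \<xi>\<^sup>2) powr s * (cmod (fourier f \<xi>))\<^sup>2 \<partial>lborel)"

text \<open>Membership in \<open>C([0,\<infinity>); H\<^sup>s)\<close>, and the derivative of a curve in \<open>H\<^sup>s\<close> (one-sided at \<open>t = 0\<close>).\<close>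

definition Hs_continuous :: "real \<Rightarrow> (real \<Rightarrow> real \<Rightarrow> real) \<Rightarrow> bool" where
  "Hs_continuous s u \<longleftrightarrow> (\<forall>t\<ge>0. u t \<in> Hs s \<and>
     ((\<lambda>r. Hs_norm s (\<lambda>x. u r x - u t x)) \<longlongrightarrow> 0) (at t within {0..}))"

definition Hs_time_derivative :: "real \<Rightarrow> (real \<Rightarrow> real \<Rightarrow> real) \<Rightarrow> (real \<Rightarrow> real \<Rightarrow> real) \<Rightarrow> bool" where
  "Hs_time_derivative s u u' \<longleftrightarrow> (\<forall>t\<ge>0. u t \<in> Hs s \<and> u' t \<in> Hs s \<and>
     ((\<lambda>r. Hs_norm s (\<lambda>x. (u r x - u t x) / (r - t) - u' t x)) \<longlongrightarrow> 0) (at t within {0..}))"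

definition test_function :: "(real \<Rightarrow> real) \<Rightarrow> bool" where
  "test_function \<phi> \<longleftrightarrow>
     (\<forall>n. (deriv ^^ n) \<phi> differentiable_on UNIV) \<and> (\<exists>R. \<forall>x. R < \<bar>x\<bar> \<longrightarrow> \<phi> x = 0)"

definition locally_integrable :: "(real \<Rightarrow> real) \<Rightarrow> bool" where
  "locally_integrable f \<longleftrightarrow> (\<forall>R. set_integrable lborel {-R..R} f)"

definition has_weak_derivative :: "(real \<Rightarrow> real) \<Rightarrow> (real \<Rightarrow> real) \<Rightarrow> bool" where
  "has_weak_derivative f g \<longleftrightarrow> locally_integrable f \<and> locally_integrable g \<and>
     (\<forall>\<phi>. test_function \<phi> \<longrightarrow>
        (\<integral>x. f x * deriv \<phi> x \<partial>lborel) = - (\<integral>x. g x * \<phi> x \<partial>lborel))"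

definition conv :: "(real \<Rightarrow> real) \<Rightarrow> (real \<Rightarrow> real) \<Rightarrow> real \<Rightarrow> real" where
  "conv k f x = (\<integral>y. k (x - y) * f y \<partial>lborel)"

text \<open>
  The distribution \<open>f - \<partial>\<^sub>x\<^sup>2 f\<close> is (integration against) a nonnegative Borel measure of finite total
  mass; on the real line such a measure is automatically Radon.
\<close>

definition momentum_nonneg_finite_measure :: "(real \<Rightarrow> real) \<Rightarrow> bool" where
  "momentum_nonneg_finite_measure f \<longleftrightarrow>
     (\<exists>\<mu> :: real measure. sets \<mu> = sets borel \<and> finite_measure \<mu> \<and>
        (\<forall>\<phi>. test_function \<phi> \<longrightarrow>
           (\<integral>x. f x * (\<phi> x - (deriv ^^ 2) \<phi> x) \<partial>lborel) = (\<integral>x. \<phi> x \<partial>\<mu>)))"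

text \<open>
  A global solution \<open>u \<in> C([0,\<infinity>); H\<^sup>s) \<inter> C\<^sup>1([0,\<infinity>); H\<^bsup>s-1\<^esup>)\<close>, \<open>u(0) = u\<^sub>0\<close>, of the nonlocal form
  \<open>u\<^sub>t + u u\<^sub>x + \<partial>\<^sub>x p * (3/2 u\<^sup>2) = 0\<close> with \<open>p(x) = 1/2 e\<^bsup>-|x|\<^esup>\<close>. Here \<open>w = u\<^sub>x\<close> and
  \<open>q = \<partial>\<^sub>x (p * (3/2 u\<^sup>2))\<close>. Values at negative times are irrelevant.
\<close>

definition DP_solution :: "real \<Rightarrow> (real \<Rightarrow> real) \<Rightarrow> (real \<Rightarrow> real \<Rightarrow> real) \<Rightarrow> bool" where
  "DP_solution s u\<^sub>0 u \<longleftrightarrow>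
     Hs_continuous s u \<and> (AE x in lborel. u 0 x = u\<^sub>0 x) \<and>
     (\<exists>u'. Hs_time_derivative (s - 1) u u' \<and> Hs_continuous (s - 1) u' \<and>
        (\<forall>t>0. \<exists>w q. has_weak_derivative (u t) w \<and>
           has_weak_derivative (conv (\<lambda>x. 1/2 * exp (- \<bar>x\<bar>)) (\<lambda>x. 3/2 * (u t x)\<^sup>2)) q \<and>
           (AE x in lborel. u' t x + u t x * w x + q x = 0)))"

text \<open>The convolution operator \<open>(4 - \<partial>\<^sub>x\<^sup>2)\<^bsup>-1\<^esup>\<close> on \<open>L\<^sup>2\<close>.\<close>

definition resolvent4 :: "(real \<Rightarrow> real) \<Rightarrow> real \<Rightarrow> real" where
  "resolvent4 f = conv (\<lambda>x. 1/4 * exp (- 2 * \<bar>x\<bar>)) f"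

text \<open>
  \<open>E\<^sub>2(f) = \<integral> [(1 - \<partial>\<^sub>x\<^sup>2)f] [(4 - \<partial>\<^sub>x\<^sup>2)\<^bsup>-1\<^esup> f] dx\<close>. For \<open>f \<in> L\<^sup>2\<close> the first factor is only a distribution
  in \<open>H\<^bsup>-2\<^esup>\<close>, so the integral is a duality pairing, given on the Fourier side by the formula below.
\<close>

definition E2 :: "(real \<Rightarrow> real) \<Rightarrow> real" where
  "E2 f = (\<integral>\<xi>. (1 + \<xi>\<^sup>2) / (4 + \<xi>\<^sup>2) * (cmod (fourier f \<xi>))\<^sup>2 \<partial>lborel)"

definition normX :: "(real \<Rightarrow> real) \<Rightarrow> real" where
  "normX f = sqrt (E2 f)"

definition E3 :: "(real \<Rightarrow> real) \<Rightarrow> real" where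
  "E3 f = (\<integral>x. (f x) ^ 3 \<partial>lborel)"

definition peakon :: "real \<Rightarrow> real" where
  "peakon x = exp (- \<bar>x\<bar>)"

definition local_max_point :: "(real \<Rightarrow> real) \<Rightarrow> real \<Rightarrow> bool" where
  "local_max_point f x \<longleftrightarrow> (\<forall>\<^sub>F y in nhds x. f y \<le> f x)"

definition local_min_point :: "(real \<Rightarrow> real) \<Rightarrow> real \<Rightarrow> bool" where
  "local_min_point f x \<longleftrightarrow> (\<forall>\<^sub>F y in nhds x. f x \<le> f y)"

text \<open>
  \<open>xs\<close> and \<open>ys\<close> list, from left to right, the finitely many local maximum points and local minimum
  points of \<open>f\<close>, and these alternate, starting and ending with a local maximum point.
\<close>

definition alternating_extrema :: "(real \<Rightarrow> real) \<Rightarrow> real list \<Rightarrow> real list \<Rightarrow> bool" where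
  "alternating_extrema f xs ys \<longleftrightarrow>
     set xs = {x. local_max_point f x} \<and> set ys = {y. local_min_point f y} \<and>
     length xs = length ys + 1 \<and>
     (\<forall>i<length ys. xs ! i < ys ! i \<and> ys ! i < xs ! (i + 1))"

text \<open>
  The \<open>i\<close>-th largest (counting from 1, with multiplicity) of the values of \<open>f\<close> at the points \<open>xs\<close>;
  meaningful for \<open>1 \<le> i \<le> length xs\<close>.
\<close>

definition ordered_value :: "(real \<Rightarrow> real) \<Rightarrow> real list \<Rightarrow> nat \<Rightarrow> real" where
  "ordered_value f xs i = rev (sort (map f xs)) ! (i - 1)"

end

theory Submission
  imports Defs "HOL-Computational_Algebra.Polynomial"
begin

text \<open>
  The proof rests on two conservation laws, on the persistence of a sign, and on one inequality
  between three numbers attached to a profile.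

  Let \<open>u\<close> be a profile with \<open>u - u'' \<ge> 0\<close>, let \<open>v = (4 - \<partial>\<^sup>2)\<^sup>-\<^sup>1 u\<close> and \<open>M = max v\<close>. The
  function \<open>g = 2v + v'' - 3|v'|\<close> vanishes identically when \<open>u\<close> is a peakon, and with
  \<open>h = 16v - v'' - 6|v'|\<close> exact derivatives integrate away to give
  \<open>\<integral> g\<^sup>2 = E\<^sub>2 - 12 \<integral> v|v'|\<close> and \<open>\<integral> h g\<^sup>2 = E\<^sub>3 - 216 \<integral> v\<^sup>2|v'|\<close>. The sign of \<open>u - u''\<close> makes
  \<open>e\<^sup>x u\<close> nondecreasing and \<open>e\<^bsup>-x\<^esup> u\<close> nonincreasing, hence \<open>u \<le> 6v - 3|v'|\<close>, which is the same as
  \<open>v'' \<ge> -2v + 3|v'|\<close> and yields \<open>h \<le> 18M\<close>. As \<open>v\<close> rises from 0 to \<open>M\<close> and falls back to 0, the integral of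
  \<open>v|v'|(M - v)\<close> is at least \<open>M\<^sup>3/3\<close>. Altogether \<open>E\<^sub>3 \<le> 18 M E\<^sub>2 - 72 M\<^sup>3\<close> (\<open>cubic_le_energy_max\<close>). For
  \<open>E\<^sub>2 = c\<^sup>2/3\<close> and \<open>E\<^sub>3 = 2c\<^sup>3/3\<close>, the values of the peakon, this reads \<open>(M - c/6)\<^sup>2 (M + c/3) \<le> 0\<close>; for nearby
  values \<open>M - c/6\<close> is of order \<open>c \<surd>\<epsilon>\<close>. Pairing with a peakon evaluates \<open>v\<close>, so
  \<open>\<parallel>u - c \<phi>(\<cdot> - \<xi>)\<parallel>\<^sup>2 = E\<^sub>2(u) - 4c v(\<xi>) + c\<^sup>2/3\<close> (\<open>E2_diff_peakon\<close>), which is small at the maximum point. The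
  alternating sum of squares over the extrema is at most \<open>\<integral> v|v'| \<le> E\<^sub>2/12\<close>, since the fundamental theorem of
  calculus applies between consecutive extrema.

  \<open>E\<^sub>2\<close> and \<open>E\<^sub>3\<close> are constant along the flow because the quadratic and the cubic flux are exact
  derivatives in space; the solution is differentiable in time as a curve in \<open>L\<^sup>2\<close> and bounded, which is
  enough to differentiate both functionals.

  That \<open>u - u\<^sub>x\<^sub>x\<close> stays nonnegative needs a separate argument. The momentum \<open>y = u - u\<^sub>x\<^sub>x\<close> solves \<open>y\<^sub>t + u y\<^sub>x + 3 u\<^sub>x y = 0\<close>, but for \<open>s\<close> close to
  \<open>3/2\<close> it is only a distribution. Its pairing with a nonnegative test function \<open>\<psi>\<close> at time \<open>t + h\<close> is compared with
  the pairing at time \<open>t\<close> with the transported function \<open>\<psi>(x + hG)(1 - 2hG')\<close>, which is again a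
  nonnegative test function. The velocity \<open>G\<close> is the part of \<open>u(t)\<close> with frequencies at most \<open>N\<close>.
  After integration by parts, the most dangerous terms in the error made by replacing \<open>u\<close> by \<open>G\<close> contain two
  factors from the high frequencies. For \<open>s \<le> 2\<close>, as may be assumed, the error per unit of time is of order
  \<open>N\<^bsup>3 - 2s\<^esup>\<close>, and it tends to 0 exactly because \<open>s > 3/2\<close> (\<open>one_step\<close>, \<open>momentum_nonneg_persists\<close>).

  Both \<open>E\<^sub>2\<close> and the Sobolev norms are defined by the unitary Fourier transform. The inequality
  \<open>\<parallel>Ff\<parallel> \<le> \<parallel>f\<parallel>\<close> comes from damping the transform by \<open>e\<^bsup>-d|\<xi>|\<^esup>\<close>, which amounts to convolution with the Poisson kernel;
  it gives the existence of the transform on \<open>L\<^sup>2\<close>, and inversion follows by testing against intervals. Functions in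
  \<open>H\<^sup>s\<close>, \<open>s > 3/2\<close>, then have a continuously differentiable representative, given by the inversion formula.
\<close>

section \<open>Square integrable functions on the line\<close>

definition l2 :: "(real \<Rightarrow> 'a::real_normed_vector) \<Rightarrow> real" where
  "l2 f = sqrt (LBINT x. (norm (f x))\<^sup>2)"

lemma L2D: assumes "f \<in> L2" shows "f \<in> borel_measurable lborel" "integrable lborel (\<lambda>x. (norm (f x))\<^sup>2)"
  using assms by (auto simp: L2_def)

lemma l2_nonneg[simp]: "0 \<le> l2 f" by (simp add: l2_def)

lemma l2_power2: "(l2 f)\<^sup>2 = (LBINT x. (norm (f x))\<^sup>2)" by (simp add: l2_def)

lemma L2_dominated:
  fixes f :: "real \<Rightarrow> 'a::{real_normed_vector,second_countable_topology}" and g :: "real \<Rightarrow> 'b::{real_normed_vector,second_countable_topology}"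
  assumes "g \<in> L2" "f \<in> borel_measurable lborel" "\<And>x. norm (f x) \<le> norm (g x)"
  shows "f \<in> L2" "l2 f \<le> l2 g"
proof -
  have 1: "integrable lborel (\<lambda>x. (norm (f x))\<^sup>2)"
    by (rule Bochner_Integration.integrable_bound[OF L2D(2)[OF assms(1)]]) (use assms in \<open>auto intro!: power_mono\<close>)
  then show "f \<in> L2" using assms by (simp add: L2_def)
  show "l2 f \<le> l2 g" unfolding l2_def
    by (intro real_sqrt_le_mono integral_mono 1 L2D assms power_mono) auto
qed

lemma L2_scale:
  fixes f :: "real \<Rightarrow> 'a::{real_normed_algebra,second_countable_topology}" and C :: real
  assumes "g \<in> L2" "f \<in> borel_measurable lborel" "0 \<le> C" "\<And>x. norm (f x) \<le> C * norm (g x)"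
  shows "f \<in> L2" "l2 f \<le> C * l2 g"
proof -
  have i: "integrable lborel (\<lambda>x. C\<^sup>2 * (norm (g x))\<^sup>2)" using L2D[OF assms(1)] by simp
  have b: "(norm (f x))\<^sup>2 \<le> C\<^sup>2 * (norm (g x))\<^sup>2" for x
    using assms(4)[of x] by (metis norm_ge_zero power_mono power_mult_distrib)
  have 1: "integrable lborel (\<lambda>x. (norm (f x))\<^sup>2)"
    by (rule Bochner_Integration.integrable_bound[OF i]) (use assms b in auto)
  then show "f \<in> L2" using assms by (simp add: L2_def)
  have "(l2 f)\<^sup>2 \<le> (C * l2 g)\<^sup>2"
    unfolding l2_power2 power_mult_distrib using integral_mono[OF 1 i b] by simp
  then show "l2 f \<le> C * l2 g" using power2_le_imp_le assms(3) by (metis l2_nonneg mult_nonneg_nonneg)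
qed

lemma L2_cong_AE:
  fixes f g :: "real \<Rightarrow> 'a::{real_normed_vector,second_countable_topology}"
  assumes "f \<in> L2" "g \<in> borel_measurable lborel" "AE x in lborel. f x = g x"
  shows "g \<in> L2" "l2 g = l2 f"
proof -
  have [measurable]: "f \<in> borel_measurable lborel" "g \<in> borel_measurable lborel" using assms by (auto simp: L2_def)
  have "integrable lborel (\<lambda>x. (norm (g x))\<^sup>2) \<longleftrightarrow> integrable lborel (\<lambda>x. (norm (f x))\<^sup>2)"
    by (rule integrable_cong_AE) (use assms(3) in auto)
  then show "g \<in> L2" using assms by (auto simp: L2_def)
  show "l2 g = l2 f" unfolding l2_def
    by (rule arg_cong[where f=sqrt], rule integral_cong_AE) (use assms(3) in auto)
qed

lemma L2_mult_integrable:
  fixes f g :: "real \<Rightarrow> 'a::{real_normed_field,banach,second_countable_topology}"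
  assumes "f \<in> L2" "g \<in> L2" shows "integrable lborel (\<lambda>x. f x * g x)"
proof -
  have "integrable lborel (\<lambda>x. (norm (f x))\<^sup>2 + (norm (g x))\<^sup>2)" using assms by (auto simp: L2_def)
  then show ?thesis
  proof (rule Bochner_Integration.integrable_bound)
    show "(\<lambda>x. f x * g x) \<in> borel_measurable lborel" using assms by (auto simp: L2_def)
    have "norm (f x) * norm (g x) \<le> (norm (f x))\<^sup>2 + (norm (g x))\<^sup>2" for x
    proof -
      have "0 \<le> norm (f x) * norm (g x)" by simp
      then show ?thesis using sum_squares_bound[of "norm (f x)" "norm (g x)"] by linarith
    qed
    then show "AE x in lborel. norm (f x * g x) \<le> norm ((norm (f x))\<^sup>2 + (norm (g x))\<^sup>2)"
      by (auto simp: norm_mult)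
  qed
qed

lemma L2_Cauchy_Schwarz:
  fixes f g :: "real \<Rightarrow> 'a::{real_normed_field,banach,second_countable_topology}"
  assumes "f \<in> L2" "g \<in> L2"
  shows "(LBINT x. norm (f x) * norm (g x)) \<le> l2 f * l2 g"
    and "norm (LBINT x. f x * g x) \<le> l2 f * l2 g"
proof -
  have [measurable]: "f \<in> borel_measurable lborel" "g \<in> borel_measurable lborel" using assms by (auto simp: L2_def)
  have i: "integrable lborel (\<lambda>x. norm (f x) * norm (g x))"
    using integrable_norm[OF L2_mult_integrable[OF assms]] by (simp add: norm_mult)
  have "(\<integral>\<^sup>+x. ennreal (norm (f x)) * ennreal (norm (g x)) \<partial>lborel)\<^sup>2
     \<le> (\<integral>\<^sup>+x. (ennreal (norm (f x)))\<^sup>2 \<partial>lborel) * (\<integral>\<^sup>+x. (ennreal (norm (g x)))\<^sup>2 \<partial>lborel)"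
    by (rule Cauchy_Schwarz_nn_integral) auto
  also have "(\<integral>\<^sup>+x. (ennreal (norm (f x)))\<^sup>2 \<partial>lborel) = ennreal ((l2 f)\<^sup>2)"
    unfolding l2_power2 using nn_integral_eq_integral[OF L2D(2)[OF assms(1)]] by (simp add: ennreal_power)
  also have "(\<integral>\<^sup>+x. (ennreal (norm (g x)))\<^sup>2 \<partial>lborel) = ennreal ((l2 g)\<^sup>2)"
    unfolding l2_power2 using nn_integral_eq_integral[OF L2D(2)[OF assms(2)]] by (simp add: ennreal_power)
  also have "(\<integral>\<^sup>+x. ennreal (norm (f x)) * ennreal (norm (g x)) \<partial>lborel) = ennreal (LBINT x. norm (f x) * norm (g x))"
    using nn_integral_eq_integral[OF i] by (simp add: ennreal_mult)
  finally have "(LBINT x. norm (f x) * norm (g x))\<^sup>2 \<le> (l2 f * l2 g)\<^sup>2"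
    by (simp add: ennreal_power ennreal_mult[symmetric] power_mult_distrib)
  then show 1: "(LBINT x. norm (f x) * norm (g x)) \<le> l2 f * l2 g"
    by (rule power2_le_imp_le) simp
  have "norm (LBINT x. f x * g x) \<le> (LBINT x. norm (f x * g x))" by (rule integral_norm_bound)
  then show "norm (LBINT x. f x * g x) \<le> l2 f * l2 g" using 1 by (simp add: norm_mult)
qed

lemma L2_add:
  fixes f g :: "real \<Rightarrow> 'a::{real_normed_field,banach,second_countable_topology}"
  assumes "f \<in> L2" "g \<in> L2" shows "(\<lambda>x. f x + g x) \<in> L2" "l2 (\<lambda>x. f x + g x) \<le> l2 f + l2 g"
proof -
  have [measurable]: "f \<in> borel_measurable lborel" "g \<in> borel_measurable lborel" using assms by (auto simp: L2_def)
  note ii = L2D(2)[OF assms(1)] L2D(2)[OF assms(2)]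
  have i: "integrable lborel (\<lambda>x. norm (f x) * norm (g x))"
    using integrable_norm[OF L2_mult_integrable[OF assms]] by (simp add: norm_mult)
  have j: "integrable lborel (\<lambda>x. (norm (f x))\<^sup>2 + 2 * (norm (f x) * norm (g x)) + (norm (g x))\<^sup>2)"
    using ii i by auto
  have b: "(norm (f x + g x))\<^sup>2 \<le> (norm (f x))\<^sup>2 + 2 * (norm (f x) * norm (g x)) + (norm (g x))\<^sup>2" for x
    using power_mono[OF norm_triangle_ineq[of "f x" "g x"], of 2] by (simp add: power2_sum algebra_simps)
  have k: "integrable lborel (\<lambda>x. (norm (f x + g x))\<^sup>2)"
    by (rule Bochner_Integration.integrable_bound[OF j]) (use b in auto)
  then show "(\<lambda>x. f x + g x) \<in> L2" by (simp add: L2_def)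
  have "(l2 (\<lambda>x. f x + g x))\<^sup>2 \<le> (LBINT x. (norm (f x))\<^sup>2 + 2 * (norm (f x) * norm (g x)) + (norm (g x))\<^sup>2)"
    unfolding l2_power2 by (rule integral_mono[OF k j b])
  also have "\<dots> = (l2 f)\<^sup>2 + 2 * (LBINT x. norm (f x) * norm (g x)) + (l2 g)\<^sup>2"
    unfolding l2_power2 using ii i by simp
  also have "\<dots> \<le> (l2 f + l2 g)\<^sup>2" using L2_Cauchy_Schwarz(1)[OF assms] by (simp add: power2_sum)
  finally show "l2 (\<lambda>x. f x + g x) \<le> l2 f + l2 g" by (rule power2_le_imp_le) simp
qed

lemma L2_cmult:
  fixes f :: "real \<Rightarrow> 'a::{real_normed_field,banach,second_countable_topology}"
  assumes "f \<in> L2" shows "(\<lambda>x. c * f x) \<in> L2" "l2 (\<lambda>x. c * f x) = norm c * l2 f"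
  using assms by (auto simp: L2_def l2_def norm_mult power_mult_distrib real_sqrt_mult)

lemma L2_diff:
  fixes f g :: "real \<Rightarrow> 'a::{real_normed_field,banach,second_countable_topology}"
  assumes "f \<in> L2" "g \<in> L2" shows "(\<lambda>x. f x - g x) \<in> L2" "l2 (\<lambda>x. f x - g x) \<le> l2 f + l2 g"
  using L2_add[OF assms(1) L2_cmult(1)[OF assms(2), of "-1"]] L2_cmult(2)[OF assms(2), of "-1"] by simp_all

lemma L2_mult_bounded:
  fixes f g :: "real \<Rightarrow> 'a::{real_normed_field,banach,second_countable_topology}"
  assumes "f \<in> L2" "g \<in> borel_measurable lborel" "\<And>x. norm (g x) \<le> C"
  shows "(\<lambda>x. g x * f x) \<in> L2" "l2 (\<lambda>x. g x * f x) \<le> C * l2 f"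
proof -
  have m: "(\<lambda>x. g x * f x) \<in> borel_measurable lborel" using assms by (auto simp: L2_def)
  have "0 \<le> C" using assms(3)[of 0] norm_ge_zero order_trans by blast
  moreover have "norm (g x * f x) \<le> C * norm (f x)" for x
    by (simp add: norm_mult mult_right_mono assms(3))
  ultimately show "(\<lambda>x. g x * f x) \<in> L2" "l2 (\<lambda>x. g x * f x) \<le> C * l2 f"
    using L2_scale[OF assms(1) m] by blast+
qed

text \<open>Both factors may vary: difference quotients in time are paired with functions that depend on time as well.\<close>

lemma L2_tendsto_integral_mult:
  fixes f :: "'i \<Rightarrow> real \<Rightarrow> 'a::{real_normed_field,banach,second_countable_topology}"
  assumes "eventually (\<lambda>i. f i \<in> L2) F" "g \<in> L2" "eventually (\<lambda>i. h i \<in> L2) F" "k \<in> L2"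
    and "((\<lambda>i. l2 (\<lambda>x. f i x - g x)) \<longlongrightarrow> 0) F" "((\<lambda>i. l2 (\<lambda>x. h i x - k x)) \<longlongrightarrow> 0) F"
  shows "((\<lambda>i. LBINT x. f i x * h i x) \<longlongrightarrow> (LBINT x. g x * k x)) F"
proof -
  define e where "e i = l2 (\<lambda>x. f i x - g x) * (l2 k + l2 (\<lambda>x. h i x - k x)) + l2 g * l2 (\<lambda>x. h i x - k x)" for i
  have "((\<lambda>i. (LBINT x. f i x * h i x) - (LBINT x. g x * k x)) \<longlongrightarrow> 0) F"
  proof (rule Lim_null_comparison)
    show "(e \<longlongrightarrow> 0) F" unfolding e_def
      by (rule tendsto_eq_intros assms refl | simp)+
    show "\<forall>\<^sub>F i in F. norm ((LBINT x. f i x * h i x) - (LBINT x. g x * k x)) \<le> e i"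
      using assms(1,3)
    proof eventually_elim
      fix i assume i: "f i \<in> L2" "h i \<in> L2"
      note d1 = L2_diff(1)[OF i(1) assms(2)] and d2 = L2_diff(1)[OF i(2) assms(4)]
      have hh: "l2 (h i) \<le> l2 k + l2 (\<lambda>x. h i x - k x)"
        using L2_add(2)[OF assms(4) d2] by simp
      have "(LBINT x. f i x * h i x) - (LBINT x. g x * k x)
          = (LBINT x. (f i x - g x) * h i x + g x * (h i x - k x))"
        by (subst Bochner_Integration.integral_diff[symmetric])
          (auto intro!: L2_mult_integrable i assms Bochner_Integration.integral_cong simp: algebra_simps)
      also have "\<dots> = (LBINT x. (f i x - g x) * h i x) + (LBINT x. g x * (h i x - k x))"
        by (intro Bochner_Integration.integral_add L2_mult_integrable d1 d2 i assms)
      also have "norm \<dots> \<le> l2 (\<lambda>x. f i x - g x) * l2 (h i) + l2 g * l2 (\<lambda>x. h i x - k x)"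
        by (intro order_trans[OF norm_triangle_ineq] add_mono L2_Cauchy_Schwarz d1 d2 i assms)
      also have "\<dots> \<le> e i" unfolding e_def using hh by (auto intro!: mult_left_mono)
      finally show "norm ((LBINT x. f i x * h i x) - (LBINT x. g x * k x)) \<le> e i" .
    qed
  qed
  then show ?thesis by (simp add: LIM_zero_iff)
qed

section \<open>Integrals over the line\<close>

lemma integral_eq_sum_half_lines:
  fixes f :: "real \<Rightarrow> 'a::{banach,second_countable_topology}"
  assumes "integrable lborel f"
  shows "(LBINT x. f x) = (LBINT x. indicator {a..} x *\<^sub>R f x) + (LBINT x. indicator {..a} x *\<^sub>R f x)"
proof -
  have [measurable]: "f \<in> borel_measurable borel" using assms by auto
  have "(LBINT x. f x) = (LBINT x. indicator {a..} x *\<^sub>R f x + indicator {..a} x *\<^sub>R f x)"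
  proof (rule integral_cong_AE)
    show "AE x in lborel. f x = indicator {a..} x *\<^sub>R f x + indicator {..a} x *\<^sub>R f x"
      using AE_lborel_singleton[of a] by eventually_elim (auto split: split_indicator)
  qed auto
  also have "\<dots> = (LBINT x. indicator {a..} x *\<^sub>R f x) + (LBINT x. indicator {..a} x *\<^sub>R f x)"
    using assms by (intro Bochner_Integration.integral_add integrable_mult_indicator) auto
  finally show ?thesis .
qed

lemma integral_reflect:
  fixes f :: "real \<Rightarrow> 'a::{banach,second_countable_topology}"
  shows "(LBINT x. f (- x)) = (LBINT x. f x)"
  using lborel_integral_real_affine[of "-1" f 0] by simp

lemma integrable_reflect:
  fixes f :: "real \<Rightarrow> 'a::{banach,second_countable_topology}"
  shows "integrable lborel (\<lambda>x. f (- x)) \<longleftrightarrow> integrable lborel f"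
  using lborel_integrable_real_affine_iff[of "-1" f 0] by simp

lemma integral_translate:
  fixes f :: "real \<Rightarrow> 'a::{banach,second_countable_topology}"
  shows "(LBINT x. f (x - a)) = (LBINT x. f x)" "(LBINT x. f (a - x)) = (LBINT x. f x)"
  using lborel_integral_real_affine[of 1 f "-a"] lborel_integral_real_affine[of "-1" f a] by simp_all

lemma integrable_translate:
  fixes f :: "real \<Rightarrow> 'a::{banach,second_countable_topology}"
  shows "integrable lborel (\<lambda>x. f (x - a)) \<longleftrightarrow> integrable lborel f" "integrable lborel (\<lambda>x. f (a - x)) \<longleftrightarrow> integrable lborel f"
  using lborel_integrable_real_affine_iff[of 1 f "-a"] lborel_integrable_real_affine_iff[of "-1" f a] by simp_all

lemma L2_reflect:
  fixes f :: "real \<Rightarrow> 'a::{banach,second_countable_topology}"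
  assumes "f \<in> L2" shows "(\<lambda>x. f (- x)) \<in> L2" "l2 (\<lambda>x. f (- x)) = l2 f"
proof -
  have [measurable]: "f \<in> borel_measurable borel" using assms by (auto simp: L2_def)
  have "integrable lborel (\<lambda>x. (norm (f (- x)))\<^sup>2)"
    using L2D(2)[OF assms] integrable_reflect[of "\<lambda>x. (norm (f x))\<^sup>2"] by simp
  then show "(\<lambda>x. f (- x)) \<in> L2" by (auto simp: L2_def)
  show "l2 (\<lambda>x. f (- x)) = l2 f" unfolding l2_def using integral_reflect[of "\<lambda>x. (norm (f x))\<^sup>2"] by simp
qed

text \<open>If the derivative is integrable, a limit at infinity exists; for integrable \<open>F\<close> it can only be 0. This disposes of the
  boundary terms in all integrations by parts.\<close>

lemma integral_derivative_at_top:
  fixes F f :: "real \<Rightarrow> real"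
  assumes der: "\<And>x. (F has_real_derivative f x) (at x)" and cf: "continuous_on UNIV f"
    and iF: "integrable lborel F" and i_f: "integrable lborel f"
  shows "(F \<longlongrightarrow> 0) at_top" "(LBINT x. indicator {a..} x * f x) = - F a"
proof -
  have FTC: "(LBINT x. indicator {a..y} x * f x) = F y - F a" if "a \<le> y" for a y
  proof -
    have "has_bochner_integral lborel (\<lambda>x. indicator {a..y} x *\<^sub>R f x) (F y - F a)"
      by (rule has_bochner_integral_FTC_Icc[OF that])
        (auto intro!: DERIV_subset[OF der, simplified] continuous_on_subset[OF cf] simp: has_real_derivative_iff_has_vector_derivative[symmetric] has_field_derivative_at_within der)
    then show ?thesis by (simp add: has_bochner_integral_integral_eq)
  qed
  have lim: "(F \<longlongrightarrow> F a + (LBINT x. indicator {a..} x * f x)) at_top" for a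
  proof -
    have "((\<lambda>y. LBINT x. indicator {..y} x *\<^sub>R (indicator {a..} x * f x)) \<longlongrightarrow> (LBINT x. indicator {a..} x * f x)) at_top"
      by (rule tendsto_integral_at_top) (use i_f integrable_mult_indicator[OF _ i_f, of "{a..}"] in auto)
    then have "((\<lambda>y. F a + (LBINT x. indicator {..y} x *\<^sub>R (indicator {a..} x * f x))) \<longlongrightarrow> F a + (LBINT x. indicator {a..} x * f x)) at_top"
      by (intro tendsto_intros)
    then show ?thesis
    proof (rule Lim_transform_eventually)
      show "\<forall>\<^sub>F y in at_top. F a + (LBINT x. indicator {..y} x *\<^sub>R (indicator {a..} x * f x)) = F y"
        using eventually_ge_at_top[of a]
      proof eventually_elim
        case (elim y)
        have "(\<lambda>x. indicator {..y} x *\<^sub>R (indicator {a..} x * f x)) = (\<lambda>x. indicator {a..y} x * f x)"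
          by (auto split: split_indicator)
        then show ?case using FTC[OF elim] by (simp only:)
      qed
    qed
  qed
  define l where "l = F a + (LBINT x. indicator {a..} x * f x)"
  have "l = 0"
  proof (rule ccontr)
    assume "l \<noteq> 0"
    have "((\<lambda>x. \<bar>F x\<bar>) \<longlongrightarrow> \<bar>l\<bar>) at_top" using lim[of a] unfolding l_def by (rule tendsto_rabs)
    then have "\<forall>\<^sub>F x in at_top. \<bar>l\<bar> / 2 < \<bar>F x\<bar>" by (rule order_tendstoD(1)) (use \<open>l \<noteq> 0\<close> in auto)
    then obtain b where b: "\<And>x. b \<le> x \<Longrightarrow> \<bar>l\<bar> / 2 < \<bar>F x\<bar>" by (auto simp: eventually_at_top_linorder)
    have "(\<integral>\<^sup>+x. ennreal (\<bar>l\<bar> / 2) * indicator {b..} x \<partial>lborel) \<le> (\<integral>\<^sup>+x. ennreal (norm (F x)) \<partial>lborel)"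
      by (rule nn_integral_mono) (use b in \<open>auto split: split_indicator simp: less_imp_le ennreal_leI\<close>)
    also have "\<dots> < \<infinity>" using iF by (simp add: integrable_iff_bounded)
    also have "(\<integral>\<^sup>+x. ennreal (\<bar>l\<bar> / 2) * indicator {b..} x \<partial>lborel) = ennreal (\<bar>l\<bar> / 2) * emeasure lborel {b..}"
      by (rule nn_integral_cmult_indicator) auto
    finally have "emeasure lborel {b..} < \<infinity>"
      using \<open>l \<noteq> 0\<close> by (auto simp: ennreal_mult_less_top less_top[symmetric] ennreal_eq_0_iff)
    moreover have "ennreal (real n) \<le> emeasure lborel {b..}" for n
      using emeasure_mono[of "{b..b + real n}" "{b..}" lborel] by auto
    ultimately show False
      by (metis ennreal_Ex_less_of_nat ennreal_of_nat_eq_real_of_nat infinity_ennreal_def leD)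
  qed
  then show "(F \<longlongrightarrow> 0) at_top" "(LBINT x. indicator {a..} x * f x) = - F a" using lim[of a] unfolding l_def by auto
qed

lemma integral_derivative_at_bot:
  fixes F f :: "real \<Rightarrow> real"
  assumes der: "\<And>x. (F has_real_derivative f x) (at x)" and cf: "continuous_on UNIV f"
    and iF: "integrable lborel F" and i_f: "integrable lborel f"
  shows "(F \<longlongrightarrow> 0) at_bot" "(LBINT x. indicator {..a} x * f x) = F a"
proof -
  have d: "((\<lambda>x. F (- x)) has_real_derivative - f (- x)) (at x)" for x
    using der[of "- x"] by (simp add: DERIV_mirror)
  have c: "continuous_on UNIV (\<lambda>x. - f (- x))"
    by (intro continuous_intros continuous_on_compose2[OF cf]) auto
  have i: "integrable lborel (\<lambda>x. F (- x))" "integrable lborel (\<lambda>x. - f (- x))"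
    using iF i_f integrable_reflect[of F] integrable_reflect[of f] by auto
  note * = integral_derivative_at_top[OF d c i]
  show "(F \<longlongrightarrow> 0) at_bot" using *(1) by (simp add: filterlim_at_bot_mirror)
  have "(LBINT x. indicator {..a} x * f x) = (LBINT x. indicator {..a} (-x) * f (-x))"
    using integral_reflect[of "\<lambda>x. indicator {..a} x * f x"] by simp
  also have "\<dots> = - (LBINT x. indicator {-a..} x * - f (-x))"
    by (subst Bochner_Integration.integral_minus[symmetric]) (auto intro!: Bochner_Integration.integral_cong split: split_indicator)
  finally show "(LBINT x. indicator {..a} x * f x) = F a" using *(2)[of "-a"] by simp
qed

text \<open>Every identity between integrals over the line that follows is obtained by exhibiting an antiderivative.\<close>

lemma integral_derivative_eq_0:
  fixes F f :: "real \<Rightarrow> real"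
  assumes der: "\<And>x. (F has_real_derivative f x) (at x)" and cf: "continuous_on UNIV f"
    and iF: "integrable lborel F" and i_f: "integrable lborel f"
  shows "(LBINT x. f x) = 0"
  using integral_eq_sum_half_lines[OF i_f, of 0] integral_derivative_at_bot(2)[OF assms, of 0]
    integral_derivative_at_top(2)[OF assms, of 0] by simp

section \<open>Exponential and Poisson kernels\<close>

lemma has_integral_exp_half_line:
  fixes c :: complex
  assumes "Re c < 0"
  shows "integrable lborel (\<lambda>x. indicator {0..} x *\<^sub>R exp (c * of_real x))"
    "(LBINT x. indicator {0..} x *\<^sub>R exp (c * of_real x)) = - (1 / c)"
proof -
  have c0: "c \<noteq> 0" using assms by auto
  have tl: "((\<lambda>x. exp (Re c * x)) \<longlongrightarrow> 0) at_top"
    by (rule filterlim_compose[OF exp_at_bot], rule filterlim_tendsto_neg_mult_at_bot[OF tendsto_const assms filterlim_ident])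
  have "(\<integral>\<^sup>+x. ennreal (exp (Re c * x)) * indicator {0..} x \<partial>lborel) = ennreal (0 - exp (Re c * 0) / Re c)"
  proof (rule nn_integral_FTC_atLeast)
    show "((\<lambda>x. exp (Re c * x) / Re c) \<longlongrightarrow> 0) at_top" using tendsto_divide[OF tl tendsto_const[of "Re c"]] assms by simp
  qed (use assms in \<open>auto intro!: derivative_eq_intros\<close>)
  moreover have e: "(\<integral>\<^sup>+x. ennreal (norm (indicator {0..} x *\<^sub>R exp (c * of_real x))) \<partial>lborel) = (\<integral>\<^sup>+x. ennreal (exp (Re c * x)) * indicator {0..} x \<partial>lborel)"
    by (rule nn_integral_cong) (auto split: split_indicator)
  have m: "(\<lambda>x. exp (c * of_real x)) \<in> borel_measurable borel"
    by (intro borel_measurable_continuous_onI continuous_intros)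
  ultimately show i: "integrable lborel (\<lambda>x. indicator {0..} x *\<^sub>R exp (c * of_real x))"
    using m unfolding integrable_iff_bounded e by (simp del: indicator_scaleR_eq_if)
  have FTC: "(LBINT x. indicator {0..y} x *\<^sub>R exp (c * of_real x)) = exp (c * of_real y) / c - 1 / c" if "0 \<le> y" for y
  proof -
    have "has_bochner_integral lborel (\<lambda>x. indicator {0..y} x *\<^sub>R exp (c * of_real x)) (exp (c * of_real y) / c - exp (c * of_real 0) / c)"
    proof (rule has_bochner_integral_FTC_Icc[OF that])
      fix x
      have "((\<lambda>z. exp (c * z) / c) has_field_derivative exp (c * of_real x)) (at (of_real x))"
        using c0 by (auto intro!: derivative_eq_intros)
      then have "((\<lambda>x. exp (c * of_real x) / c) has_vector_derivative exp (c * of_real x)) (at x)"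
        by (rule has_vector_derivative_real_field)
      then show "((\<lambda>x. exp (c * of_real x) / c) has_vector_derivative exp (c * of_real x)) (at x within {0..y})"
        by (rule has_vector_derivative_at_within)
    qed (intro continuous_intros)
    then show ?thesis by (simp add: has_bochner_integral_integral_eq)
  qed
  have 1: "((\<lambda>y. LBINT x. indicator {..y} x *\<^sub>R (indicator {0..} x *\<^sub>R exp (c * of_real x))) \<longlongrightarrow> (LBINT x. indicator {0..} x *\<^sub>R exp (c * of_real x))) at_top"
    by (rule tendsto_integral_at_top[OF _ i]) simp
  have "((\<lambda>y. exp (c * of_real y)) \<longlongrightarrow> 0) at_top"
    using tl by (subst tendsto_norm_zero_iff[symmetric]) simp
  then have "((\<lambda>y. exp (c * of_real y) / c - 1 / c) \<longlongrightarrow> 0 / c - 1 / c) at_top"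
    by (intro tendsto_intros c0)
  then have "((\<lambda>y. LBINT x. indicator {..y} x *\<^sub>R (indicator {0..} x *\<^sub>R exp (c * of_real x))) \<longlongrightarrow> 0 / c - 1 / c) at_top"
  proof (rule Lim_transform_eventually)
    show "\<forall>\<^sub>F y in at_top. exp (c * of_real y) / c - 1 / c = (LBINT x. indicator {..y} x *\<^sub>R (indicator {0..} x *\<^sub>R exp (c * of_real x)))"
      using eventually_ge_at_top[of 0]
    proof eventually_elim
      case (elim y)
      have "(\<lambda>x. indicator {..y} x *\<^sub>R (indicator {0..} x *\<^sub>R exp (c * of_real x))) = (\<lambda>x. indicator {0..y} x *\<^sub>R exp (c * of_real x))"
        by (auto split: split_indicator)
      then show ?case using FTC[OF elim] by (simp only:)
    qed
  qed
  from tendsto_unique[OF _ 1 this] show "(LBINT x. indicator {0..} x *\<^sub>R exp (c * of_real x)) = - (1 / c)" by simp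
qed

lemma exp_kernel_transform:
  assumes "0 < b"
  shows "integrable lborel (\<lambda>x. cis (x * \<xi>) * complex_of_real (exp (- b * \<bar>x\<bar>)))"
    "(LBINT x. cis (x * \<xi>) * complex_of_real (exp (- b * \<bar>x\<bar>))) = complex_of_real (2 * b / (b\<^sup>2 + \<xi>\<^sup>2))"
proof -
  define f where "f x = cis (x * \<xi>) * complex_of_real (exp (- b * \<bar>x\<bar>))" for x
  have 1: "indicator {0..} x *\<^sub>R f x = indicator {0..} x *\<^sub>R exp (Complex (-b) \<xi> * of_real x)" for x
    by (auto split: split_indicator simp: f_def cis_conv_exp exp_of_real[symmetric] exp_add[symmetric] complex_eq_iff Re_exp Im_exp mult.commute)
  have 2: "indicator {0..} x *\<^sub>R f (-x) = indicator {0..} x *\<^sub>R exp (Complex (-b) (-\<xi>) * of_real x)" for x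
    by (auto split: split_indicator simp: f_def cis_conv_exp exp_of_real[symmetric] exp_add[symmetric] complex_eq_iff Re_exp Im_exp mult.commute)
  note h1 = has_integral_exp_half_line[of "Complex (-b) \<xi>", folded 1] and h2 = has_integral_exp_half_line[of "Complex (-b) (-\<xi>)", folded 2]
  have i1: "integrable lborel (\<lambda>x. indicator {0..} x *\<^sub>R f x)" using h1 assms by simp
  have i2: "integrable lborel (\<lambda>x. indicator {..0} x *\<^sub>R f x)"
  proof -
    have "integrable lborel (\<lambda>x. indicator {..0} (-x) *\<^sub>R f (-x))"
      using h2(1) assms by (auto simp: indicator_def if_distrib cong: if_cong)
    then show ?thesis using integrable_reflect[of "\<lambda>x. indicator {..0} x *\<^sub>R f x"] by simp
  qed
  have cm: "f \<in> borel_measurable borel" unfolding f_def cis_conv_exp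
    by (intro borel_measurable_continuous_onI continuous_intros)
  have i: "integrable lborel f"
  proof (rule integrable_cong_AE_imp[OF Bochner_Integration.integrable_add[OF i1 i2]])
    show "AE x in lborel. indicator {0..} x *\<^sub>R f x + indicator {..0} x *\<^sub>R f x = f x"
      using AE_lborel_singleton[of 0] by eventually_elim (auto split: split_indicator)
  qed (use cm in auto)
  then show "integrable lborel (\<lambda>x. cis (x * \<xi>) * complex_of_real (exp (- b * \<bar>x\<bar>)))" by (simp add: f_def[abs_def])
  have "(LBINT x. indicator {..0} x *\<^sub>R f x) = (LBINT x. indicator {..0} (-x) *\<^sub>R f (-x))"
    using integral_reflect[of "\<lambda>x. indicator {..0} x *\<^sub>R f x"] by simp
  also have "\<dots> = (LBINT x. indicator {0..} x *\<^sub>R f (-x))"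
    by (intro Bochner_Integration.integral_cong) (auto split: split_indicator)
  also have "\<dots> = - (1 / Complex (-b) (-\<xi>))" using h2(2) assms by simp
  finally have "(LBINT x. f x) = - (1 / Complex (-b) \<xi>) - (1 / Complex (-b) (-\<xi>))"
    using integral_eq_sum_half_lines[OF i, of 0] h1(2) assms by simp
  also have "\<dots> = complex_of_real (2 * b / (b\<^sup>2 + \<xi>\<^sup>2))"
    using assms by (auto simp: complex_eq_iff Re_divide Im_divide field_simps power2_eq_square)
  finally show "(LBINT x. cis (x * \<xi>) * complex_of_real (exp (- b * \<bar>x\<bar>))) = complex_of_real (2 * b / (b\<^sup>2 + \<xi>\<^sup>2))"
    by (simp add: f_def[abs_def])
qed

lemma exp_kernel_integral:
  fixes b :: real
  assumes "0 < b"
  shows "integrable lborel (\<lambda>x::real. exp (- b * \<bar>x\<bar>))" "(LBINT x. exp (- b * \<bar>x\<bar>)) = 2 / b"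
proof -
  have "integrable lborel (\<lambda>x. complex_of_real (exp (- b * \<bar>x\<bar>)))" using exp_kernel_transform(1)[OF assms, of 0] by simp
  then show 1: "integrable lborel (\<lambda>x. exp (- b * \<bar>x\<bar>))" by (metis (no_types) complex_of_real_integrable_eq)
  have "complex_of_real (LBINT x. exp (- b * \<bar>x\<bar>)) = complex_of_real (2 / b)"
    using exp_kernel_transform(2)[OF assms, of 0] assms by (simp add: power2_eq_square field_simps)
  then show "(LBINT x. exp (- b * \<bar>x\<bar>)) = 2 / b" using of_real_eq_iff by blast
qed

definition poisson :: "real \<Rightarrow> real \<Rightarrow> real" where
  "poisson d x = d / (pi * (d\<^sup>2 + x\<^sup>2))"

lemma poisson_nonneg: "0 < d \<Longrightarrow> 0 \<le> poisson d x" by (simp add: poisson_def)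

lemma poisson_antiderivative:
  assumes "0 < d" shows "((\<lambda>x. arctan (x / d) / pi) has_real_derivative poisson d x) (at x)"
proof -
  have "((\<lambda>x. arctan (x / d) / pi) has_real_derivative inverse (1 + (x/d)\<^sup>2) * (1 / d) / pi) (at x)"
    by (rule derivative_eq_intros DERIV_arctan refl | use assms in simp)+
  moreover have "inverse (1 + (x/d)\<^sup>2) * (1 / d) / pi = poisson d x"
  proof -
    have "d\<^sup>2 + x\<^sup>2 \<noteq> 0" using assms by (metis less_irrefl sum_power2_eq_zero_iff)
    then show ?thesis using assms by (simp add: poisson_def field_simps power2_eq_square)
  qed
  ultimately show ?thesis by simp
qed

lemma poisson_measurable[measurable]: "poisson d \<in> borel_measurable borel"
  unfolding poisson_def by simp

lemma nn_integral_poisson: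
  assumes "0 < d" shows "(\<integral>\<^sup>+x. ennreal (poisson d x) \<partial>lborel) = 1"
proof -
  have l: "((\<lambda>x. arctan (x / d) / pi) \<longlongrightarrow> (pi/2)/pi) at_top"
  proof (intro tendsto_divide tendsto_const filterlim_compose[OF tendsto_arctan_at_top])
    have "LIM x at_top. inverse d * x :> at_top"
      by (rule filterlim_tendsto_pos_mult_at_top[OF tendsto_const _ filterlim_ident]) (use assms in auto)
    then show "LIM x at_top. x / d :> at_top" by (simp add: divide_inverse mult.commute)
  qed auto
  have 1: "(\<integral>\<^sup>+x. ennreal (poisson d x) * indicator {0..} x \<partial>lborel) = ennreal ((pi/2)/pi - arctan (0 / d) / pi)"
    by (rule nn_integral_FTC_atLeast[OF _ poisson_antiderivative[OF assms] poisson_nonneg[OF assms] l]) auto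
  have 2: "(\<integral>\<^sup>+x. ennreal (poisson d x) * indicator {..0} x \<partial>lborel) = (\<integral>\<^sup>+x. ennreal (poisson d x) * indicator {0..} x \<partial>lborel)"
    by (subst nn_integral_real_affine[where c="-1" and t=0]) (auto intro!: nn_integral_cong simp: poisson_def split: split_indicator)
  have "(\<integral>\<^sup>+x. ennreal (poisson d x) \<partial>lborel) = (\<integral>\<^sup>+x. ennreal (poisson d x) * indicator {0..} x + ennreal (poisson d x) * indicator {..0} x \<partial>lborel)"
    by (rule nn_integral_cong_AE) (use AE_lborel_singleton[of 0] in \<open>eventually_elim, auto split: split_indicator\<close>)
  also have "\<dots> = ennreal (1/2) + ennreal (1/2)"
    by (subst nn_integral_add) (auto simp: 1 2)
  also have "\<dots> = ennreal (1/2 + 1/2)" by (rule ennreal_plus[symmetric]) auto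
  finally show ?thesis by simp
qed

section \<open>Limits and null sets\<close>

lemma cis_measurable[measurable]: "cis \<in> borel_measurable borel"
  unfolding cis_conv_exp[abs_def] by (intro borel_measurable_continuous_onI continuous_intros)

lemma cnj_measurable[measurable]: "cnj \<in> borel_measurable borel"
  by (intro borel_measurable_continuous_onI continuous_intros)

lemma L2_Fatou:
  fixes h :: "nat \<Rightarrow> real \<Rightarrow> 'a::{real_normed_field,banach,second_countable_topology}"
  assumes "\<And>n. h n \<in> L2" "f \<in> borel_measurable lborel" "AE x in lborel. (\<lambda>n. h n x) \<longlonglongrightarrow> f x"
    and "eventually (\<lambda>n. l2 (h n) \<le> C) sequentially" "0 \<le> C"
  shows "f \<in> L2" "l2 f \<le> C"
proof -
  have [measurable]: "\<And>n. h n \<in> borel_measurable borel" "f \<in> borel_measurable borel" using assms by (auto simp: L2_def)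
  have "(\<integral>\<^sup>+x. ennreal ((norm (f x))\<^sup>2) \<partial>lborel) = (\<integral>\<^sup>+x. liminf (\<lambda>n. ennreal ((norm (h n x))\<^sup>2)) \<partial>lborel)"
  proof (rule nn_integral_cong_AE, use assms(3) in eventually_elim)
    case (elim x)
    have "(\<lambda>n. ennreal ((norm (h n x))\<^sup>2)) \<longlonglongrightarrow> ennreal ((norm (f x))\<^sup>2)"
      by (intro tendsto_ennrealI tendsto_intros elim)
    from lim_imp_Liminf[OF _ this] show ?case by simp
  qed
  also have "\<dots> \<le> liminf (\<lambda>n. \<integral>\<^sup>+x. ennreal ((norm (h n x))\<^sup>2) \<partial>lborel)"
    by (rule nn_integral_liminf) auto
  also have "\<dots> \<le> limsup (\<lambda>n. \<integral>\<^sup>+x. ennreal ((norm (h n x))\<^sup>2) \<partial>lborel)"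
    by (rule Liminf_le_Limsup) simp
  also have "\<dots> \<le> ennreal (C\<^sup>2)"
  proof (rule Limsup_bounded, use assms(4) in eventually_elim)
    fix n assume *: "l2 (h n) \<le> C"
    have "(\<integral>\<^sup>+x. ennreal ((norm (h n x))\<^sup>2) \<partial>lborel) = ennreal ((l2 (h n))\<^sup>2)"
      unfolding l2_power2 by (rule nn_integral_eq_integral[OF L2D(2)[OF assms(1)]]) simp
    also have "\<dots> \<le> ennreal (C\<^sup>2)" using * by (intro ennreal_leI power_mono) auto
    finally show "(\<integral>\<^sup>+x. ennreal ((norm (h n x))\<^sup>2) \<partial>lborel) \<le> ennreal (C\<^sup>2)" .
  qed
  finally have *: "(\<integral>\<^sup>+x. ennreal ((norm (f x))\<^sup>2) \<partial>lborel) \<le> ennreal (C\<^sup>2)" .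
  then have "(\<integral>\<^sup>+x. ennreal ((norm (f x))\<^sup>2) \<partial>lborel) < \<infinity>"
    using ennreal_less_top order_le_less_trans by (metis infinity_ennreal_def)
  then have i: "integrable lborel (\<lambda>x. (norm (f x))\<^sup>2)" by (auto simp: integrable_iff_bounded)
  then show "f \<in> L2" by (auto simp: L2_def)
  have "ennreal ((l2 f)\<^sup>2) \<le> ennreal (C\<^sup>2)"
    unfolding l2_power2 using nn_integral_eq_integral[OF i] * by simp
  then have "(l2 f)\<^sup>2 \<le> C\<^sup>2" by (simp add: ennreal_le_iff)
  then show "l2 f \<le> C" using assms(5) by (rule power2_le_imp_le)
qed

lemma l2_eq_0_iff:
  fixes f :: "real \<Rightarrow> 'a::{real_normed_vector,second_countable_topology}"
  assumes "f \<in> L2" shows "l2 f = 0 \<longleftrightarrow> (AE x in lborel. f x = 0)"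
proof -
  have "l2 f = 0 \<longleftrightarrow> (LBINT x. (norm (f x))\<^sup>2) = 0" by (simp add: l2_def)
  also have "\<dots> \<longleftrightarrow> (AE x in lborel. (norm (f x))\<^sup>2 = 0)"
    by (rule integral_nonneg_eq_0_iff_AE[OF L2D(2)[OF assms]]) simp
  finally show ?thesis by simp
qed

lemma norm_integral_le_nn_integral:
  fixes f :: "'b \<Rightarrow> 'a::{banach,second_countable_topology}"
  shows "ennreal (norm (integral\<^sup>L M f)) \<le> (\<integral>\<^sup>+x. ennreal (norm (f x)) \<partial>M)"
  by (cases "integrable M f") (auto simp: integral_norm_bound_ennreal not_integrable_integral_eq)

section \<open>The Fourier transform\<close>

definition FT :: "(real \<Rightarrow> complex) \<Rightarrow> real \<Rightarrow> complex" where
  "FT f \<xi> = complex_of_real (1 / sqrt (2 * pi)) * (LBINT x. cis (- (x * \<xi>)) * f x)"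

lemma cis_mult_integrable:
  assumes "integrable lborel f" "r \<in> borel_measurable borel"
  shows "integrable lborel (\<lambda>x. cis (r x) * f x)"
  by (rule Bochner_Integration.integrable_bound[OF assms(1)]) (use assms in \<open>auto simp: norm_mult\<close>)

lemma FT_bound:
  assumes "integrable lborel f" shows "cmod (FT f \<xi>) \<le> (LBINT x. cmod (f x))"
proof -
  have "1 \<le> sqrt (2 * pi)" using pi_gt3 by (simp add: real_le_rsqrt)
  have "cmod (LBINT x. cis (- (x * \<xi>)) * f x) \<le> (LBINT x. cmod (cis (- (x * \<xi>)) * f x))" by (rule integral_norm_bound)
  also have "\<dots> = (LBINT x. cmod (f x))" by (simp add: norm_mult)
  finally have *: "cmod (LBINT x. cis (- (x * \<xi>)) * f x) \<le> (LBINT x. cmod (f x))" .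
  have "cmod (FT f \<xi>) = cmod (LBINT x. cis (- (x * \<xi>)) * f x) / sqrt (2 * pi)"
    by (simp add: FT_def norm_divide)
  also have "\<dots> \<le> cmod (LBINT x. cis (- (x * \<xi>)) * f x) / 1"
    using \<open>1 \<le> sqrt (2 * pi)\<close> by (intro divide_left_mono) auto
  finally show ?thesis using * by simp
qed

lemma FT_measurable[measurable]:
  assumes [measurable]: "f \<in> borel_measurable borel" shows "FT f \<in> borel_measurable borel"
  unfolding FT_def[abs_def] by measurable

lemma FT_add: "integrable lborel f \<Longrightarrow> integrable lborel g \<Longrightarrow> FT (\<lambda>x. f x + g x) \<xi> = FT f \<xi> + FT g \<xi>"
  using cis_mult_integrable[of f "\<lambda>x. - (x * \<xi>)"] cis_mult_integrable[of g "\<lambda>x. - (x * \<xi>)"]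
  by (simp add: FT_def algebra_simps)

lemma FT_cmult: "FT (\<lambda>x. c * f x) \<xi> = c * FT f \<xi>"
proof -
  have "(LBINT x. cis (- (x * \<xi>)) * (c * f x)) = (LBINT x. c * (cis (- (x * \<xi>)) * f x))"
    by (rule Bochner_Integration.integral_cong) auto
  then show ?thesis by (simp add: FT_def del: of_real_divide)
qed

lemma FT_diff: "integrable lborel f \<Longrightarrow> integrable lborel g \<Longrightarrow> FT (\<lambda>x. f x - g x) \<xi> = FT f \<xi> - FT g \<xi>"
  using FT_add[of f "\<lambda>x. - 1 * g x" \<xi>] FT_cmult[of "-1" g \<xi>] by simp

lemma FT_multiplication:
  assumes f: "integrable lborel f" and g: "integrable lborel g"
  shows "(LBINT \<xi>. g \<xi> * FT f \<xi>) = (LBINT x. f x * FT g x)"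
proof -
  have [measurable]: "f \<in> borel_measurable borel" "g \<in> borel_measurable borel" using f g by auto
  define k where "k x \<xi> = cis (- (x * \<xi>)) * (f x * g \<xi>)" for x \<xi>
  have "integrable (lborel \<Otimes>\<^sub>M lborel) (\<lambda>(x, \<xi>). k x \<xi>)"
  proof (rule lborel_pair.Fubini_integrable)
    show "(\<lambda>(x, \<xi>). k x \<xi>) \<in> borel_measurable (lborel \<Otimes>\<^sub>M lborel)" unfolding k_def by measurable
    have "(\<lambda>x. LBINT y. norm (case (x, y) of (x, \<xi>) \<Rightarrow> k x \<xi>)) = (\<lambda>x. cmod (f x) * (LBINT y. cmod (g y)))"
      by (auto simp: k_def norm_mult)
    then show "integrable lborel (\<lambda>x. LBINT y. norm (case (x, y) of (x, \<xi>) \<Rightarrow> k x \<xi>))" using f by simp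
    have "integrable lborel (\<lambda>y. k x y)" for x
      unfolding k_def by (rule cis_mult_integrable) (use g in auto)
    then show "AE x in lborel. integrable lborel (\<lambda>y. case (x, y) of (x, \<xi>) \<Rightarrow> k x \<xi>)" by simp
  qed
  then have F: "(LBINT \<xi>. (LBINT x. k x \<xi>)) = (LBINT x. (LBINT \<xi>. k x \<xi>))"
    by (rule lborel_pair.Fubini_integral)
  define c where "c = complex_of_real (1 / sqrt (2 * pi))"
  have 1: "g \<xi> * FT f \<xi> = c * (LBINT x. k x \<xi>)" for \<xi>
  proof -
    have "(LBINT x. k x \<xi>) = (LBINT x. g \<xi> * (cis (- (x * \<xi>)) * f x))"
      by (rule Bochner_Integration.integral_cong) (auto simp: k_def)
    then show ?thesis by (simp add: FT_def c_def del: of_real_divide)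
  qed
  have 2: "f x * FT g x = c * (LBINT \<xi>. k x \<xi>)" for x
  proof -
    have "(LBINT \<xi>. k x \<xi>) = (LBINT \<xi>. f x * (cis (- (\<xi> * x)) * g \<xi>))"
      by (rule Bochner_Integration.integral_cong) (auto simp: k_def mult.commute)
    then show ?thesis by (simp add: FT_def c_def del: of_real_divide)
  qed
  show ?thesis unfolding 1 2 by (simp add: F)
qed

lemma FT_exp_cis:
  assumes "0 < d"
  shows "integrable lborel (\<lambda>\<xi>. complex_of_real (1 / sqrt (2 * pi)) * (cis (\<xi> * x) * complex_of_real (exp (- d * \<bar>\<xi>\<bar>))))"
    "FT (\<lambda>\<xi>. complex_of_real (1 / sqrt (2 * pi)) * (cis (\<xi> * x) * complex_of_real (exp (- d * \<bar>\<xi>\<bar>)))) y = complex_of_real (poisson d (x - y))"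
proof -
  note * = exp_kernel_transform[OF assms, of "x - y"]
  show "integrable lborel (\<lambda>\<xi>. complex_of_real (1 / sqrt (2 * pi)) * (cis (\<xi> * x) * complex_of_real (exp (- d * \<bar>\<xi>\<bar>))))"
    using exp_kernel_transform(1)[OF assms, of x] by (simp del: of_real_divide)
  define c where "c = complex_of_real (1 / sqrt (2 * pi))"
  have "c * c = complex_of_real (1 / (2 * pi))" unfolding c_def of_real_mult[symmetric] by simp
  have "FT (\<lambda>\<xi>. c * (cis (\<xi> * x) * complex_of_real (exp (- d * \<bar>\<xi>\<bar>)))) y = c * FT (\<lambda>\<xi>. cis (\<xi> * x) * complex_of_real (exp (- d * \<bar>\<xi>\<bar>))) y"
    by (rule FT_cmult)
  also have "FT (\<lambda>\<xi>. cis (\<xi> * x) * complex_of_real (exp (- d * \<bar>\<xi>\<bar>))) y = c * (LBINT \<xi>. cis (\<xi> * (x - y)) * complex_of_real (exp (- d * \<bar>\<xi>\<bar>)))"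
    unfolding FT_def c_def[symmetric]
    by (intro arg_cong[where f="\<lambda>z. c * z"] Bochner_Integration.integral_cong) (auto simp: cis_mult[symmetric] mult.assoc[symmetric] cis_mult algebra_simps)
  also have "c * (c * (LBINT \<xi>. cis (\<xi> * (x - y)) * complex_of_real (exp (- d * \<bar>\<xi>\<bar>)))) = complex_of_real (1 / (2 * pi)) * complex_of_real (2 * d / (d\<^sup>2 + (x - y)\<^sup>2))"
    unfolding * mult.assoc[symmetric] \<open>c * c = _\<close> ..
  also have "\<dots> = complex_of_real (poisson d (x - y))"
    unfolding of_real_mult[symmetric] poisson_def by (rule arg_cong[where f=complex_of_real]) simp
  finally show "FT (\<lambda>\<xi>. complex_of_real (1 / sqrt (2 * pi)) * (cis (\<xi> * x) * complex_of_real (exp (- d * \<bar>\<xi>\<bar>)))) y = complex_of_real (poisson d (x - y))"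
    by (simp add: c_def)
qed

lemma exp_damped_integrable:
  fixes g :: "real \<Rightarrow> complex"
  assumes "0 < d" "g \<in> borel_measurable borel" "\<And>\<xi>. cmod (g \<xi>) \<le> C"
  shows "integrable lborel (\<lambda>\<xi>. complex_of_real (exp (- d * \<bar>\<xi>\<bar>)) * g \<xi>)"
proof (rule Bochner_Integration.integrable_bound)
  show "integrable lborel (\<lambda>\<xi>. C * exp (- d * \<bar>\<xi>\<bar>))" using exp_kernel_integral(1)[OF assms(1)] by simp
  show "AE \<xi> in lborel. norm (complex_of_real (exp (- d * \<bar>\<xi>\<bar>)) * g \<xi>) \<le> norm (C * exp (- d * \<bar>\<xi>\<bar>))"
    using assms(3) order_trans[OF norm_ge_zero assms(3)] by (auto simp: norm_mult mult.commute intro!: mult_right_mono)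
qed (use assms(2) in measurable)

text \<open>The function \<open>e\<^bsup>ix\<xi> - d|\<xi>|\<^esup>\<close> transforms into a translate of the Poisson kernel, so this is the multiplication
  formula.\<close>

lemma inverse_FT_damped:
  assumes f: "integrable lborel f" and d: "0 < d"
  shows "complex_of_real (1 / sqrt (2 * pi)) * (LBINT \<xi>. cis (\<xi> * x) * (complex_of_real (exp (- d * \<bar>\<xi>\<bar>)) * FT f \<xi>))
       = (LBINT y. f y * complex_of_real (poisson d (x - y)))"
proof -
  have "complex_of_real (1 / sqrt (2 * pi)) * (LBINT \<xi>. cis (\<xi> * x) * (complex_of_real (exp (- d * \<bar>\<xi>\<bar>)) * FT f \<xi>))
    = (LBINT \<xi>. (complex_of_real (1 / sqrt (2 * pi)) * (cis (\<xi> * x) * complex_of_real (exp (- d * \<bar>\<xi>\<bar>)))) * FT f \<xi>)"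
    by (simp add: mult.assoc del: of_real_divide)
  also have "\<dots> = (LBINT y. f y * FT (\<lambda>\<xi>. complex_of_real (1 / sqrt (2 * pi)) * (cis (\<xi> * x) * complex_of_real (exp (- d * \<bar>\<xi>\<bar>)))) y)"
    by (rule FT_multiplication[OF f FT_exp_cis(1)[OF d]])
  finally show ?thesis unfolding FT_exp_cis(2)[OF d] .
qed

text \<open>Pairing the damped transform with the transform itself gives \<open>\<integral>\<integral> f(x) conj (f(y)) P(x - y)\<close> with \<open>P\<close> the Poisson kernel,
  at most \<open>\<parallel>f\<parallel>\<^sup>2\<close> since \<open>|f(x) f(y)| \<le> (|f(x)|\<^sup>2 + |f(y)|\<^sup>2)/2\<close> and \<open>P\<close> has mass 1. The damping is removed by Fatou's lemma.\<close>

lemma FT_L2: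
  assumes f: "integrable lborel f" "f \<in> L2"
  shows "FT f \<in> L2" "l2 (FT f) \<le> l2 f"
proof -
  have [measurable]: "f \<in> borel_measurable borel" using f by auto
  define C where "C = (LBINT x. cmod (f x))"
  have C: "cmod (FT f \<xi>) \<le> C" for \<xi> unfolding C_def by (rule FT_bound[OF f(1)])
  define h where "h n \<xi> = complex_of_real (exp (- (1 / real (Suc n)) / 2 * \<bar>\<xi>\<bar>)) * FT f \<xi>" for n :: nat and \<xi>
  have h: "h n \<in> L2 \<and> l2 (h n) \<le> l2 f" for n
  proof -
    define d where "d = 1 / real (Suc n)"
    have d: "0 < d" by (simp add: d_def)
    define g where "g \<xi> = complex_of_real (exp (- d * \<bar>\<xi>\<bar>)) * cnj (FT f \<xi>)" for \<xi>
    have g: "integrable lborel g" unfolding g_def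
      by (rule exp_damped_integrable[OF d, where C=C]) (use C in auto)
    have hg: "g \<xi> * FT f \<xi> = complex_of_real ((norm (h n \<xi>))\<^sup>2)" for \<xi>
    proof -
      have "h n \<xi> = complex_of_real (exp (- d / 2 * \<bar>\<xi>\<bar>)) * FT f \<xi>" by (simp add: h_def d_def)
      then have "(norm (h n \<xi>))\<^sup>2 = (exp (- d / 2 * \<bar>\<xi>\<bar>))\<^sup>2 * (cmod (FT f \<xi>))\<^sup>2"
        by (simp add: norm_mult power_mult_distrib)
      also have "(exp (- d / 2 * \<bar>\<xi>\<bar>))\<^sup>2 = exp (- d * \<bar>\<xi>\<bar>)"
        by (simp add: power2_eq_square exp_add[symmetric])
      finally have "complex_of_real ((norm (h n \<xi>))\<^sup>2) = complex_of_real (exp (- d * \<bar>\<xi>\<bar>)) * (FT f \<xi> * cnj (FT f \<xi>))"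
        by (simp only: of_real_mult complex_norm_square)
      then show ?thesis by (simp add: g_def mult_ac)
    qed
    have gi: "integrable lborel (\<lambda>\<xi>. g \<xi> * FT f \<xi>)"
    proof -
      have "integrable lborel (\<lambda>\<xi>. complex_of_real (exp (- d * \<bar>\<xi>\<bar>)) * (cnj (FT f \<xi>) * FT f \<xi>))"
        by (rule exp_damped_integrable[OF d, where C="C * C"]) (use C in \<open>auto simp: norm_mult intro!: mult_mono order_trans[OF norm_ge_zero C]\<close>)
      then show ?thesis by (simp add: g_def mult.assoc)
    qed
    then have i: "integrable lborel (\<lambda>\<xi>. (norm (h n \<xi>))\<^sup>2)"
      unfolding hg complex_of_real_integrable_eq .
    have hm: "h n \<in> borel_measurable lborel" unfolding h_def[abs_def] by measurable
    have hL: "h n \<in> L2" using i hm by (simp add: L2_def)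
    have FTg: "FT g x = cnj (LBINT y. f y * complex_of_real (poisson d (x - y)))" for x
    proof -
      have "FT g x = cnj (complex_of_real (1 / sqrt (2 * pi)) * (LBINT \<xi>. cis (\<xi> * x) * (complex_of_real (exp (- d * \<bar>\<xi>\<bar>)) * FT f \<xi>)))"
      proof -
        have "(LBINT \<xi>. cis (- (\<xi> * x)) * g \<xi>) = (LBINT \<xi>. cnj (cis (\<xi> * x) * (complex_of_real (exp (- d * \<bar>\<xi>\<bar>)) * FT f \<xi>)))"
          by (rule Bochner_Integration.integral_cong) (auto simp: g_def cis_cnj)
        also have "\<dots> = cnj (LBINT \<xi>. cis (\<xi> * x) * (complex_of_real (exp (- d * \<bar>\<xi>\<bar>)) * FT f \<xi>))"
          by (rule Bochner_Integration.integral_cnj)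
        finally show ?thesis by (simp add: FT_def[of g] del: of_real_divide)
      qed
      then show ?thesis by (simp only: inverse_FT_damped[OF f(1) d])
    qed
    have "complex_of_real ((l2 (h n))\<^sup>2) = (LBINT \<xi>. complex_of_real ((norm (h n \<xi>))\<^sup>2))"
      unfolding l2_power2 by (rule integral_complex_of_real[symmetric])
    also have "\<dots> = (LBINT \<xi>. g \<xi> * FT f \<xi>)" unfolding hg ..
    also have "\<dots> = (LBINT x. f x * FT g x)" by (rule FT_multiplication[OF f(1) g])
    finally have e: "complex_of_real ((l2 (h n))\<^sup>2) = (LBINT x. f x * FT g x)" .
    have "ennreal ((l2 (h n))\<^sup>2) = ennreal (cmod (complex_of_real ((l2 (h n))\<^sup>2)))" by (simp only: norm_of_real) simp
    also have "\<dots> \<le> (\<integral>\<^sup>+x. ennreal (cmod (f x * FT g x)) \<partial>lborel)" unfolding e by (rule norm_integral_le_nn_integral)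
    also have "\<dots> \<le> (\<integral>\<^sup>+x. \<integral>\<^sup>+y. ennreal ((cmod (f x))\<^sup>2 / 2) * ennreal (poisson d (x - y)) + ennreal ((cmod (f y))\<^sup>2 / 2) * ennreal (poisson d (x - y)) \<partial>lborel \<partial>lborel)"
    proof (rule nn_integral_mono)
      fix x
      have "ennreal (cmod (f x * FT g x)) = ennreal (cmod (f x)) * ennreal (cmod (LBINT y. f y * complex_of_real (poisson d (x - y))))"
        by (simp add: norm_mult ennreal_mult FTg)
      also have "\<dots> \<le> ennreal (cmod (f x)) * (\<integral>\<^sup>+y. ennreal (cmod (f y * complex_of_real (poisson d (x - y)))) \<partial>lborel)"
        by (intro mult_left_mono norm_integral_le_nn_integral) auto
      also have "\<dots> = (\<integral>\<^sup>+y. ennreal (cmod (f x)) * ennreal (cmod (f y * complex_of_real (poisson d (x - y)))) \<partial>lborel)"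
        by (rule nn_integral_cmult[symmetric]) auto
      also have "\<dots> \<le> (\<integral>\<^sup>+y. ennreal ((cmod (f x))\<^sup>2 / 2) * ennreal (poisson d (x - y)) + ennreal ((cmod (f y))\<^sup>2 / 2) * ennreal (poisson d (x - y)) \<partial>lborel)"
      proof (rule nn_integral_mono)
        fix y
        have P: "0 \<le> poisson d (x - y)" by (rule poisson_nonneg[OF d])
        have "cmod (f x) * cmod (f y) \<le> (cmod (f x))\<^sup>2 / 2 + (cmod (f y))\<^sup>2 / 2"
          using sum_squares_bound[of "cmod (f x)" "cmod (f y)"] by simp
        then have "cmod (f x) * cmod (f y) * poisson d (x - y) \<le> ((cmod (f x))\<^sup>2 / 2 + (cmod (f y))\<^sup>2 / 2) * poisson d (x - y)"
          using P by (rule mult_right_mono)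
        then show "ennreal (cmod (f x)) * ennreal (cmod (f y * complex_of_real (poisson d (x - y)))) \<le> ennreal ((cmod (f x))\<^sup>2 / 2) * ennreal (poisson d (x - y)) + ennreal ((cmod (f y))\<^sup>2 / 2) * ennreal (poisson d (x - y))"
          using P by (simp add: ennreal_mult[symmetric] norm_mult ennreal_plus[symmetric] ennreal_leI algebra_simps del: ennreal_plus)
      qed
      finally show "ennreal (cmod (f x * FT g x)) \<le> (\<integral>\<^sup>+y. ennreal ((cmod (f x))\<^sup>2 / 2) * ennreal (poisson d (x - y)) + ennreal ((cmod (f y))\<^sup>2 / 2) * ennreal (poisson d (x - y)) \<partial>lborel)" .
    qed
    also have "\<dots> = (\<integral>\<^sup>+x. \<integral>\<^sup>+y. ennreal ((cmod (f x))\<^sup>2 / 2) * ennreal (poisson d (x - y)) \<partial>lborel \<partial>lborel) + (\<integral>\<^sup>+x. \<integral>\<^sup>+y. ennreal ((cmod (f y))\<^sup>2 / 2) * ennreal (poisson d (x - y)) \<partial>lborel \<partial>lborel)"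
      by (subst nn_integral_add[symmetric]) (auto intro!: nn_integral_cong nn_integral_add)
    also have "(\<integral>\<^sup>+x. \<integral>\<^sup>+y. ennreal ((cmod (f y))\<^sup>2 / 2) * ennreal (poisson d (x - y)) \<partial>lborel \<partial>lborel) = (\<integral>\<^sup>+y. \<integral>\<^sup>+x. ennreal ((cmod (f y))\<^sup>2 / 2) * ennreal (poisson d (x - y)) \<partial>lborel \<partial>lborel)"
      by (rule lborel_pair.Fubini') measurable
    also have "(\<integral>\<^sup>+y. \<integral>\<^sup>+x. ennreal ((cmod (f y))\<^sup>2 / 2) * ennreal (poisson d (x - y)) \<partial>lborel \<partial>lborel) = (\<integral>\<^sup>+y. ennreal ((cmod (f y))\<^sup>2 / 2) \<partial>lborel)"
    proof (rule nn_integral_cong)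
      fix y
      have "(\<integral>\<^sup>+x. ennreal (poisson d (x - y)) \<partial>lborel) = (\<integral>\<^sup>+x. ennreal (poisson d x) \<partial>lborel)"
        using nn_integral_real_affine[of "\<lambda>x. ennreal (poisson d x)" 1 "-y"] by simp
      then show "(\<integral>\<^sup>+x. ennreal ((cmod (f y))\<^sup>2 / 2) * ennreal (poisson d (x - y)) \<partial>lborel) = ennreal ((cmod (f y))\<^sup>2 / 2)"
        by (subst nn_integral_cmult) (auto simp: nn_integral_poisson[OF d])
    qed
    also have "(\<integral>\<^sup>+x. \<integral>\<^sup>+y. ennreal ((cmod (f x))\<^sup>2 / 2) * ennreal (poisson d (x - y)) \<partial>lborel \<partial>lborel) = (\<integral>\<^sup>+y. ennreal ((cmod (f y))\<^sup>2 / 2) \<partial>lborel)"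
    proof (rule nn_integral_cong)
      fix x
      have "(\<integral>\<^sup>+y. ennreal (poisson d (x - y)) \<partial>lborel) = (\<integral>\<^sup>+x. ennreal (poisson d x) \<partial>lborel)"
        using nn_integral_real_affine[of "\<lambda>x. ennreal (poisson d x)" "-1" x] by simp
      then show "(\<integral>\<^sup>+y. ennreal ((cmod (f x))\<^sup>2 / 2) * ennreal (poisson d (x - y)) \<partial>lborel) = ennreal ((cmod (f x))\<^sup>2 / 2)"
        by (subst nn_integral_cmult) (auto simp: nn_integral_poisson[OF d])
    qed
    also have "(\<integral>\<^sup>+y. ennreal ((cmod (f y))\<^sup>2 / 2) \<partial>lborel) = ennreal ((l2 f)\<^sup>2 / 2)"
      using nn_integral_eq_integral[of lborel "\<lambda>y. (cmod (f y))\<^sup>2 / 2"] L2D(2)[OF f(2)] by (simp add: l2_power2)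
    also have "ennreal ((l2 f)\<^sup>2 / 2) + ennreal ((l2 f)\<^sup>2 / 2) = ennreal ((l2 f)\<^sup>2)"
      by (subst ennreal_plus[symmetric]) auto
    finally have "(l2 (h n))\<^sup>2 \<le> (l2 f)\<^sup>2" by (simp add: ennreal_le_iff)
    then have "l2 (h n) \<le> l2 f" by (rule power2_le_imp_le) simp
    then show ?thesis using hL by simp
  qed
  have lim: "(\<lambda>n. h n \<xi>) \<longlonglongrightarrow> FT f \<xi>" for \<xi>
  proof -
    have "(\<lambda>n. complex_of_real (exp (- (1 / real (Suc n)) / 2 * \<bar>\<xi>\<bar>)) * FT f \<xi>) \<longlonglongrightarrow> complex_of_real (exp (- 0 / 2 * \<bar>\<xi>\<bar>)) * FT f \<xi>"
      using LIMSEQ_inverse_real_of_nat by (intro tendsto_intros) (auto simp: inverse_eq_divide)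
    then show ?thesis by (simp add: h_def)
  qed
  show "FT f \<in> L2" "l2 (FT f) \<le> l2 f"
    by (rule L2_Fatou[of h "FT f" "l2 f"]; use h lim in auto)+
qed

section \<open>Square integrable functions: existence, uniqueness and linearity of the transform\<close>

definition cut :: "real \<Rightarrow> (real \<Rightarrow> real) \<Rightarrow> real \<Rightarrow> complex" where
  "cut R f x = complex_of_real (indicator {-R..R} x * f x)"

lemma truncated_fourier_eq: "truncated_fourier R f = FT (cut R f)"
proof
  fix \<xi>
  have "(CLINT x:{-R..R}|lborel. cis (- (x * \<xi>)) * complex_of_real (f x)) = (LBINT x. cis (- (x * \<xi>)) * cut R f x)"
    unfolding set_lebesgue_integral_def cut_def by (rule Bochner_Integration.integral_cong) (auto split: split_indicator)
  then show "truncated_fourier R f \<xi> = FT (cut R f) \<xi>" by (simp add: truncated_fourier_def FT_def)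
qed

lemma indicator_L2: "(\<lambda>x. complex_of_real (indicator {a..b::real} x)) \<in> L2" "(\<lambda>x. indicator {a..b} x :: real) \<in> L2"
proof -
  have "(\<lambda>x. (norm (complex_of_real (indicator {a..b::real} x)))\<^sup>2) = indicator {a..b}" "(\<lambda>x. (norm (indicator {a..b} x :: real))\<^sup>2) = indicator {a..b}"
    by (auto split: split_indicator)
  moreover have "integrable lborel (indicator {a..b::real} :: real \<Rightarrow> real)" by (simp add: emeasure_lborel_Icc_eq)
  ultimately show "(\<lambda>x. complex_of_real (indicator {a..b::real} x)) \<in> L2" "(\<lambda>x. indicator {a..b} x :: real) \<in> L2" unfolding L2_def by simp_all
qed

lemma of_real_L2: "f \<in> L2 \<Longrightarrow> (\<lambda>x. complex_of_real (f x)) \<in> L2" "l2 (\<lambda>x. complex_of_real (f x)) = l2 f"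
  by (auto simp: L2_def l2_def)

lemma cut_props:
  assumes "f \<in> L2"
  shows "cut R f \<in> L2" "integrable lborel (cut R f)"
proof -
  have [measurable]: "f \<in> borel_measurable borel" using assms by (auto simp: L2_def)
  show "cut R f \<in> L2"
    by (rule L2_dominated[OF assms]) (auto simp: cut_def[abs_def] split: split_indicator)
  show "integrable lborel (cut R f)"
    using L2_mult_integrable[OF indicator_L2(1) of_real_L2(1)[OF assms], of "-R" R] by (simp add: cut_def[abs_def])
qed

lemma cut_tendsto:
  assumes "f \<in> L2"
  shows "((\<lambda>R. l2 (\<lambda>x. cut R f x - complex_of_real (f x))) \<longlongrightarrow> 0) at_top"
proof -
  have [measurable]: "f \<in> borel_measurable borel" using assms by (auto simp: L2_def)
  have "((\<lambda>R. LBINT x. (cmod (cut R f x - complex_of_real (f x)))\<^sup>2) \<longlongrightarrow> (\<integral>x. (0::real) \<partial>(lborel :: real measure))) at_top"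
  proof (rule integral_dominated_convergence_at_top[where w="\<lambda>x. (norm (f x))\<^sup>2"])
    show "AE x in lborel. ((\<lambda>R. (cmod (cut R f x - complex_of_real (f x)))\<^sup>2) \<longlongrightarrow> 0) at_top"
    proof (rule AE_I2, rule tendsto_eventually)
      fix x
      show "\<forall>\<^sub>F R in at_top. (cmod (cut R f x - complex_of_real (f x)))\<^sup>2 = 0"
        using eventually_ge_at_top[of "\<bar>x\<bar>"] by eventually_elim (auto simp: cut_def indicator_def abs_le_iff)
    qed
    show "\<forall>\<^sub>F R in at_top. AE x in lborel. norm ((cmod (cut R f x - complex_of_real (f x)))\<^sup>2) \<le> (norm (f x))\<^sup>2"
      by (intro always_eventually allI AE_I2) (auto simp: cut_def norm_mult split: split_indicator)
  qed (use L2D[OF assms] in \<open>auto simp: cut_def\<close>)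
  then have "((\<lambda>R. sqrt (LBINT x. (cmod (cut R f x - complex_of_real (f x)))\<^sup>2)) \<longlongrightarrow> sqrt 0) at_top"
    by (intro tendsto_intros) simp
  then show ?thesis by (simp add: l2_def)
qed

lemma FT_cut_L2:
  assumes "f \<in> L2" shows "FT (cut R f) \<in> L2"
  by (intro FT_L2(1) cut_props assms)

text \<open>For square integrable \<open>g\<close> all differences are square integrable and the possibly infinite distance becomes an
  ordinary norm.\<close>

lemma is_fourier_iff:
  assumes "f \<in> L2"
  shows "is_fourier f g \<longleftrightarrow> g \<in> L2 \<and> ((\<lambda>R. l2 (\<lambda>\<xi>. FT (cut R f) \<xi> - g \<xi>)) \<longlongrightarrow> 0) at_top"
proof -
  have "(\<integral>\<^sup>+ \<xi>. ennreal ((cmod (truncated_fourier R f \<xi> - g \<xi>))\<^sup>2) \<partial>lborel) = ennreal ((l2 (\<lambda>\<xi>. FT (cut R f) \<xi> - g \<xi>))\<^sup>2)" if "g \<in> L2" for R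
    unfolding l2_power2 truncated_fourier_eq
    by (rule nn_integral_eq_integral[OF L2D(2)[OF L2_diff(1)[OF FT_cut_L2[OF assms] that]]]) simp
  moreover have "((\<lambda>R. ennreal ((l2 (\<lambda>\<xi>. FT (cut R f) \<xi> - g \<xi>))\<^sup>2)) \<longlongrightarrow> 0) at_top \<longleftrightarrow> ((\<lambda>R. l2 (\<lambda>\<xi>. FT (cut R f) \<xi> - g \<xi>)) \<longlongrightarrow> 0) at_top" (is "?A \<longleftrightarrow> ?B")
  proof
    assume ?A
    then have "((\<lambda>R. ennreal ((l2 (\<lambda>\<xi>. FT (cut R f) \<xi> - g \<xi>))\<^sup>2)) \<longlongrightarrow> ennreal 0) at_top" by simp
    then have "((\<lambda>R. (l2 (\<lambda>\<xi>. FT (cut R f) \<xi> - g \<xi>))\<^sup>2) \<longlongrightarrow> 0) at_top"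
      by (subst (asm) tendsto_ennreal_iff) auto
    then have "((\<lambda>R. sqrt ((l2 (\<lambda>\<xi>. FT (cut R f) \<xi> - g \<xi>))\<^sup>2)) \<longlongrightarrow> sqrt 0) at_top" by (rule tendsto_real_sqrt)
    then show ?B by simp
  next
    assume ?B
    then have "((\<lambda>R. ennreal ((l2 (\<lambda>\<xi>. FT (cut R f) \<xi> - g \<xi>))\<^sup>2)) \<longlongrightarrow> ennreal (0\<^sup>2)) at_top"
      by (intro tendsto_ennrealI tendsto_intros)
    then show ?A by simp
  qed
  ultimately show ?thesis unfolding is_fourier_def by auto
qed

lemma FT_cut_diff:
  assumes "f \<in> L2"
  shows "l2 (\<lambda>\<xi>. FT (cut R f) \<xi> - FT (cut S f) \<xi>)
    \<le> l2 (\<lambda>x. cut R f x - complex_of_real (f x)) + l2 (\<lambda>x. cut S f x - complex_of_real (f x))"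
proof -
  note c = cut_props[OF assms] and f = of_real_L2(1)[OF assms]
  have "l2 (\<lambda>\<xi>. FT (cut R f) \<xi> - FT (cut S f) \<xi>) = l2 (FT (\<lambda>x. cut R f x - cut S f x))"
    by (rule arg_cong[where f=l2]) (simp add: FT_diff[OF c(2) c(2)] fun_eq_iff)
  also have "\<dots> \<le> l2 (\<lambda>x. cut R f x - cut S f x)"
    by (intro FT_L2(2) L2_diff c Bochner_Integration.integrable_diff)
  also have "\<dots> = l2 (\<lambda>x. (cut R f x - complex_of_real (f x)) - (cut S f x - complex_of_real (f x)))" by simp
  also have "\<dots> \<le> l2 (\<lambda>x. cut R f x - complex_of_real (f x)) + l2 (\<lambda>x. cut S f x - complex_of_real (f x))"
    by (intro L2_diff c f)
  finally show ?thesis .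
qed

text \<open>The truncated transforms form a Cauchy family in L2; along a fast subsequence they converge almost everywhere,
  as in the Riesz-Fischer theorem.\<close>

lemma ex_is_fourier:
  assumes f: "f \<in> L2" shows "\<exists>g. is_fourier f g"
proof -
  define e where "e R = l2 (\<lambda>x. cut R f x - complex_of_real (f x))" for R
  have e0: "0 \<le> e R" for R by (simp add: e_def)
  have etend: "(e \<longlongrightarrow> 0) at_top" using cut_tendsto[OF f] by (simp add: e_def[abs_def])
  have "\<exists>R. e R \<le> (1/4)^n" for n :: nat
  proof -
    have "\<forall>\<^sub>F R in at_top. e R < (1/4)^n" by (rule order_tendstoD(2)[OF etend]) simp
    then show ?thesis by (auto simp: eventually_at_top_linorder intro: less_imp_le)
  qed
  then obtain r where r: "\<And>n. e (r n) \<le> (1/4)^n" by metis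
  define T where "T n = FT (cut (r n) f)" for n
  have TL: "T n \<in> L2" for n unfolding T_def by (rule FT_cut_L2[OF f])
  have [measurable]: "T n \<in> borel_measurable borel" for n using TL[of n] by (auto simp: L2_def)
  define D where "D n \<xi> = T (Suc n) \<xi> - T n \<xi>" for n \<xi>
  have DL: "D n \<in> L2" for n unfolding D_def by (intro L2_diff TL)
  have Dn: "l2 (D n) \<le> 2 * (1/4)^n" for n
  proof -
    have "l2 (D n) \<le> e (r (Suc n)) + e (r n)" unfolding D_def T_def e_def by (rule FT_cut_diff[OF f])
    also have "\<dots> \<le> (1/4)^Suc n + (1/4)^n" by (intro add_mono r)
    also have "\<dots> \<le> 2 * (1/4)^n" by simp
    finally show ?thesis .
  qed
  have [measurable]: "D n \<in> borel_measurable borel" for n unfolding D_def by measurable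
  have "(\<integral>\<^sup>+\<xi>. (\<Sum>n. ennreal (2^n * (cmod (D n \<xi>))\<^sup>2)) \<partial>lborel) = (\<Sum>n. \<integral>\<^sup>+\<xi>. ennreal (2^n * (cmod (D n \<xi>))\<^sup>2) \<partial>lborel)"
    by (rule nn_integral_suminf) auto
  also have "\<dots> \<le> (\<Sum>n. ennreal (4 * (1/8)^n))"
  proof (intro suminf_le)
    fix n
    have "(\<integral>\<^sup>+\<xi>. ennreal (2^n * (cmod (D n \<xi>))\<^sup>2) \<partial>lborel) = ennreal (2^n * (l2 (D n))\<^sup>2)"
      unfolding l2_power2 using nn_integral_eq_integral[of lborel "\<lambda>\<xi>. 2^n * (cmod (D n \<xi>))\<^sup>2"] L2D(2)[OF DL[of n]] by simp
    also have "\<dots> \<le> ennreal (4 * (1/8)^n)"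
    proof (rule ennreal_leI)
      have "2^n * (l2 (D n))\<^sup>2 \<le> 2^n * (2 * (1/4)^n)\<^sup>2" using Dn[of n] by (intro mult_left_mono power_mono) auto
      also have "\<dots> = 4 * (2 * ((1/4)^2))^n" by (simp only: power_mult_distrib power_mult[symmetric] mult.commute[of n 2]) simp
      finally show "2^n * (l2 (D n))\<^sup>2 \<le> 4 * (1/8)^n" by (simp add: power2_eq_square)
    qed
    finally show "(\<integral>\<^sup>+\<xi>. ennreal (2^n * (cmod (D n \<xi>))\<^sup>2) \<partial>lborel) \<le> ennreal (4 * (1/8)^n)" .
  qed auto
  also have "\<dots> < \<infinity>"
    by (subst suminf_ennreal2) (auto intro!: summable_mult summable_geometric)
  finally have "AE \<xi> in lborel. (\<Sum>n. ennreal (2^n * (cmod (D n \<xi>))\<^sup>2)) \<noteq> \<infinity>"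
    by (intro nn_integral_noteq_infinite) auto
  then have conv: "AE \<xi> in lborel. convergent (\<lambda>n. T n \<xi>)"
  proof eventually_elim
    case (elim \<xi>)
    then have s: "summable (\<lambda>n. 2^n * (cmod (D n \<xi>))\<^sup>2)" by (intro summable_suminf_not_top) auto
    have "summable (\<lambda>n. 2^n * (cmod (D n \<xi>))\<^sup>2 + (1/2)^n)" by (intro summable_add s summable_geometric) auto
    then have "summable (\<lambda>n. D n \<xi>)"
    proof (rule summable_comparison_test')
      fix n :: nat
      define a where "a = (2::real)^n"
      have a: "0 < a" by (simp add: a_def)
      have "2 * cmod (D n \<xi>) \<le> a * (cmod (D n \<xi>))\<^sup>2 + 1 / a"
      proof -
        have "0 \<le> (a * cmod (D n \<xi>) - 1)\<^sup>2 / a" using a by simp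
        also have "\<dots> = a * (cmod (D n \<xi>))\<^sup>2 + 1 / a - 2 * cmod (D n \<xi>)" using a by (simp add: field_simps power2_eq_square)
        finally show ?thesis by simp
      qed
      then have "cmod (D n \<xi>) \<le> a * (cmod (D n \<xi>))\<^sup>2 + 1 / a" using norm_ge_zero[of "D n \<xi>"] by linarith
      then show "norm (D n \<xi>) \<le> 2^n * (cmod (D n \<xi>))\<^sup>2 + (1/2)^n" by (simp add: a_def power_one_over)
    qed
    then have "convergent (\<lambda>n. \<Sum>i<n. D i \<xi>)" by (simp add: summable_iff_convergent)
    then have "convergent (\<lambda>n. T 0 \<xi> + (\<Sum>i<n. D i \<xi>))" by (intro convergent_add convergent_const)
    moreover have "T 0 \<xi> + (\<Sum>i<n. D i \<xi>) = T n \<xi>" for n by (induction n) (auto simp: D_def algebra_simps)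
    ultimately show ?case by simp
  qed
  define g where "g \<xi> = lim (\<lambda>n. T n \<xi>)" for \<xi>
  have [measurable]: "g \<in> borel_measurable borel" unfolding g_def[abs_def] by measurable
  have lim: "AE \<xi> in lborel. (\<lambda>n. T n \<xi>) \<longlonglongrightarrow> g \<xi>"
    using conv by eventually_elim (simp add: g_def convergent_LIMSEQ_iff)
  have key: "(\<lambda>\<xi>. FT (cut R f) \<xi> - g \<xi>) \<in> L2 \<and> l2 (\<lambda>\<xi>. FT (cut R f) \<xi> - g \<xi>) \<le> e R + (1/4)^m" for R m
  proof -
    have a: "(\<lambda>\<xi>. FT (cut R f) \<xi> - T n \<xi>) \<in> L2" for n by (intro L2_diff FT_cut_L2 TL f)
    have b: "(\<lambda>\<xi>. FT (cut R f) \<xi> - g \<xi>) \<in> borel_measurable lborel"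
      using L2D(1)[OF FT_cut_L2[OF f, of R]] by simp
    have c: "AE \<xi> in lborel. (\<lambda>n. FT (cut R f) \<xi> - T n \<xi>) \<longlonglongrightarrow> FT (cut R f) \<xi> - g \<xi>"
      using lim by eventually_elim (intro tendsto_intros)
    have d: "\<forall>\<^sub>F n in sequentially. l2 (\<lambda>\<xi>. FT (cut R f) \<xi> - T n \<xi>) \<le> e R + (1/4)^m"
      using eventually_ge_at_top[of m]
    proof eventually_elim
      case (elim n)
      have "l2 (\<lambda>\<xi>. FT (cut R f) \<xi> - T n \<xi>) \<le> e R + e (r n)" unfolding T_def e_def by (rule FT_cut_diff[OF f])
      also have "e (r n) \<le> (1/4)^n" by (rule r)
      also have "(1/4::real)^n \<le> (1/4)^m" using elim by (intro power_decreasing) auto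
      finally show ?case by simp
    qed
    have "0 \<le> e R + (1/4)^m" using e0[of R] by simp
    from L2_Fatou[OF a b c d this] show ?thesis by simp
  qed
  have key2: "l2 (\<lambda>\<xi>. FT (cut R f) \<xi> - g \<xi>) \<le> e R" for R
  proof (rule LIMSEQ_le_const)
    have "(\<lambda>m. e R + (1/4)^m) \<longlonglongrightarrow> e R + 0" by (intro tendsto_intros) simp
    then show "(\<lambda>m. e R + (1/4)^m) \<longlonglongrightarrow> e R" by simp
  qed (use key in auto)
  have "(\<lambda>\<xi>. FT (cut 0 f) \<xi> - (FT (cut 0 f) \<xi> - g \<xi>)) \<in> L2"
    by (rule L2_diff(1)[OF FT_cut_L2[OF f] conjunct1[OF key]])
  moreover have "(\<lambda>\<xi>. FT (cut 0 f) \<xi> - (FT (cut 0 f) \<xi> - g \<xi>)) = g" by auto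
  ultimately have gL: "g \<in> L2" by (simp only:)
  have "((\<lambda>R. l2 (\<lambda>\<xi>. FT (cut R f) \<xi> - g \<xi>)) \<longlongrightarrow> 0) at_top"
    by (rule tendsto_sandwich[OF _ _ tendsto_const etend]) (use key2 in auto)
  then show ?thesis using gL is_fourier_iff[OF f] by blast
qed

lemma is_fourier_fourier: "f \<in> L2 \<Longrightarrow> is_fourier f (fourier f)"
  unfolding fourier_def using ex_is_fourier by (rule someI_ex)

lemma is_fourier_unique:
  assumes f: "f \<in> L2" and "is_fourier f g" "is_fourier f h"
  shows "AE \<xi> in lborel. g \<xi> = h \<xi>"
proof -
  have g: "g \<in> L2" "((\<lambda>R. l2 (\<lambda>\<xi>. FT (cut R f) \<xi> - g \<xi>)) \<longlongrightarrow> 0) at_top"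
    and h: "h \<in> L2" "((\<lambda>R. l2 (\<lambda>\<xi>. FT (cut R f) \<xi> - h \<xi>)) \<longlongrightarrow> 0) at_top"
    using assms is_fourier_iff[OF f] by auto
  have "l2 (\<lambda>\<xi>. g \<xi> - h \<xi>) \<le> 0"
  proof (rule tendsto_lowerbound)
    show "((\<lambda>R. l2 (\<lambda>\<xi>. FT (cut R f) \<xi> - h \<xi>) + l2 (\<lambda>\<xi>. FT (cut R f) \<xi> - g \<xi>)) \<longlongrightarrow> 0) at_top"
      using tendsto_add[OF h(2) g(2)] by simp
    show "\<forall>\<^sub>F R in at_top. l2 (\<lambda>\<xi>. g \<xi> - h \<xi>) \<le> l2 (\<lambda>\<xi>. FT (cut R f) \<xi> - h \<xi>) + l2 (\<lambda>\<xi>. FT (cut R f) \<xi> - g \<xi>)"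
    proof (rule always_eventually, rule allI)
      fix R
      show "l2 (\<lambda>\<xi>. g \<xi> - h \<xi>) \<le> l2 (\<lambda>\<xi>. FT (cut R f) \<xi> - h \<xi>) + l2 (\<lambda>\<xi>. FT (cut R f) \<xi> - g \<xi>)"
        using L2_diff(2)[OF L2_diff(1)[OF FT_cut_L2[OF f, of R] h(1)] L2_diff(1)[OF FT_cut_L2[OF f, of R] g(1)]] by simp
    qed
  qed simp
  then have "l2 (\<lambda>\<xi>. g \<xi> - h \<xi>) = 0" using l2_nonneg[of "\<lambda>\<xi>. g \<xi> - h \<xi>"] by simp
  then show ?thesis using l2_eq_0_iff[OF L2_diff(1)[OF g(1) h(1)]] by simp
qed

lemma is_fourier_linear:
  assumes f: "f \<in> L2" "is_fourier f a" and g: "g \<in> L2" "is_fourier g b"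
  shows "is_fourier (\<lambda>x. p * f x + q * g x) (\<lambda>\<xi>. complex_of_real p * a \<xi> + complex_of_real q * b \<xi>)"
proof -
  have h: "(\<lambda>x. p * f x + q * g x) \<in> L2" by (intro L2_add(1) L2_cmult(1) f g)
  have a: "a \<in> L2" "((\<lambda>R. l2 (\<lambda>\<xi>. FT (cut R f) \<xi> - a \<xi>)) \<longlongrightarrow> 0) at_top"
    and b: "b \<in> L2" "((\<lambda>R. l2 (\<lambda>\<xi>. FT (cut R g) \<xi> - b \<xi>)) \<longlongrightarrow> 0) at_top"
    using assms is_fourier_iff by auto
  have F: "FT (cut R (\<lambda>x. p * f x + q * g x)) \<xi> = p * FT (cut R f) \<xi> + q * FT (cut R g) \<xi>" for R \<xi>
  proof -
    have "FT (cut R (\<lambda>x. p * f x + q * g x)) \<xi> = FT (\<lambda>x. complex_of_real p * cut R f x + complex_of_real q * cut R g x) \<xi>"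
      by (rule arg_cong[where f="\<lambda>h. FT h \<xi>"]) (auto simp: cut_def fun_eq_iff algebra_simps)
    also have "\<dots> = p * FT (cut R f) \<xi> + q * FT (cut R g) \<xi>"
      by (subst FT_add) (auto simp: FT_cmult intro!: cut_props f g)
    finally show ?thesis .
  qed
  have "((\<lambda>R. l2 (\<lambda>\<xi>. FT (cut R (\<lambda>x. p * f x + q * g x)) \<xi> - (complex_of_real p * a \<xi> + complex_of_real q * b \<xi>))) \<longlongrightarrow> 0) at_top"
  proof (rule tendsto_sandwich[OF _ _ tendsto_const])
    show "((\<lambda>R. \<bar>p\<bar> * l2 (\<lambda>\<xi>. FT (cut R f) \<xi> - a \<xi>) + \<bar>q\<bar> * l2 (\<lambda>\<xi>. FT (cut R g) \<xi> - b \<xi>)) \<longlongrightarrow> 0) at_top"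
      by (rule tendsto_eq_intros a(2) b(2) refl | simp)+
    show "\<forall>\<^sub>F R in at_top. l2 (\<lambda>\<xi>. FT (cut R (\<lambda>x. p * f x + q * g x)) \<xi> - (complex_of_real p * a \<xi> + complex_of_real q * b \<xi>))
        \<le> \<bar>p\<bar> * l2 (\<lambda>\<xi>. FT (cut R f) \<xi> - a \<xi>) + \<bar>q\<bar> * l2 (\<lambda>\<xi>. FT (cut R g) \<xi> - b \<xi>)"
    proof (rule always_eventually, rule allI)
      fix R
      note A = L2_diff(1)[OF FT_cut_L2[OF f(1), of R] a(1)] and B = L2_diff(1)[OF FT_cut_L2[OF g(1), of R] b(1)]
      have "l2 (\<lambda>\<xi>. FT (cut R (\<lambda>x. p * f x + q * g x)) \<xi> - (complex_of_real p * a \<xi> + complex_of_real q * b \<xi>))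
         = l2 (\<lambda>\<xi>. complex_of_real p * (FT (cut R f) \<xi> - a \<xi>) + complex_of_real q * (FT (cut R g) \<xi> - b \<xi>))"
        by (rule arg_cong[where f=l2]) (auto simp: F fun_eq_iff algebra_simps)
      also have "\<dots> \<le> \<bar>p\<bar> * l2 (\<lambda>\<xi>. FT (cut R f) \<xi> - a \<xi>) + \<bar>q\<bar> * l2 (\<lambda>\<xi>. FT (cut R g) \<xi> - b \<xi>)"
        using L2_add(2)[OF L2_cmult(1)[OF A, of p] L2_cmult(1)[OF B, of q]] by (simp add: L2_cmult(2)[OF A] L2_cmult(2)[OF B])
      finally show "l2 (\<lambda>\<xi>. FT (cut R (\<lambda>x. p * f x + q * g x)) \<xi> - (complex_of_real p * a \<xi> + complex_of_real q * b \<xi>))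
        \<le> \<bar>p\<bar> * l2 (\<lambda>\<xi>. FT (cut R f) \<xi> - a \<xi>) + \<bar>q\<bar> * l2 (\<lambda>\<xi>. FT (cut R g) \<xi> - b \<xi>)" .
    qed
  qed auto
  then show ?thesis using is_fourier_iff[OF h] L2_add(1)[OF L2_cmult(1)[OF a(1)] L2_cmult(1)[OF b(1)]] by blast
qed

lemma fourier_linear:
  assumes "f \<in> L2" "g \<in> L2"
  shows "AE \<xi> in lborel. fourier (\<lambda>x. p * f x + q * g x) \<xi> = complex_of_real p * fourier f \<xi> + complex_of_real q * fourier g \<xi>"
  by (intro is_fourier_unique[where f="\<lambda>x. p * f x + q * g x"] is_fourier_fourier is_fourier_linear L2_add(1) L2_cmult(1) assms)

lemma fourier_L2: "f \<in> L2 \<Longrightarrow> fourier f \<in> L2"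
  using is_fourier_fourier is_fourier_iff by blast

lemma is_fourier_FT:
  assumes "f \<in> L2" "integrable lborel f"
  shows "is_fourier f (FT (\<lambda>x. complex_of_real (f x)))"
proof -
  have f: "integrable lborel (\<lambda>x. complex_of_real (f x))" using assms by simp
  note fL = of_real_L2(1)[OF assms(1)]
  have "((\<lambda>R. l2 (\<lambda>\<xi>. FT (cut R f) \<xi> - FT (\<lambda>x. complex_of_real (f x)) \<xi>)) \<longlongrightarrow> 0) at_top"
  proof (rule tendsto_sandwich[OF _ _ tendsto_const cut_tendsto[OF assms(1)]])
    show "\<forall>\<^sub>F R in at_top. l2 (\<lambda>\<xi>. FT (cut R f) \<xi> - FT (\<lambda>x. complex_of_real (f x)) \<xi>) \<le> l2 (\<lambda>x. cut R f x - complex_of_real (f x))"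
    proof (rule always_eventually, rule allI)
      fix R
      have "l2 (\<lambda>\<xi>. FT (cut R f) \<xi> - FT (\<lambda>x. complex_of_real (f x)) \<xi>) = l2 (FT (\<lambda>x. cut R f x - complex_of_real (f x)))"
        by (rule arg_cong[where f=l2]) (simp add: FT_diff[OF cut_props(2)[OF assms(1)] f] fun_eq_iff)
      also have "\<dots> \<le> l2 (\<lambda>x. cut R f x - complex_of_real (f x))"
        by (intro FT_L2(2) L2_diff Bochner_Integration.integrable_diff f fL cut_props assms)
      finally show "l2 (\<lambda>\<xi>. FT (cut R f) \<xi> - FT (\<lambda>x. complex_of_real (f x)) \<xi>) \<le> l2 (\<lambda>x. cut R f x - complex_of_real (f x))" .
    qed
  qed auto
  then show ?thesis using is_fourier_iff[OF assms(1)] FT_L2(1)[OF f fL] by blast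
qed

lemma is_fourier_multiplication:
  assumes u: "u \<in> L2" "is_fourier u a" and b: "integrable lborel b" "b \<in> L2"
  shows "(LBINT x. complex_of_real (u x) * FT b x) = (LBINT \<xi>. a \<xi> * b \<xi>)"
proof -
  have a: "a \<in> L2" "((\<lambda>R. l2 (\<lambda>\<xi>. FT (cut R u) \<xi> - a \<xi>)) \<longlongrightarrow> 0) at_top"
    using u is_fourier_iff by auto
  have z: "((\<lambda>R. l2 (\<lambda>\<xi>. h \<xi> - h \<xi>)) \<longlongrightarrow> 0) at_top" for h :: "real \<Rightarrow> complex" by (simp add: l2_def)
  have 1: "((\<lambda>R. LBINT x. cut R u x * FT b x) \<longlongrightarrow> (LBINT x. complex_of_real (u x) * FT b x)) at_top"
    by (rule L2_tendsto_integral_mult[OF _ _ _ _ cut_tendsto[OF u(1)] z]) (auto intro!: always_eventually cut_props FT_L2 u b of_real_L2)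
  have 2: "((\<lambda>R. LBINT \<xi>. FT (cut R u) \<xi> * b \<xi>) \<longlongrightarrow> (LBINT \<xi>. a \<xi> * b \<xi>)) at_top"
    by (rule L2_tendsto_integral_mult[OF _ _ _ _ a(2) z]) (auto intro!: always_eventually FT_cut_L2 u b a)
  have 3: "(LBINT \<xi>. FT (cut R u) \<xi> * b \<xi>) = (LBINT x. cut R u x * FT b x)" for R
    using FT_multiplication[OF cut_props(2)[OF u(1), of R] b(1)] by (simp add: mult.commute)
  show ?thesis using tendsto_unique[OF _ 1 2[unfolded 3]] by simp
qed

section \<open>Fourier inversion\<close>

text \<open>Compact intervals are stable under intersection and generate the Borel sets.\<close>

lemma AE_eq_0_if_interval_integrals:
  fixes w :: "real \<Rightarrow> real"
  assumes li: "locally_integrable w" and z: "\<And>p q. p \<le> q \<Longrightarrow> (LBINT x. indicator {p..q} x * w x) = 0"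
  shows "AE x in lborel. w x = 0"
proof -
  have "AE x in lborel. indicator {-real N..real N} x * w x = 0" for N :: nat
  proof (rule density_unique_real)
    define wN where "wN x = indicator {-real N..real N} x * w x" for x
    have i: "integrable lborel wN"
      using li by (auto simp: locally_integrable_def set_integrable_def wN_def[abs_def])
    then show "integrable lborel (\<lambda>x. indicator {-real N..real N} x * w x)" by (simp add: wN_def[abs_def])
    have si: "set_integrable lborel A wN" if "A \<in> sets borel" for A
      unfolding set_integrable_def using integrable_mult_indicator[OF _ i, of A] that by simp
    have total: "(LBINT x. wN x) = 0" using z[of "-real N" "real N"] by (simp add: wN_def)
    have int: "Int_stable (range (\<lambda>(a, b). {a..b::real}))"
      by (auto simp: Int_stable_def)
    have cl: "range (\<lambda>(a, b). {a..b::real}) \<subseteq> Pow UNIV" by auto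
    have "A \<in> sigma_sets UNIV (range (\<lambda>(a, b). {a..b::real})) \<Longrightarrow> (\<integral>x\<in>A. wN x \<partial>lborel) = 0" for A
    proof (induction rule: sigma_sets_induct_disjoint[OF int cl, consumes 1, case_names basic empty compl union])
      case (basic A)
      then obtain a b where A: "A = {a..b}" by auto
      have "indicator A x *\<^sub>R wN x = indicator {max a (-real N)..min b (real N)} x * w x" for x
        by (auto simp: A wN_def split: split_indicator)
      then have e: "(\<integral>x\<in>A. wN x \<partial>lborel) = (LBINT x. indicator {max a (-real N)..min b (real N)} x * w x)"
        unfolding set_lebesgue_integral_def by simp
      show ?case
      proof (cases "max a (-real N) \<le> min b (real N)")
        case True
        then show ?thesis using z e by simp
      next
        case False
        then have "{max a (-real N)..min b (real N)} = {}" by auto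
        then show ?thesis using e by simp
      qed
    next
      case empty
      then show ?case by (simp add: set_lebesgue_integral_def)
    next
      case (compl A)
      have A: "A \<in> sets borel" using compl(1) by (simp add: borel_eq_atLeastAtMost)
      have "(LBINT x. wN x) = (\<integral>x\<in>A \<union> (UNIV - A). wN x \<partial>lborel)" by (simp add: set_lebesgue_integral_def)
      also have "\<dots> = (\<integral>x\<in>A. wN x \<partial>lborel) + (\<integral>x\<in>UNIV - A. wN x \<partial>lborel)"
        by (rule set_integral_Un) (use A in \<open>auto intro!: si\<close>)
      finally show ?case using total compl by simp
    next
      case (union A)
      have A: "A i \<in> sets borel" for i using union(2) by (auto simp: borel_eq_atLeastAtMost)
      have "(\<integral>x\<in>(\<Union>i. A i). wN x \<partial>lborel) = (\<Sum>i. \<integral>x\<in>A i. wN x \<partial>lborel)"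
        by (rule lebesgue_integral_countable_add) (use A union(1) in \<open>auto intro!: si simp: disjoint_family_on_def\<close>)
      then show ?case using union by simp
    qed
    then have "(\<integral>x\<in>A. wN x \<partial>lborel) = 0" if "A \<in> sets lborel" for A
      using that by (simp add: borel_eq_atLeastAtMost)
    then show "(\<integral>x\<in>A. indicator {-real N..real N} x * w x \<partial>lborel) = (\<integral>x\<in>A. 0 \<partial>lborel)" if "A \<in> sets lborel" for A
      using that by (simp add: wN_def[abs_def])
  qed simp
  then have "AE x in lborel. \<forall>N :: nat. indicator {-real N..real N} x * w x = 0"
    by (subst AE_all_countable) blast
  then show ?thesis
  proof eventually_elim
    case (elim x)
    obtain N :: nat where "\<bar>x\<bar> \<le> real N" using real_arch_simple by blast
    then have "indicator {-real N..real N} x = (1::real)" by (auto simp: abs_le_iff)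
    then show ?case using elim by (metis mult_1)
  qed
qed

definition IFT :: "(real \<Rightarrow> complex) \<Rightarrow> real \<Rightarrow> complex" where
  "IFT a x = FT a (- x)"

lemma IFT_eq: "IFT a x = complex_of_real (1 / sqrt (2 * pi)) * (LBINT \<xi>. cis (x * \<xi>) * a \<xi>)"
  by (simp add: IFT_def FT_def mult.commute)

lemma IFT_cnj: "IFT b x = cnj (FT (\<lambda>\<xi>. cnj (b \<xi>)) x)"
proof -
  have "(LBINT \<xi>. cis (x * \<xi>) * b \<xi>) = (LBINT \<xi>. cnj (cis (- (\<xi> * x)) * cnj (b \<xi>)))"
    by (rule Bochner_Integration.integral_cong) (auto simp: cis_cnj mult.commute)
  also have "\<dots> = cnj (LBINT \<xi>. cis (- (\<xi> * x)) * cnj (b \<xi>))" by (rule Bochner_Integration.integral_cnj)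
  finally show ?thesis by (simp add: IFT_eq FT_def del: of_real_divide)
qed

lemma IFT_L2:
  assumes "integrable lborel a" "a \<in> L2" shows "IFT a \<in> L2" "l2 (IFT a) \<le> l2 a"
proof -
  have "IFT a = (\<lambda>x. FT a (- x))" by (simp add: IFT_def[abs_def])
  then show "IFT a \<in> L2" "l2 (IFT a) \<le> l2 a" using L2_reflect[OF FT_L2(1)[OF assms]] FT_L2(2)[OF assms] by simp_all
qed

lemma IFT_bound: "integrable lborel a \<Longrightarrow> cmod (IFT a x) \<le> (LBINT \<xi>. cmod (a \<xi>))"
  unfolding IFT_def by (rule FT_bound)

lemma cnj_L2: "a \<in> L2 \<Longrightarrow> (\<lambda>\<xi>. cnj (a \<xi>)) \<in> L2" "l2 (\<lambda>\<xi>. cnj (a \<xi>)) = l2 a"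
  by (auto simp: L2_def l2_def)

lemma cnj_integrable: "integrable lborel a \<Longrightarrow> integrable lborel (\<lambda>\<xi>. cnj (a \<xi>))"
  by (simp add: complex_integrable_cnj)

text \<open>The first factor is only square integrable, so this is the multiplication formula for truncations, passed to the limit.\<close>

lemma fourier_parseval:
  assumes u: "u \<in> L2" and b: "integrable lborel b" "b \<in> L2"
  shows "(LBINT x. complex_of_real (u x) * IFT b x) = (LBINT \<xi>. cnj (fourier u \<xi>) * b \<xi>)"
proof -
  have "(LBINT x. complex_of_real (u x) * IFT b x) = (LBINT x. cnj (complex_of_real (u x) * FT (\<lambda>\<xi>. cnj (b \<xi>)) x))"
    by (rule Bochner_Integration.integral_cong) (auto simp: IFT_cnj)
  also have "\<dots> = cnj (LBINT x. complex_of_real (u x) * FT (\<lambda>\<xi>. cnj (b \<xi>)) x)" by (rule Bochner_Integration.integral_cnj)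
  also have "\<dots> = cnj (LBINT \<xi>. fourier u \<xi> * cnj (b \<xi>))"
    by (subst is_fourier_multiplication[OF u is_fourier_fourier[OF u]]) (auto intro: cnj_L2 cnj_integrable b)
  also have "\<dots> = (LBINT \<xi>. cnj (fourier u \<xi> * cnj (b \<xi>)))" by (rule Bochner_Integration.integral_cnj[symmetric])
  finally show ?thesis by simp
qed

lemma poisson_smoothed_indicator:
  assumes "0 < d" "p \<le> q"
  shows "(LBINT y. complex_of_real (indicator {p..q} y) * complex_of_real (poisson d (x - y)))
    = complex_of_real ((arctan ((x - p) / d) - arctan ((x - q) / d)) / pi)"
proof -
  have "has_bochner_integral lborel (\<lambda>y. indicator {p..q} y *\<^sub>R poisson d (x - y)) (- (arctan ((x - q) / d) / pi) - - (arctan ((x - p) / d) / pi))"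
  proof (rule has_bochner_integral_FTC_Icc[OF assms(2)])
    fix y
    have "((\<lambda>y. arctan ((x - y) / d) / pi) has_real_derivative poisson d (x - y) * -1) (at y)"
      by (rule DERIV_chain2[OF poisson_antiderivative[OF assms(1)]]) (auto intro!: derivative_eq_intros)
    then have "((\<lambda>y. - (arctan ((x - y) / d) / pi)) has_real_derivative poisson d (x - y)) (at y)"
      using DERIV_minus by fastforce
    then show "((\<lambda>y. - (arctan ((x - y) / d) / pi)) has_vector_derivative poisson d (x - y)) (at y within {p..q})"
      by (simp add: has_real_derivative_iff_has_vector_derivative[symmetric] has_field_derivative_at_within)
  next
    have "d\<^sup>2 + z\<^sup>2 \<noteq> 0" for z using assms(1) by (metis less_irrefl sum_power2_eq_zero_iff)
    then show "continuous_on {p..q} (\<lambda>y. poisson d (x - y))"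
      unfolding poisson_def by (intro continuous_intros) auto
  qed
  then have 1: "(LBINT y. indicator {p..q} y * poisson d (x - y)) = (arctan ((x - p) / d) - arctan ((x - q) / d)) / pi"
    by (simp add: has_bochner_integral_integral_eq diff_divide_distrib)
  show ?thesis unfolding of_real_mult[symmetric] integral_complex_of_real 1 ..
qed

lemma arctan_scaled_tendsto:
  "(\<lambda>n. arctan (z / (1 / real (Suc n)))) \<longlonglongrightarrow> (pi / 2) * sgn z"
proof (cases z "0 :: real" rule: linorder_cases)
  case greater
  have "filterlim (\<lambda>n. z * real (Suc n)) at_top sequentially"
    by (rule filterlim_tendsto_pos_mult_at_top[OF tendsto_const greater]) (rule filterlim_compose[OF filterlim_real_sequentially filterlim_Suc])
  then have "(\<lambda>n. arctan (z * real (Suc n))) \<longlonglongrightarrow> pi / 2" by (rule filterlim_compose[OF tendsto_arctan_at_top])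
  then show ?thesis using greater by simp
next
  case less
  have "filterlim (\<lambda>n. z * real (Suc n)) at_bot sequentially"
    by (rule filterlim_tendsto_neg_mult_at_bot[OF tendsto_const less]) (rule filterlim_compose[OF filterlim_real_sequentially filterlim_Suc])
  then have "(\<lambda>n. arctan (z * real (Suc n))) \<longlonglongrightarrow> - (pi / 2)" by (rule filterlim_compose[OF tendsto_arctan_at_bot])
  then show ?thesis using less by simp
qed simp

text \<open>Damping the transform of the indicator makes it integrable, and it transforms back into the indicator smoothed by the
  Poisson kernel, an explicit difference of arctangents that converges boundedly to the indicator.\<close>

lemma FT_pairing_indicator:
  assumes f: "integrable lborel f" "f \<in> L2" and pq: "p \<le> q"
  shows "(LBINT x. f x * complex_of_real (indicator {p..q} x))
    = (LBINT \<xi>. FT f \<xi> * IFT (\<lambda>x. complex_of_real (indicator {p..q} x)) \<xi>)"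
proof -
  define i where "i x = complex_of_real (indicator {p..q} x)" for x :: real
  have ii: "integrable lborel i" unfolding i_def using pq by (simp add: emeasure_lborel_Icc_eq)
  have iL: "i \<in> L2" unfolding i_def[abs_def] by (rule indicator_L2)
  have [measurable]: "f \<in> borel_measurable borel" "i \<in> borel_measurable borel" using f ii by auto
  have Im[measurable]: "IFT i \<in> borel_measurable borel" unfolding IFT_def[abs_def] by measurable
  define C where "C = (LBINT x. cmod (i x))"
  have C: "cmod (IFT i \<xi>) \<le> C" for \<xi> unfolding C_def by (rule IFT_bound[OF ii])
  define b where "b n \<xi> = complex_of_real (exp (- (1 / real (Suc n)) * \<bar>\<xi>\<bar>)) * IFT i \<xi>" for n :: nat and \<xi>
  define P where "P n x = complex_of_real ((arctan ((x - p) / (1 / real (Suc n))) - arctan ((x - q) / (1 / real (Suc n)))) / pi)" for n :: nat and x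
  have bi: "integrable lborel (b n)" for n
    unfolding b_def by (rule exp_damped_integrable[where C=C]) (use C in auto)
  have FTb: "FT (b n) x = P n x" for n x
  proof -
    define d where "d = 1 / real (Suc n)"
    have d: "0 < d" by (simp add: d_def)
    have "(LBINT \<xi>. cis (- (\<xi> * x)) * b n \<xi>) = (LBINT \<xi>. cis (\<xi> * x) * b n (- \<xi>))"
      by (subst integral_reflect[symmetric]) simp
    also have "\<dots> = (LBINT \<xi>. cis (\<xi> * x) * (complex_of_real (exp (- d * \<bar>\<xi>\<bar>)) * FT i \<xi>))"
      by (simp add: b_def d_def IFT_def)
    finally have "FT (b n) x = (LBINT y. i y * complex_of_real (poisson d (x - y)))"
      unfolding inverse_FT_damped[OF ii d, symmetric] by (simp add: FT_def)
    then show ?thesis unfolding P_def i_def d_def[symmetric] poisson_smoothed_indicator[OF d pq] .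
  qed
  have e: "(LBINT \<xi>. b n \<xi> * FT f \<xi>) = (LBINT x. f x * P n x)" for n
    using FT_multiplication[OF f(1) bi[of n]] unfolding FTb .
  have [measurable]: "P n \<in> borel_measurable borel" for n unfolding P_def by measurable
  have [measurable]: "b n \<in> borel_measurable borel" for n unfolding b_def by measurable
  have 1: "(\<lambda>n. LBINT \<xi>. b n \<xi> * FT f \<xi>) \<longlonglongrightarrow> (LBINT \<xi>. IFT i \<xi> * FT f \<xi>)"
  proof (rule integral_dominated_convergence)
    show "integrable lborel (\<lambda>\<xi>. cmod (IFT i \<xi> * FT f \<xi>))"
      by (intro integrable_norm L2_mult_integrable IFT_L2 FT_L2 ii iL f)
    show "AE \<xi> in lborel. (\<lambda>n. b n \<xi> * FT f \<xi>) \<longlonglongrightarrow> IFT i \<xi> * FT f \<xi>"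
    proof (rule AE_I2)
      fix \<xi>
      have "(\<lambda>n. complex_of_real (exp (- (1 / real (Suc n)) * \<bar>\<xi>\<bar>)) * IFT i \<xi> * FT f \<xi>) \<longlonglongrightarrow> complex_of_real (exp (- 0 * \<bar>\<xi>\<bar>)) * IFT i \<xi> * FT f \<xi>"
        using LIMSEQ_inverse_real_of_nat by (intro tendsto_intros) (auto simp: inverse_eq_divide)
      then show "(\<lambda>n. b n \<xi> * FT f \<xi>) \<longlonglongrightarrow> IFT i \<xi> * FT f \<xi>" by (simp add: b_def)
    qed
    show "AE \<xi> in lborel. norm (b n \<xi> * FT f \<xi>) \<le> cmod (IFT i \<xi> * FT f \<xi>)" for n
      by (rule AE_I2) (auto simp: b_def norm_mult mult_le_one intro!: mult_right_mono mult_left_le_one_le)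
  qed auto
  have 2: "(\<lambda>n. LBINT x. f x * P n x) \<longlonglongrightarrow> (LBINT x. f x * i x)"
  proof (rule integral_dominated_convergence)
    show "integrable lborel (\<lambda>x. cmod (f x))" using f by simp
    have n: "AE x in lborel. x \<noteq> p" "AE x in lborel. x \<noteq> q" by (rule AE_lborel_singleton)+
    then show "AE x in lborel. (\<lambda>n. f x * P n x) \<longlonglongrightarrow> f x * i x"
    proof eventually_elim
      case (elim x)
      have "(\<lambda>n. f x * P n x) \<longlonglongrightarrow> f x * complex_of_real (((pi / 2) * sgn (x - p) - (pi / 2) * sgn (x - q)) / pi)"
        unfolding P_def by (intro tendsto_intros arctan_scaled_tendsto) simp
      moreover have "((pi / 2) * sgn (x - p) - (pi / 2) * sgn (x - q)) / pi = indicator {p..q} x"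
        using elim pq by (auto simp: sgn_if split: split_indicator)
      ultimately show ?case by (simp only: i_def)
    qed
    have "cmod (P n x) \<le> 1" for n x
    proof -
      have "\<bar>arctan s - arctan t\<bar> \<le> pi" for s t :: real
        using arctan_bounded[of s] arctan_bounded[of t] by (auto simp: abs_le_iff)
      then show ?thesis unfolding P_def by (simp add: norm_divide del: of_real_divide of_real_diff)
    qed
    then show "AE x in lborel. norm (f x * P n x) \<le> cmod (f x)" for n
      by (intro AE_I2) (simp add: norm_mult mult_left_le)
  qed auto
  show ?thesis using LIMSEQ_unique[OF 1 2[folded e]] by (simp add: i_def[abs_def] mult.commute)
qed

text \<open>Both sides have the same integral over every interval: on the left the transform of \<open>u\<close> is paired with that of the
  indicator, and the multiplication formula moves the latter onto the former.\<close>

theorem fourier_inversion: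
  assumes u: "u \<in> L2" and a: "integrable lborel (fourier u)"
  shows "AE x in lborel. complex_of_real (u x) = IFT (fourier u) x"
proof -
  define a where "a = fourier u"
  have ai: "integrable lborel a" and aL: "a \<in> L2" using a fourier_L2[OF u] by (auto simp: a_def)
  have um[measurable]: "u \<in> borel_measurable borel" using u by (auto simp: L2_def)
  have Im: "IFT a \<in> L2" by (rule IFT_L2[OF ai aL])
  have Im'[measurable]: "IFT a \<in> borel_measurable borel" using Im by (auto simp: L2_def)
  define w where "w x = complex_of_real (u x) - IFT a x" for x
  have wL: "w \<in> L2" unfolding w_def by (intro L2_diff of_real_L2 u Im)
  have lim: "((\<lambda>R. l2 (\<lambda>\<xi>. FT (cut R u) \<xi> - a \<xi>)) \<longlongrightarrow> 0) at_top"
    using is_fourier_fourier[OF u] is_fourier_iff[OF u] by (simp add: a_def)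
  have z: "((\<lambda>R. l2 (\<lambda>\<xi>. h \<xi> - h \<xi>)) \<longlongrightarrow> 0) at_top" for h :: "real \<Rightarrow> complex" by (simp add: l2_def)
  have key: "(LBINT x. w x * complex_of_real (indicator {p..q} x)) = 0" if pq: "p \<le> q" for p q
  proof -
    define i where "i x = complex_of_real (indicator {p..q} x)" for x :: real
    have ii: "integrable lborel i" unfolding i_def using pq by (simp add: emeasure_lborel_Icc_eq)
    have iL: "i \<in> L2" unfolding i_def[abs_def] by (rule indicator_L2)
    have 1: "((\<lambda>R. LBINT x. cut R u x * i x) \<longlongrightarrow> (LBINT x. complex_of_real (u x) * i x)) at_top"
      by (rule L2_tendsto_integral_mult[OF _ _ _ _ cut_tendsto[OF u] z]) (auto intro!: always_eventually cut_props u iL of_real_L2)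
    have 2: "((\<lambda>R. LBINT \<xi>. FT (cut R u) \<xi> * IFT i \<xi>) \<longlongrightarrow> (LBINT \<xi>. a \<xi> * IFT i \<xi>)) at_top"
      by (rule L2_tendsto_integral_mult[OF _ _ _ _ lim z]) (auto intro!: always_eventually FT_cut_L2 u IFT_L2 ii iL aL)
    have "(LBINT x. cut R u x * i x) = (LBINT \<xi>. FT (cut R u) \<xi> * IFT i \<xi>)" for R
      unfolding i_def[abs_def] by (rule FT_pairing_indicator[OF cut_props(2)[OF u] cut_props(1)[OF u] pq])
    then have "(LBINT x. complex_of_real (u x) * i x) = (LBINT \<xi>. a \<xi> * IFT i \<xi>)"
      using tendsto_unique[OF _ 1] 2 by simp
    also have "\<dots> = (LBINT \<xi>. a (- \<xi>) * FT i \<xi>)"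
      by (subst integral_reflect[symmetric]) (simp add: IFT_def)
    also have "\<dots> = (LBINT x. i x * FT (\<lambda>\<xi>. a (- \<xi>)) x)"
      by (rule FT_multiplication[OF ii]) (use ai integrable_reflect[of a] in simp)
    also have "\<dots> = (LBINT x. IFT a x * i x)"
    proof -
      have "FT (\<lambda>\<xi>. a (- \<xi>)) x = IFT a x" for x
        unfolding IFT_def FT_def by (subst integral_reflect[symmetric]) simp
      then show ?thesis by (simp add: mult.commute)
    qed
    finally have "(LBINT x. complex_of_real (u x) * i x) = (LBINT x. IFT a x * i x)" .
    moreover have "(LBINT x. w x * i x) = (LBINT x. complex_of_real (u x) * i x) - (LBINT x. IFT a x * i x)"
      unfolding w_def left_diff_distrib by (intro Bochner_Integration.integral_diff L2_mult_integrable of_real_L2 u iL Im)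
    ultimately show ?thesis by (simp add: i_def)
  qed
  have wi: "integrable lborel (\<lambda>x. w x * complex_of_real (indicator {p..q} x))" for p q
    by (intro L2_mult_integrable wL indicator_L2)
  have "AE x in lborel. Re (w x) = 0"
  proof (rule AE_eq_0_if_interval_integrals)
    show "locally_integrable (\<lambda>x. Re (w x))" unfolding locally_integrable_def set_integrable_def
      using integrable_Re[OF wi] by (simp add: mult.commute)
    show "(LBINT x. indicator {p..q} x * Re (w x)) = 0" if "p \<le> q" for p q
      using arg_cong[OF key[OF that], of Re] integral_Re[OF wi[of p q]] by (simp add: mult.commute)
  qed
  moreover have "AE x in lborel. Im (w x) = 0"
  proof (rule AE_eq_0_if_interval_integrals)
    show "locally_integrable (\<lambda>x. Im (w x))" unfolding locally_integrable_def set_integrable_def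
      using integrable_Im[OF wi] by (simp add: mult.commute)
    show "(LBINT x. indicator {p..q} x * Im (w x)) = 0" if "p \<le> q" for p q
      using arg_cong[OF key[OF that], of Im] integral_Im[OF wi[of p q]] by (simp add: mult.commute)
  qed
  ultimately show ?thesis by eventually_elim (simp add: w_def complex_eq_iff a_def)
qed

section \<open>Smooth functions and test functions\<close>

definition smooth :: "(real \<Rightarrow> real) \<Rightarrow> bool" where
  "smooth f \<longleftrightarrow> (\<forall>n. (deriv ^^ n) f differentiable_on UNIV)"

lemma smooth_DERIV:
  assumes "smooth f" shows "(f has_real_derivative deriv f x) (at x)"
proof -
  have "(deriv ^^ 0) f differentiable_on UNIV" using assms unfolding smooth_def by blast
  then have "f differentiable (at x)" by (simp add: differentiable_on_def)
  then show ?thesis by (simp add: DERIV_deriv_iff_real_differentiable)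
qed

lemma smooth_deriv: assumes "smooth f" shows "smooth (deriv f)"
  unfolding smooth_def
proof
  fix n
  have "(deriv ^^ Suc n) f differentiable_on UNIV" using assms unfolding smooth_def by blast
  then show "(deriv ^^ n) (deriv f) differentiable_on UNIV" by (simp only: funpow_Suc_right o_apply)
qed

lemma smooth_continuous: "smooth f \<Longrightarrow> continuous_on A f"
  by (meson DERIV_isCont continuous_at_imp_continuous_on smooth_DERIV)

text \<open>No higher derivative has to be computed: it is enough to exhibit a class of functions closed under
  differentiation.\<close>

lemma smooth_coinduct:
  assumes "P f" and "\<And>g. P g \<Longrightarrow> \<exists>g'. P g' \<and> (\<forall>x. (g has_real_derivative g' x) (at x))"
  shows "smooth f"
proof -
  have d: "P (deriv g)" if g: "P g" for g
  proof -
    obtain g' where g': "P g'" "\<And>x. (g has_real_derivative g' x) (at x)" using assms(2)[OF g] by blast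
    then have "deriv g = g'" using DERIV_imp_deriv by blast
    then show ?thesis using g' by simp
  qed
  have "P ((deriv ^^ n) f)" for n by (induction n) (auto intro: d assms(1))
  then show ?thesis unfolding smooth_def differentiable_on_def
    using assms(2) real_differentiable_def by (metis UNIV_I differentiable_at_withinI)
qed

text \<open>Sums, products and compositions have to be treated together, since the derivative of a composition is a product.\<close>

inductive smooth_closure :: "(real \<Rightarrow> real) \<Rightarrow> bool" where
  base: "smooth f \<Longrightarrow> smooth_closure f"
| add: "smooth_closure f \<Longrightarrow> smooth_closure g \<Longrightarrow> smooth_closure (\<lambda>x. f x + g x)"
| mult: "smooth_closure f \<Longrightarrow> smooth_closure g \<Longrightarrow> smooth_closure (\<lambda>x. f x * g x)"
| comp: "smooth_closure f \<Longrightarrow> smooth_closure g \<Longrightarrow> smooth_closure (\<lambda>x. f (g x))"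

lemma smooth_closure_derivative:
  "smooth_closure f \<Longrightarrow> \<exists>f'. smooth_closure f' \<and> (\<forall>x. (f has_real_derivative f' x) (at x))"
proof (induction rule: smooth_closure.induct)
  case (base f)
  then show ?case using smooth_DERIV smooth_deriv smooth_closure.base by blast
next
  case (add f g)
  obtain f' where f': "smooth_closure f'" "\<And>x. (f has_real_derivative f' x) (at x)" using add.IH(1) by metis
  obtain g' where g': "smooth_closure g'" "\<And>x. (g has_real_derivative g' x) (at x)" using add.IH(2) by metis
  note f' g'
  then show ?case by (intro exI[of _ "\<lambda>x. f' x + g' x"] conjI smooth_closure.add allI DERIV_add)
next
  case (mult f g)
  obtain f' where f': "smooth_closure f'" "\<And>x. (f has_real_derivative f' x) (at x)" using mult.IH(1) by metis
  obtain g' where g': "smooth_closure g'" "\<And>x. (g has_real_derivative g' x) (at x)" using mult.IH(2) by metis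
  note f' g'
  then show ?case
    using smooth_closure.add[OF smooth_closure.mult[OF f'(1) mult.hyps(2)] smooth_closure.mult[OF g'(1) mult.hyps(1)]] DERIV_mult[OF f'(2) g'(2)]
    by (intro exI[of _ "\<lambda>x. f' x * g x + g' x * f x"]) simp
next
  case (comp f g)
  obtain f' where f': "smooth_closure f'" "\<And>x. (f has_real_derivative f' x) (at x)" using comp.IH(1) by metis
  obtain g' where g': "smooth_closure g'" "\<And>x. (g has_real_derivative g' x) (at x)" using comp.IH(2) by metis
  note f' g'
  then show ?case
    using smooth_closure.mult[OF smooth_closure.comp[OF f'(1) comp.hyps(2)] g'(1)] DERIV_chain2[OF f'(2) g'(2)]
    by (intro exI[of _ "\<lambda>x. f' (g x) * g' x"]) simp
qed

lemma smooth_closure_smooth: "smooth_closure f \<Longrightarrow> smooth f"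
  by (rule smooth_coinduct[where P=smooth_closure]) (auto intro: smooth_closure_derivative)

lemma smooth_const[simp]: "smooth (\<lambda>x. c)"
  by (rule smooth_coinduct[where P="\<lambda>f. \<exists>c. f = (\<lambda>x. c)"]) (auto intro!: exI[of _ "\<lambda>x. 0"])

lemma smooth_ident[simp]: "smooth (\<lambda>x. x)"
proof (rule smooth_coinduct[where P="\<lambda>f. f = (\<lambda>x. x) \<or> smooth f"])
  fix g :: "real \<Rightarrow> real" assume "g = (\<lambda>x. x) \<or> smooth g"
  then show "\<exists>g'. (g' = (\<lambda>x. x) \<or> smooth g') \<and> (\<forall>x. (g has_real_derivative g' x) (at x))"
  proof
    assume "g = (\<lambda>x. x)" then show ?thesis by (intro exI[of _ "\<lambda>x. 1"]) auto
  next
    assume "smooth g" then show ?thesis using smooth_DERIV smooth_deriv by blast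
  qed
qed simp

lemma smooth_add: "smooth f \<Longrightarrow> smooth g \<Longrightarrow> smooth (\<lambda>x. f x + g x)"
  and smooth_mult: "smooth f \<Longrightarrow> smooth g \<Longrightarrow> smooth (\<lambda>x. f x * g x)"
  and smooth_comp: "smooth f \<Longrightarrow> smooth g \<Longrightarrow> smooth (\<lambda>x. f (g x))"
  using smooth_closure_smooth[OF smooth_closure.add[OF smooth_closure.base smooth_closure.base]]
    smooth_closure_smooth[OF smooth_closure.mult[OF smooth_closure.base smooth_closure.base]]
    smooth_closure_smooth[OF smooth_closure.comp[OF smooth_closure.base smooth_closure.base]] by blast+

lemma smooth_diff: "smooth f \<Longrightarrow> smooth g \<Longrightarrow> smooth (\<lambda>x. f x - g x)"
  using smooth_add[of f "\<lambda>x. (-1) * g x"] smooth_mult[of "\<lambda>x. -1" g] by simp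

lemma test_function_iff: "test_function \<psi> \<longleftrightarrow> smooth \<psi> \<and> (\<exists>R. \<forall>x. R < \<bar>x\<bar> \<longrightarrow> \<psi> x = 0)"
  by (simp add: test_function_def smooth_def)

lemma deriv_eq_0_outside:
  assumes "\<And>x. R < \<bar>x\<bar> \<Longrightarrow> \<psi> x = 0" "R < \<bar>x\<bar>" shows "deriv \<psi> x = (0::real)"
proof -
  have "open {x::real. R < \<bar>x\<bar>}" by (intro open_Collect_less continuous_intros)
  then have "(\<psi> has_real_derivative 0) (at x)"
    using has_field_derivative_transform_within_open[of "\<lambda>x. 0" 0 x "{x. R < \<bar>x\<bar>}" \<psi>] assms by auto
  then show ?thesis by (rule DERIV_imp_deriv)
qed

lemma test_function_deriv: "test_function \<psi> \<Longrightarrow> test_function (deriv \<psi>)"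
  unfolding test_function_iff using deriv_eq_0_outside smooth_deriv by blast

lemma integrable_compact_support:
  fixes f :: "real \<Rightarrow> real"
  assumes "continuous_on UNIV f" "\<And>x. R < \<bar>x\<bar> \<Longrightarrow> f x = 0" shows "integrable lborel f"
proof -
  have "set_integrable lborel {-R..R} f"
    by (rule borel_integrable_atLeastAtMost') (use assms continuous_on_subset in blast)
  moreover have "(\<lambda>x. indicator {-R..R} x *\<^sub>R f x) = f"
  proof
    fix x show "indicator {-R..R} x *\<^sub>R f x = f x" using assms(2)[of x] by (cases "R < \<bar>x\<bar>") (auto simp: indicator_def abs_le_iff not_less)
  qed
  ultimately show ?thesis by (simp add: set_integrable_def)
qed

text \<open>The function \<open>e\<^bsup>-1/x\<^esup>\<close>, extended by 0 to the negative half-line, is smooth: its derivatives are polynomials in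
  \<open>1/x\<close> times the function itself.\<close>

definition flat :: "real \<Rightarrow> real" where "flat x = (if 0 < x then exp (- (1 / x)) else 0)"

definition flatp :: "real poly \<Rightarrow> real \<Rightarrow> real" where "flatp p x = (if 0 < x then poly p (1 / x) * exp (- (1 / x)) else 0)"

lemma poly_exp_tendsto_0: "((\<lambda>t. poly p t * exp (- t)) \<longlongrightarrow> (0::real)) at_top"
proof -
  have "((\<lambda>t. \<Sum>i\<le>degree p. coeff p i * (t ^ i / exp t)) \<longlongrightarrow> (\<Sum>i\<le>degree p. coeff p i * 0)) at_top"
    by (intro tendsto_sum tendsto_mult tendsto_const tendsto_power_div_exp_0)
  moreover have "(\<Sum>i\<le>degree p. coeff p i * (t ^ i / exp t)) = poly p t * exp (- t)" for t
    by (simp add: poly_altdef exp_minus sum_distrib_right divide_inverse mult.assoc)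
  ultimately show ?thesis by simp
qed

lemma flatp_deriv: "(flatp p has_real_derivative flatp ([:0, 0, 1:] * (p - pderiv p)) x) (at x)"
proof (cases x "0 :: real" rule: linorder_cases)
  case less
  have "((\<lambda>x. 0) has_real_derivative 0) (at x)" by simp
  then have "(flatp p has_real_derivative 0) (at x)"
    by (rule has_field_derivative_transform_within_open[of _ _ _ "{..<0}"]) (use less in \<open>auto simp: flatp_def\<close>)
  then show ?thesis using less by (simp add: flatp_def)
next
  case greater
  have inv: "((\<lambda>x. 1 / x) has_real_derivative - (1 / x\<^sup>2)) (at x)"
    using DERIV_inverse[of x UNIV] greater by (simp add: inverse_eq_divide power2_eq_square)
  have "((\<lambda>x. poly p (1 / x) * exp (- (1 / x))) has_real_derivative poly (pderiv p) (1 / x) * (- (1 / x\<^sup>2)) * exp (- (1 / x)) + exp (- (1 / x)) * (1 / x\<^sup>2) * poly p (1 / x)) (at x)"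
    using DERIV_mult[OF DERIV_chain2[OF poly_DERIV inv] DERIV_chain2[OF DERIV_exp DERIV_minus[OF inv]], of p] by simp
  then have "(flatp p has_real_derivative poly (pderiv p) (1 / x) * (- (1 / x\<^sup>2)) * exp (- (1 / x)) + exp (- (1 / x)) * (1 / x\<^sup>2) * poly p (1 / x)) (at x)"
    by (rule has_field_derivative_transform_within_open[of _ _ _ "{0<..}"]) (use greater in \<open>auto simp: flatp_def\<close>)
  moreover have "poly (pderiv p) (1 / x) * (- (1 / x\<^sup>2)) * exp (- (1 / x)) + exp (- (1 / x)) * (1 / x\<^sup>2) * poly p (1 / x) = flatp ([:0, 0, 1:] * (p - pderiv p)) x"
    using greater by (simp add: flatp_def power2_eq_square algebra_simps)
  ultimately show ?thesis by simp
next
  case equal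
  have "((\<lambda>y. flatp p y / y) \<longlongrightarrow> 0) (at_right 0)"
  proof -
    have "filterlim (\<lambda>y::real. 1 / y) at_top (at_right 0)" using filterlim_inverse_at_top_right by (simp add: inverse_eq_divide)
    from filterlim_compose[OF poly_exp_tendsto_0[of "[:0, 1:] * p"] this]
    have "((\<lambda>y. poly ([:0, 1:] * p) (1 / y) * exp (- (1 / y))) \<longlongrightarrow> 0) (at_right 0)" .
    then show ?thesis
    proof (rule Lim_transform_eventually)
      show "\<forall>\<^sub>F y in at_right 0. poly ([:0, 1:] * p) (1 / y) * exp (- (1 / y)) = flatp p y / y"
        using eventually_at_right_less[of 0] by eventually_elim (simp add: flatp_def)
    qed
  qed
  moreover have "((\<lambda>y. flatp p y / y) \<longlongrightarrow> 0) (at_left 0)"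
  proof (rule tendsto_eventually)
    show "\<forall>\<^sub>F y in at_left 0. flatp p y / y = 0"
      by (rule eventually_mono[OF eventually_at_left_real[of "-1" 0]]) (auto simp: flatp_def)
  qed
  ultimately have "((\<lambda>y. flatp p y / y) \<longlongrightarrow> 0) (at 0)" by (simp add: filterlim_split_at)
  then show ?thesis using equal by (simp add: has_field_derivative_iff flatp_def)
qed

lemma smooth_flat: "smooth flat"
proof (rule smooth_coinduct[where P="\<lambda>f. \<exists>p. f = flatp p"])
  show "\<exists>p. flat = flatp p" by (rule exI[of _ 1]) (auto simp: flat_def flatp_def)
qed (use flatp_deriv in blast)

lemma flat_bounds: "0 \<le> flat x" "flat x \<le> 1" "x \<le> 0 \<Longrightarrow> flat x = 0" by (auto simp: flat_def)

lemma flat_tendsto: "0 < x \<Longrightarrow> (\<lambda>n. flat (real (Suc n) * x)) \<longlonglongrightarrow> 1"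
proof -
  assume x: "0 < x"
  have "(\<lambda>n. exp (- (inverse (real (Suc n)) / x))) \<longlonglongrightarrow> exp (- (0 / x))"
    using x by (intro tendsto_intros LIMSEQ_inverse_real_of_nat) auto
  moreover have "flat (real (Suc n) * x) = exp (- (inverse (real (Suc n)) / x))" for n
    using x mult_pos_pos[of "real (Suc n)" x] by (simp add: flat_def inverse_eq_divide del: of_nat_Suc)
  ultimately show ?thesis by simp
qed

text \<open>Smooth approximations of the indicator of an interval.\<close>

definition bump :: "real \<Rightarrow> real \<Rightarrow> nat \<Rightarrow> real \<Rightarrow> real" where
  "bump a b n x = flat (real (Suc n) * (x - a)) * flat (real (Suc n) * (b - x))"

lemma bump_test: "test_function (bump a b n)"
proof -
  have "smooth (\<lambda>x. flat (real (Suc n) * (x - a)) * flat (real (Suc n) * (b - x)))"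
    by (intro smooth_mult smooth_comp[OF smooth_flat] smooth_diff smooth_const smooth_ident)
  moreover have "bump a b n x = 0" if "max \<bar>a\<bar> \<bar>b\<bar> < \<bar>x\<bar>" for x
  proof -
    have "x \<le> a \<or> b \<le> x" using that by linarith
    then show ?thesis by (auto simp: bump_def flat_bounds mult_nonneg_nonpos)
  qed
  moreover have "bump a b n = (\<lambda>x. flat (real (Suc n) * (x - a)) * flat (real (Suc n) * (b - x)))"
    by (simp add: bump_def[abs_def])
  ultimately show ?thesis unfolding test_function_iff by (intro conjI exI[of _ "max \<bar>a\<bar> \<bar>b\<bar>"] allI impI) (simp_all only:)
qed

lemma bump_bounds: "0 \<le> bump a b n x" "bump a b n x \<le> 1"
  by (auto simp: bump_def flat_bounds mult_le_one)

lemma bump_outside: "x \<notin> {a<..<b} \<Longrightarrow> bump a b n x = 0"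
  by (cases "x \<le> a") (auto simp: bump_def flat_bounds mult_nonneg_nonpos)

lemma bump_tendsto: "(\<lambda>n. bump a b n x) \<longlonglongrightarrow> indicator {a<..<b} x"
proof (cases "x \<in> {a<..<b}")
  case True
  then have "(\<lambda>n. flat (real (Suc n) * (x - a)) * flat (real (Suc n) * (b - x))) \<longlonglongrightarrow> 1 * 1"
    by (intro tendsto_mult flat_tendsto) auto
  then show ?thesis using True by (simp add: bump_def)
qed (simp add: bump_outside)

lemma test_function_bounded:
  assumes "test_function \<psi>" obtains B where "\<And>x. \<bar>\<psi> x\<bar> \<le> B"
proof -
  from assms obtain R where s: "smooth \<psi>" and R: "\<And>x. R < \<bar>x\<bar> \<Longrightarrow> \<psi> x = 0" by (auto simp: test_function_iff)
  have "compact (\<psi> ` {-R..R})" by (intro compact_continuous_image smooth_continuous s compact_Icc)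
  then obtain B where B: "\<And>x. x \<in> {-R..R} \<Longrightarrow> \<bar>\<psi> x\<bar> \<le> B"
    using compact_imp_bounded bounded_iff by (metis imageI real_norm_def)
  have "\<bar>\<psi> x\<bar> \<le> max B 0" for x
  proof (cases "R < \<bar>x\<bar>")
    case False then show ?thesis using B[of x] by (auto simp: abs_le_iff not_less)
  qed (use R in auto)
  then show ?thesis using that by blast
qed

lemma test_function_measurable[measurable_dest]: "test_function \<psi> \<Longrightarrow> \<psi> \<in> borel_measurable borel"
  unfolding test_function_iff by (intro borel_measurable_continuous_onI smooth_continuous) auto

text \<open>The bumps converge boundedly to the indicator of an open interval.\<close>

lemma AE_eq_0_if_test_integrals:
  assumes li: "locally_integrable w" and z: "\<And>\<psi>. test_function \<psi> \<Longrightarrow> (LBINT x. w x * \<psi> x) = 0"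
  shows "AE x in lborel. w x = 0"
proof (rule AE_eq_0_if_interval_integrals[OF li])
  fix p q :: real assume pq: "p \<le> q"
  define R where "R = max \<bar>p\<bar> \<bar>q\<bar>"
  have i: "integrable lborel (\<lambda>x. indicator {-R..R} x * w x)" using li by (auto simp: locally_integrable_def set_integrable_def)
  have [measurable]: "bump p q n \<in> borel_measurable borel" for n by (rule test_function_measurable[OF bump_test])
  have e: "w x * bump p q n x = (indicator {-R..R} x * w x) * bump p q n x" for n x
    using bump_outside[of x p q n] by (cases "x \<in> {p<..<q}") (auto simp: R_def indicator_def)
  have e': "indicator {p<..<q} x * w x = (indicator {-R..R} x * w x) * indicator {p<..<q} x" for x
    by (auto simp: R_def abs_le_iff indicator_def)
  have "(\<lambda>n. LBINT x. (indicator {-R..R} x * w x) * bump p q n x) \<longlonglongrightarrow> (LBINT x. (indicator {-R..R} x * w x) * indicator {p<..<q} x)"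
  proof (rule integral_dominated_convergence)
    show "integrable lborel (\<lambda>x. norm (indicator {-R..R} x * w x))" by (rule integrable_norm[OF i])
    show "AE x in lborel. (\<lambda>n. (indicator {-R..R} x * w x) * bump p q n x) \<longlonglongrightarrow> (indicator {-R..R} x * w x) * indicator {p<..<q} x"
      by (intro AE_I2 tendsto_intros bump_tendsto)
    show "AE x in lborel. norm ((indicator {-R..R} x * w x) * bump p q n x) \<le> norm (indicator {-R..R} x * w x)" for n
      using bump_bounds[of p q n] by (intro AE_I2) (simp add: abs_mult mult_left_le)
  qed (use borel_measurable_integrable[OF i] in \<open>auto intro!: borel_measurable_times[OF borel_measurable_integrable[OF i], simplified]\<close>)
  then have "(\<lambda>n. 0) \<longlonglongrightarrow> (LBINT x. indicator {p<..<q} x * w x)"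
    unfolding e[symmetric] e'[symmetric] using z[OF bump_test] by simp
  then have "(LBINT x. indicator {p<..<q} x * w x) = 0" by (simp add: LIMSEQ_const_iff)
  moreover have "(LBINT x. indicator {p..q} x * w x) = (LBINT x. indicator {p<..<q} x * w x)"
  proof (rule integral_cong_AE)
    have "AE x in lborel. x \<noteq> p" "AE x in lborel. x \<noteq> q" by (rule AE_lborel_singleton)+
    then show "AE x in lborel. indicator {p..q} x * w x = indicator {p<..<q} x * w x"
      by eventually_elim (auto simp: indicator_def)
    have *: "indicator {p..q} x * w x = indicator {p..q} x * (indicator {-R..R} x * w x)" for x
      by (auto simp: R_def abs_le_iff indicator_def)
    show "(\<lambda>x. indicator {p..q} x * w x) \<in> borel_measurable lborel" unfolding * using borel_measurable_times[OF borel_measurable_indicator[of "{p..q}" lborel, where 'b=real] borel_measurable_integrable[OF i]] by simp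
    show "(\<lambda>x. indicator {p<..<q} x * w x) \<in> borel_measurable lborel" unfolding e' using borel_measurable_times[OF borel_measurable_integrable[OF i] borel_measurable_indicator[of "{p<..<q}" lborel, where 'b=real]] by simp
  qed
  ultimately show "(LBINT x. indicator {p..q} x * w x) = 0" by simp
qed

lemma continuous_locally_integrable: "continuous_on UNIV f \<Longrightarrow> locally_integrable f"
  unfolding locally_integrable_def using borel_integrable_atLeastAtMost' continuous_on_subset by blast

lemma integrable_mult_test:
  assumes "locally_integrable f" "test_function \<psi>" shows "integrable lborel (\<lambda>x. f x * \<psi> x)"
proof -
  obtain R where R: "\<And>x. R < \<bar>x\<bar> \<Longrightarrow> \<psi> x = 0" using assms(2) by (auto simp: test_function_iff)
  obtain B where B: "\<And>x. \<bar>\<psi> x\<bar> \<le> B" using test_function_bounded[OF assms(2)] by blast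
  have i: "integrable lborel (\<lambda>x. indicator {-R..R} x * f x)" using assms(1) by (auto simp: locally_integrable_def set_integrable_def)
  have e: "f x * \<psi> x = \<psi> x * (indicator {-R..R} x * f x)" for x using R[of x] by (cases "R < \<bar>x\<bar>") (auto simp: indicator_def abs_le_iff not_less)
  show ?thesis unfolding e
  proof (rule Bochner_Integration.integrable_bound[of _ "\<lambda>x. B * (indicator {-R..R} x * f x)"])
    show "integrable lborel (\<lambda>x. B * (indicator {-R..R} x * f x))" using i by simp
    show "(\<lambda>x. \<psi> x * (indicator {-R..R} x * f x)) \<in> borel_measurable lborel"
      using borel_measurable_times[OF test_function_measurable[OF assms(2)], of "\<lambda>x. indicator {-R..R} x * f x"] borel_measurable_integrable[OF i] by simp
    show "AE x in lborel. norm (\<psi> x * (indicator {- R..R} x * f x)) \<le> norm (B * (indicator {- R..R} x * f x))"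
      using B by (intro AE_I2) (auto simp: abs_mult intro!: mult_right_mono order_trans[OF B])
  qed
qed

lemma integral_by_parts_test:
  assumes F: "\<And>x. (F has_real_derivative f x) (at x)" "continuous_on UNIV f" and t: "test_function \<psi>"
  shows "(LBINT x. F x * deriv \<psi> x) = - (LBINT x. f x * \<psi> x)"
proof -
  obtain R where R: "\<And>x. R < \<bar>x\<bar> \<Longrightarrow> \<psi> x = 0" and s: "smooth \<psi>" using t by (auto simp: test_function_iff)
  have cF: "continuous_on UNIV F" using F(1) by (meson DERIV_isCont continuous_at_imp_continuous_on)
  have i1: "integrable lborel (\<lambda>x. F x * deriv \<psi> x)" "integrable lborel (\<lambda>x. f x * \<psi> x)" "integrable lborel (\<lambda>x. F x * \<psi> x)"
    by (intro integrable_mult_test continuous_locally_integrable cF F t test_function_deriv)+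
  have "(LBINT x. F x * deriv \<psi> x + f x * \<psi> x) = 0"
  proof (rule integral_derivative_eq_0[where F="\<lambda>x. F x * \<psi> x"])
    show "((\<lambda>x. F x * \<psi> x) has_real_derivative F x * deriv \<psi> x + f x * \<psi> x) (at x)" for x
      using DERIV_mult[OF F(1) smooth_DERIV[OF s]] by (simp add: algebra_simps)
    show "continuous_on UNIV (\<lambda>x. F x * deriv \<psi> x + f x * \<psi> x)"
      by (intro continuous_intros cF F smooth_continuous smooth_deriv s)
  qed (use i1 in auto)
  then show ?thesis using i1 by simp
qed

text \<open>Weak derivatives are unique up to null sets; this is how the distributional form of the equation is turned
  into an identity between continuous functions.\<close>

lemma weak_derivative_eq:
  assumes w: "has_weak_derivative g w" and g: "AE x in lborel. g x = F x" "g \<in> borel_measurable borel"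
    and F: "\<And>x. (F has_real_derivative f x) (at x)" "continuous_on UNIV f"
  shows "AE x in lborel. w x = f x"
proof -
  have cF: "continuous_on UNIV F" using F(1) by (meson DERIV_isCont continuous_at_imp_continuous_on)
  have [measurable]: "F \<in> borel_measurable borel" "g \<in> borel_measurable borel" using cF g by (auto intro: borel_measurable_continuous_onI)
  have lw: "locally_integrable w" and lf: "locally_integrable f" using w F continuous_locally_integrable by (auto simp: has_weak_derivative_def)
  have "AE x in lborel. w x - f x = 0"
  proof (rule AE_eq_0_if_test_integrals)
    show "locally_integrable (\<lambda>x. w x - f x)" using lw lf unfolding locally_integrable_def by (auto intro: set_integral_diff)
    fix \<psi> assume t: "test_function \<psi>"
    have [measurable]: "deriv \<psi> \<in> borel_measurable borel" by (rule test_function_measurable[OF test_function_deriv[OF t]])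
    have "(LBINT x. w x * \<psi> x) = - (LBINT x. g x * deriv \<psi> x)" using w t by (simp add: has_weak_derivative_def)
    also have "(LBINT x. g x * deriv \<psi> x) = (LBINT x. F x * deriv \<psi> x)"
      by (rule integral_cong_AE) (use g in auto)
    also have "\<dots> = - (LBINT x. f x * \<psi> x)" by (rule integral_by_parts_test[OF F t])
    finally show "(LBINT x. (w x - f x) * \<psi> x) = 0"
      using integrable_mult_test[OF lw t] integrable_mult_test[OF lf t] by (simp add: left_diff_distrib)
  qed
  then show ?thesis by eventually_elim simp
qed

section \<open>The resolvent of the second derivative\<close>

text \<open>The kernel \<open>e\<^bsup>-b|x|\<^esup>\<close> is split at its kink. Each half of the convolution solves a first order equation,
  \<open>L' = f - bL\<close> and \<open>R' = bR - f\<close>, and their combinations \<open>res\<close> and \<open>dres\<close> are \<open>(b\<^sup>2 - \<partial>\<^sup>2)\<^sup>-\<^sup>1 f\<close> and its derivative.\<close>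

definition ltail :: "real \<Rightarrow> (real \<Rightarrow> real) \<Rightarrow> real \<Rightarrow> real" where
  "ltail b f x = (LBINT y. indicator {..x} y * (exp (- b * (x - y)) * f y))"

definition rtail :: "real \<Rightarrow> (real \<Rightarrow> real) \<Rightarrow> real \<Rightarrow> real" where
  "rtail b f x = ltail b (\<lambda>y. f (- y)) (- x)"

lemma ltail_integrand_integrable:
  assumes "0 < b" "f \<in> borel_measurable borel" "\<And>x. \<bar>f x\<bar> \<le> M"
  shows "integrable lborel (\<lambda>y. indicator {..x} y * (exp (- b * (x - y)) * f y))" "\<bar>ltail b f x\<bar> \<le> 2 * M / b"
proof -
  have i: "integrable lborel (\<lambda>y. M * exp (- b * \<bar>x - y\<bar>))"
    using integrable_translate(2)[of "\<lambda>y. exp (- b * \<bar>y\<bar>)" x] exp_kernel_integral(1)[OF assms(1)] by simp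
  have bd: "norm (indicator {..x} y * (exp (- b * (x - y)) * f y)) \<le> M * exp (- b * \<bar>x - y\<bar>)" for y
    using assms(3)[of y] order_trans[OF abs_ge_zero assms(3)]
    by (auto simp: indicator_def abs_mult mult.commute[of _ "exp _"] intro!: mult_left_mono)
  show 1: "integrable lborel (\<lambda>y. indicator {..x} y * (exp (- b * (x - y)) * f y))"
    by (rule Bochner_Integration.integrable_bound[OF i]) (use assms bd in \<open>auto intro: order_trans[OF _ abs_ge_self]\<close>)
  have "\<bar>ltail b f x\<bar> \<le> (LBINT y. norm (indicator {..x} y * (exp (- b * (x - y)) * f y)))"
    unfolding ltail_def real_norm_def[symmetric] by (rule integral_norm_bound)
  also have "\<dots> \<le> (LBINT y. M * exp (- b * \<bar>x - y\<bar>))" by (rule integral_mono[OF integrable_norm[OF 1] i bd])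
  also have "\<dots> = M * (2 / b)" using integral_translate(2)[of "\<lambda>y. exp (- b * \<bar>y\<bar>)" x] exp_kernel_integral(2)[OF assms(1)] by simp
  finally show "\<bar>ltail b f x\<bar> \<le> 2 * M / b" by (simp add: mult.commute)
qed

lemma ltail_nonneg: "(\<And>x. 0 \<le> f x) \<Longrightarrow> 0 \<le> ltail b f x"
  unfolding ltail_def by (rule Bochner_Integration.integral_nonneg) auto

lemma tail_integral_deriv:
  fixes g :: "real \<Rightarrow> real"
  assumes gc: "continuous_on UNIV g" and gi: "\<And>z. integrable lborel (\<lambda>y. indicator {..z} y * g y)"
  shows "((\<lambda>z. LBINT y. indicator {..z} y * g y) has_real_derivative g x) (at x)"
proof -
  define G where "G z = (LBINT y. indicator {..z} y * g y)" for z
  have gA: "continuous_on A g" for A by (rule continuous_on_subset[OF gc]) simp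
  define x0 where "x0 = x - 1"
  have Gz: "G z = G x0 + integral {x0..z} g" if "x0 \<le> z" for z
  proof -
    have si: "set_integrable lborel {x0..z} g" by (rule borel_integrable_atLeastAtMost'[OF gA])
    have "G z = (LBINT y. indicator {..x0} y * g y + indicator {x0..z} y *\<^sub>R g y)"
      unfolding G_def
    proof (rule integral_cong_AE)
      show "AE y in lborel. indicator {..z} y * g y = indicator {..x0} y * g y + indicator {x0..z} y *\<^sub>R g y"
        using AE_lborel_singleton[of x0] by eventually_elim (use that in \<open>auto simp: indicator_def\<close>)
    qed (use borel_measurable_continuous_onI[OF gc] in auto)
    also have "\<dots> = G x0 + (LBINT y. indicator {x0..z} y *\<^sub>R g y)"
      unfolding G_def by (rule Bochner_Integration.integral_add[OF gi si[unfolded set_integrable_def]])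
    also have "(LBINT y. indicator {x0..z} y *\<^sub>R g y) = integral {x0..z} g"
      using set_borel_integral_eq_integral(2)[OF si] by (simp add: set_lebesgue_integral_def)
    finally show ?thesis .
  qed
  have "((\<lambda>z. integral {x0..z} g) has_real_derivative g x) (at x within {x0..x + 1})"
    by (rule integral_has_real_derivative[OF gA]) (simp add: x0_def)
  then have "((\<lambda>z. integral {x0..z} g) has_real_derivative g x) (at x)"
    using at_within_Icc_at[of x0 x "x + 1"] by (simp add: x0_def)
  then have "((\<lambda>z. G x0 + integral {x0..z} g) has_real_derivative g x) (at x)"
    by (auto intro!: derivative_eq_intros)
  then have "(G has_real_derivative g x) (at x)"
  proof (rule has_field_derivative_transform_within_open[of _ _ _ "{x0<..}"])
    show "G x0 + integral {x0..z} g = G z" if "z \<in> {x0<..}" for z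
      by (rule Gz[symmetric]) (use that in simp)
  qed (simp_all add: x0_def)
  then show ?thesis by (simp add: G_def[abs_def])
qed

lemma ltail_deriv:
  assumes b: "0 < b" and f: "continuous_on UNIV f" "\<And>x. \<bar>f x\<bar> \<le> M"
  shows "(ltail b f has_real_derivative f x - b * ltail b f x) (at x)"
proof -
  have fm: "f \<in> borel_measurable borel" using f(1) by (rule borel_measurable_continuous_onI)
  define g where "g y = exp (b * y) * f y" for y
  have gc: "continuous_on UNIV g" unfolding g_def by (intro continuous_intros f(1))
  have e: "indicator {..z} y * (exp (- b * (z - y)) * f y) = exp (- b * z) * (indicator {..z} y * g y)" for z y
    by (simp add: g_def right_diff_distrib exp_diff exp_minus field_simps)
  have gi: "integrable lborel (\<lambda>y. indicator {..z} y * g y)" for z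
    using ltail_integrand_integrable(1)[OF b fm f(2), of z] unfolding e by simp
  define G where "G z = (LBINT y. indicator {..z} y * g y)" for z
  have lG: "ltail b f z = exp (- b * z) * G z" for z unfolding ltail_def e G_def by simp
  have "(G has_real_derivative g x) (at x)" unfolding G_def[abs_def] by (rule tail_integral_deriv[OF gc gi])
  then have "((\<lambda>z. exp (- b * z) * G z) has_real_derivative exp (- b * x) * g x + exp (- b * x) * (- b) * G x) (at x)"
    by (auto intro!: derivative_eq_intros)
  moreover have "exp (- b * x) * g x = f x" by (simp add: g_def exp_minus)
  ultimately show ?thesis unfolding lG by (simp add: lG[abs_def] algebra_simps)
qed

lemma rtail_deriv:
  assumes b: "0 < b" and f: "continuous_on UNIV f" "\<And>x. \<bar>f x\<bar> \<le> M"
  shows "(rtail b f has_real_derivative b * rtail b f x - f x) (at x)"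
proof -
  have "continuous_on UNIV (\<lambda>y. f (- y))" by (intro continuous_on_compose2[OF f(1)] continuous_intros) auto
  from ltail_deriv[OF b this f(2), of "- x"]
  have "((\<lambda>z. ltail b (\<lambda>y. f (- y)) (- z)) has_real_derivative - (f x - b * ltail b (\<lambda>y. f (- y)) (- x))) (at x)"
    by (simp add: DERIV_mirror)
  then show ?thesis by (simp add: rtail_def[abs_def])
qed

lemma exp_convolution_eq_tails:
  assumes "0 < b" "f \<in> borel_measurable borel" "\<And>x. \<bar>f x\<bar> \<le> M"
  shows "(LBINT y. exp (- b * \<bar>x - y\<bar>) * f y) = ltail b f x + rtail b f x"
proof -
  have "integrable lborel (\<lambda>y. M * exp (- b * \<bar>x - y\<bar>))"
    using integrable_translate(2)[of "\<lambda>y. exp (- b * \<bar>y\<bar>)" x] exp_kernel_integral(1)[OF assms(1)] by simp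
  then have i: "integrable lborel (\<lambda>y. exp (- b * \<bar>x - y\<bar>) * f y)"
    by (rule Bochner_Integration.integrable_bound)
      (use assms order_trans[OF abs_ge_zero assms(3)] in \<open>auto simp: abs_mult mult.commute[of _ "exp _"] intro!: mult_left_mono\<close>)
  have 1: "(LBINT y. indicator {..x} y *\<^sub>R (exp (- b * \<bar>x - y\<bar>) * f y)) = ltail b f x"
    unfolding ltail_def by (rule Bochner_Integration.integral_cong) (auto simp: indicator_def)
  have 2: "(LBINT y. indicator {x..} y *\<^sub>R (exp (- b * \<bar>x - y\<bar>) * f y)) = rtail b f x"
    unfolding rtail_def ltail_def
    by (subst integral_reflect[symmetric], rule Bochner_Integration.integral_cong) (auto simp: indicator_def algebra_simps)
  show ?thesis using integral_eq_sum_half_lines[OF i, of x] 1 2 by simp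
qed

lemma ltail_measurable:
  assumes [measurable]: "f \<in> borel_measurable borel" shows "ltail b f \<in> borel_measurable borel"
proof -
  have "ltail b f = (\<lambda>x. LBINT y. (if y \<le> x then 1 else 0) * (exp (- b * (x - y)) * f y))"
    unfolding ltail_def by (intro ext Bochner_Integration.integral_cong) (auto simp: indicator_def)
  then show ?thesis by simp
qed

lemma ltail_integrable:
  assumes b: "0 < b" and f: "integrable lborel f"
  shows "integrable lborel (ltail b f)"
proof -
  have [measurable]: "f \<in> borel_measurable borel" using f by auto
  have k: "(\<integral>\<^sup>+x. ennreal (exp (- b * (x - y))) * indicator {y..} x \<partial>lborel) = ennreal (1 / b)" for y
  proof -
    have l: "((\<lambda>x. - (exp (- b * (x - y)) / b)) \<longlongrightarrow> - (0 / b)) at_top"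
    proof (intro tendsto_intros)
      have "filterlim (\<lambda>x. - b * (x - y)) at_bot at_top"
      proof (rule filterlim_tendsto_neg_mult_at_bot[OF tendsto_const])
        show "filterlim (\<lambda>x. x - y) at_top at_top"
          using filterlim_tendsto_add_at_top[OF tendsto_const filterlim_ident, of "-y"] by simp
      qed (use b in simp)
      then show "((\<lambda>x. exp (- b * (x - y))) \<longlongrightarrow> 0) at_top" by (rule filterlim_compose[OF exp_at_bot])
    qed (use b in auto)
    have "(\<integral>\<^sup>+x. ennreal (exp (- b * (x - y))) * indicator {y..} x \<partial>lborel) = ennreal (- (0 / b) - (- (exp (- b * (y - y)) / b)))"
      by (rule nn_integral_FTC_atLeast[OF _ _ _ l]) (use b in \<open>auto intro!: derivative_eq_intros\<close>)
    then show ?thesis by simp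
  qed
  have "(\<integral>\<^sup>+x. ennreal (norm (ltail b f x)) \<partial>lborel) \<le> (\<integral>\<^sup>+x. \<integral>\<^sup>+y. ennreal (norm (f y)) * (ennreal (exp (- b * (x - y))) * indicator {y..} x) \<partial>lborel \<partial>lborel)"
  proof (rule nn_integral_mono)
    fix x
    have "ennreal (norm (ltail b f x)) \<le> (\<integral>\<^sup>+y. ennreal (norm (indicator {..x} y * (exp (- b * (x - y)) * f y))) \<partial>lborel)"
      unfolding ltail_def by (rule norm_integral_le_nn_integral)
    also have "\<dots> = (\<integral>\<^sup>+y. ennreal (norm (f y)) * (ennreal (exp (- b * (x - y))) * indicator {y..} x) \<partial>lborel)"
      by (rule nn_integral_cong) (auto simp: indicator_def abs_mult ennreal_mult mult.commute)
    finally show "ennreal (norm (ltail b f x)) \<le> (\<integral>\<^sup>+y. ennreal (norm (f y)) * (ennreal (exp (- b * (x - y))) * indicator {y..} x) \<partial>lborel)" .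
  qed
  also have "\<dots> = (\<integral>\<^sup>+y. \<integral>\<^sup>+x. ennreal (norm (f y)) * (ennreal (exp (- b * (x - y))) * indicator {y..} x) \<partial>lborel \<partial>lborel)"
  proof (rule lborel_pair.Fubini'[symmetric])
    have e: "(\<lambda>(x, y). ennreal (norm (f y)) * (ennreal (exp (- b * (x - y))) * indicator {y..} x))
      = (\<lambda>z. ennreal (norm (f (snd z))) * (ennreal (exp (- b * (fst z - snd z))) * (if snd z \<le> fst z then 1 else 0)))"
      by (auto simp: indicator_def fun_eq_iff)
    show "(\<lambda>(x, y). ennreal (norm (f y)) * (ennreal (exp (- b * (x - y))) * indicator {y..} x)) \<in> borel_measurable (lborel \<Otimes>\<^sub>M lborel)"
      unfolding e by measurable
  qed
  also have "\<dots> = (\<integral>\<^sup>+y. ennreal (norm (f y)) * ennreal (1 / b) \<partial>lborel)"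
  proof (rule nn_integral_cong)
    fix y
    have "(\<integral>\<^sup>+x. ennreal (norm (f y)) * (ennreal (exp (- b * (x - y))) * indicator {y..} x) \<partial>lborel)
        = ennreal (norm (f y)) * (\<integral>\<^sup>+x. ennreal (exp (- b * (x - y))) * indicator {y..} x \<partial>lborel)"
      by (rule nn_integral_cmult) simp
    then show "(\<integral>\<^sup>+x. ennreal (norm (f y)) * (ennreal (exp (- b * (x - y))) * indicator {y..} x) \<partial>lborel) = ennreal (norm (f y)) * ennreal (1 / b)"
      by (simp only: k)
  qed
  also have "\<dots> = (\<integral>\<^sup>+y. ennreal (norm (f y)) \<partial>lborel) * ennreal (1 / b)" by (rule nn_integral_multc) auto
  also have "\<dots> < \<infinity>" using f by (simp add: integrable_iff_bounded ennreal_mult_less_top)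
  finally show ?thesis using ltail_measurable[of f b] by (simp add: integrable_iff_bounded)
qed

text \<open>Cauchy-Schwarz with the kernel split evenly between the two factors; integrability of the square of the tail is
  thereby reduced to that of a tail.\<close>

lemma ltail_power2_le:
  assumes b: "0 < b" and f: "f \<in> borel_measurable borel" "\<And>x. \<bar>f x\<bar> \<le> M"
  shows "(ltail b f x)\<^sup>2 \<le> ltail b (\<lambda>y. 1) x * ltail b (\<lambda>y. (f y)\<^sup>2) x"
proof -
  note [measurable] = f(1)
  define F where "F y = indicator {..x} y * exp (- b * (x - y) / 2)" for y
  define G where "G y = F y * f y" for y
  have F2: "(norm (F y))\<^sup>2 = indicator {..x} y * (exp (- b * (x - y)) * 1)" for y
    by (auto simp: F_def indicator_def power2_eq_square exp_add[symmetric])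
  have G2: "(norm (G y))\<^sup>2 = indicator {..x} y * (exp (- b * (x - y)) * (f y)\<^sup>2)" for y
    using F2[of y] by (simp add: G_def power_mult_distrib abs_mult)
  have sq: "\<bar>(f y)\<^sup>2\<bar> \<le> M\<^sup>2" for y using power_mono[OF f(2)[of y], of 2] by simp
  have FL: "F \<in> L2" unfolding L2_def mem_Collect_eq F2 using ltail_integrand_integrable(1)[OF b, of "\<lambda>y. 1" 1 x]
    by (auto simp: F_def[abs_def])
  have GL: "G \<in> L2" unfolding L2_def mem_Collect_eq G2 using ltail_integrand_integrable(1)[of b "\<lambda>y. (f y)\<^sup>2" "M\<^sup>2" x, OF b _ sq]
    by (auto simp: F_def[abs_def] G_def[abs_def])
  have e: "indicator {..x} y * (exp (- b * (x - y)) * f y) = F y * G y" for y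
    using F2[of y] by (auto simp: F_def G_def indicator_def power2_eq_square)
  have "\<bar>ltail b f x\<bar> \<le> l2 F * l2 G" unfolding ltail_def e using L2_Cauchy_Schwarz(2)[OF FL GL] by simp
  then have "\<bar>ltail b f x\<bar>\<^sup>2 \<le> (l2 F * l2 G)\<^sup>2" by (rule power_mono) simp
  then have "(ltail b f x)\<^sup>2 \<le> (l2 F * l2 G)\<^sup>2" by simp
  also have "\<dots> = ltail b (\<lambda>y. 1) x * ltail b (\<lambda>y. (f y)\<^sup>2) x"
    unfolding power_mult_distrib l2_power2 F2 G2 ltail_def ..
  finally show ?thesis .
qed

lemma ltail_L2:
  assumes b: "0 < b" and f: "f \<in> L2" "\<And>x. \<bar>f x\<bar> \<le> M"
  shows "ltail b f \<in> L2"
proof -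
  have [measurable]: "f \<in> borel_measurable borel" using f by (auto simp: L2_def)
  have i: "integrable lborel (\<lambda>x. (f x)\<^sup>2)" using L2D(2)[OF f(1)] by simp
  have c: "\<bar>ltail b (\<lambda>y. 1) x\<bar> \<le> 2 * 1 / b" for x by (rule ltail_integrand_integrable(2)[OF b]) auto
  have "integrable lborel (\<lambda>x. 2 / b * ltail b (\<lambda>y. (f y)\<^sup>2) x)" using ltail_integrable[OF b i] by simp
  then have "integrable lborel (\<lambda>x. (ltail b f x)\<^sup>2)"
  proof (rule Bochner_Integration.integrable_bound)
    show "(\<lambda>x. (ltail b f x)\<^sup>2) \<in> borel_measurable lborel" using ltail_measurable[of f b] by simp
    have "(ltail b f x)\<^sup>2 \<le> 2 / b * ltail b (\<lambda>y. (f y)\<^sup>2) x" for x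
      using ltail_power2_le[of b f M x, OF b _ f(2)] mult_right_mono[OF abs_le_D1[OF c[of x]] ltail_nonneg[of "\<lambda>y. (f y)\<^sup>2" b x]] by simp
    then show "AE x in lborel. norm ((ltail b f x)\<^sup>2) \<le> norm (2 / b * ltail b (\<lambda>y. (f y)\<^sup>2) x)"
      unfolding real_norm_def abs_of_nonneg[OF zero_le_power2] by (intro AE_I2 order_trans[OF _ abs_ge_self])
  qed
  then show ?thesis using ltail_measurable[of f b] by (simp add: L2_def)
qed

definition res :: "real \<Rightarrow> (real \<Rightarrow> real) \<Rightarrow> real \<Rightarrow> real" where
  "res b f x = (ltail b f x + rtail b f x) / (2 * b)"

definition dres :: "real \<Rightarrow> (real \<Rightarrow> real) \<Rightarrow> real \<Rightarrow> real" where
  "dres b f x = (rtail b f x - ltail b f x) / 2"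

lemma res_deriv:
  assumes b: "0 < b" and f: "continuous_on UNIV f" "\<And>x. \<bar>f x\<bar> \<le> M"
  shows "(res b f has_real_derivative dres b f x) (at x)" "(dres b f has_real_derivative b\<^sup>2 * res b f x - f x) (at x)"
proof -
  note d = ltail_deriv[OF assms, of x] rtail_deriv[OF assms, of x]
  have "((\<lambda>x. (ltail b f x + rtail b f x) / (2 * b)) has_real_derivative ((f x - b * ltail b f x) + (b * rtail b f x - f x)) / (2 * b)) (at x)"
    by (intro DERIV_cdivide DERIV_add d)
  moreover have "((f x - b * ltail b f x) + (b * rtail b f x - f x)) / (2 * b) = dres b f x" using b by (simp add: dres_def field_simps)
  ultimately show "(res b f has_real_derivative dres b f x) (at x)" unfolding res_def[abs_def] by (simp only:)
  have "((\<lambda>x. (rtail b f x - ltail b f x) / 2) has_real_derivative ((b * rtail b f x - f x) - (f x - b * ltail b f x)) / 2) (at x)"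
    by (intro DERIV_cdivide DERIV_diff d)
  moreover have "((b * rtail b f x - f x) - (f x - b * ltail b f x)) / 2 = b\<^sup>2 * res b f x - f x" using b by (simp add: res_def field_simps power2_eq_square)
  ultimately show "(dres b f has_real_derivative b\<^sup>2 * res b f x - f x) (at x)" unfolding dres_def[abs_def] by (simp only:)
qed

lemma res_bounded:
  assumes b: "0 < b" and f: "f \<in> borel_measurable borel" "\<And>x. \<bar>f x\<bar> \<le> M"
  shows "\<bar>res b f x\<bar> \<le> 2 * M / b\<^sup>2" "\<bar>dres b f x\<bar> \<le> 2 * M / b"
proof -
  have m: "(\<lambda>y. f (- y)) \<in> borel_measurable borel" using f(1) by measurable
  note l = ltail_integrand_integrable(2)[OF b f, of x] ltail_integrand_integrable(2)[OF b m f(2), of "-x", folded rtail_def]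
  have "\<bar>ltail b f x + rtail b f x\<bar> \<le> 4 * M / b" using l by linarith
  then have "\<bar>ltail b f x + rtail b f x\<bar> / (2 * b) \<le> (4 * M / b) / (2 * b)" using b by (intro divide_right_mono) auto
  then show "\<bar>res b f x\<bar> \<le> 2 * M / b\<^sup>2" using b by (simp add: res_def power2_eq_square)
  show "\<bar>dres b f x\<bar> \<le> 2 * M / b" using l by (simp add: dres_def)
qed

lemma rtail_L2: "0 < b \<Longrightarrow> f \<in> L2 \<Longrightarrow> (\<And>x. \<bar>f x\<bar> \<le> M) \<Longrightarrow> rtail b f \<in> L2"
  using ltail_L2[of b "\<lambda>y. f (- y)" M] L2_reflect(1)[of f] L2_reflect(1)[of "ltail b (\<lambda>y. f (- y))"]
  by (simp add: rtail_def[abs_def])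

lemma res_L2:
  assumes "0 < b" "f \<in> L2" "\<And>x. \<bar>f x\<bar> \<le> M"
  shows "res b f \<in> L2" "dres b f \<in> L2"
proof -
  note l = ltail_L2[OF assms] rtail_L2[OF assms]
  show "res b f \<in> L2" using L2_cmult(1)[OF L2_add(1)[OF l], of "1 / (2 * b)"] by (simp add: res_def[abs_def])
  show "dres b f \<in> L2" using L2_cmult(1)[OF L2_diff(1)[OF l(2,1)], of "1 / 2"] by (simp add: dres_def[abs_def])
qed

lemma conv_exp_eq_res:
  assumes "0 < b" "f \<in> borel_measurable borel" "\<And>x. \<bar>f x\<bar> \<le> M"
  shows "conv (\<lambda>x. 1 / (2 * b) * exp (- b * \<bar>x\<bar>)) f x = res b f x"
proof -
  have "conv (\<lambda>x. 1 / (2 * b) * exp (- b * \<bar>x\<bar>)) f x = 1 / (2 * b) * (LBINT y. exp (- b * \<bar>x - y\<bar>) * f y)"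
    unfolding conv_def mult.assoc by simp
  then show ?thesis using exp_convolution_eq_tails[OF assms] by (simp add: res_def)
qed

lemma conv_cong_AE:
  assumes "AE x in lborel. f x = g x" "f \<in> borel_measurable borel" "g \<in> borel_measurable borel" "k \<in> borel_measurable borel"
  shows "conv k f x = conv k g x"
  unfolding conv_def by (rule integral_cong_AE) (use assms in auto)

section \<open>Sobolev spaces\<close>

lemma integrable_weight:
  assumes p: "1 / 2 < p" shows "integrable lborel (\<lambda>\<xi>::real. (1 + \<xi>\<^sup>2) powr (- p))"
proof -
  define g where "g \<xi> = (1 + \<bar>\<xi>\<bar>) powr (- 2 * p)" for \<xi> :: real
  have [measurable]: "g \<in> borel_measurable borel" unfolding g_def by measurable
  have l: "((\<lambda>x::real. (1 + x) powr (1 - 2 * p) / (1 - 2 * p)) \<longlongrightarrow> 0 / (1 - 2 * p)) at_top"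
  proof (intro tendsto_divide tendsto_const tendsto_neg_powr)
    show "filterlim (\<lambda>x::real. 1 + x) at_top at_top" by (rule filterlim_tendsto_add_at_top[OF tendsto_const filterlim_ident])
  qed (use p in auto)
  have "(\<integral>\<^sup>+x. ennreal (g x) * indicator {0..} x \<partial>lborel) = (\<integral>\<^sup>+x. ennreal ((1 + x) powr (- 2 * p)) * indicator {0..} x \<partial>lborel)"
    by (rule nn_integral_cong) (auto simp: g_def indicator_def)
  also have "\<dots> = ennreal (0 / (1 - 2 * p) - (1 + 0) powr (1 - 2 * p) / (1 - 2 * p))"
  proof (rule nn_integral_FTC_atLeast[OF _ _ _ l])
    fix x :: real assume "0 \<le> x"
    then have "((\<lambda>x. (1 + x) powr (1 - 2 * p) / (1 - 2 * p)) has_real_derivative ((1 - 2 * p) * (1 + x) powr (1 - 2 * p - 1)) * 1 / (1 - 2 * p)) (at x)"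
      by (intro DERIV_cdivide DERIV_chain2[OF has_real_derivative_powr]) (auto intro!: derivative_eq_intros)
    then show "((\<lambda>x. (1 + x) powr (1 - 2 * p) / (1 - 2 * p)) has_real_derivative (1 + x) powr (- 2 * p)) (at x)" using p by simp
  qed auto
  finally have 1: "(\<integral>\<^sup>+x. ennreal (g x) * indicator {0..} x \<partial>lborel) < \<infinity>" by simp
  have 2: "(\<integral>\<^sup>+x. ennreal (g x) * indicator {..0} x \<partial>lborel) = (\<integral>\<^sup>+x. ennreal (g x) * indicator {0..} x \<partial>lborel)"
    by (subst nn_integral_real_affine[where c="-1" and t=0]) (auto intro!: nn_integral_cong simp: g_def indicator_def)
  have "(\<integral>\<^sup>+x. ennreal (g x) \<partial>lborel) \<le> (\<integral>\<^sup>+x. ennreal (g x) * indicator {0..} x + ennreal (g x) * indicator {..0} x \<partial>lborel)"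
    by (rule nn_integral_mono) (auto simp: indicator_def)
  also have "\<dots> = (\<integral>\<^sup>+x. ennreal (g x) * indicator {0..} x \<partial>lborel) + (\<integral>\<^sup>+x. ennreal (g x) * indicator {..0} x \<partial>lborel)"
    by (rule nn_integral_add) auto
  also have "\<dots> < \<infinity>" using 1 2 by simp
  finally have gi: "integrable lborel g" by (auto simp: integrable_iff_bounded g_def)
  show ?thesis
  proof (rule Bochner_Integration.integrable_bound[of _ "\<lambda>x. 2 powr p * g x"])
    show "integrable lborel (\<lambda>x. 2 powr p * g x)" using gi by simp
    have "(1 + x\<^sup>2) powr (- p) \<le> 2 powr p * g x" for x :: real
    proof -
      have pos: "0 < 1 + x\<^sup>2" "0 < 1 + \<bar>x\<bar>" by (auto intro: add_pos_nonneg)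
      have "(1 + \<bar>x\<bar>)\<^sup>2 \<le> 2 * (1 + x\<^sup>2)" using sum_squares_bound[of 1 "\<bar>x\<bar>"] by (simp add: power2_sum)
      then have "((1 + \<bar>x\<bar>)\<^sup>2 / 2) \<le> 1 + x\<^sup>2" by simp
      then have "(1 + x\<^sup>2) powr (- p) \<le> ((1 + \<bar>x\<bar>)\<^sup>2 / 2) powr (- p)"
        using p pos by (intro powr_mono2') auto
      also have "\<dots> = ((1 + \<bar>x\<bar>)\<^sup>2) powr (- p) * 2 powr p"
        using pos by (simp add: powr_divide powr_minus_divide powr_minus)
      also have "((1 + \<bar>x\<bar>)\<^sup>2) powr (- p) = g x" unfolding g_def using pos by (simp add: powr_powr powr_numeral[symmetric] del: powr_numeral)
      finally show ?thesis by (simp add: mult.commute)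
    qed
    then show "AE x in lborel. norm ((1 + x\<^sup>2) powr (- p)) \<le> norm (2 powr p * g x)"
      by (intro AE_I2) (auto intro: order_trans[OF _ abs_ge_self])
  qed simp
qed

text \<open>Square integrability of the weighted transform is membership in the Sobolev space, so that its norm is an \<open>L\<^sup>2\<close> norm and
  inherits the triangle inequality.\<close>

definition weighted :: "real \<Rightarrow> (real \<Rightarrow> real) \<Rightarrow> real \<Rightarrow> complex" where
  "weighted \<sigma> f \<xi> = complex_of_real ((1 + \<xi>\<^sup>2) powr (\<sigma> / 2)) * fourier f \<xi>"

lemma norm_weighted: "(cmod (weighted \<sigma> f \<xi>))\<^sup>2 = (1 + \<xi>\<^sup>2) powr \<sigma> * (cmod (fourier f \<xi>))\<^sup>2"
proof -
  have "((1 + \<xi>\<^sup>2) powr (\<sigma> / 2))\<^sup>2 = (1 + \<xi>\<^sup>2) powr \<sigma>" by (simp add: power2_eq_square powr_add[symmetric])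
  then show ?thesis by (simp add: weighted_def norm_mult power_mult_distrib)
qed

lemma fourier_measurable: "f \<in> L2 \<Longrightarrow> fourier f \<in> borel_measurable borel"
  using fourier_L2[of f] by (auto simp: L2_def)

lemma Hs_iff: "f \<in> Hs \<sigma> \<longleftrightarrow> f \<in> L2 \<and> weighted \<sigma> f \<in> L2"
  unfolding Hs_def L2_def[where 'a=complex] using norm_weighted fourier_measurable[of f] by (auto simp: weighted_def[abs_def])

lemma Hs_norm_eq: "Hs_norm \<sigma> f = l2 (weighted \<sigma> f)"
  by (simp add: Hs_norm_def l2_def norm_weighted)

lemma weighted_linear:
  assumes "f \<in> L2" "g \<in> L2"
  shows "AE \<xi> in lborel. weighted \<sigma> (\<lambda>x. p * f x + q * g x) \<xi> = complex_of_real p * weighted \<sigma> f \<xi> + complex_of_real q * weighted \<sigma> g \<xi>"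
  using fourier_linear[OF assms, of p q] by eventually_elim (simp add: weighted_def algebra_simps)

lemma Hs_linear:
  assumes "f \<in> Hs \<sigma>" "g \<in> Hs \<sigma>" shows "(\<lambda>x. p * f x + q * g x) \<in> Hs \<sigma>"
proof -
  have f: "f \<in> L2" "weighted \<sigma> f \<in> L2" and g: "g \<in> L2" "weighted \<sigma> g \<in> L2" using assms by (auto simp: Hs_iff)
  have h: "(\<lambda>x. p * f x + q * g x) \<in> L2" by (intro L2_add L2_cmult f g)
  have "weighted \<sigma> (\<lambda>x. p * f x + q * g x) \<in> L2"
  proof (rule L2_cong_AE(1))
    show "(\<lambda>\<xi>. complex_of_real p * weighted \<sigma> f \<xi> + complex_of_real q * weighted \<sigma> g \<xi>) \<in> L2" by (intro L2_add L2_cmult f g)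
    show "AE \<xi> in lborel. complex_of_real p * weighted \<sigma> f \<xi> + complex_of_real q * weighted \<sigma> g \<xi> = weighted \<sigma> (\<lambda>x. p * f x + q * g x) \<xi>"
      using weighted_linear[OF f(1) g(1), of \<sigma> p q] by eventually_elim simp
    show "weighted \<sigma> (\<lambda>x. p * f x + q * g x) \<in> borel_measurable lborel" using fourier_measurable[OF h] by (simp add: weighted_def[abs_def])
  qed
  then show ?thesis using h by (simp add: Hs_iff)
qed

lemma Hs_diff: "f \<in> Hs \<sigma> \<Longrightarrow> g \<in> Hs \<sigma> \<Longrightarrow> (\<lambda>x. f x - g x) \<in> Hs \<sigma>"
  using Hs_linear[of f \<sigma> g 1 "-1"] by simp

lemma Hs_norm_le_diff:
  assumes "f \<in> Hs \<sigma>" "g \<in> Hs \<sigma>" shows "Hs_norm \<sigma> f \<le> Hs_norm \<sigma> g + Hs_norm \<sigma> (\<lambda>x. f x - g x)"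
proof -
  have f: "f \<in> L2" "weighted \<sigma> f \<in> L2" and g: "g \<in> L2" "weighted \<sigma> g \<in> L2" using assms by (auto simp: Hs_iff)
  have h: "weighted \<sigma> (\<lambda>x. f x - g x) \<in> L2" using Hs_diff[OF assms] by (simp add: Hs_iff)
  have "l2 (weighted \<sigma> f) = l2 (\<lambda>\<xi>. weighted \<sigma> g \<xi> + weighted \<sigma> (\<lambda>x. f x - g x) \<xi>)"
  proof (rule L2_cong_AE(2)[OF L2_add(1)[OF g(2) h]])
    show "weighted \<sigma> f \<in> borel_measurable lborel" using f by (auto simp: L2_def)
    show "AE \<xi> in lborel. weighted \<sigma> g \<xi> + weighted \<sigma> (\<lambda>x. f x - g x) \<xi> = weighted \<sigma> f \<xi>"
      using weighted_linear[OF f(1) g(1), of \<sigma> 1 "-1"] by eventually_elim simp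
  qed
  also have "\<dots> \<le> l2 (weighted \<sigma> g) + l2 (weighted \<sigma> (\<lambda>x. f x - g x))" by (rule L2_add(2)[OF g(2) h])
  finally show ?thesis by (simp add: Hs_norm_eq)
qed

lemma Hs_mono:
  assumes "f \<in> Hs s" "\<sigma> \<le> s" shows "f \<in> Hs \<sigma>" "Hs_norm \<sigma> f \<le> Hs_norm s f"
proof -
  have f: "f \<in> L2" "weighted s f \<in> L2" using assms by (auto simp: Hs_iff)
  have m: "weighted \<sigma> f \<in> borel_measurable lborel" using fourier_measurable[OF f(1)] by (simp add: weighted_def[abs_def])
  have "cmod (weighted \<sigma> f \<xi>) \<le> cmod (weighted s f \<xi>)" for \<xi>
    using assms(2) by (auto simp: weighted_def norm_mult intro!: mult_right_mono powr_mono)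
  from L2_dominated[OF f(2) m this] f(1) show "f \<in> Hs \<sigma>" "Hs_norm \<sigma> f \<le> Hs_norm s f" by (auto simp: Hs_iff Hs_norm_eq)
qed

lemma l2_fourier_le: assumes "f \<in> Hs \<sigma>" "0 \<le> \<sigma>" shows "l2 (fourier f) \<le> Hs_norm \<sigma> f"
proof -
  have "(1 + \<xi>\<^sup>2) powr 0 = 1" for \<xi> :: real
  proof -
    have "0 < 1 + \<xi>\<^sup>2" by (simp add: add_pos_nonneg)
    then show ?thesis by simp
  qed
  then have "weighted 0 f = fourier f" by (simp add: weighted_def fun_eq_iff)
  then show ?thesis using Hs_mono(2)[OF assms] by (simp add: Hs_norm_eq)
qed

definition der :: "(real \<Rightarrow> complex) \<Rightarrow> real \<Rightarrow> complex" where "der b \<xi> = \<i> * complex_of_real \<xi> * b \<xi>"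

lemma norm_der: "cmod (der b \<xi>) = \<bar>\<xi>\<bar> * cmod (b \<xi>)" by (simp add: der_def norm_mult)

lemma norm_cis_diff_le: "cmod (cis s - cis t) \<le> \<bar>s - t\<bar>"
proof -
  have "cis s - cis t = cis t * (cis (s - t) - 1)" by (simp add: algebra_simps cis_mult)
  then have "cmod (cis s - cis t) = cmod (cis (s - t) - 1)" by (simp add: norm_mult)
  also have "\<dots> = 2 * \<bar>sin ((s - t) / 2)\<bar>" using dist_exp_i_1[of "s - t"] by (simp add: cis_conv_exp dist_norm)
  also have "\<dots> \<le> 2 * \<bar>(s - t) / 2\<bar>" by (intro mult_left_mono abs_sin_x_le_abs_x) auto
  finally show ?thesis by simp
qed

lemma IFT_continuous:
  assumes b: "integrable lborel b" shows "continuous_on UNIV (\<lambda>x. Re (IFT b x))"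
proof -
  have [measurable]: "b \<in> borel_measurable borel" using b by auto
  have "(\<lambda>n. Re (IFT b (X n))) \<longlonglongrightarrow> Re (IFT b x)" if X: "X \<longlonglongrightarrow> x" for X x
  proof -
    have "(\<lambda>n. LBINT \<xi>. cis (X n * \<xi>) * b \<xi>) \<longlonglongrightarrow> (LBINT \<xi>. cis (x * \<xi>) * b \<xi>)"
    proof (rule integral_dominated_convergence)
      show "integrable lborel (\<lambda>\<xi>. cmod (b \<xi>))" using b by simp
      show "AE \<xi> in lborel. (\<lambda>n. cis (X n * \<xi>) * b \<xi>) \<longlonglongrightarrow> cis (x * \<xi>) * b \<xi>"
        unfolding cis_conv_exp by (intro AE_I2 tendsto_intros X)
      show "AE \<xi> in lborel. norm (cis (X n * \<xi>) * b \<xi>) \<le> cmod (b \<xi>)" for n by (simp add: norm_mult)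
    qed auto
    then show ?thesis unfolding IFT_eq by (intro tendsto_intros)
  qed
  then show ?thesis by (auto simp: continuous_on_sequentially comp_def)
qed

lemma IFT_deriv:
  assumes b: "integrable lborel b" and d: "integrable lborel (der b)"
  shows "((\<lambda>x. Re (IFT b x)) has_real_derivative Re (IFT (der b) x)) (at x)"
  unfolding has_field_derivative_iff tendsto_at_iff_sequentially
proof (intro allI impI)
  fix X :: "nat \<Rightarrow> real" assume X0: "\<forall>i. X i \<in> UNIV - {x}" and X: "X \<longlonglongrightarrow> x"
  have [measurable]: "b \<in> borel_measurable borel" "der b \<in> borel_measurable borel" using b d by auto
  define q where "q n \<xi> = (cis (X n * \<xi>) - cis (x * \<xi>)) / complex_of_real (X n - x) * b \<xi>" for n \<xi>
  have ne: "X n - x \<noteq> 0" for n using X0 by auto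
  have "(\<lambda>n. LBINT \<xi>. q n \<xi>) \<longlonglongrightarrow> (LBINT \<xi>. cis (x * \<xi>) * der b \<xi>)"
  proof (rule integral_dominated_convergence)
    show "integrable lborel (\<lambda>\<xi>. cmod (der b \<xi>))" using d by simp
    show "AE \<xi> in lborel. (\<lambda>n. q n \<xi>) \<longlonglongrightarrow> cis (x * \<xi>) * der b \<xi>"
    proof (rule AE_I2)
      fix \<xi>
      define c where "c = \<i> * complex_of_real \<xi>"
      have D: "((\<lambda>z. exp (c * z)) has_field_derivative exp (c * complex_of_real x) * c) (at (complex_of_real x))"
        by (auto intro!: derivative_eq_intros)
      have "filterlim (\<lambda>n. complex_of_real (X n)) (at (complex_of_real x)) sequentially"
        unfolding filterlim_at using X X0 by (auto intro!: tendsto_intros)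
      from filterlim_compose[OF D[unfolded has_field_derivative_iff] this]
      have "(\<lambda>n. (exp (c * complex_of_real (X n)) - exp (c * complex_of_real x)) / (complex_of_real (X n) - complex_of_real x)) \<longlonglongrightarrow> exp (c * complex_of_real x) * c" .
      moreover have "exp (c * complex_of_real y) = cis (y * \<xi>)" for y by (simp add: c_def cis_conv_exp mult_ac)
      ultimately have "(\<lambda>n. (cis (X n * \<xi>) - cis (x * \<xi>)) / complex_of_real (X n - x) * b \<xi>) \<longlonglongrightarrow> cis (x * \<xi>) * c * b \<xi>"
        by (intro tendsto_mult tendsto_const) simp
      then show "(\<lambda>n. q n \<xi>) \<longlonglongrightarrow> cis (x * \<xi>) * der b \<xi>" by (simp add: q_def der_def c_def mult.assoc)
    qed
    show "AE \<xi> in lborel. norm (q n \<xi>) \<le> cmod (der b \<xi>)" for n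
    proof (rule AE_I2)
      fix \<xi>
      have "cmod (cis (X n * \<xi>) - cis (x * \<xi>)) \<le> \<bar>X n - x\<bar> * \<bar>\<xi>\<bar>"
        using norm_cis_diff_le[of "X n * \<xi>" "x * \<xi>"] by (simp add: abs_mult[symmetric] algebra_simps)
      then have "cmod (cis (X n * \<xi>) - cis (x * \<xi>)) / \<bar>X n - x\<bar> \<le> \<bar>\<xi>\<bar>"
        using ne[of n] by (simp add: pos_divide_le_eq mult.commute)
      then show "norm (q n \<xi>) \<le> cmod (der b \<xi>)"
        unfolding q_def norm_der norm_mult norm_divide norm_of_real by (rule mult_right_mono) simp
    qed
  qed (auto simp: q_def)
  then have lim: "(\<lambda>n. Re (complex_of_real (1 / sqrt (2 * pi)) * (LBINT \<xi>. q n \<xi>))) \<longlonglongrightarrow> Re (IFT (der b) x)"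
    unfolding IFT_eq by (intro tendsto_intros)
  have "Re (complex_of_real (1 / sqrt (2 * pi)) * (LBINT \<xi>. q n \<xi>)) = (Re (IFT b (X n)) - Re (IFT b x)) / (X n - x)" for n
  proof -
    have i: "integrable lborel (\<lambda>\<xi>. cis (y * \<xi>) * b \<xi>)" for y by (rule cis_mult_integrable[OF b]) simp
    have "(LBINT \<xi>. q n \<xi>) = (LBINT \<xi>. (cis (X n * \<xi>) * b \<xi> - cis (x * \<xi>) * b \<xi>) / complex_of_real (X n - x))"
      by (rule Bochner_Integration.integral_cong) (auto simp: q_def algebra_simps diff_divide_distrib)
    also have "\<dots> = ((LBINT \<xi>. cis (X n * \<xi>) * b \<xi>) - (LBINT \<xi>. cis (x * \<xi>) * b \<xi>)) / complex_of_real (X n - x)"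
      using i by (simp del: of_real_diff)
    finally have "complex_of_real (1 / sqrt (2 * pi)) * (LBINT \<xi>. q n \<xi>) = (IFT b (X n) - IFT b x) / complex_of_real (X n - x)"
      unfolding IFT_eq by (simp only: right_diff_distrib[symmetric] times_divide_eq_right)
    then show ?thesis by (simp only: Re_divide_of_real minus_complex.simps)
  qed
  then show "((\<lambda>y. (Re (IFT b y) - Re (IFT b x)) / (y - x)) \<circ> X) \<longlonglongrightarrow> Re (IFT (der b) x)"
    using lim by (simp add: comp_def)
qed

lemma Re_IFT_L2:
  assumes "integrable lborel b" "b \<in> L2"
  shows "(\<lambda>x. Re (IFT b x)) \<in> L2" "l2 (\<lambda>x. Re (IFT b x)) \<le> l2 b"
proof -
  note I = IFT_L2[OF assms]
  have m: "(\<lambda>x. Re (IFT b x)) \<in> borel_measurable lborel" using I by (auto simp: L2_def)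
  have "norm (Re (IFT b x)) \<le> norm (IFT b x)" for x by (simp add: abs_Re_le_cmod)
  from L2_dominated[OF I(1) m this] I(2) show "(\<lambda>x. Re (IFT b x)) \<in> L2" "l2 (\<lambda>x. Re (IFT b x)) \<le> l2 b" by auto
qed

lemma Re_IFT_bound: "integrable lborel b \<Longrightarrow> \<bar>Re (IFT b x)\<bar> \<le> (LBINT \<xi>. cmod (b \<xi>))"
  using IFT_bound[of b x] abs_Re_le_cmod[of "IFT b x"] by linarith

text \<open>The inversion formula selects, for an integrable transform, a continuous representative; if also \<open>\<xi>\<close> times the transform is
  integrable, the representative is continuously differentiable with derivative \<open>drep\<close>.\<close>

definition rep :: "(real \<Rightarrow> real) \<Rightarrow> real \<Rightarrow> real" where "rep f x = Re (IFT (fourier f) x)"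
definition drep :: "(real \<Rightarrow> real) \<Rightarrow> real \<Rightarrow> real" where "drep f x = Re (IFT (der (fourier f)) x)"

text \<open>A constant for the embedding of \<open>H\<^bsup>\<sigma>\<^esup>\<close> into the continuously differentiable functions with bounded derivative, finite for
  \<open>\<sigma> > 3/2\<close>.\<close>

definition Cs :: "real \<Rightarrow> real" where "Cs \<sigma> = l2 (\<lambda>\<xi>. complex_of_real ((1 + \<xi>\<^sup>2) powr ((1 - \<sigma>) / 2)))"

lemma Cs_nonneg: "0 \<le> Cs \<sigma>" by (simp add: Cs_def)

lemma abs_le_weight:
  fixes \<xi> :: real shows "\<bar>\<xi>\<bar> \<le> (1 + \<xi>\<^sup>2) powr (1 / 2)" "1 \<le> (1 + \<xi>\<^sup>2) powr (1 / 2)"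
  by (auto simp: powr_half_sqrt real_le_rsqrt)

text \<open>Cauchy-Schwarz with the weight \<open>(1 + \<xi>\<^sup>2)\<^bsup>(1 - \<sigma>)/2\<^esup>\<close>, which is square integrable exactly for \<open>\<sigma> > 3/2\<close>.\<close>

lemma Hs_first_moment:
  assumes f: "f \<in> Hs \<sigma>" and s: "3 / 2 < \<sigma>"
  shows "integrable lborel (\<lambda>\<xi>. (1 + \<xi>\<^sup>2) powr (1 / 2) * cmod (fourier f \<xi>))"
    "(LBINT \<xi>. (1 + \<xi>\<^sup>2) powr (1 / 2) * cmod (fourier f \<xi>)) \<le> Cs \<sigma> * Hs_norm \<sigma> f"
proof -
  have L: "weighted \<sigma> f \<in> L2" using f by (simp add: Hs_iff)
  define k where "k \<xi> = complex_of_real ((1 + \<xi>\<^sup>2) powr ((1 - \<sigma>) / 2))" for \<xi> :: real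
  have "(norm (k \<xi>))\<^sup>2 = (1 + \<xi>\<^sup>2) powr (- (\<sigma> - 1))" for \<xi>
    by (simp add: k_def power2_eq_square powr_add[symmetric])
  moreover have "k \<in> borel_measurable lborel" unfolding k_def by measurable
  ultimately have K: "k \<in> L2" using integrable_weight[of "\<sigma> - 1"] s by (simp add: L2_def)
  have e: "cmod (k \<xi> * weighted \<sigma> f \<xi>) = (1 + \<xi>\<^sup>2) powr (1 / 2) * cmod (fourier f \<xi>)" for \<xi>
  proof -
    have "(1 + \<xi>\<^sup>2) powr ((1 - \<sigma>) / 2) * (1 + \<xi>\<^sup>2) powr (\<sigma> / 2) = (1 + \<xi>\<^sup>2) powr (1 / 2)"
      by (simp add: powr_add[symmetric] add_divide_distrib[symmetric])
    then show ?thesis by (simp add: k_def weighted_def norm_mult mult.assoc[symmetric])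
  qed
  show "integrable lborel (\<lambda>\<xi>. (1 + \<xi>\<^sup>2) powr (1 / 2) * cmod (fourier f \<xi>))"
    using integrable_norm[OF L2_mult_integrable[OF K L]] unfolding e .
  show "(LBINT \<xi>. (1 + \<xi>\<^sup>2) powr (1 / 2) * cmod (fourier f \<xi>)) \<le> Cs \<sigma> * Hs_norm \<sigma> f"
    using L2_Cauchy_Schwarz(1)[OF K L] unfolding norm_mult[symmetric] e Cs_def Hs_norm_eq by (simp add: k_def[abs_def])
qed

lemma Hs_multiplier_integrable:
  assumes f: "f \<in> Hs \<sigma>" and s: "3 / 2 < \<sigma>" and m: "b \<in> borel_measurable borel" "\<And>\<xi>. cmod (b \<xi>) \<le> C * ((1 + \<xi>\<^sup>2) powr (1 / 2) * cmod (fourier f \<xi>))"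
    and C: "0 \<le> C"
  shows "integrable lborel b" "(LBINT \<xi>. cmod (b \<xi>)) \<le> C * (Cs \<sigma> * Hs_norm \<sigma> f)"
proof -
  note h = Hs_first_moment[OF f s]
  have i: "integrable lborel (\<lambda>\<xi>. C * ((1 + \<xi>\<^sup>2) powr (1 / 2) * cmod (fourier f \<xi>)))" using h by simp
  show b: "integrable lborel b"
    by (rule Bochner_Integration.integrable_bound[OF i]) (use m in \<open>auto intro: order_trans[OF _ abs_ge_self]\<close>)
  have "(LBINT \<xi>. cmod (b \<xi>)) \<le> (LBINT \<xi>. C * ((1 + \<xi>\<^sup>2) powr (1 / 2) * cmod (fourier f \<xi>)))"
    by (rule integral_mono[OF integrable_norm[OF b] i m(2)])
  also have "\<dots> \<le> C * (Cs \<sigma> * Hs_norm \<sigma> f)" using mult_left_mono[OF h(2) C] by simp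
  finally show "(LBINT \<xi>. cmod (b \<xi>)) \<le> C * (Cs \<sigma> * Hs_norm \<sigma> f)" .
qed

lemma Hs_fourier_integrable:
  assumes f: "f \<in> Hs \<sigma>" and s: "3 / 2 < \<sigma>"
  shows "integrable lborel (fourier f)" "(LBINT \<xi>. cmod (fourier f \<xi>)) \<le> Cs \<sigma> * Hs_norm \<sigma> f"
    "integrable lborel (der (fourier f))" "(LBINT \<xi>. cmod (der (fourier f) \<xi>)) \<le> Cs \<sigma> * Hs_norm \<sigma> f"
proof -
  have [measurable]: "fourier f \<in> borel_measurable borel" using f fourier_measurable by (auto simp: Hs_iff)
  have 1: "cmod (fourier f \<xi>) \<le> 1 * ((1 + \<xi>\<^sup>2) powr (1 / 2) * cmod (fourier f \<xi>))" for \<xi>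
    using mult_right_mono[OF abs_le_weight(2)[of \<xi>] norm_ge_zero[of "fourier f \<xi>"]] by simp
  show "integrable lborel (fourier f)" "(LBINT \<xi>. cmod (fourier f \<xi>)) \<le> Cs \<sigma> * Hs_norm \<sigma> f"
    using Hs_multiplier_integrable[OF f s \<open>fourier f \<in> borel_measurable borel\<close> 1 zero_le_one] by (simp_all only: mult_1)
  have 2: "cmod (der (fourier f) \<xi>) \<le> 1 * ((1 + \<xi>\<^sup>2) powr (1 / 2) * cmod (fourier f \<xi>))" for \<xi>
    using mult_right_mono[OF abs_le_weight(1)[of \<xi>] norm_ge_zero[of "fourier f \<xi>"]] by (simp add: norm_der)
  have "der (fourier f) \<in> borel_measurable borel" unfolding der_def by measurable
  from Hs_multiplier_integrable[OF f s this 2 zero_le_one]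
  show "integrable lborel (der (fourier f))" "(LBINT \<xi>. cmod (der (fourier f) \<xi>)) \<le> Cs \<sigma> * Hs_norm \<sigma> f"
    by (simp_all only: mult_1)
qed

lemma der_fourier_L2:
  assumes f: "f \<in> Hs \<sigma>" and s: "1 \<le> \<sigma>" shows "der (fourier f) \<in> L2" "l2 (der (fourier f)) \<le> Hs_norm \<sigma> f"
proof -
  have L: "weighted \<sigma> f \<in> L2" and [measurable]: "fourier f \<in> borel_measurable borel" using f fourier_measurable by (auto simp: Hs_iff)
  have m: "der (fourier f) \<in> borel_measurable lborel" unfolding der_def by measurable
  have "\<bar>\<xi>\<bar> \<le> (1 + \<xi>\<^sup>2) powr (\<sigma> / 2)" for \<xi>
    using order_trans[OF abs_le_weight(1)] s powr_mono[of "1 / 2" "\<sigma> / 2" "1 + \<xi>\<^sup>2"] by simp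
  then have "cmod (der (fourier f) \<xi>) \<le> cmod (weighted \<sigma> f \<xi>)" for \<xi>
    by (simp add: norm_der weighted_def norm_mult mult_right_mono)
  from L2_dominated[OF L m this] show "der (fourier f) \<in> L2" "l2 (der (fourier f)) \<le> Hs_norm \<sigma> f" by (simp_all add: Hs_norm_eq)
qed

lemma rep_props:
  assumes f: "f \<in> Hs \<sigma>" and s: "3 / 2 < \<sigma>"
  shows "AE x in lborel. f x = rep f x"
    and "(rep f has_real_derivative drep f x) (at x)"
    and "continuous_on UNIV (rep f)" and "continuous_on UNIV (drep f)"
    and "\<bar>rep f x\<bar> \<le> Cs \<sigma> * Hs_norm \<sigma> f" and "\<bar>drep f x\<bar> \<le> Cs \<sigma> * Hs_norm \<sigma> f"
    and "rep f \<in> L2" and "drep f \<in> L2"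
    and "l2 (rep f) \<le> Hs_norm \<sigma> f" and "l2 (drep f) \<le> Hs_norm \<sigma> f"
proof -
  have fL: "f \<in> L2" using f by (simp add: Hs_iff)
  note i = Hs_fourier_integrable[OF f s]
  have e: "rep f = (\<lambda>x. Re (IFT (fourier f) x))" "drep f = (\<lambda>x. Re (IFT (der (fourier f)) x))" by (auto simp: rep_def drep_def)
  show "AE x in lborel. f x = rep f x"
    using fourier_inversion[OF fL i(1)]
  proof eventually_elim
    case (elim x)
    have "Re (complex_of_real (f x)) = Re (IFT (fourier f) x)" unfolding elim ..
    then show ?case by (simp add: rep_def)
  qed
  show "(rep f has_real_derivative drep f x) (at x)" unfolding e by (rule IFT_deriv[OF i(1,3)])
  show "continuous_on UNIV (rep f)" "continuous_on UNIV (drep f)" unfolding e by (intro IFT_continuous i)+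
  show "\<bar>rep f x\<bar> \<le> Cs \<sigma> * Hs_norm \<sigma> f" "\<bar>drep f x\<bar> \<le> Cs \<sigma> * Hs_norm \<sigma> f"
    unfolding e using Re_IFT_bound[OF i(1), of x] Re_IFT_bound[OF i(3), of x] i(2,4) by linarith+
  have d: "der (fourier f) \<in> L2" "l2 (der (fourier f)) \<le> Hs_norm \<sigma> f" using der_fourier_L2[OF f] s by auto
  show "rep f \<in> L2" "drep f \<in> L2" unfolding e by (intro Re_IFT_L2 i fourier_L2 fL d)+
  show "l2 (rep f) \<le> Hs_norm \<sigma> f" "l2 (drep f) \<le> Hs_norm \<sigma> f" unfolding e
    using Re_IFT_L2(2)[OF i(1) fourier_L2[OF fL]] l2_fourier_le[OF f] Re_IFT_L2(2)[OF i(3) d(1)] d(2) s by linarith+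
qed

lemma IFT_cong_AE:
  assumes "AE \<xi> in lborel. a \<xi> = b \<xi>" "a \<in> borel_measurable borel" "b \<in> borel_measurable borel"
  shows "IFT a x = IFT b x"
  unfolding IFT_eq by (intro arg_cong[where f="\<lambda>z. _ * z"] integral_cong_AE) (use assms in auto)

lemma rep_diff:
  assumes f: "f \<in> Hs \<sigma>" and g: "g \<in> Hs \<sigma>" and s: "3 / 2 < \<sigma>"
  shows "rep (\<lambda>x. f x - g x) x = rep f x - rep g x" "drep (\<lambda>x. f x - g x) x = drep f x - drep g x"
proof -
  have L: "f \<in> L2" "g \<in> L2" "(\<lambda>x. f x - g x) \<in> L2" using f g Hs_diff[OF f g] by (auto simp: Hs_iff)
  note [measurable] = L[THEN fourier_measurable]
  have [measurable]: "der (fourier f) \<in> borel_measurable borel" "der (fourier g) \<in> borel_measurable borel" "der (fourier (\<lambda>x. f x - g x)) \<in> borel_measurable borel"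
    unfolding der_def by measurable
  note i = Hs_fourier_integrable[OF f s] and j = Hs_fourier_integrable[OF g s]
  have AE: "AE \<xi> in lborel. fourier (\<lambda>x. f x - g x) \<xi> = fourier f \<xi> - fourier g \<xi>"
    using fourier_linear[OF L(1,2), of 1 "-1"] by eventually_elim simp
  have "IFT (fourier (\<lambda>x. f x - g x)) x = IFT (\<lambda>\<xi>. fourier f \<xi> - fourier g \<xi>) x"
    by (rule IFT_cong_AE[OF AE]) auto
  also have "\<dots> = IFT (fourier f) x - IFT (fourier g) x" unfolding IFT_def by (rule FT_diff[OF i(1) j(1)])
  finally show "rep (\<lambda>x. f x - g x) x = rep f x - rep g x" by (simp add: rep_def)
  have "IFT (der (fourier (\<lambda>x. f x - g x))) x = IFT (\<lambda>\<xi>. der (fourier f) \<xi> - der (fourier g) \<xi>) x"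
  proof (rule IFT_cong_AE)
    show "AE \<xi> in lborel. der (fourier (\<lambda>x. f x - g x)) \<xi> = der (fourier f) \<xi> - der (fourier g) \<xi>"
      using AE by eventually_elim (simp add: der_def right_diff_distrib)
  qed auto
  also have "\<dots> = IFT (der (fourier f)) x - IFT (der (fourier g)) x" unfolding IFT_def by (rule FT_diff[OF i(3) j(3)])
  finally show "drep (\<lambda>x. f x - g x) x = drep f x - drep g x" by (simp add: drep_def)
qed

text \<open>Frequencies beyond \<open>N\<close> are cut off sharply. Derivatives of the truncation stay bounded up to powers of \<open>N\<close>, since already the
  first derivative of \<open>f\<close> has an integrable transform; each power of \<open>N\<close> in the \<open>L\<^sup>2\<close> estimates measures the
  distance of the order of differentiation from \<open>\<sigma>\<close>, with \<open>\<sigma> \<le> 2\<close> making the last one nonnegative.\<close>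

lemma Hs_truncation:
  assumes f: "f \<in> Hs \<sigma>" and s: "3 / 2 < \<sigma>" "\<sigma> \<le> 2" and N: "1 \<le> N"
  obtains U where "smooth U" "\<And>x. \<bar>U x\<bar> \<le> Cs \<sigma> * Hs_norm \<sigma> f"
    "\<And>j x. \<bar>(deriv ^^ Suc j) U x\<bar> \<le> N ^ j * (Cs \<sigma> * Hs_norm \<sigma> f)"
    "(\<lambda>x. rep f x - U x) \<in> L2" "l2 (\<lambda>x. rep f x - U x) \<le> N powr (- \<sigma>) * Hs_norm \<sigma> f"
    "(\<lambda>x. drep f x - deriv U x) \<in> L2" "l2 (\<lambda>x. drep f x - deriv U x) \<le> N powr (1 - \<sigma>) * Hs_norm \<sigma> f"
    "deriv (deriv U) \<in> L2" "l2 (deriv (deriv U)) \<le> N powr (2 - \<sigma>) * Hs_norm \<sigma> f"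
proof -
  define a where "a = fourier f"
  have L: "weighted \<sigma> f \<in> L2" and aL: "a \<in> L2" and am[measurable]: "a \<in> borel_measurable borel" using f fourier_measurable fourier_L2 by (auto simp: Hs_iff a_def)
  have w: "cmod (weighted \<sigma> f \<xi>) = (1 + \<xi>\<^sup>2) powr (\<sigma> / 2) * cmod (a \<xi>)" for \<xi> by (simp add: weighted_def norm_mult a_def)
  define b where "b j \<xi> = (\<i> * complex_of_real \<xi>) ^ j * (indicator {-N..N} \<xi> * a \<xi>)" for j \<xi>
  define hi where "hi \<xi> = a \<xi> - indicator {-N..N} \<xi> * a \<xi>" for \<xi>
  define U where "U x = Re (IFT (b 0) x)" for x
  have bm[measurable]: "b j \<in> borel_measurable borel" for j unfolding b_def by measurable
  have hm[measurable]: "hi \<in> borel_measurable borel" unfolding hi_def by measurable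
  have bn: "cmod (b j \<xi>) = \<bar>\<xi>\<bar> ^ j * (indicator {-N..N} \<xi> * cmod (a \<xi>))" for j \<xi>
    by (simp add: b_def norm_mult norm_power indicator_def)
  have i: "integrable lborel a" "integrable lborel (der a)" using Hs_fourier_integrable[OF f s(1)] by (auto simp: a_def)
  have b0: "integrable lborel (b 0)" "(LBINT \<xi>. cmod (b 0 \<xi>)) \<le> 1 * (Cs \<sigma> * Hs_norm \<sigma> f)"
  proof -
    have "cmod (b 0 \<xi>) \<le> 1 * ((1 + \<xi>\<^sup>2) powr (1 / 2) * cmod (fourier f \<xi>))" for \<xi>
      using mult_right_mono[OF abs_le_weight(2)[of \<xi>] norm_ge_zero[of "a \<xi>"]] by (simp add: bn a_def indicator_def)
    from Hs_multiplier_integrable[OF f s(1) bm this zero_le_one]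
    show "integrable lborel (b 0)" "(LBINT \<xi>. cmod (b 0 \<xi>)) \<le> 1 * (Cs \<sigma> * Hs_norm \<sigma> f)" .
  qed
  have bS: "integrable lborel (b (Suc j))" "(LBINT \<xi>. cmod (b (Suc j) \<xi>)) \<le> N ^ j * (Cs \<sigma> * Hs_norm \<sigma> f)" for j
  proof -
    have "cmod (b (Suc j) \<xi>) \<le> N ^ j * ((1 + \<xi>\<^sup>2) powr (1 / 2) * cmod (fourier f \<xi>))" for \<xi>
    proof (cases "\<bar>\<xi>\<bar> \<le> N")
      case True
      then have "\<bar>\<xi>\<bar> ^ j * (\<bar>\<xi>\<bar> * cmod (a \<xi>)) \<le> N ^ j * ((1 + \<xi>\<^sup>2) powr (1 / 2) * cmod (a \<xi>))"
        using N by (intro mult_mono power_mono mult_right_mono abs_le_weight(1)) auto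
      then show ?thesis using True by (simp add: bn a_def abs_le_iff mult.assoc mult.left_commute)
    next
      case False
      then have "indicator {-N..N} \<xi> = (0::real)" by (auto simp: indicator_def abs_le_iff)
      then show ?thesis using N by (simp add: bn)
    qed
    moreover have "0 \<le> N ^ j" using N by simp
    ultimately show "integrable lborel (b (Suc j))" "(LBINT \<xi>. cmod (b (Suc j) \<xi>)) \<le> N ^ j * (Cs \<sigma> * Hs_norm \<sigma> f)"
      using Hs_multiplier_integrable[OF f s(1) bm[of "Suc j"]] by blast+
  qed
  have bi: "integrable lborel (b j)" for j using b0 bS by (cases j) auto
  have db: "der (b j) = b (Suc j)" for j by (auto simp: der_def b_def fun_eq_iff)
  have D: "((\<lambda>x. Re (IFT (b j) x)) has_real_derivative Re (IFT (b (Suc j)) x)) (at x)" for j x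
    using IFT_deriv[OF bi[of j]] bi[of "Suc j"] by (simp add: db)
  have dU: "(deriv ^^ j) U = (\<lambda>x. Re (IFT (b j) x))" for j
  proof (induction j)
    case 0 then show ?case by (simp add: U_def[abs_def])
  next
    case (Suc j)
    have "deriv (\<lambda>x. Re (IFT (b j) x)) = (\<lambda>x. Re (IFT (b (Suc j)) x))" by (rule ext, rule DERIV_imp_deriv[OF D])
    then show ?case by (simp only: funpow.simps o_apply Suc)
  qed
  have smU: "smooth U"
    by (rule smooth_coinduct[where P="\<lambda>g. \<exists>j. g = (\<lambda>x. Re (IFT (b j) x))"]) (use D in \<open>auto simp: U_def[abs_def]\<close>)
  have Ub: "\<bar>U x\<bar> \<le> Cs \<sigma> * Hs_norm \<sigma> f" for x
    using Re_IFT_bound[OF b0(1), of x] b0(2) by (simp add: U_def)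
  have dUb: "\<bar>(deriv ^^ Suc j) U x\<bar> \<le> N ^ j * (Cs \<sigma> * Hs_norm \<sigma> f)" for j x
    unfolding dU using Re_IFT_bound[OF bi, of "Suc j" x] bS(2)[of j] by linarith
  have out: "N \<le> \<bar>\<xi>\<bar>" if "\<xi> \<notin> {-N..N}" for \<xi> using that by (auto simp: abs_if not_le)
  have base: "N powr p \<le> (1 + \<xi>\<^sup>2) powr (p / 2)" if "N \<le> \<bar>\<xi>\<bar>" "0 \<le> p" for \<xi> p
  proof -
    have "N\<^sup>2 \<le> 1 + \<xi>\<^sup>2" using power_mono[OF that(1), of 2] N by simp
    then have "(N\<^sup>2) powr (p / 2) \<le> (1 + \<xi>\<^sup>2) powr (p / 2)" using N that(2) by (intro powr_mono2) auto
    moreover have "(N\<^sup>2) powr (p / 2) = N powr p" using N by (simp add: powr_numeral[symmetric] powr_powr del: powr_numeral)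
    ultimately show ?thesis by simp
  qed
  have hib: "cmod (hi \<xi>) \<le> N powr (- \<sigma>) * cmod (weighted \<sigma> f \<xi>)" for \<xi>
  proof (cases "\<xi> \<in> {-N..N}")
    case False
    have "1 \<le> N powr (- \<sigma>) * (1 + \<xi>\<^sup>2) powr (\<sigma> / 2)"
      using mult_left_mono[OF base[OF out[OF False], of \<sigma>], of "N powr (- \<sigma>)"] s N by (simp add: powr_add[symmetric])
    from mult_right_mono[OF this norm_ge_zero[of "a \<xi>"]] show ?thesis using False by (simp add: hi_def w mult.assoc)
  qed (simp add: hi_def)
  have hL: "hi \<in> L2" "l2 hi \<le> N powr (- \<sigma>) * l2 (weighted \<sigma> f)" using L2_scale[OF L _ _ hib] by auto
  have dhb: "cmod (der hi \<xi>) \<le> N powr (1 - \<sigma>) * cmod (weighted \<sigma> f \<xi>)" for \<xi>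
  proof (cases "\<xi> \<in> {-N..N}")
    case False
    have "\<bar>\<xi>\<bar> \<le> (1 + \<xi>\<^sup>2) powr (1 / 2)" by (rule abs_le_weight)
    also have "\<dots> = (1 + \<xi>\<^sup>2) powr (\<sigma> / 2) / (1 + \<xi>\<^sup>2) powr ((\<sigma> - 1) / 2)"
      by (simp add: powr_diff[symmetric] diff_divide_distrib)
    also have "\<dots> \<le> (1 + \<xi>\<^sup>2) powr (\<sigma> / 2) / N powr (\<sigma> - 1)"
    proof (rule divide_left_mono)
      have "0 < N powr (\<sigma> - 1)" using N by simp
      then show "0 < (1 + \<xi>\<^sup>2) powr ((\<sigma> - 1) / 2) * N powr (\<sigma> - 1)"
        using base[OF out[OF False], of "\<sigma> - 1"] s by (intro mult_pos_pos) auto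
    qed (use base[OF out[OF False], of "\<sigma> - 1"] s in auto)
    also have "\<dots> = N powr (1 - \<sigma>) * (1 + \<xi>\<^sup>2) powr (\<sigma> / 2)"
      using powr_minus[of N "\<sigma> - 1"] by (simp add: field_simps)
    finally have "\<bar>\<xi>\<bar> \<le> N powr (1 - \<sigma>) * (1 + \<xi>\<^sup>2) powr (\<sigma> / 2)" .
    from mult_right_mono[OF this norm_ge_zero[of "a \<xi>"]] show ?thesis using False by (simp add: norm_der hi_def w mult.assoc)
  qed (simp add: hi_def der_def)
  have dhm: "der hi \<in> borel_measurable borel" unfolding der_def by measurable
  have dhL: "der hi \<in> L2" "l2 (der hi) \<le> N powr (1 - \<sigma>) * l2 (weighted \<sigma> f)" using L2_scale[OF L _ _ dhb] dhm by auto
  have b2b: "cmod (b 2 \<xi>) \<le> N powr (2 - \<sigma>) * cmod (weighted \<sigma> f \<xi>)" for \<xi>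
  proof (cases "\<bar>\<xi>\<bar> \<le> N \<and> \<xi> \<noteq> 0")
    case True
    have "\<bar>\<xi>\<bar>\<^sup>2 = \<bar>\<xi>\<bar> powr (2 - \<sigma>) * \<bar>\<xi>\<bar> powr \<sigma>" using True by (simp add: powr_add[symmetric])
    also have "\<bar>\<xi>\<bar> powr \<sigma> = (\<xi>\<^sup>2) powr (\<sigma> / 2)"
    proof -
      have "(\<xi>\<^sup>2) powr (\<sigma> / 2) = (\<bar>\<xi>\<bar> powr 2) powr (\<sigma> / 2)" using True by simp
      then show ?thesis by (simp only: powr_powr) simp
    qed
    also have "\<bar>\<xi>\<bar> powr (2 - \<sigma>) * (\<xi>\<^sup>2) powr (\<sigma> / 2) \<le> N powr (2 - \<sigma>) * (1 + \<xi>\<^sup>2) powr (\<sigma> / 2)"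
      using True s N by (intro mult_mono powr_mono2) auto
    finally have "\<bar>\<xi>\<bar>\<^sup>2 \<le> N powr (2 - \<sigma>) * (1 + \<xi>\<^sup>2) powr (\<sigma> / 2)" .
    from mult_right_mono[OF this norm_ge_zero[of "a \<xi>"]] show ?thesis using True by (simp add: bn w mult.assoc abs_le_iff)
  qed (auto simp: bn indicator_def abs_le_iff)
  have b2L: "b 2 \<in> L2" "l2 (b 2) \<le> N powr (2 - \<sigma>) * l2 (weighted \<sigma> f)" using L2_scale[OF L _ _ b2b] by auto
  have hii: "integrable lborel hi" unfolding hi_def[abs_def]
    using bi[of 0] i by (simp add: b_def[abs_def])
  have dhii: "integrable lborel (der hi)"
  proof -
    have "der hi = (\<lambda>\<xi>. der a \<xi> - b 1 \<xi>)" by (auto simp: der_def hi_def b_def fun_eq_iff algebra_simps)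
    then show ?thesis using bi[of 1] i by simp
  qed
  have d1: "(\<lambda>x. rep f x - U x) = (\<lambda>x. Re (IFT hi x))"
  proof
    fix x
    have "IFT hi x = IFT a x - IFT (b 0) x" unfolding IFT_def
      using FT_diff[OF i(1) bi[of 0]] by (simp add: hi_def[abs_def] b_def[abs_def])
    then show "rep f x - U x = Re (IFT hi x)" by (simp add: rep_def U_def a_def)
  qed
  have d2: "(\<lambda>x. drep f x - deriv U x) = (\<lambda>x. Re (IFT (der hi) x))"
  proof
    fix x
    have e: "der hi = (\<lambda>\<xi>. der a \<xi> - b 1 \<xi>)" by (auto simp: der_def hi_def b_def fun_eq_iff algebra_simps)
    have "IFT (der hi) x = IFT (der a) x - IFT (b 1) x" unfolding IFT_def e by (rule FT_diff[OF i(2) bi])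
    then show "drep f x - deriv U x = Re (IFT (der hi) x)" using dU[of 1] by (simp add: drep_def a_def)
  qed
  have d3: "deriv (deriv U) = (\<lambda>x. Re (IFT (b 2) x))" using dU[of 2] by (simp add: numeral_2_eq_2)
  show ?thesis
  proof (rule that[OF smU Ub dUb])
    show "(\<lambda>x. rep f x - U x) \<in> L2" "l2 (\<lambda>x. rep f x - U x) \<le> N powr (- \<sigma>) * Hs_norm \<sigma> f"
      unfolding d1 Hs_norm_eq using Re_IFT_L2[OF hii hL(1)] hL(2) by auto
    show "(\<lambda>x. drep f x - deriv U x) \<in> L2" "l2 (\<lambda>x. drep f x - deriv U x) \<le> N powr (1 - \<sigma>) * Hs_norm \<sigma> f"
      unfolding d2 Hs_norm_eq using Re_IFT_L2[OF dhii dhL(1)] dhL(2) by auto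
    show "deriv (deriv U) \<in> L2" "l2 (deriv (deriv U)) \<le> N powr (2 - \<sigma>) * Hs_norm \<sigma> f"
      unfolding d3 Hs_norm_eq using Re_IFT_L2[OF bi b2L(1)] b2L(2) by auto
  qed
qed

section \<open>The energy \<open>E\<^sub>2\<close> and the peakon\<close>

definition mult_res :: "(real \<Rightarrow> complex) \<Rightarrow> real \<Rightarrow> complex" where
  "mult_res a \<xi> = complex_of_real (1 / (4 + \<xi>\<^sup>2)) * a \<xi>"

lemma mult_res_measurable[measurable]: "a \<in> borel_measurable borel \<Longrightarrow> mult_res a \<in> borel_measurable borel"
  unfolding mult_res_def[abs_def] by measurable

lemma norm_mult_res: "cmod (mult_res a \<xi>) \<le> cmod (a \<xi>)"
proof -
  have "0 < 4 + \<xi>\<^sup>2" "1 \<le> 4 + \<xi>\<^sup>2" using zero_le_power2[of \<xi>] by linarith+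
  then have "1 / (4 + \<xi>\<^sup>2) \<le> 1" by (simp only: divide_le_eq_1_pos)
  then have "\<bar>1 / (4 + \<xi>\<^sup>2)\<bar> \<le> 1" by simp
  then show ?thesis unfolding mult_res_def norm_mult norm_of_real by (rule mult_left_le_one_le[rotated 2]) auto
qed

lemma mult_res_integrable: "integrable lborel a \<Longrightarrow> integrable lborel (mult_res a)"
  by (rule Bochner_Integration.integrable_bound) (auto simp: norm_mult_res)

text \<open>The transform of the kernel \<open>e\<^bsup>-2|x|\<^esup>/4\<close> is proportional to \<open>1 / (4 + \<xi>\<^sup>2)\<close>; the multiplication formula does the rest.\<close>

lemma exp_convolution_IFT:
  assumes a: "integrable lborel a"
  shows "(LBINT y. complex_of_real (1/4 * exp (- 2 * \<bar>x - y\<bar>)) * IFT a y) = IFT (mult_res a) x"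
proof -
  define g where "g y = complex_of_real (1/4 * exp (- 2 * \<bar>x - y\<bar>))" for y
  have k: "integrable lborel (\<lambda>z. complex_of_real (1/4 * exp (- 2 * \<bar>z\<bar>)))"
    using exp_kernel_integral(1)[of 2] by (simp del: of_real_mult)
  have gi: "integrable lborel (\<lambda>y. g (- y))"
    using integrable_translate(1)[of "\<lambda>z. complex_of_real (1/4 * exp (- 2 * \<bar>z\<bar>))" "- x"] k unfolding g_def by (simp add: add.commute)
  have F: "FT (\<lambda>y. g (- y)) \<xi> = complex_of_real (1 / sqrt (2 * pi)) * (cis (x * \<xi>) * complex_of_real (1 / (4 + \<xi>\<^sup>2)))" for \<xi>
  proof -
    have "(LBINT y. cis (- (y * \<xi>)) * g (- y)) = (LBINT y. cis (- ((y - x) * \<xi>)) * g (- (y - x)))"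
      by (rule integral_translate(1)[symmetric])
    also have "\<dots> = (LBINT y. (cis (x * \<xi>) * complex_of_real (1/4)) * (cis (y * - \<xi>) * complex_of_real (exp (- 2 * \<bar>y\<bar>))))"
    proof (rule Bochner_Integration.integral_cong[OF refl])
      fix y
      have "cis (- ((y - x) * \<xi>)) = cis (x * \<xi>) * cis (y * - \<xi>)" by (simp add: cis_mult algebra_simps)
      moreover have "g (- (y - x)) = complex_of_real (1/4) * complex_of_real (exp (- 2 * \<bar>y\<bar>))" by (simp add: g_def)
      ultimately show "cis (- ((y - x) * \<xi>)) * g (- (y - x)) = (cis (x * \<xi>) * complex_of_real (1/4)) * (cis (y * - \<xi>) * complex_of_real (exp (- 2 * \<bar>y\<bar>)))"
        by (simp only: mult_ac)
    qed
    also have "\<dots> = (cis (x * \<xi>) * complex_of_real (1/4)) * complex_of_real (2 * 2 / (2\<^sup>2 + (- \<xi>)\<^sup>2))"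
      by (simp only: integral_mult_right_zero exp_kernel_transform(2)[OF zero_less_numeral])
    also have "\<dots> = cis (x * \<xi>) * complex_of_real (1/4 * (2 * 2 / (2\<^sup>2 + (- \<xi>)\<^sup>2)))"
      by (simp only: of_real_mult mult.assoc)
    also have "1/4 * (2 * 2 / (2\<^sup>2 + (- \<xi>)\<^sup>2)) = 1 / (4 + \<xi>\<^sup>2)" by simp
    finally show ?thesis unfolding FT_def by (simp only:)
  qed
  have "(LBINT y. g y * IFT a y) = (LBINT y. g (- y) * FT a y)"
    by (subst integral_reflect[symmetric]) (simp add: IFT_def)
  also have "\<dots> = (LBINT \<xi>. a \<xi> * FT (\<lambda>y. g (- y)) \<xi>)" by (rule FT_multiplication[OF a gi])
  also have "\<dots> = (LBINT \<xi>. complex_of_real (1 / sqrt (2 * pi)) * (cis (x * \<xi>) * mult_res a \<xi>))"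
    unfolding F mult_res_def by (rule Bochner_Integration.integral_cong) (auto simp only: mult_ac)
  also have "\<dots> = IFT (mult_res a) x" unfolding IFT_eq by (rule integral_mult_right_zero)
  finally show ?thesis by (simp add: g_def)
qed

lemma resolvent4_eq_IFT:
  assumes f: "f \<in> L2" and a: "integrable lborel (fourier f)"
  shows "complex_of_real (resolvent4 f x) = IFT (mult_res (fourier f)) x"
proof -
  have [measurable]: "f \<in> borel_measurable borel" using f by (auto simp: L2_def)
  have [measurable]: "IFT (fourier f) \<in> borel_measurable borel" using IFT_L2(1)[OF a fourier_L2[OF f]] by (auto simp: L2_def)
  have "complex_of_real (resolvent4 f x) = (LBINT y. complex_of_real (1/4 * exp (- 2 * \<bar>x - y\<bar>) * f y))"
    unfolding resolvent4_def conv_def by (rule integral_complex_of_real[symmetric])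
  also have "\<dots> = (LBINT y. complex_of_real (1/4 * exp (- 2 * \<bar>x - y\<bar>)) * IFT (fourier f) y)"
  proof (rule integral_cong_AE)
    show "AE y in lborel. complex_of_real (1/4 * exp (- 2 * \<bar>x - y\<bar>) * f y) = complex_of_real (1/4 * exp (- 2 * \<bar>x - y\<bar>)) * IFT (fourier f) y"
      using fourier_inversion[OF f a] by eventually_elim (simp only: of_real_mult)
  qed auto
  also have "\<dots> = IFT (mult_res (fourier f)) x" by (rule exp_convolution_IFT[OF a])
  finally show ?thesis .
qed

text \<open>The multiplier of the quadratic form \<open>E\<^sub>2\<close>, and the corresponding operator \<open>1 - 3(4 - \<partial>\<^sup>2)\<^sup>-\<^sup>1\<close>.\<close>

definition mX :: "real \<Rightarrow> real" where "mX \<xi> = (1 + \<xi>\<^sup>2) / (4 + \<xi>\<^sup>2)"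

lemma mX_bounds: "0 \<le> mX \<xi>" "mX \<xi> \<le> 1" "mX \<xi> = 1 - 3 * (1 / (4 + \<xi>\<^sup>2))"
proof -
  have p: "0 < 4 + \<xi>\<^sup>2" by (simp add: add_pos_nonneg)
  then show "0 \<le> mX \<xi>" "mX \<xi> \<le> 1" "mX \<xi> = 1 - 3 * (1 / (4 + \<xi>\<^sup>2))" by (auto simp: mX_def field_simps)
qed

text \<open>Half of the gradient of the quadratic form \<open>E\<^sub>2\<close>.\<close>

definition Z :: "(real \<Rightarrow> real) \<Rightarrow> real \<Rightarrow> real" where "Z f x = rep f x - 3 * resolvent4 f x"

definition mXf :: "(real \<Rightarrow> complex) \<Rightarrow> real \<Rightarrow> complex" where "mXf a \<xi> = complex_of_real (mX \<xi>) * a \<xi>"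

lemma mX_measurable[measurable]: "mX \<in> borel_measurable borel" unfolding mX_def[abs_def] by measurable

lemma norm_mXf: "cmod (mXf a \<xi>) \<le> cmod (a \<xi>)"
  unfolding mXf_def norm_mult norm_of_real using mX_bounds[of \<xi>] by (simp add: mult_left_le_one_le)

lemma mXf_measurable[measurable]: "a \<in> borel_measurable borel \<Longrightarrow> mXf a \<in> borel_measurable borel"
  unfolding mXf_def[abs_def] by measurable

lemma mXf_integrable: "integrable lborel a \<Longrightarrow> integrable lborel (mXf a)"
  by (rule Bochner_Integration.integrable_bound) (auto simp: norm_mXf)

lemma mXf_L2: "a \<in> L2 \<Longrightarrow> mXf a \<in> L2" "a \<in> L2 \<Longrightarrow> l2 (mXf a) \<le> l2 a"
  using L2_dominated[of a "mXf a"] norm_mXf by (auto simp: L2_def)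

lemma Z_eq:
  assumes f: "f \<in> L2" and a: "integrable lborel (fourier f)"
  shows "Z f x = Re (IFT (mXf (fourier f)) x)"
proof -
  have "mXf (fourier f) = (\<lambda>\<xi>. fourier f \<xi> - 3 * mult_res (fourier f) \<xi>)"
    by (auto simp: mXf_def mX_bounds(3) mult_res_def fun_eq_iff algebra_simps)
  then have "IFT (mXf (fourier f)) x = IFT (fourier f) x - 3 * IFT (mult_res (fourier f)) x"
    unfolding IFT_def using FT_diff[OF a, of "\<lambda>\<xi>. 3 * mult_res (fourier f) \<xi>"] mult_res_integrable[OF a] by (simp add: FT_cmult)
  then have "Re (IFT (mXf (fourier f)) x) = Re (IFT (fourier f) x) - 3 * Re (IFT (mult_res (fourier f)) x)" by simp
  moreover have "resolvent4 f x = Re (IFT (mult_res (fourier f)) x)"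
    using arg_cong[OF resolvent4_eq_IFT[OF f a, of x], of Re] by simp
  ultimately show ?thesis by (simp add: Z_def rep_def)
qed

lemma Z_L2:
  assumes f: "f \<in> L2" and a: "integrable lborel (fourier f)"
  shows "Z f \<in> L2" "l2 (Z f) \<le> l2 (fourier f)"
proof -
  have e: "Z f = (\<lambda>x. Re (IFT (mXf (fourier f)) x))" using Z_eq[OF assms] by auto
  note m = mXf_integrable[OF a] mXf_L2[OF fourier_L2[OF f]]
  show "Z f \<in> L2" "l2 (Z f) \<le> l2 (fourier f)" unfolding e
    using Re_IFT_L2[OF m(1,2)] m(3) by auto
qed

lemma pairing_Z:
  assumes g: "g \<in> L2" and f: "f \<in> L2" and a: "integrable lborel (fourier f)"
  shows "(LBINT x. g x * Z f x) = Re (LBINT \<xi>. cnj (fourier g \<xi>) * mXf (fourier f) \<xi>)"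
proof -
  have mi: "integrable lborel (mXf (fourier f))" by (rule mXf_integrable[OF a])
  have mL: "mXf (fourier f) \<in> L2" by (rule mXf_L2(1)[OF fourier_L2[OF f]])
  have i: "integrable lborel (\<lambda>x. complex_of_real (g x) * IFT (mXf (fourier f)) x)"
    by (intro L2_mult_integrable of_real_L2 g IFT_L2 mi mL)
  have "(LBINT x. g x * Z f x) = (LBINT x. Re (complex_of_real (g x) * IFT (mXf (fourier f)) x))"
    using Z_eq[OF f a] by simp
  also have "\<dots> = Re (LBINT x. complex_of_real (g x) * IFT (mXf (fourier f)) x)" by (rule integral_Re[OF i])
  finally show ?thesis unfolding fourier_parseval[OF g mi mL] .
qed

lemma pairing_Z_symmetric:
  assumes f: "f \<in> L2" "integrable lborel (fourier f)" and g: "g \<in> L2" "integrable lborel (fourier g)"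
  shows "(LBINT x. g x * Z f x) = (LBINT x. f x * Z g x)"
proof -
  have "(LBINT \<xi>. cnj (fourier g \<xi>) * mXf (fourier f) \<xi>) = (LBINT \<xi>. cnj (cnj (fourier f \<xi>) * mXf (fourier g) \<xi>))"
    by (rule Bochner_Integration.integral_cong) (auto simp: mXf_def)
  also have "\<dots> = cnj (LBINT \<xi>. cnj (fourier f \<xi>) * mXf (fourier g) \<xi>)" by (rule Bochner_Integration.integral_cnj)
  finally show ?thesis unfolding pairing_Z[OF g(1) f] pairing_Z[OF f(1) g] by simp
qed

lemma E2_integrable:
  assumes "a \<in> L2" shows "integrable lborel (\<lambda>\<xi>. mX \<xi> * (cmod (a \<xi>))\<^sup>2)"
proof (rule Bochner_Integration.integrable_bound[OF L2D(2)[OF assms]])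
  show "(\<lambda>\<xi>. mX \<xi> * (cmod (a \<xi>))\<^sup>2) \<in> borel_measurable lborel" using L2D(1)[OF assms] by measurable
  show "AE \<xi> in lborel. norm (mX \<xi> * (cmod (a \<xi>))\<^sup>2) \<le> norm ((cmod (a \<xi>))\<^sup>2)"
    using mX_bounds by (intro AE_I2) (simp add: abs_mult mult_left_le_one_le)
qed

lemma E2_alt: "E2 f = (LBINT \<xi>. mX \<xi> * (cmod (fourier f \<xi>))\<^sup>2)"
  by (simp add: E2_def mX_def)

lemma E2_eq_pairing:
  assumes f: "f \<in> L2" and a: "integrable lborel (fourier f)"
  shows "E2 f = (LBINT x. f x * Z f x)"
proof -
  have "complex_of_real (E2 f) = (LBINT \<xi>. complex_of_real (mX \<xi> * (cmod (fourier f \<xi>))\<^sup>2))"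
    unfolding E2_alt by (rule integral_complex_of_real[symmetric])
  also have "\<dots> = (LBINT \<xi>. cnj (fourier f \<xi>) * mXf (fourier f) \<xi>)"
    by (rule Bochner_Integration.integral_cong) (auto simp: mXf_def complex_norm_square simp del: of_real_power)
  finally have "Re (complex_of_real (E2 f)) = Re (LBINT \<xi>. cnj (fourier f \<xi>) * mXf (fourier f) \<xi>)" by (rule arg_cong)
  then show ?thesis unfolding pairing_Z[OF f f a] by simp
qed

lemma E2_nonneg: "0 \<le> E2 f"
  unfolding E2_alt by (intro Bochner_Integration.integral_nonneg mult_nonneg_nonneg mX_bounds) auto

lemma E2_cong_fourier:
  assumes "AE \<xi> in lborel. fourier f \<xi> = a \<xi>" "f \<in> L2" "a \<in> borel_measurable borel"
  shows "E2 f = (LBINT \<xi>. mX \<xi> * (cmod (a \<xi>))\<^sup>2)"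
  unfolding E2_alt
proof (rule integral_cong_AE)
  show "AE \<xi> in lborel. mX \<xi> * (cmod (fourier f \<xi>))\<^sup>2 = mX \<xi> * (cmod (a \<xi>))\<^sup>2" using assms(1) by eventually_elim simp
qed (use fourier_measurable[OF assms(2)] assms(3) in measurable)

lemma fourier_cong_AE:
  assumes "AE x in lborel. f x = g x" "f \<in> L2" "g \<in> L2"
  shows "AE \<xi> in lborel. fourier f \<xi> = fourier g \<xi>"
proof (rule is_fourier_unique[OF assms(2) is_fourier_fourier[OF assms(2)]])
  have [measurable]: "f \<in> borel_measurable borel" "g \<in> borel_measurable borel" using assms by (auto simp: L2_def)
  have "FT (cut R f) = FT (cut R g)" for R
  proof
    fix \<xi>
    have "(LBINT x. cis (- (x * \<xi>)) * cut R f x) = (LBINT x. cis (- (x * \<xi>)) * cut R g x)"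
    proof (rule integral_cong_AE)
      show "AE x in lborel. cis (- (x * \<xi>)) * cut R f x = cis (- (x * \<xi>)) * cut R g x" using assms(1) by eventually_elim (simp add: cut_def)
    qed (auto simp: cut_def)
    then show "FT (cut R f) \<xi> = FT (cut R g) \<xi>" by (simp add: FT_def)
  qed
  then show "is_fourier f (fourier g)" using is_fourier_fourier[OF assms(3)] unfolding is_fourier_iff[OF assms(2)] is_fourier_iff[OF assms(3)] by simp
qed

text \<open>The norm is the \<open>L\<^sup>2\<close> norm of the transform multiplied by the square root of the multiplier.\<close>

lemma normX_triangle:
  assumes f: "f \<in> L2" and g: "g \<in> L2"
  shows "normX f \<le> normX (\<lambda>x. f x - g x) + normX g"
proof -
  define r where "r a \<xi> = complex_of_real (sqrt (mX \<xi>)) * a \<xi>" for a :: "real \<Rightarrow> complex" and \<xi>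
  have h: "(\<lambda>x. f x - g x) \<in> L2" by (rule L2_diff(1)[OF f g])
  have rn: "(cmod (r a \<xi>))\<^sup>2 = mX \<xi> * (cmod (a \<xi>))\<^sup>2" for a \<xi>
    using mX_bounds[of \<xi>] by (simp add: r_def norm_mult power_mult_distrib)
  have rL: "r a \<in> L2" if "a \<in> L2" for a
  proof (rule L2_dominated(1)[OF that])
    show "r a \<in> borel_measurable lborel" using L2D(1)[OF that] unfolding r_def by measurable
    show "norm (r a \<xi>) \<le> norm (a \<xi>)" for \<xi> using mX_bounds[of \<xi>]
      by (simp add: r_def norm_mult mult_left_le_one_le)
  qed
  have nX: "normX f = l2 (r (fourier f))" for f by (simp add: normX_def E2_alt l2_def rn)
  have "l2 (r (fourier f)) = l2 (\<lambda>\<xi>. r (fourier (\<lambda>x. f x - g x)) \<xi> + r (fourier g) \<xi>)"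
  proof (rule L2_cong_AE(2)[OF L2_add(1)])
    show "AE \<xi> in lborel. r (fourier (\<lambda>x. f x - g x)) \<xi> + r (fourier g) \<xi> = r (fourier f) \<xi>"
      using fourier_linear[OF f g, of 1 "-1"] by eventually_elim (simp add: r_def distrib_left[symmetric] add.commute)
    show "r (fourier f) \<in> borel_measurable lborel" using rL[OF fourier_L2[OF f]] by (simp add: L2_def)
  qed (intro rL fourier_L2 f g h)+
  also have "\<dots> \<le> l2 (r (fourier (\<lambda>x. f x - g x))) + l2 (r (fourier g))" by (intro L2_add rL fourier_L2 h g)
  finally show ?thesis by (simp add: nX)
qed

definition peakon_hat :: "real \<Rightarrow> real \<Rightarrow> complex" where
  "peakon_hat p \<xi> = complex_of_real (1 / sqrt (2 * pi)) * (cis (- (p * \<xi>)) * complex_of_real (2 / (1 + \<xi>\<^sup>2)))"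

lemma peakon_L2: "(\<lambda>x. peakon (x - p)) \<in> L2" "integrable lborel (\<lambda>x. peakon (x - p))"
proof -
  have i1: "integrable lborel (\<lambda>x::real. exp (- 1 * \<bar>x\<bar>))" and i2: "integrable lborel (\<lambda>x::real. exp (- 2 * \<bar>x\<bar>))"
    by (rule exp_kernel_integral; simp)+
  show "integrable lborel (\<lambda>x. peakon (x - p))"
    using integrable_translate(1)[of "\<lambda>x. exp (- 1 * \<bar>x\<bar>)" p] i1 by (simp add: peakon_def)
  have "(norm (peakon (x - p)))\<^sup>2 = exp (- 2 * \<bar>x - p\<bar>)" for x by (simp add: peakon_def exp_double[symmetric] power2_eq_square exp_add[symmetric])
  then show "(\<lambda>x. peakon (x - p)) \<in> L2"
    using integrable_translate(1)[of "\<lambda>x. exp (- 2 * \<bar>x\<bar>)" p] i2 by (simp add: L2_def peakon_def)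
qed

lemma fourier_peakon: "AE \<xi> in lborel. fourier (\<lambda>x. peakon (x - p)) \<xi> = peakon_hat p \<xi>"
proof -
  have "FT (\<lambda>x. complex_of_real (peakon (x - p))) \<xi> = peakon_hat p \<xi>" for \<xi>
  proof -
    have "(LBINT x. cis (- (x * \<xi>)) * complex_of_real (peakon (x - p))) = (LBINT x. cis (- ((x - (- p)) * \<xi>)) * complex_of_real (peakon (x - (- p) - p)))"
      by (rule integral_translate(1)[symmetric])
    also have "\<dots> = (LBINT x. cis (- (p * \<xi>)) * (cis (x * - \<xi>) * complex_of_real (exp (- 1 * \<bar>x\<bar>))))"
      by (rule Bochner_Integration.integral_cong) (auto simp: peakon_def mult.assoc[symmetric] cis_mult algebra_simps)
    also have "\<dots> = cis (- (p * \<xi>)) * complex_of_real (2 * 1 / (1\<^sup>2 + (- \<xi>)\<^sup>2))"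
      by (simp only: integral_mult_right_zero exp_kernel_transform(2)[OF zero_less_one])
    finally show ?thesis by (simp add: FT_def peakon_hat_def)
  qed
  then have "FT (\<lambda>x. complex_of_real (peakon (x - p))) = peakon_hat p" by auto
  then show ?thesis using is_fourier_unique[OF peakon_L2(1) is_fourier_fourier[OF peakon_L2(1)] is_fourier_FT[OF peakon_L2], of p] by simp
qed

lemma peakon_hat_measurable[measurable]: "peakon_hat p \<in> borel_measurable borel"
  unfolding peakon_hat_def[abs_def] by measurable

lemma peakon_fourier_integrable: "integrable lborel (fourier (\<lambda>x. peakon (x - p)))"
proof -
  have "integrable lborel (\<lambda>\<xi>::real. 2 * (1 + \<xi>\<^sup>2) powr (- 1))" by (rule integrable_mult_right[OF integrable_weight]) simp
  then have "integrable lborel (peakon_hat p)"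
  proof (rule Bochner_Integration.integrable_bound)
    have "1 \<le> sqrt (2 * pi)" using pi_gt3 by (simp add: real_le_rsqrt)
    have "cmod (peakon_hat p \<xi>) \<le> 2 * (1 + \<xi>\<^sup>2) powr (- 1)" for \<xi>
    proof -
      have q: "0 < 1 + \<xi>\<^sup>2" by (simp add: add_pos_nonneg)
      have "cmod (peakon_hat p \<xi>) = (1 / sqrt (2 * pi)) * (2 / (1 + \<xi>\<^sup>2))"
        unfolding peakon_hat_def norm_mult norm_of_real norm_cis using q by simp
      also have "\<dots> \<le> 1 * (2 / (1 + \<xi>\<^sup>2))" using \<open>1 \<le> sqrt (2 * pi)\<close> q by (intro mult_right_mono) auto
      finally show ?thesis using q by (simp add: powr_minus_divide)
    qed
    then show "AE \<xi> in lborel. norm (peakon_hat p \<xi>) \<le> norm (2 * (1 + \<xi>\<^sup>2) powr (- 1))"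
      by (intro AE_I2) (auto intro: order_trans[OF _ abs_ge_self])
  qed simp
  then show ?thesis
    by (rule integrable_cong_AE_imp) (use fourier_peakon[of p] fourier_measurable[OF peakon_L2(1)] in \<open>auto elim: eventually_mono\<close>)
qed

text \<open>Since \<open>(1 - \<partial>\<^sup>2)\<close> maps the peakon to twice a Dirac mass, pairing with a peakon evaluates the resolvent.\<close>

lemma pairing_peakon:
  assumes f: "f \<in> L2" and a: "integrable lborel (fourier f)"
  shows "Re (LBINT \<xi>. cnj (peakon_hat p \<xi>) * mXf (fourier f) \<xi>) = 2 * resolvent4 f p"
proof -
  have "cnj (peakon_hat p \<xi>) * mXf (fourier f) \<xi> = 2 * (complex_of_real (1 / sqrt (2 * pi)) * (cis (p * \<xi>) * mult_res (fourier f) \<xi>))" for \<xi>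
  proof -
    have q: "0 < 1 + \<xi>\<^sup>2" by (simp add: add_pos_nonneg)
    have "complex_of_real (2 / (1 + \<xi>\<^sup>2)) * complex_of_real (mX \<xi>) = 2 * complex_of_real (1 / (4 + \<xi>\<^sup>2))"
    proof -
      have "2 / A * (A / B) = 2 * (1 / B)" if "A \<noteq> 0" for A B :: real using that by simp
      from this[of "1 + \<xi>\<^sup>2" "4 + \<xi>\<^sup>2"] q have "2 / (1 + \<xi>\<^sup>2) * mX \<xi> = 2 * (1 / (4 + \<xi>\<^sup>2))" unfolding mX_def by linarith
      then have "complex_of_real (2 / (1 + \<xi>\<^sup>2) * mX \<xi>) = complex_of_real (2 * (1 / (4 + \<xi>\<^sup>2)))" by (rule arg_cong)
      then show ?thesis by (simp only: of_real_mult of_real_numeral)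
    qed
    moreover have "cnj (peakon_hat p \<xi>) = complex_of_real (1 / sqrt (2 * pi)) * (cis (p * \<xi>) * complex_of_real (2 / (1 + \<xi>\<^sup>2)))"
      by (simp add: peakon_hat_def cis_cnj)
    moreover have "(k * (s * D)) * (M * a) = 2 * (k * (s * (e * a)))" if "D * M = 2 * e" for k s D M a e :: complex
    proof -
      have "(k * (s * D)) * (M * a) = k * (s * ((D * M) * a))" by (simp only: mult_ac)
      then show ?thesis unfolding that by (simp only: mult_ac)
    qed
    ultimately show ?thesis unfolding mXf_def mult_res_def by (simp only:)
  qed
  then have "(LBINT \<xi>. cnj (peakon_hat p \<xi>) * mXf (fourier f) \<xi>) = 2 * IFT (mult_res (fourier f)) p"
    unfolding IFT_eq by (simp only: integral_mult_right_zero)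
  moreover have "Re (IFT (mult_res (fourier f)) p) = resolvent4 f p"
    unfolding resolvent4_eq_IFT[OF f a, symmetric] by simp
  ultimately show ?thesis by simp
qed

lemma resolvent4_peakon: "resolvent4 (\<lambda>x. peakon (x - p)) p = 1 / 6"
proof -
  have "resolvent4 (\<lambda>x. peakon (x - p)) p = (LBINT y. 1/4 * exp (- 3 * \<bar>y - p\<bar>))"
    unfolding resolvent4_def conv_def
    by (rule Bochner_Integration.integral_cong) (auto simp: peakon_def exp_add[symmetric] abs_minus_commute)
  also have "\<dots> = 1/4 * (LBINT y. exp (- 3 * \<bar>y\<bar>))"
    using integral_translate(1)[of "\<lambda>y. 1/4 * exp (- 3 * \<bar>y\<bar>)" p] by simp
  also have "\<dots> = 1 / 6" using exp_kernel_integral(2)[of 3] by simp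
  finally show ?thesis .
qed

lemma E2_peakon: "E2 (\<lambda>x. peakon (x - p)) = 1 / 3"
proof -
  note L = peakon_L2[of p] and i = peakon_fourier_integrable[of p]
  have "E2 (\<lambda>x. peakon (x - p)) = Re (LBINT \<xi>. cnj (fourier (\<lambda>x. peakon (x - p)) \<xi>) * mXf (fourier (\<lambda>x. peakon (x - p))) \<xi>)"
    unfolding E2_eq_pairing[OF L(1) i] by (rule pairing_Z[OF L(1) L(1) i])
  also have "(LBINT \<xi>. cnj (fourier (\<lambda>x. peakon (x - p)) \<xi>) * mXf (fourier (\<lambda>x. peakon (x - p))) \<xi>) = (LBINT \<xi>. cnj (peakon_hat p \<xi>) * mXf (fourier (\<lambda>x. peakon (x - p))) \<xi>)"
  proof (rule integral_cong_AE)
    show "AE \<xi> in lborel. cnj (fourier (\<lambda>x. peakon (x - p)) \<xi>) * mXf (fourier (\<lambda>x. peakon (x - p))) \<xi> = cnj (peakon_hat p \<xi>) * mXf (fourier (\<lambda>x. peakon (x - p))) \<xi>"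
      using fourier_peakon[of p] by eventually_elim simp
  qed (use fourier_measurable[OF L(1)] in measurable)
  finally show ?thesis unfolding pairing_peakon[OF L(1) i] resolvent4_peakon by simp
qed

text \<open>Expanding the square, the cross term is the pairing with a peakon. In particular the peakon closest to \<open>f\<close> sits at the
  maximum of \<open>resolvent4 f\<close>.\<close>

lemma E2_diff_peakon:
  assumes f: "f \<in> L2" and a: "integrable lborel (fourier f)"
  shows "E2 (\<lambda>x. f x - c * peakon (x - p)) = E2 f - 4 * c * resolvent4 f p + c\<^sup>2 / 3"
proof -
  note L = peakon_L2[of p]
  have [measurable]: "fourier f \<in> borel_measurable borel" by (rule fourier_measurable[OF f])
  have h: "(\<lambda>x. f x - c * peakon (x - p)) \<in> L2" by (intro L2_diff L2_cmult f L)
  have AE: "AE \<xi> in lborel. fourier (\<lambda>x. f x - c * peakon (x - p)) \<xi> = fourier f \<xi> - complex_of_real c * peakon_hat p \<xi>"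
    using fourier_linear[OF f L(1), of 1 "-c"] fourier_peakon[of p] by eventually_elim simp
  have pL: "peakon_hat p \<in> L2" by (rule L2_cong_AE(1)[OF fourier_L2[OF L(1)] _ fourier_peakon]) simp
  have exp: "mX \<xi> * (cmod (fourier f \<xi> - complex_of_real c * peakon_hat p \<xi>))\<^sup>2
     = mX \<xi> * (cmod (fourier f \<xi>))\<^sup>2 - 2 * c * Re (cnj (peakon_hat p \<xi>) * mXf (fourier f) \<xi>) + c\<^sup>2 * (mX \<xi> * (cmod (peakon_hat p \<xi>))\<^sup>2)" for \<xi>
  proof -
    have A: "(cmod (z - complex_of_real c * w))\<^sup>2 = (cmod z)\<^sup>2 - 2 * c * Re (cnj w * z) + c\<^sup>2 * (cmod w)\<^sup>2" for z w
      by (simp only: cmod_power2) (simp add: power2_eq_square algebra_simps)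
    have B: "Re (cnj w * mXf (fourier f) \<xi>) = mX \<xi> * Re (cnj w * fourier f \<xi>)" for w
      by (simp add: mXf_def algebra_simps)
    show ?thesis unfolding A B by (simp only: right_diff_distrib distrib_left mult_ac)
  qed
  have i: "integrable lborel (\<lambda>\<xi>. cnj (peakon_hat p \<xi>) * mXf (fourier f) \<xi>)"
    by (intro L2_mult_integrable cnj_L2 pL mXf_L2 fourier_L2 f)
  have "E2 (\<lambda>x. f x - c * peakon (x - p)) = (LBINT \<xi>. mX \<xi> * (cmod (fourier f \<xi> - complex_of_real c * peakon_hat p \<xi>))\<^sup>2)"
    by (rule E2_cong_fourier[OF AE h]) simp
  also have "\<dots> = (LBINT \<xi>. mX \<xi> * (cmod (fourier f \<xi>))\<^sup>2) - 2 * c * (LBINT \<xi>. Re (cnj (peakon_hat p \<xi>) * mXf (fourier f) \<xi>)) + c\<^sup>2 * (LBINT \<xi>. mX \<xi> * (cmod (peakon_hat p \<xi>))\<^sup>2)"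
    unfolding exp using E2_integrable[OF fourier_L2[OF f]] E2_integrable[OF pL] integrable_Re[OF i] by simp
  also have "(LBINT \<xi>. mX \<xi> * (cmod (fourier f \<xi>))\<^sup>2) = E2 f" by (simp add: E2_alt)
  also have "(LBINT \<xi>. mX \<xi> * (cmod (peakon_hat p \<xi>))\<^sup>2) = 1 / 3"
    unfolding E2_peakon[of p, symmetric] by (rule E2_cong_fourier[OF fourier_peakon L(1), symmetric]) simp
  also have "(LBINT \<xi>. Re (cnj (peakon_hat p \<xi>) * mXf (fourier f) \<xi>)) = 2 * resolvent4 f p"
    unfolding integral_Re[OF i] by (rule pairing_peakon[OF f a])
  finally show ?thesis by simp
qed

lemma E2_scaled_peakon: "E2 (\<lambda>x. c * peakon x) = c\<^sup>2 / 3"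
proof -
  have L: "peakon \<in> L2" using peakon_L2(1)[of 0] by simp
  have "AE \<xi> in lborel. fourier (\<lambda>x. c * peakon x) \<xi> = complex_of_real c * fourier peakon \<xi>"
    using fourier_linear[OF L L, of c 0] by eventually_elim simp
  from E2_cong_fourier[OF this] have "E2 (\<lambda>x. c * peakon x) = (LBINT \<xi>. mX \<xi> * (cmod (complex_of_real c * fourier peakon \<xi>))\<^sup>2)"
    using L2_cmult(1)[OF L] fourier_measurable[OF L] by simp
  also have "\<dots> = (LBINT \<xi>. c\<^sup>2 * (mX \<xi> * (cmod (fourier peakon \<xi>))\<^sup>2))"
    by (rule Bochner_Integration.integral_cong) (auto simp: norm_mult power_mult_distrib)
  also have "\<dots> = c\<^sup>2 * E2 peakon" by (simp add: E2_alt)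
  finally show ?thesis using E2_peakon[of 0] by simp
qed

lemma E3_scaled_peakon: "E3 (\<lambda>x. c * peakon x) = 2 * c ^ 3 / 3"
proof -
  have "(c * peakon x) ^ 3 = c ^ 3 * exp (- 3 * \<bar>x\<bar>)" for x
    by (simp add: peakon_def power_mult_distrib exp_of_nat_mult[symmetric])
  then show ?thesis unfolding E3_def using exp_kernel_integral(2)[of 3] by simp
qed

text \<open>The triangle inequality, squared; the norm of \<open>c\<close> times the peakon is \<open>c / \<surd>3\<close>.\<close>

lemma E2_le_near_peakon:
  assumes f: "f \<in> L2" and c: "0 < c" and e: "normX (\<lambda>x. f x - c * peakon x) < c * \<epsilon>" "0 < \<epsilon>"
  shows "E2 f \<le> c\<^sup>2 / 3 + c\<^sup>2 * \<epsilon> * (2 / sqrt 3 + \<epsilon>)"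
proof -
  have L: "(\<lambda>x. c * peakon x) \<in> L2" using L2_cmult(1)[OF peakon_L2(1)[of 0]] by simp
  have "normX (\<lambda>x. c * peakon x) = c / sqrt 3"
    unfolding normX_def E2_scaled_peakon using c by (simp add: real_sqrt_divide)
  then have n: "normX f \<le> c * \<epsilon> + c / sqrt 3" using normX_triangle[OF f L] e by simp
  have "E2 f = (normX f)\<^sup>2" by (simp add: normX_def E2_nonneg)
  also have "\<dots> \<le> (c * \<epsilon> + c / sqrt 3)\<^sup>2" using n by (rule power_mono) (simp add: normX_def E2_nonneg)
  also have "\<dots> = c\<^sup>2 / 3 + c\<^sup>2 * \<epsilon> * (2 / sqrt 3 + \<epsilon>)"
    by (simp add: power2_sum power_mult_distrib power_divide algebra_simps power2_eq_square)
  finally show ?thesis .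
qed

section \<open>Spatial identities for a fixed time\<close>

lemma integrable_mult3:
  fixes f g h :: "real \<Rightarrow> real"
  assumes "h \<in> borel_measurable borel" "\<And>x. \<bar>h x\<bar> \<le> C" "f \<in> L2" "g \<in> L2"
  shows "integrable lborel (\<lambda>x. h x * f x * g x)"
  using L2_mult_integrable[OF L2_mult_bounded(1)[of f h C] assms(4)] assms by simp

lemma L2_mult_bdd:
  fixes f g :: "real \<Rightarrow> real"
  assumes "f \<in> L2" "g \<in> borel_measurable borel" "\<And>x. \<bar>g x\<bar> \<le> C"
  shows "(\<lambda>x. g x * f x) \<in> L2" "l2 (\<lambda>x. g x * f x) \<le> C * l2 f"
  using L2_mult_bounded[of f g C] assms by simp_all

text \<open>The solution at a fixed time and its spatial derivative. The bound \<open>M\<close> turns products of three square integrable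
  functions into integrable ones.\<close>

locale profile =
  fixes U K :: "real \<Rightarrow> real" and M :: real
  assumes U_der: "\<And>x. (U has_real_derivative K x) (at x)"
    and K_cont: "continuous_on UNIV K"
    and U_L2: "U \<in> L2" and K_L2: "K \<in> L2"
    and U_bd: "\<And>x. \<bar>U x\<bar> \<le> M" and K_bd: "\<And>x. \<bar>K x\<bar> \<le> M"
begin

text \<open>\<open>P = p * (3/2 U\<^sup>2)\<close> with \<open>p(x) = e\<^bsup>-|x|\<^esup>/2\<close> is the nonlocal term, \<open>V = (4 - \<partial>\<^sup>2)\<^sup>-\<^sup>1 U\<close> the smoothed profile; \<open>Q\<close> and \<open>W\<close> are their
  derivatives.\<close>

definition f2 :: "real \<Rightarrow> real" where "f2 x = 3/2 * (U x)\<^sup>2"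
definition P :: "real \<Rightarrow> real" where "P = res 1 f2"
definition Q :: "real \<Rightarrow> real" where "Q = dres 1 f2"
definition V :: "real \<Rightarrow> real" where "V = res 2 U"
definition W :: "real \<Rightarrow> real" where "W = dres 2 U"

lemma M_nonneg: "0 \<le> M" using U_bd[of 0] by linarith

lemma U_cont: "continuous_on UNIV U" by (meson DERIV_isCont U_der continuous_at_imp_continuous_on)

lemma f2_cont: "continuous_on UNIV f2" unfolding f2_def by (intro continuous_intros U_cont)

lemma f2_bd: "\<bar>f2 x\<bar> \<le> 3/2 * M\<^sup>2"
  using power_mono[OF U_bd[of x], of 2] by (simp add: f2_def abs_mult)

lemma UK_meas[measurable]: "U \<in> borel_measurable borel" "K \<in> borel_measurable borel" "f2 \<in> borel_measurable borel"
  by (auto intro: borel_measurable_continuous_onI U_cont K_cont f2_cont)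

lemma f2_L2: "f2 \<in> L2"
proof -
  have "f2 = (\<lambda>x. 3/2 * (U x * U x))" by (auto simp: f2_def power2_eq_square)
  then show ?thesis using L2_cmult(1)[OF L2_mult_bdd(1)[OF U_L2 UK_meas(1) U_bd], of "3/2"] by simp
qed

lemma P_der: "(P has_real_derivative Q x) (at x)" and Q_der: "(Q has_real_derivative P x - f2 x) (at x)"
  using res_deriv[OF zero_less_one f2_cont f2_bd, of x] by (simp_all add: P_def Q_def)

lemma V_der: "(V has_real_derivative W x) (at x)" and W_der: "(W has_real_derivative 4 * V x - U x) (at x)"
  using res_deriv[of 2 U M x] U_cont U_bd by (simp_all add: V_def W_def)

lemma PQ_L2: "P \<in> L2" "Q \<in> L2" using res_L2[OF zero_less_one f2_L2 f2_bd] by (simp_all add: P_def Q_def)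
lemma VW_L2: "V \<in> L2" "W \<in> L2" using res_L2[of 2 U M] U_L2 U_bd by (simp_all add: V_def W_def)

lemma VW_bd: "\<bar>V x\<bar> \<le> M" "\<bar>W x\<bar> \<le> M"
  using res_bounded[of 2 U M x] U_bd M_nonneg by (auto simp: V_def W_def)

lemma PQ_cont: "continuous_on UNIV P" "continuous_on UNIV Q"
  using P_der Q_der by (meson DERIV_isCont continuous_at_imp_continuous_on)+
lemma VW_cont: "continuous_on UNIV V" "continuous_on UNIV W"
  using V_der W_der by (meson DERIV_isCont continuous_at_imp_continuous_on)+

lemma PQVW_meas[measurable]: "P \<in> borel_measurable borel" "Q \<in> borel_measurable borel" "V \<in> borel_measurable borel" "W \<in> borel_measurable borel"
  by (auto intro: borel_measurable_continuous_onI PQ_cont VW_cont)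

lemma ib2: "h \<in> borel_measurable borel \<Longrightarrow> (\<And>x. \<bar>h x\<bar> \<le> C) \<Longrightarrow> f \<in> {U, K, P, Q, V, W} \<Longrightarrow> g \<in> {U, K, P, Q, V, W} \<Longrightarrow> integrable lborel (\<lambda>x. h x * f x * g x)"
  by (rule integrable_mult3[where C=C]) (auto intro: U_L2 K_L2 PQ_L2 VW_L2)

lemma ib1: "f \<in> {U, K, P, Q, V, W} \<Longrightarrow> g \<in> {U, K, P, Q, V, W} \<Longrightarrow> integrable lborel (\<lambda>x. f x * g x)"
  by (rule L2_mult_integrable) (auto intro: U_L2 K_L2 PQ_L2 VW_L2)

lemma flux_L2: "(\<lambda>x. U x * K x + Q x) \<in> L2"
  by (intro L2_add(1) PQ_L2 L2_mult_bdd(1)[OF K_L2 UK_meas(1) U_bd])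

text \<open>As \<open>P'' = P - 3/2 U\<^sup>2\<close>, the nonlocal part \<open>U\<^sup>2 Q = 2/3 (P - P'') P'\<close> is a derivative.\<close>

lemma cubic_flux: "(LBINT x. (U x)\<^sup>2 * (U x * K x + Q x)) = 0"
proof (rule integral_derivative_eq_0[where F="\<lambda>x. 1 / 4 * (U x)^4 + 1 / 3 * ((P x)\<^sup>2 - (Q x)\<^sup>2)"])
  show "((\<lambda>x. 1 / 4 * (U x)^4 + 1 / 3 * ((P x)\<^sup>2 - (Q x)\<^sup>2)) has_real_derivative (U x)\<^sup>2 * (U x * K x + Q x)) (at x)" for x
    by (rule derivative_eq_intros U_der P_der Q_der refl)+ (simp add: f2_def power2_eq_square power3_eq_cube algebra_simps)
  show "continuous_on UNIV (\<lambda>x. (U x)\<^sup>2 * (U x * K x + Q x))" by (intro continuous_intros U_cont K_cont PQ_cont)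
  have U2: "\<bar>(U x)\<^sup>2\<bar> \<le> M\<^sup>2" for x using power_mono[OF U_bd[of x], of 2] by simp
  have i: "integrable lborel (\<lambda>x. (U x)\<^sup>2 * U x * U x)" "integrable lborel (\<lambda>x. P x * P x)" "integrable lborel (\<lambda>x. Q x * Q x)"
    "integrable lborel (\<lambda>x. (U x)\<^sup>2 * U x * K x)" "integrable lborel (\<lambda>x. U x * U x * Q x)"
    using ib2[of "\<lambda>x. (U x)\<^sup>2" "M\<^sup>2" U U, OF _ U2] ib2[of "\<lambda>x. (U x)\<^sup>2" "M\<^sup>2" U K, OF _ U2] ib2[of U M U Q, OF UK_meas(1) U_bd] ib1[of P P] ib1[of Q Q] by auto
  have "integrable lborel (\<lambda>x. ((U x)\<^sup>2 * U x * U x) / 4 + (P x * P x - Q x * Q x) / 3)" using i by simp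
  then show "integrable lborel (\<lambda>x. 1 / 4 * (U x)^4 + 1 / 3 * ((P x)\<^sup>2 - (Q x)\<^sup>2))" by (simp add: power2_eq_square power4_eq_xxxx)
  have "integrable lborel (\<lambda>x. (U x)\<^sup>2 * U x * K x + U x * U x * Q x)" using i by simp
  then show "integrable lborel (\<lambda>x. (U x)\<^sup>2 * (U x * K x + Q x))" by (simp add: power2_eq_square algebra_simps)
qed

lemma quadratic_flux: "(LBINT x. (U x * K x + Q x) * (U x - 3 * V x)) = 0"
proof (rule integral_derivative_eq_0[where F="\<lambda>x. 1 / 3 * (U x)^3 - Q x * W x + (P x - f2 x) * V x"])
  have f2_der: "(f2 has_real_derivative 3 * U x * K x) (at x)" for x
    unfolding f2_def by (rule derivative_eq_intros U_der refl)+ simp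
  show "((\<lambda>x. 1 / 3 * (U x)^3 - Q x * W x + (P x - f2 x) * V x) has_real_derivative (U x * K x + Q x) * (U x - 3 * V x)) (at x)" for x
    by (rule derivative_eq_intros U_der P_der Q_der V_der W_der f2_der refl)+ (simp add: power2_eq_square algebra_simps)
  show "continuous_on UNIV (\<lambda>x. (U x * K x + Q x) * (U x - 3 * V x))" by (intro continuous_intros U_cont K_cont PQ_cont VW_cont)
  have "integrable lborel (\<lambda>x. (U x * U x * U x) / 3 - Q x * W x + P x * V x - 3/2 * (U x * U x * V x))"
    using ib2[of U M U U, OF UK_meas(1) U_bd] ib2[of U M U V, OF UK_meas(1) U_bd] ib1[of Q W] ib1[of P V] by simp
  then show "integrable lborel (\<lambda>x. 1 / 3 * (U x)^3 - Q x * W x + (P x - f2 x) * V x)" by (simp add: f2_def power2_eq_square power3_eq_cube algebra_simps)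
  show "integrable lborel (\<lambda>x. (U x * K x + Q x) * (U x - 3 * V x))"
    by (intro L2_mult_integrable flux_L2 L2_diff(1) L2_cmult(1) U_L2 VW_L2)
qed

text \<open>Applying \<open>1 - \<partial>\<^sup>2\<close> removes the nonlocal term: \<open>(1 - \<partial>\<^sup>2) Q = 3 U U'\<close>.\<close>

lemma test_flux:
  assumes t: "test_function \<psi>"
  shows "(LBINT x. (U x * K x + Q x) * (\<psi> x - deriv (deriv \<psi>) x)) = (LBINT x. U x * K x * (4 * \<psi> x - deriv (deriv \<psi>) x))"
proof -
  note t' = test_function_deriv[OF t] and t'' = test_function_deriv[OF test_function_deriv[OF t]]
  have sm: "smooth \<psi>" "smooth (deriv \<psi>)" "smooth (deriv (deriv \<psi>))" using t t' t'' by (auto simp: test_function_iff)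
  have f2_der: "(f2 has_real_derivative 3 * U x * K x) (at x)" for x
    unfolding f2_def by (rule derivative_eq_intros U_der refl)+ simp
  have it: "integrable lborel (\<lambda>x. h x * \<psi> x)" "integrable lborel (\<lambda>x. h x * deriv \<psi> x)" "integrable lborel (\<lambda>x. h x * deriv (deriv \<psi>) x)" if "continuous_on UNIV h" for h
    by (intro integrable_mult_test continuous_locally_integrable that t t' t'')+
  have UKc: "continuous_on UNIV (\<lambda>x. U x * K x)" by (intro continuous_intros U_cont K_cont)
  have i: "integrable lborel (\<lambda>x. (U x * K x + Q x) * (\<psi> x - deriv (deriv \<psi>) x))"
    using it(1)[of "\<lambda>x. U x * K x + Q x"] it(3)[of "\<lambda>x. U x * K x + Q x"] UKc PQ_cont by (simp add: right_diff_distrib continuous_on_add)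
  have j: "integrable lborel (\<lambda>x. U x * K x * (4 * \<psi> x - deriv (deriv \<psi>) x))"
    using it(1)[OF UKc] it(3)[OF UKc] by (simp add: right_diff_distrib mult.left_commute[of _ 4])
  have "(LBINT x. (U x * K x + Q x) * (\<psi> x - deriv (deriv \<psi>) x) - U x * K x * (4 * \<psi> x - deriv (deriv \<psi>) x)) = 0"
  proof (rule integral_derivative_eq_0[where F="\<lambda>x. (P x - f2 x) * \<psi> x - Q x * deriv \<psi> x"])
    show "((\<lambda>x. (P x - f2 x) * \<psi> x - Q x * deriv \<psi> x) has_real_derivative (U x * K x + Q x) * (\<psi> x - deriv (deriv \<psi>) x) - U x * K x * (4 * \<psi> x - deriv (deriv \<psi>) x)) (at x)" for x
      by (rule derivative_eq_intros P_der Q_der f2_der smooth_DERIV[OF sm(1)] smooth_DERIV[OF sm(2)] refl)+ (simp add: algebra_simps)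
    show "continuous_on UNIV (\<lambda>x. (U x * K x + Q x) * (\<psi> x - deriv (deriv \<psi>) x) - U x * K x * (4 * \<psi> x - deriv (deriv \<psi>) x))"
      by (intro continuous_intros U_cont K_cont PQ_cont smooth_continuous sm)
    show "integrable lborel (\<lambda>x. (P x - f2 x) * \<psi> x - Q x * deriv \<psi> x)"
      by (intro Bochner_Integration.integrable_diff it continuous_intros PQ_cont f2_cont)
  qed (use i j in auto)
  then show ?thesis using i j by simp
qed

text \<open>The energy without nonlocal operators on \<open>U\<close>: here \<open>4V - U\<close> is \<open>V''\<close>.\<close>

lemma energy_identity: "(LBINT x. U x * (U x - 3 * V x)) = (LBINT x. 4 * (V x)\<^sup>2 + 5 * (W x)\<^sup>2 + (4 * V x - U x)\<^sup>2)"
proof -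
  have i: "integrable lborel (\<lambda>x. U x * (U x - 3 * V x))"
    by (intro L2_mult_integrable L2_diff(1) L2_cmult(1) U_L2 VW_L2)
  have j: "integrable lborel (\<lambda>x. 4 * (V x)\<^sup>2 + 5 * (W x)\<^sup>2 + (4 * V x - U x)\<^sup>2)"
    using ib1[of V V] ib1[of W W] L2_mult_integrable[OF L2_diff(1)[OF L2_cmult(1)[OF VW_L2(1), of 4] U_L2] L2_diff(1)[OF L2_cmult(1)[OF VW_L2(1), of 4] U_L2]]
    by (simp add: power2_eq_square)
  have "(LBINT x. (4 * (V x)\<^sup>2 + 5 * (W x)\<^sup>2 + (4 * V x - U x)\<^sup>2) - U x * (U x - 3 * V x)) = 0"
  proof (rule integral_derivative_eq_0[where F="\<lambda>x. 5 * (V x * W x)"])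
    show "((\<lambda>x. 5 * (V x * W x)) has_real_derivative (4 * (V x)\<^sup>2 + 5 * (W x)\<^sup>2 + (4 * V x - U x)\<^sup>2) - U x * (U x - 3 * V x)) (at x)" for x
      by (rule derivative_eq_intros V_der W_der refl)+ (simp add: power2_eq_square algebra_simps)
    show "continuous_on UNIV (\<lambda>x. (4 * (V x)\<^sup>2 + 5 * (W x)\<^sup>2 + (4 * V x - U x)\<^sup>2) - U x * (U x - 3 * V x))"
      by (intro continuous_intros U_cont VW_cont)
  qed (use i j ib1[of V W] in auto)
  then show ?thesis using i j by simp
qed

end

section \<open>Evolution in time: conservation laws\<close>

lemma profile_rep:
  assumes "f \<in> Hs \<sigma>" "3 / 2 < \<sigma>" shows "profile (rep f) (drep f) (Cs \<sigma> * Hs_norm \<sigma> f)"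
  using rep_props[OF assms] by unfold_locales auto

lemma resolvent4_rep:
  assumes "f \<in> Hs \<sigma>" "3 / 2 < \<sigma>" shows "resolvent4 f = res 2 (rep f)"
proof
  fix x
  interpret profile "rep f" "drep f" "Cs \<sigma> * Hs_norm \<sigma> f" by (rule profile_rep[OF assms])
  have "f \<in> borel_measurable borel" using assms by (auto simp: Hs_iff L2_def)
  then have "resolvent4 f x = conv (\<lambda>x. 1 / 4 * exp (- 2 * \<bar>x\<bar>)) (rep f) x"
    unfolding resolvent4_def by (intro conv_cong_AE rep_props[OF assms]) auto
  also have "\<dots> = res 2 (rep f) x" using conv_exp_eq_res[of 2 "rep f", OF _ UK_meas(1) U_bd] by simp
  finally show "resolvent4 f x = res 2 (rep f) x" .
qed

lemma Z_rep:
  assumes "f \<in> Hs \<sigma>" "3 / 2 < \<sigma>" shows "Z f x = rep f x - 3 * res 2 (rep f) x"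
  by (simp add: Z_def resolvent4_rep[OF assms])

lemma Z_diff:
  assumes f: "f \<in> Hs \<sigma>" and g: "g \<in> Hs \<sigma>" and s: "3 / 2 < \<sigma>"
  shows "Z (\<lambda>x. f x - g x) x = Z f x - Z g x"
proof -
  have k: "(\<lambda>y. 1 / 4 * exp (- 2 * \<bar>x - y\<bar>)) \<in> L2"
  proof -
    have e: "(\<lambda>y. (norm (1 / 4 * exp (- 2 * \<bar>x - y\<bar>)))\<^sup>2) = (\<lambda>y. 1 / 16 * exp (- 4 * \<bar>x - y\<bar>))"
      by (rule ext) (simp add: power2_eq_square abs_mult exp_add[symmetric])
    have i: "integrable lborel (\<lambda>y. 1 / 16 * exp (- 4 * \<bar>x - y\<bar>))"
      using integrable_translate(2)[of "\<lambda>y. exp (- 4 * \<bar>y\<bar>)" x] exp_kernel_integral(1)[of 4] by simp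
    show ?thesis unfolding L2_def mem_Collect_eq e by (intro conjI i) simp
  qed
  have "f \<in> L2" "g \<in> L2" using f g by (auto simp: Hs_iff)
  then have "resolvent4 (\<lambda>x. f x - g x) x = resolvent4 f x - resolvent4 g x"
    unfolding resolvent4_def conv_def right_diff_distrib by (intro Bochner_Integration.integral_diff L2_mult_integrable k)
  then show ?thesis by (simp add: Z_def rep_diff[OF f g s])
qed

lemma L2_integral_cong_AE:
  fixes f g :: "real \<Rightarrow> real"
  assumes "AE x in lborel. f x = g x" "f \<in> borel_measurable borel" "g \<in> borel_measurable borel" "h \<in> borel_measurable borel"
  shows "(LBINT x. f x * h x) = (LBINT x. g x * h x)"
  by (rule integral_cong_AE) (use assms in auto)

text \<open>The flow as it is used below: \<open>ut\<close> is the derivative in time, in the sense of \<open>L\<^sup>2\<close>, and the equation is written with the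
  continuous representatives, the last term being \<open>\<partial>\<^sub>x p * (3/2 u\<^sup>2)\<close>. The Sobolev spaces decrease with the
  exponent, so \<open>\<sigma>\<close> can be taken at most 2; this fixes which powers of the cut-off frequency dominate.\<close>

locale dp_flow =
  fixes \<sigma> :: real and u ut :: "real \<Rightarrow> real \<Rightarrow> real"
  assumes s1: "3 / 2 < \<sigma>" and s2: "\<sigma> \<le> 2"
    and Hc: "Hs_continuous \<sigma> u"
    and utL: "\<And>t. 0 \<le> t \<Longrightarrow> ut t \<in> L2"
    and utd: "\<And>t. 0 \<le> t \<Longrightarrow> ((\<lambda>r. l2 (\<lambda>x. (u r x - u t x) / (r - t) - ut t x)) \<longlongrightarrow> 0) (at t within {0..})"
    and dp: "\<And>t. 0 < t \<Longrightarrow> AE x in lborel. ut t x = - (rep (u t) x * drep (u t) x + dres 1 (\<lambda>x. 3/2 * (rep (u t) x)\<^sup>2) x)"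
begin

lemma uH: "0 \<le> t \<Longrightarrow> u t \<in> Hs \<sigma>" using Hc by (auto simp: Hs_continuous_def)
lemma uL: "0 \<le> t \<Longrightarrow> u t \<in> L2" using uH by (auto simp: Hs_iff)

lemma prof: "0 \<le> t \<Longrightarrow> profile (rep (u t)) (drep (u t)) (Cs \<sigma> * Hs_norm \<sigma> (u t))"
  by (rule profile_rep[OF uH s1])

lemma Hs_dist: "0 \<le> t \<Longrightarrow> ((\<lambda>r. Hs_norm \<sigma> (\<lambda>x. u r x - u t x)) \<longlongrightarrow> 0) (at t within {0..})"
  using Hc by (auto simp: Hs_continuous_def)

lemma ev: "\<forall>\<^sub>F r in at t within {0..}. 0 \<le> r \<and> r \<noteq> t"
  by (auto simp: eventually_at_filter)

lemma l2_dist: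
  assumes "0 \<le> t" "0 \<le> r"
  shows "l2 (\<lambda>x. rep (u r) x - rep (u t) x) \<le> Hs_norm \<sigma> (\<lambda>x. u r x - u t x)"
    "l2 (\<lambda>x. drep (u r) x - drep (u t) x) \<le> Hs_norm \<sigma> (\<lambda>x. u r x - u t x)"
    "\<bar>rep (u r) x - rep (u t) x\<bar> \<le> Cs \<sigma> * Hs_norm \<sigma> (\<lambda>x. u r x - u t x)"
    "l2 (\<lambda>x. Z (u r) x - Z (u t) x) \<le> Hs_norm \<sigma> (\<lambda>x. u r x - u t x)"
proof -
  have d: "(\<lambda>x. u r x - u t x) \<in> Hs \<sigma>" by (intro Hs_diff uH assms)
  note R = rep_diff[OF uH[OF assms(2)] uH[OF assms(1)] s1, symmetric]
  show "l2 (\<lambda>x. rep (u r) x - rep (u t) x) \<le> Hs_norm \<sigma> (\<lambda>x. u r x - u t x)"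
    "l2 (\<lambda>x. drep (u r) x - drep (u t) x) \<le> Hs_norm \<sigma> (\<lambda>x. u r x - u t x)"
    "\<bar>rep (u r) x - rep (u t) x\<bar> \<le> Cs \<sigma> * Hs_norm \<sigma> (\<lambda>x. u r x - u t x)"
    unfolding R using rep_props[OF d s1] by auto
  show "l2 (\<lambda>x. Z (u r) x - Z (u t) x) \<le> Hs_norm \<sigma> (\<lambda>x. u r x - u t x)"
    unfolding Z_diff[OF uH[OF assms(2)] uH[OF assms(1)] s1, symmetric]
    using Z_L2(2)[of "\<lambda>x. u r x - u t x"] Hs_fourier_integrable(1)[OF d s1] d l2_fourier_le[OF d] s1 by (auto simp: Hs_iff intro: order_trans)
qed

lemma rep_quotient:
  assumes t: "0 \<le> t"
  shows "((\<lambda>r. l2 (\<lambda>x. (rep (u r) x - rep (u t) x) / (r - t) - ut t x)) \<longlongrightarrow> 0) (at t within {0..})"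
proof (rule Lim_transform_eventually[OF utd[OF t]])
  show "\<forall>\<^sub>F r in at t within {0..}. l2 (\<lambda>x. (u r x - u t x) / (r - t) - ut t x) = l2 (\<lambda>x. (rep (u r) x - rep (u t) x) / (r - t) - ut t x)"
    using ev
  proof eventually_elim
    case (elim r)
    have "(\<lambda>x. (1 / (r - t)) * (u r x - u t x) - ut t x) \<in> L2" by (intro L2_diff L2_cmult uL utL t) (use elim in auto)
    then have L: "(\<lambda>x. (u r x - u t x) / (r - t) - ut t x) \<in> L2" by simp
    interpret r: profile "rep (u r)" "drep (u r)" "Cs \<sigma> * Hs_norm \<sigma> (u r)" using elim by (intro prof) simp
    interpret t: profile "rep (u t)" "drep (u t)" "Cs \<sigma> * Hs_norm \<sigma> (u t)" using t by (intro prof)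
    have "AE x in lborel. u r x = rep (u r) x" "AE x in lborel. u t x = rep (u t) x" using rep_props(1)[OF uH s1] t elim by auto
    then have "AE x in lborel. (u r x - u t x) / (r - t) - ut t x = (rep (u r) x - rep (u t) x) / (r - t) - ut t x" by eventually_elim simp
    then show ?case by (intro L2_cong_AE(2)[OF L, symmetric]) (use utL[OF t] in \<open>auto simp: L2_def\<close>)
  qed
qed

lemma quotient_L2: "0 \<le> t \<Longrightarrow> \<forall>\<^sub>F r in at t within {0..}. (\<lambda>x. (rep (u r) x - rep (u t) x) / (r - t)) \<in> L2"
  using ev
proof eventually_elim
  case (elim r)
  have "(\<lambda>x. (1 / (r - t)) * (rep (u r) x - rep (u t) x)) \<in> L2"
    by (intro L2_diff L2_cmult profile.U_L2[OF prof]) (use elim in auto)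
  then show ?case by simp
qed

lemma l2_dist_tendsto:
  assumes "0 \<le> t"
  shows "((\<lambda>r. l2 (\<lambda>x. rep (u r) x - rep (u t) x)) \<longlongrightarrow> 0) (at t within {0..})"
    and "((\<lambda>r. l2 (\<lambda>x. Z (u r) x - Z (u t) x)) \<longlongrightarrow> 0) (at t within {0..})"
proof -
  have "\<forall>\<^sub>F r in at t within {0..}. l2 (\<lambda>x. rep (u r) x - rep (u t) x) \<le> Hs_norm \<sigma> (\<lambda>x. u r x - u t x)"
    using ev by eventually_elim (simp add: l2_dist(1) assms)
  then show "((\<lambda>r. l2 (\<lambda>x. rep (u r) x - rep (u t) x)) \<longlongrightarrow> 0) (at t within {0..})"
    by (rule tendsto_sandwich[OF always_eventually _ tendsto_const Hs_dist[OF assms], rotated]) simp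
  have "\<forall>\<^sub>F r in at t within {0..}. l2 (\<lambda>x. Z (u r) x - Z (u t) x) \<le> Hs_norm \<sigma> (\<lambda>x. u r x - u t x)"
    using ev by eventually_elim (simp add: l2_dist(4) assms)
  then show "((\<lambda>r. l2 (\<lambda>x. Z (u r) x - Z (u t) x)) \<longlongrightarrow> 0) (at t within {0..})"
    by (rule tendsto_sandwich[OF always_eventually _ tendsto_const Hs_dist[OF assms], rotated]) simp
qed

lemma rep_L2: "0 \<le> t \<Longrightarrow> rep (u t) \<in> L2" by (rule profile.U_L2[OF prof])

lemma Zu_L2: "0 \<le> t \<Longrightarrow> Z (u t) \<in> L2"
  by (intro Z_L2 uL Hs_fourier_integrable[OF uH s1])

lemma flux_pairing:
  assumes t: "0 < t" and h: "h \<in> borel_measurable borel"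
  shows "(LBINT x. ut t x * h x) = - (LBINT x. (rep (u t) x * drep (u t) x + dres 1 (\<lambda>x. 3/2 * (rep (u t) x)\<^sup>2) x) * h x)"
proof -
  interpret profile "rep (u t)" "drep (u t)" "Cs \<sigma> * Hs_norm \<sigma> (u t)" using t by (intro prof) simp
  have Q: "dres 1 (\<lambda>x. 3/2 * (rep (u t) x)\<^sup>2) = Q" by (simp add: Q_def f2_def[abs_def])
  have "(LBINT x. ut t x * h x) = (LBINT x. - (rep (u t) x * drep (u t) x + Q x) * h x)"
    by (rule L2_integral_cong_AE[OF dp[OF t, unfolded Q]]) (use utL[of t] t h in \<open>auto simp: L2_def\<close>)
  then show ?thesis unfolding Q mult_minus_left Bochner_Integration.integral_minus .
qed

text \<open>The equation holds for positive times only; continuity extends the conservation laws to the initial time.\<close>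

lemma constant_in_time:
  assumes c: "\<And>t. 0 \<le> t \<Longrightarrow> (f \<longlongrightarrow> f t) (at t within {0..})"
    and d: "\<And>t. 0 < t \<Longrightarrow> ((\<lambda>r. (f r - f t) / (r - t)) \<longlongrightarrow> 0) (at t within {0..})" and t: "0 \<le> t"
  shows "f t = (f 0 :: real)"
proof (cases "t = 0")
  case False
  show ?thesis
  proof (rule DERIV_isconst_end[of 0 t f])
    show "0 < t" using t False by simp
    show "continuous_on {0..t} f" unfolding continuous_on_def
    proof
      fix x assume "x \<in> {0..t}"
      then show "(f \<longlongrightarrow> f x) (at x within {0..t})" by (intro tendsto_within_subset[OF c]) auto
    qed
    fix x assume x: "0 < x" "x < t"
    have "at x within {0..} = at x" by (rule at_within_interior) (use x in simp)
    then show "DERIV f x :> 0" using d[OF x(1)] by (simp add: has_field_derivative_iff)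
  qed
qed simp

lemma tendsto_from_quotient:
  assumes "((\<lambda>r. (f r - f t) / (r - t)) \<longlongrightarrow> (L::real)) (at t within {0..})"
  shows "(f \<longlongrightarrow> f t) (at t within {0..})"
proof -
  have "((\<lambda>r. (f r - f t) / (r - t) * (r - t) + f t) \<longlongrightarrow> L * (t - t) + f t) (at t within {0..})"
    by (intro tendsto_intros assms)
  then have "((\<lambda>r. (f r - f t) / (r - t) * (r - t) + f t) \<longlongrightarrow> f t) (at t within {0..})" by simp
  then show ?thesis by (rule Lim_transform_eventually) (use ev in \<open>auto elim!: eventually_mono\<close>)
qed

text \<open>Factoring \<open>a\<^sup>3 - b\<^sup>3\<close>, the difference quotient converges in \<open>L\<^sup>2\<close> and the other factor does so because
  \<open>u\<close> is continuous in time with values in the bounded functions.\<close>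

lemma cubic_quotient:
  assumes t: "0 \<le> t"
  shows "((\<lambda>r. ((LBINT x. rep (u r) x ^ 3) - (LBINT x. rep (u t) x ^ 3)) / (r - t)) \<longlongrightarrow> (LBINT x. ut t x * (3 * (rep (u t) x)\<^sup>2))) (at t within {0..})"
proof -
  interpret t: profile "rep (u t)" "drep (u t)" "Cs \<sigma> * Hs_norm \<sigma> (u t)" using t by (rule prof)
  define q where "q r x = (rep (u r) x - rep (u t) x) / (r - t)" for r x
  define h where "h r x = (rep (u r) x)\<^sup>2 + rep (u r) x * rep (u t) x + (rep (u t) x)\<^sup>2" for r x
  define k where "k x = 3 * (rep (u t) x)\<^sup>2" for x
  define e where "e r = Hs_norm \<sigma> (\<lambda>x. u r x - u t x)" for r
  have e0: "(e \<longlongrightarrow> 0) (at t within {0..})" using Hs_dist[OF t] by (simp add: e_def[abs_def])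
  have kL: "k \<in> L2"
    using L2_cmult(1)[OF t.f2_L2, of 2] by (simp add: k_def[abs_def] t.f2_def[abs_def])
  have hk: "h r \<in> L2 \<and> l2 (\<lambda>x. h r x - k x) \<le> Cs \<sigma> * e r * (3 * l2 (rep (u t)) + e r)" if r: "0 \<le> r" for r
  proof -
    interpret r: profile "rep (u r)" "drep (u r)" "Cs \<sigma> * Hs_norm \<sigma> (u r)" using r by (rule prof)
    have s: "(\<lambda>x. rep (u r) x + 2 * rep (u t) x) \<in> L2" by (intro L2_add(1) L2_cmult(1) r.U_L2 t.U_L2)
    have d: "(\<lambda>x. rep (u r) x - rep (u t) x) \<in> L2" by (intro L2_diff r.U_L2 t.U_L2)
    have eq: "h r x - k x = (rep (u r) x - rep (u t) x) * (rep (u r) x + 2 * rep (u t) x)" for x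
      by (simp add: h_def k_def power2_eq_square algebra_simps)
    have bd: "norm (rep (u r) x - rep (u t) x) \<le> Cs \<sigma> * e r" for x using l2_dist(3)[OF t r] by (simp add: e_def)
    have "(\<lambda>x. rep (u r) x - rep (u t) x) \<in> borel_measurable borel" by simp
    note B = L2_mult_bdd[OF s this bd[unfolded real_norm_def], folded eq]
    have hkL: "(\<lambda>x. h r x - k x) \<in> L2" by (rule B(1))
    have "(\<lambda>x. (h r x - k x) + k x) \<in> L2" by (rule L2_add(1)[OF hkL kL])
    then have hL: "h r \<in> L2" by simp
    have "l2 (\<lambda>x. rep (u r) x + 2 * rep (u t) x) = l2 (\<lambda>x. (rep (u r) x - rep (u t) x) + 3 * rep (u t) x)" by (simp add: algebra_simps)
    also have "\<dots> \<le> e r + 3 * l2 (rep (u t))"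
      using L2_add(2)[OF d L2_cmult(1)[OF t.U_L2, of 3]] l2_dist(1)[OF t r] by (simp add: L2_cmult(2)[OF t.U_L2] e_def)
    finally have s2: "l2 (\<lambda>x. rep (u r) x + 2 * rep (u t) x) \<le> 3 * l2 (rep (u t)) + e r" by simp
    have "0 \<le> Cs \<sigma> * e r" using bd[of 0] norm_ge_zero order_trans by blast
    then have "l2 (\<lambda>x. h r x - k x) \<le> Cs \<sigma> * e r * (3 * l2 (rep (u t)) + e r)"
      using order_trans[OF B(2) mult_left_mono[OF s2]] by simp
    then show ?thesis using hL by simp
  qed
  have "((\<lambda>r. LBINT x. q r x * h r x) \<longlongrightarrow> (LBINT x. ut t x * k x)) (at t within {0..})"
  proof (rule L2_tendsto_integral_mult[OF _ utL[OF t] _ kL])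
    show "\<forall>\<^sub>F r in at t within {0..}. q r \<in> L2" using quotient_L2[OF t] by (simp add: q_def[abs_def])
    show "\<forall>\<^sub>F r in at t within {0..}. h r \<in> L2" using ev by eventually_elim (simp add: hk)
    show "((\<lambda>r. l2 (\<lambda>x. q r x - ut t x)) \<longlongrightarrow> 0) (at t within {0..})" using rep_quotient[OF t] by (simp add: q_def)
    show "((\<lambda>r. l2 (\<lambda>x. h r x - k x)) \<longlongrightarrow> 0) (at t within {0..})"
    proof (rule tendsto_sandwich[OF _ _ tendsto_const])
      show "((\<lambda>r. Cs \<sigma> * e r * (3 * l2 (rep (u t)) + e r)) \<longlongrightarrow> 0) (at t within {0..})"
        by (rule tendsto_eq_intros e0 refl | simp)+
      show "\<forall>\<^sub>F r in at t within {0..}. l2 (\<lambda>x. h r x - k x) \<le> Cs \<sigma> * e r * (3 * l2 (rep (u t)) + e r)"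
        using ev by eventually_elim (simp add: hk)
    qed auto
  qed
  then show ?thesis unfolding k_def
  proof (rule Lim_transform_eventually)
    show "\<forall>\<^sub>F r in at t within {0..}. (LBINT x. q r x * h r x) = ((LBINT x. rep (u r) x ^ 3) - (LBINT x. rep (u t) x ^ 3)) / (r - t)"
      using ev
    proof eventually_elim
      case (elim r)
      interpret r: profile "rep (u r)" "drep (u r)" "Cs \<sigma> * Hs_norm \<sigma> (u r)" using elim by (intro prof) simp
      have i: "integrable lborel (\<lambda>x. rep (u r) x ^ 3)" "integrable lborel (\<lambda>x. rep (u t) x ^ 3)"
        using r.ib2[of "rep (u r)" _ "rep (u r)" "rep (u r)", OF r.UK_meas(1) r.U_bd] t.ib2[of "rep (u t)" _ "rep (u t)" "rep (u t)", OF t.UK_meas(1) t.U_bd] by (simp_all add: power3_eq_cube)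
      have "(a - b) * (a\<^sup>2 + a * b + b\<^sup>2) = a ^ 3 - b ^ 3" for a b :: real
        by (simp add: power2_eq_square power3_eq_cube algebra_simps)
      then have eq: "q r x * h r x = (rep (u r) x ^ 3 - rep (u t) x ^ 3) / (r - t)" for x
        by (simp only: q_def h_def times_divide_eq_left)
      show ?case unfolding eq using i by simp
    qed
  qed
qed

theorem E3_conserved:
  assumes t: "0 \<le> t" shows "E3 (u t) = E3 (u 0)"
proof -
  have e: "E3 (u r) = (LBINT x. rep (u r) x ^ 3)" if "0 \<le> r" for r
    unfolding E3_def
  proof (rule integral_cong_AE)
    show "AE x in lborel. u r x ^ 3 = rep (u r) x ^ 3" using rep_props(1)[OF uH[OF that] s1] by eventually_elim simp
  qed (use uL[OF that] profile.UK_meas(1)[OF prof[OF that]] in \<open>auto simp: L2_def\<close>)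
  have "(LBINT x. rep (u t) x ^ 3) = (LBINT x. rep (u 0) x ^ 3)"
  proof (rule constant_in_time[OF _ _ t])
    fix t :: real
    show "((\<lambda>r. LBINT x. rep (u r) x ^ 3) \<longlongrightarrow> (LBINT x. rep (u t) x ^ 3)) (at t within {0..})" if "0 \<le> t"
      by (rule tendsto_from_quotient[OF cubic_quotient[OF that]])
    assume t: "0 < t"
    interpret profile "rep (u t)" "drep (u t)" "Cs \<sigma> * Hs_norm \<sigma> (u t)" using t by (intro prof) simp
    have "(LBINT x. ut t x * (3 * (rep (u t) x)\<^sup>2)) = - (LBINT x. (rep (u t) x * drep (u t) x + Q x) * (3 * (rep (u t) x)\<^sup>2))"
      using flux_pairing[OF t, of "\<lambda>x. 3 * (rep (u t) x)\<^sup>2"] by (simp add: Q_def f2_def[abs_def])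
    also have "(LBINT x. (rep (u t) x * drep (u t) x + Q x) * (3 * (rep (u t) x)\<^sup>2)) = (LBINT x. 3 * ((rep (u t) x)\<^sup>2 * (rep (u t) x * drep (u t) x + Q x)))"
      by (rule Bochner_Integration.integral_cong) (auto simp: mult_ac)
    also have "\<dots> = 0" using cubic_flux by simp
    finally have "(LBINT x. ut t x * (3 * (rep (u t) x)\<^sup>2)) = 0" by simp
    then show "((\<lambda>r. ((LBINT x. rep (u r) x ^ 3) - (LBINT x. rep (u t) x ^ 3)) / (r - t)) \<longlongrightarrow> 0) (at t within {0..})"
      using cubic_quotient[of t] t by simp
  qed
  then show ?thesis using e t by simp
qed

lemma E2_eq_rep: "0 \<le> t \<Longrightarrow> E2 (u t) = (LBINT x. rep (u t) x * Z (u t) x)"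
proof -
  assume t: "0 \<le> t"
  have "E2 (u t) = (LBINT x. u t x * Z (u t) x)" by (intro E2_eq_pairing uL t Hs_fourier_integrable[OF uH s1])
  also have "\<dots> = (LBINT x. rep (u t) x * Z (u t) x)"
    by (rule L2_integral_cong_AE[OF rep_props(1)[OF uH[OF t] s1]]) (use uL[OF t] rep_L2[OF t] Zu_L2[OF t] in \<open>auto simp: L2_def\<close>)
  finally show ?thesis .
qed

lemma E2_quotient:
  assumes t: "0 \<le> t"
  shows "((\<lambda>r. (E2 (u r) - E2 (u t)) / (r - t)) \<longlongrightarrow> (LBINT x. ut t x * (2 * Z (u t) x))) (at t within {0..})"
proof -
  define q where "q r x = (rep (u r) x - rep (u t) x) / (r - t)" for r x
  have "((\<lambda>r. LBINT x. q r x * (Z (u r) x + Z (u t) x)) \<longlongrightarrow> (LBINT x. ut t x * (2 * Z (u t) x))) (at t within {0..})"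
  proof (rule L2_tendsto_integral_mult[OF _ utL[OF t] _ L2_cmult(1)[OF Zu_L2[OF t]]])
    show "\<forall>\<^sub>F r in at t within {0..}. q r \<in> L2" using quotient_L2[OF t] by (simp add: q_def[abs_def])
    show "\<forall>\<^sub>F r in at t within {0..}. (\<lambda>x. Z (u r) x + Z (u t) x) \<in> L2" using ev by eventually_elim (intro L2_add(1) Zu_L2 t; simp)
    show "((\<lambda>r. l2 (\<lambda>x. q r x - ut t x)) \<longlongrightarrow> 0) (at t within {0..})" using rep_quotient[OF t] by (simp add: q_def)
    show "((\<lambda>r. l2 (\<lambda>x. Z (u r) x + Z (u t) x - 2 * Z (u t) x)) \<longlongrightarrow> 0) (at t within {0..})"
      using l2_dist_tendsto(2)[OF t] by simp
  qed
  then show ?thesis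
  proof (rule Lim_transform_eventually)
    show "\<forall>\<^sub>F r in at t within {0..}. (LBINT x. q r x * (Z (u r) x + Z (u t) x)) = (E2 (u r) - E2 (u t)) / (r - t)"
      using ev
    proof eventually_elim
      case (elim r)
      then have r: "0 \<le> r" by simp
      note L = rep_L2[OF r] rep_L2[OF t] and ZL = Zu_L2[OF r] Zu_L2[OF t]
      have swap: "(LBINT x. rep (u r) x * Z (u t) x) = (LBINT x. rep (u t) x * Z (u r) x)"
      proof -
        have "(LBINT x. rep (u r) x * Z (u t) x) = (LBINT x. u r x * Z (u t) x)"
          by (rule L2_integral_cong_AE[symmetric, OF rep_props(1)[OF uH[OF r] s1]]) (use uL[OF r] L ZL in \<open>auto simp: L2_def\<close>)
        also have "\<dots> = (LBINT x. u t x * Z (u r) x)"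
          by (intro pairing_Z_symmetric uL t r Hs_fourier_integrable[OF uH s1])
        also have "\<dots> = (LBINT x. rep (u t) x * Z (u r) x)"
          by (rule L2_integral_cong_AE[OF rep_props(1)[OF uH[OF t] s1]]) (use uL[OF t] L ZL in \<open>auto simp: L2_def\<close>)
        finally show ?thesis .
      qed
      have i: "integrable lborel (\<lambda>x. rep (u r) x * Z (u r) x)" "integrable lborel (\<lambda>x. rep (u r) x * Z (u t) x)"
        "integrable lborel (\<lambda>x. rep (u t) x * Z (u r) x)" "integrable lborel (\<lambda>x. rep (u t) x * Z (u t) x)"
        by (intro L2_mult_integrable L ZL)+
      have "(a - b) * (z + w) = a * z + a * w - (b * z + b * w)" for a b z w :: real
        by (simp add: algebra_simps)
      then have eq: "q r x * (Z (u r) x + Z (u t) x) = (rep (u r) x * Z (u r) x + rep (u r) x * Z (u t) x - (rep (u t) x * Z (u r) x + rep (u t) x * Z (u t) x)) / (r - t)" for x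
        by (simp only: q_def times_divide_eq_left)
      show ?case unfolding eq E2_eq_rep[OF r] E2_eq_rep[OF t] using i swap by simp
    qed
  qed
qed

theorem E2_conserved:
  assumes t: "0 \<le> t" shows "E2 (u t) = E2 (u 0)"
proof (rule constant_in_time[OF _ _ t])
  fix t :: real
  show "((\<lambda>r. E2 (u r)) \<longlongrightarrow> E2 (u t)) (at t within {0..})" if "0 \<le> t"
    by (rule tendsto_from_quotient[OF E2_quotient[OF that]])
  assume t: "0 < t"
  interpret profile "rep (u t)" "drep (u t)" "Cs \<sigma> * Hs_norm \<sigma> (u t)" using t by (intro prof) simp
  have Zm: "Z (u t) \<in> borel_measurable borel" using Zu_L2[of t] t by (simp add: L2_def)
  have Zx: "Z (u t) x = rep (u t) x - 3 * V x" for x using Z_rep[OF uH s1, of t x] t by (simp add: V_def)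
  have "(LBINT x. ut t x * (2 * Z (u t) x)) = - (LBINT x. (rep (u t) x * drep (u t) x + Q x) * (2 * Z (u t) x))"
    using flux_pairing[OF t, of "\<lambda>x. 2 * Z (u t) x"] Zm by (simp add: Q_def f2_def[abs_def])
  also have "(LBINT x. (rep (u t) x * drep (u t) x + Q x) * (2 * Z (u t) x)) = (LBINT x. 2 * ((rep (u t) x * drep (u t) x + Q x) * (rep (u t) x - 3 * V x)))"
    by (rule Bochner_Integration.integral_cong) (auto simp: Zx)
  also have "\<dots> = 0" using quadratic_flux by simp
  finally show "((\<lambda>r. (E2 (u r) - E2 (u t)) / (r - t)) \<longlongrightarrow> 0) (at t within {0..})"
    using E2_quotient[of t] t by simp
qed

text \<open>\<open>Y\<close> is the momentum \<open>u - u\<^sub>x\<^sub>x\<close>, as a distribution; \<open>F\<close> is its time derivative once the nonlocal term has been integrated by parts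
  (\<open>test_flux\<close>).\<close>

definition Y :: "real \<Rightarrow> (real \<Rightarrow> real) \<Rightarrow> real" where
  "Y t \<psi> = (LBINT x. rep (u t) x * (\<psi> x - deriv (deriv \<psi>) x))"

definition F :: "real \<Rightarrow> (real \<Rightarrow> real) \<Rightarrow> real" where
  "F t \<psi> = (LBINT x. rep (u t) x * drep (u t) x * (deriv (deriv \<psi>) x - 4 * \<psi> x))"

lemma test_L2: assumes "test_function \<psi>" shows "\<psi> \<in> L2"
proof -
  have c: "continuous_on UNIV \<psi>" using assms smooth_continuous by (auto simp: test_function_iff)
  have "integrable lborel (\<lambda>x. \<psi> x * \<psi> x)"
    by (rule integrable_mult_test[OF continuous_locally_integrable[OF c] assms])
  then show ?thesis using test_function_measurable[OF assms] by (simp add: L2_def power2_eq_square)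
qed

lemma Y_quotient:
  assumes t: "0 \<le> t" and \<psi>: "test_function \<psi>"
  shows "((\<lambda>r. (Y r \<psi> - Y t \<psi>) / (r - t)) \<longlongrightarrow> (LBINT x. ut t x * (\<psi> x - deriv (deriv \<psi>) x))) (at t within {0..})"
proof -
  define \<eta> where "\<eta> x = \<psi> x - deriv (deriv \<psi>) x" for x
  have \<eta>L: "\<eta> \<in> L2" unfolding \<eta>_def[abs_def] by (intro L2_diff test_L2 test_function_deriv \<psi>)
  have "((\<lambda>r. LBINT x. (rep (u r) x - rep (u t) x) / (r - t) * \<eta> x) \<longlongrightarrow> (LBINT x. ut t x * \<eta> x)) (at t within {0..})"
    by (rule L2_tendsto_integral_mult[OF quotient_L2[OF t] utL[OF t] _ \<eta>L rep_quotient[OF t]]) (auto simp: l2_def \<eta>L)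
  then show ?thesis unfolding \<eta>_def[symmetric]
  proof (rule Lim_transform_eventually)
    show "\<forall>\<^sub>F r in at t within {0..}. (LBINT x. (rep (u r) x - rep (u t) x) / (r - t) * \<eta> x) = (Y r \<psi> - Y t \<psi>) / (r - t)"
      using ev
    proof eventually_elim
      case (elim r)
      have i: "integrable lborel (\<lambda>x. rep (u r) x * \<eta> x)" "integrable lborel (\<lambda>x. rep (u t) x * \<eta> x)"
        using elim t by (auto intro!: L2_mult_integrable rep_L2 \<eta>L)
      have eq: "(rep (u r) x - rep (u t) x) / (r - t) * \<eta> x = (rep (u r) x * \<eta> x - rep (u t) x * \<eta> x) / (r - t)" for x
        by (simp only: times_divide_eq_left left_diff_distrib)
      show ?case unfolding eq Y_def \<eta>_def[symmetric] using i by simp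
    qed
  qed
qed

lemma Y_derivative:
  assumes t: "0 < t" and \<psi>: "test_function \<psi>"
  shows "((\<lambda>r. Y r \<psi>) has_real_derivative F t \<psi>) (at t)"
proof -
  interpret profile "rep (u t)" "drep (u t)" "Cs \<sigma> * Hs_norm \<sigma> (u t)" using t by (intro prof) simp
  have m: "(\<lambda>x. \<psi> x - deriv (deriv \<psi>) x) \<in> borel_measurable borel"
    using test_function_measurable[OF \<psi>] test_function_measurable[OF test_function_deriv[OF test_function_deriv[OF \<psi>]]] by simp
  have "(LBINT x. ut t x * (\<psi> x - deriv (deriv \<psi>) x)) = - (LBINT x. rep (u t) x * drep (u t) x * (4 * \<psi> x - deriv (deriv \<psi>) x))"
    unfolding flux_pairing[OF t m] using test_flux[OF \<psi>] by (simp add: Q_def f2_def[abs_def])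
  also have "\<dots> = F t \<psi>" unfolding F_def
    by (subst Bochner_Integration.integral_minus[symmetric]) (simp add: algebra_simps)
  finally have "((\<lambda>r. (Y r \<psi> - Y t \<psi>) / (r - t)) \<longlongrightarrow> F t \<psi>) (at t within {0..})"
    using Y_quotient[of t \<psi>] t \<psi> by simp
  moreover have "at t within {0..} = at t" by (rule at_within_interior) (use t in simp)
  ultimately show ?thesis by (simp add: has_field_derivative_iff)
qed

lemma Y_continuous: "test_function \<psi> \<Longrightarrow> continuous_on {0..} (\<lambda>r. Y r \<psi>)"
  unfolding continuous_on_def using tendsto_from_quotient[OF Y_quotient] by auto

end

section \<open>Transport of test functions\<close>

lemma abs_mult_le: "\<bar>x\<bar> \<le> a \<Longrightarrow> \<bar>y\<bar> \<le> b \<Longrightarrow> \<bar>x * y\<bar> \<le> a * (b::real)"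
  unfolding abs_mult by (rule mult_mono) (auto intro: order_trans[OF abs_ge_zero])

lemma abs_add_le: "\<bar>x\<bar> \<le> a \<Longrightarrow> \<bar>y\<bar> \<le> b \<Longrightarrow> \<bar>x + y\<bar> \<le> a + (b::real)" by linarith

lemma MVT_bound:
  fixes f :: "real \<Rightarrow> real"
  assumes "\<And>x. (f has_real_derivative f' x) (at x)" "\<And>x. \<bar>f' x\<bar> \<le> B"
  shows "\<bar>f (x + d) - f x\<bar> \<le> \<bar>d\<bar> * B"
proof -
  have "norm (f (x + d) - f x) \<le> B * norm ((x + d) - x)"
    by (rule field_differentiable_bound[of UNIV f f']) (use assms in \<open>auto simp: has_field_derivative_at_within\<close>)
  then show ?thesis by (simp add: mult.commute)
qed

lemma Taylor_bound:
  fixes f :: "real \<Rightarrow> real"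
  assumes f: "\<And>x. (f has_real_derivative f' x) (at x)" and f': "\<And>x. (f' has_real_derivative f'' x) (at x)" and B: "\<And>x. \<bar>f'' x\<bar> \<le> B"
  shows "\<bar>f (x + d) - f x - d * f' x\<bar> \<le> d\<^sup>2 * B"
proof -
  have "norm ((f (x + d) - f' x * (x + d)) - (f x - f' x * x)) \<le> (\<bar>d\<bar> * B) * norm ((x + d) - x)"
  proof (rule field_differentiable_bound[of "{min x (x + d)..max x (x + d)}" "\<lambda>z. f z - f' x * z" "\<lambda>z. f' z - f' x"])
    fix z assume z: "z \<in> {min x (x + d)..max x (x + d)}"
    show "((\<lambda>z. f z - f' x * z) has_field_derivative f' z - f' x) (at z within {min x (x + d)..max x (x + d)})"
      by (auto intro!: derivative_eq_intros has_field_derivative_at_within[OF f])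
    have "\<bar>f' (x + (z - x)) - f' x\<bar> \<le> \<bar>z - x\<bar> * B" by (rule MVT_bound[OF f' B])
    also have "\<dots> \<le> \<bar>d\<bar> * B" using z order_trans[OF abs_ge_zero B] by (intro mult_right_mono) auto
    finally show "norm (f' z - f' x) \<le> \<bar>d\<bar> * B" by simp
  qed auto
  then show ?thesis by (simp add: algebra_simps power2_eq_square abs_mult_self_eq)
qed

text \<open>The sizes of the derivatives are tied to the cut-off frequency \<open>N\<close> of the velocity. Under transport over a time \<open>h\<close>
  only \<open>l\<close> and \<open>R\<close> change, by a factor \<open>1 + O(h)\<close> and a term \<open>O(h)\<close>, so the class survives any number of steps.\<close>

definition test_class :: "real \<Rightarrow> real \<Rightarrow> real \<Rightarrow> (real \<Rightarrow> real) \<Rightarrow> bool" where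
  "test_class N l R \<psi> \<longleftrightarrow> smooth \<psi> \<and> (\<forall>x. 0 \<le> \<psi> x) \<and> (\<forall>x. R < \<bar>x\<bar> \<longrightarrow> \<psi> x = 0) \<and>
     (\<forall>x. \<bar>\<psi> x\<bar> \<le> l \<and> \<bar>deriv \<psi> x\<bar> \<le> l * N \<and> \<bar>deriv (deriv \<psi>) x\<bar> \<le> l * N^2 \<and> \<bar>deriv (deriv (deriv \<psi>)) x\<bar> \<le> l * N^3)"

lemma test_class_test: "test_class N l R \<psi> \<Longrightarrow> test_function \<psi>"
  by (auto simp: test_class_def test_function_iff)

text \<open>The momentum satisfies \<open>y\<^sub>t + u y\<^sub>x + 3 u\<^sub>x y = 0\<close>; in the pairing with \<open>\<psi>\<close> the spatial terms become \<open>u \<psi>' - 2 u\<^sub>x \<psi>\<close>, the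
  \<open>generator\<close>. A plain Euler step \<open>\<psi> + h\<close> times the generator would lose the sign of \<open>\<psi>\<close>; displacing the argument and
  multiplying by \<open>1 - 2hG'\<close> agrees with it to first order and keeps the sign for small \<open>h\<close>.\<close>

definition transported :: "real \<Rightarrow> (real \<Rightarrow> real) \<Rightarrow> (real \<Rightarrow> real) \<Rightarrow> real \<Rightarrow> real" where
  "transported h G \<psi> x = \<psi> (x + h * G x) * (1 - 2 * h * deriv G x)"

definition generator :: "(real \<Rightarrow> real) \<Rightarrow> (real \<Rightarrow> real) \<Rightarrow> real \<Rightarrow> real" where
  "generator G \<psi> x = G x * deriv \<psi> x - 2 * deriv G x * \<psi> x"

text \<open>The left-hand sides arise from the product and chain rules for the first three derivatives of a transported function,
  with \<open>a = hL\<close>. Only linear growth in \<open>a\<close> matters; 40 leaves ample room.\<close>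

lemma polynomial_growth:
  fixes a :: real assumes "0 \<le> a" "a \<le> 1/4"
  shows "1 + 2 * a \<le> 1 + 40 * a"
    "(1 + a) * (1 + 2 * a) + 2 * a \<le> 1 + 40 * a"
    "((1 + a)\<^sup>2 + a) * (1 + 2 * a) + 2 * ((1 + a) * (2 * a)) + 2 * a \<le> 1 + 40 * a"
    "((1 + a)^3 + 3 * ((1 + a) * a) + a) * (1 + 2 * a) + 3 * (((1 + a)\<^sup>2 + a) * (2 * a)) + 3 * ((1 + a) * (2 * a)) + 2 * a \<le> 1 + 40 * a"
proof -
  have 2: "a * a \<le> a / 4" using mult_left_mono[OF assms(2,1)] by simp
  have 3: "a * (a * a) \<le> a / 16" using mult_left_mono[OF 2 assms(1)] 2 by linarith
  have 4: "a * (a * (a * a)) \<le> a / 64" using mult_left_mono[OF 3 assms(1)] 2 by linarith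
  show "1 + 2 * a \<le> 1 + 40 * a" using assms by simp
  show "(1 + a) * (1 + 2 * a) + 2 * a \<le> 1 + 40 * a" using 2 assms by (simp add: algebra_simps)
  show "((1 + a)\<^sup>2 + a) * (1 + 2 * a) + 2 * ((1 + a) * (2 * a)) + 2 * a \<le> 1 + 40 * a"
    using 2 3 assms by (simp add: algebra_simps power2_eq_square)
  show "((1 + a)^3 + 3 * ((1 + a) * a) + a) * (1 + 2 * a) + 3 * (((1 + a)\<^sup>2 + a) * (2 * a)) + 3 * ((1 + a) * (2 * a)) + 2 * a \<le> 1 + 40 * a"
    using 2 3 4 assms by (simp add: algebra_simps power2_eq_square power3_eq_cube)
qed

context
  fixes G \<psi> :: "real \<Rightarrow> real" and h L N l R :: real
  assumes G: "smooth G" and cl: "test_class N l R \<psi>" and h: "0 \<le> h" and N: "1 \<le> N" and hL: "h * L \<le> 1/4"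
    and G0: "\<And>x. \<bar>G x\<bar> \<le> L" and G1: "\<And>x. \<bar>deriv G x\<bar> \<le> L" and G2: "\<And>x. \<bar>deriv (deriv G) x\<bar> \<le> L * N"
    and G3: "\<And>x. \<bar>deriv (deriv (deriv G)) x\<bar> \<le> L * N^2" and G4: "\<And>x. \<bar>deriv (deriv (deriv (deriv G))) x\<bar> \<le> L * N^3"
begin

private lemma L0: "0 \<le> L" using G0[of 0] by linarith
private lemma a0: "0 \<le> h * L" using L0 h by simp
private lemma l0: "0 \<le> l"
proof -
  have "\<bar>\<psi> 0\<bar> \<le> l" using cl unfolding test_class_def by blast
  then show ?thesis by linarith
qed

private lemma psi_bounds: "\<bar>\<psi> x\<bar> \<le> l" "\<bar>(deriv \<psi>) x\<bar> \<le> l * N" "\<bar>(deriv (deriv \<psi>)) x\<bar> \<le> l * N^2" "\<bar>(deriv (deriv (deriv \<psi>))) x\<bar> \<le> l * N^3"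
  using cl unfolding test_class_def by blast+

private lemma smooth_psi: "smooth \<psi>" "smooth (deriv \<psi>)" "smooth (deriv (deriv \<psi>))" "smooth (deriv G)" "smooth (deriv (deriv G))" "smooth (deriv (deriv (deriv G)))"
  using cl G by (auto simp: test_class_def intro!: smooth_deriv)

private lemmas D = smooth_psi[THEN smooth_DERIV] smooth_DERIV[OF G]

private definition "X x = x + h * G x"
private definition "X1 x = 1 + h * (deriv G) x"
private definition "c1 x = (deriv \<psi>) (X x) * X1 x"
private definition "c2 x = (deriv (deriv \<psi>)) (X x) * X1 x * X1 x + (deriv \<psi>) (X x) * (h * (deriv (deriv G)) x)"
private definition "c3 x = (deriv (deriv (deriv \<psi>))) (X x) * X1 x * X1 x * X1 x + 3 * ((deriv (deriv \<psi>)) (X x) * X1 x * (h * (deriv (deriv G)) x)) + (deriv \<psi>) (X x) * (h * (deriv (deriv (deriv G))) x)"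
private definition "m0 x = 1 - 2 * h * (deriv G) x"

private lemma X_deriv: "(X has_real_derivative X1 x) (at x)"
  unfolding X_def X1_def by (rule derivative_eq_intros D(7) refl)+ simp

private lemma X1_deriv: "(X1 has_real_derivative h * (deriv (deriv G)) x) (at x)"
  unfolding X1_def by (rule derivative_eq_intros D(4) refl)+ simp

private lemma m0_deriv: "(m0 has_real_derivative - 2 * h * (deriv (deriv G)) x) (at x)"
  unfolding m0_def by (rule derivative_eq_intros D(4) refl)+ simp

private lemma chain: "((\<lambda>x. \<psi> (X x)) has_real_derivative c1 x) (at x)"
  "((\<lambda>x. (deriv \<psi>) (X x)) has_real_derivative (deriv (deriv \<psi>)) (X x) * X1 x) (at x)" "((\<lambda>x. (deriv (deriv \<psi>)) (X x)) has_real_derivative (deriv (deriv (deriv \<psi>))) (X x) * X1 x) (at x)"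
  unfolding c1_def by (rule DERIV_chain2[OF D(1) X_deriv] DERIV_chain2[OF D(2) X_deriv] DERIV_chain2[OF D(3) X_deriv])+

private lemma c1_deriv: "(c1 has_real_derivative c2 x) (at x)"
  unfolding c1_def c2_def by (rule derivative_eq_intros chain X1_deriv refl)+ simp

private lemma c2_deriv: "(c2 has_real_derivative c3 x) (at x)"
  unfolding c2_def[abs_def] c3_def by (rule derivative_eq_intros chain X1_deriv D(5) refl)+ (simp add: algebra_simps)

private lemma transported_eq: "transported h G \<psi> = (\<lambda>x. \<psi> (X x) * m0 x)"
  by (simp add: transported_def X_def m0_def fun_eq_iff)

private lemma n_deriv: "((\<lambda>x. - 2 * h * (deriv (deriv G)) x) has_real_derivative - 2 * h * (deriv (deriv (deriv G))) x) (at x)" "((\<lambda>x. - 2 * h * (deriv (deriv (deriv G))) x) has_real_derivative - 2 * h * (deriv (deriv (deriv (deriv G)))) x) (at x)"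
  by (rule DERIV_cmult[OF D(5)] DERIV_cmult[OF D(6)])+

private lemma T1: "deriv (transported h G \<psi>) = (\<lambda>x. c1 x * m0 x + \<psi> (X x) * (- 2 * h * (deriv (deriv G)) x))"
  unfolding transported_eq
  by (rule ext, rule DERIV_imp_deriv, rule DERIV_cong[OF DERIV_mult[OF chain(1) m0_deriv]]) simp

private lemma T2: "deriv (deriv (transported h G \<psi>)) = (\<lambda>x. c2 x * m0 x + 2 * (c1 x * (- 2 * h * (deriv (deriv G)) x)) + \<psi> (X x) * (- 2 * h * (deriv (deriv (deriv G))) x))"
  unfolding T1
  by (rule ext, rule DERIV_imp_deriv, rule DERIV_cong[OF DERIV_add[OF DERIV_mult[OF c1_deriv m0_deriv] DERIV_mult[OF chain(1) n_deriv(1)]]])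
    (simp add: algebra_simps)

private lemma T3: "deriv (deriv (deriv (transported h G \<psi>))) = (\<lambda>x. c3 x * m0 x + 3 * (c2 x * (- 2 * h * (deriv (deriv G)) x)) + 3 * (c1 x * (- 2 * h * (deriv (deriv (deriv G))) x)) + \<psi> (X x) * (- 2 * h * (deriv (deriv (deriv (deriv G)))) x))"
  unfolding T2
  by (rule ext, rule DERIV_imp_deriv, rule DERIV_cong[OF DERIV_add[OF DERIV_add[OF DERIV_mult[OF c2_deriv m0_deriv] DERIV_cmult[OF DERIV_mult[OF c1_deriv n_deriv(1)]]] DERIV_mult[OF chain(1) n_deriv(2)]]])
    (simp add: algebra_simps)

lemma smooth_transported: "smooth (transported h G \<psi>)"
proof -
  have "smooth (\<lambda>x. \<psi> (x + h * G x) * (1 - 2 * h * deriv G x))"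
    by (intro smooth_mult smooth_comp[of \<psi> "\<lambda>x. x + h * G x"] smooth_add smooth_diff smooth_const smooth_ident smooth_psi G)
  then show ?thesis by (simp add: transported_def[abs_def])
qed

lemma transported_support: "R + h * L < \<bar>x\<bar> \<Longrightarrow> transported h G \<psi> x = 0"
proof -
  assume x: "R + h * L < \<bar>x\<bar>"
  have "\<bar>h * G x\<bar> \<le> h * L" using abs_mult_le[of h h "G x" L] h G0 by simp
  then have "R < \<bar>x + h * G x\<bar>" using x by linarith
  then show ?thesis using cl by (simp add: transported_def test_class_def)
qed

private lemma hg: "\<bar>h * G x\<bar> \<le> h * L" "\<bar>h * (deriv G) x\<bar> \<le> h * L" "\<bar>h * (deriv (deriv G)) x\<bar> \<le> h * L * N" "\<bar>h * (deriv (deriv (deriv G))) x\<bar> \<le> h * L * N^2" "\<bar>h * (deriv (deriv (deriv (deriv G)))) x\<bar> \<le> h * L * N^3"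
  using abs_mult_le[of h h, OF _ G0] abs_mult_le[of h h, OF _ G1] abs_mult_le[of h h, OF _ G2] abs_mult_le[of h h, OF _ G3] abs_mult_le[of h h, OF _ G4] h
  by (simp_all add: mult.assoc)

private lemma basic_bounds:
  "\<bar>X1 x\<bar> \<le> 1 + h * L" "\<bar>m0 x\<bar> \<le> 1 + 2 * (h * L)" "\<bar>- 2 * h * (deriv (deriv G)) x\<bar> \<le> 2 * (h * L) * N" "\<bar>- 2 * h * (deriv (deriv (deriv G))) x\<bar> \<le> 2 * (h * L) * N^2" "\<bar>- 2 * h * (deriv (deriv (deriv (deriv G)))) x\<bar> \<le> 2 * (h * L) * N^3"
  unfolding X1_def m0_def using hg(1)[of x] hg(2)[of x] hg(3)[of x] hg(4)[of x] hg(5)[of x] by linarith+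

private lemma c_bounds: "\<bar>c1 x\<bar> \<le> l * N * (1 + h * L)"
  "\<bar>c2 x\<bar> \<le> l * N^2 * (1 + h * L) * (1 + h * L) + l * N * (h * L * N)"
  "\<bar>c3 x\<bar> \<le> l * N^3 * (1 + h * L) * (1 + h * L) * (1 + h * L) + 3 * (l * N^2 * (1 + h * L) * (h * L * N)) + l * N * (h * L * N^2)"
  unfolding c1_def c2_def c3_def
  by (intro abs_add_le abs_mult_le psi_bounds basic_bounds hg | simp)+

lemma transported_nonneg: "0 \<le> transported h G \<psi> x"
proof -
  have "\<bar>2 * h * deriv G x\<bar> \<le> 1" using hg(2)[of x] hL by linarith
  then show ?thesis using cl by (auto simp: transported_def test_class_def intro!: mult_nonneg_nonneg)
qed

lemma test_class_transported: "test_class N (l * (1 + 40 * (h * L))) (R + h * L) (transported h G \<psi>)"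
  unfolding test_class_def
proof (intro conjI allI impI smooth_transported transported_nonneg transported_support)
  define a where "a = h * L"
  note pg = polynomial_growth[of a, OF a0[folded a_def] hL[folded a_def]]
  note b = basic_bounds[folded a_def] and c = c_bounds[folded a_def]
  have lN: "0 \<le> l * N" "0 \<le> l * N^2" "0 \<le> l * N^3" using l0 N by simp_all
  fix x
  have "\<bar>transported h G \<psi> x\<bar> \<le> l * (1 + 2 * a)" unfolding transported_eq by (intro abs_mult_le psi_bounds b)
  also have "\<dots> \<le> l * (1 + 40 * a)" by (rule mult_left_mono[OF pg(1) l0])
  finally show "\<bar>transported h G \<psi> x\<bar> \<le> l * (1 + 40 * (h * L))" by (simp add: a_def)
  have "\<bar>deriv (transported h G \<psi>) x\<bar> \<le> l * N * (1 + a) * (1 + 2 * a) + l * (2 * a * N)"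
    unfolding T1 by (intro abs_add_le abs_mult_le psi_bounds b c)
  also have "\<dots> = l * N * ((1 + a) * (1 + 2 * a) + 2 * a)" by (simp add: algebra_simps)
  also have "\<dots> \<le> l * N * (1 + 40 * a)" by (rule mult_left_mono[OF pg(2) lN(1)])
  finally show "\<bar>deriv (transported h G \<psi>) x\<bar> \<le> l * (1 + 40 * (h * L)) * N" by (simp add: a_def mult_ac)
  have "\<bar>deriv (deriv (transported h G \<psi>)) x\<bar> \<le> (l * N^2 * (1 + a) * (1 + a) + l * N * (a * N)) * (1 + 2 * a) + 2 * (l * N * (1 + a) * (2 * a * N)) + l * (2 * a * N^2)"
    unfolding T2 by (intro abs_add_le abs_mult_le psi_bounds b c) simp
  also have "\<dots> = l * N^2 * (((1 + a)\<^sup>2 + a) * (1 + 2 * a) + 2 * ((1 + a) * (2 * a)) + 2 * a)" by (simp add: algebra_simps power2_eq_square)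
  also have "\<dots> \<le> l * N^2 * (1 + 40 * a)" by (rule mult_left_mono[OF pg(3) lN(2)])
  finally show "\<bar>deriv (deriv (transported h G \<psi>)) x\<bar> \<le> l * (1 + 40 * (h * L)) * N^2" by (simp add: a_def mult_ac)
  have "\<bar>deriv (deriv (deriv (transported h G \<psi>))) x\<bar> \<le> (l * N^3 * (1 + a) * (1 + a) * (1 + a) + 3 * (l * N^2 * (1 + a) * (a * N)) + l * N * (a * N^2)) * (1 + 2 * a)
      + 3 * ((l * N^2 * (1 + a) * (1 + a) + l * N * (a * N)) * (2 * a * N)) + 3 * (l * N * (1 + a) * (2 * a * N^2)) + l * (2 * a * N^3)"
    unfolding T3 by (intro abs_add_le abs_mult_le psi_bounds b c) simp_all
  also have "\<dots> = l * N^3 * (((1 + a)^3 + 3 * ((1 + a) * a) + a) * (1 + 2 * a) + 3 * (((1 + a)\<^sup>2 + a) * (2 * a)) + 3 * ((1 + a) * (2 * a)) + 2 * a)"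
    by (simp add: algebra_simps power2_eq_square power3_eq_cube)
  also have "\<dots> \<le> l * N^3 * (1 + 40 * a)" by (rule mult_left_mono[OF pg(4) lN(3)])
  finally show "\<bar>deriv (deriv (deriv (transported h G \<psi>))) x\<bar> \<le> l * (1 + 40 * (h * L)) * N^3" by (simp add: a_def mult_ac)
qed

definition defect :: "real \<Rightarrow> real" where
  "defect x = transported h G \<psi> x - \<psi> x - h * generator G \<psi> x"

lemma smooth_generator: "smooth (generator G \<psi>)"
proof -
  have "smooth (\<lambda>x. G x * deriv \<psi> x - 2 * deriv G x * \<psi> x)"
    by (intro smooth_mult smooth_diff smooth_const smooth_psi G)
  then show ?thesis by (simp add: generator_def[abs_def])
qed

lemma generator_test: "test_function (generator G \<psi>)"
proof -
  have "generator G \<psi> x = 0" if "R < \<bar>x\<bar>" for x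
    using cl that deriv_eq_0_outside[of R \<psi> x] by (simp add: generator_def test_class_def)
  then show ?thesis using smooth_generator by (auto simp: test_function_iff)
qed

lemma defect_support: "R + h * L < \<bar>x\<bar> \<Longrightarrow> defect x = 0"
  using transported_support[of x] cl deriv_eq_0_outside[of R \<psi> x] a0
  by (simp add: defect_def generator_def test_class_def)

lemma smooth_defect: "smooth defect"
proof -
  have "smooth (\<lambda>x. transported h G \<psi> x - \<psi> x - h * generator G \<psi> x)"
    by (intro smooth_diff smooth_mult smooth_const smooth_transported smooth_generator smooth_psi)
  then show ?thesis by (simp add: defect_def[abs_def])
qed

lemma defect_bounds: "\<bar>defect x\<bar> \<le> 3 * (h * L)\<^sup>2 * l * N^3" "\<bar>deriv defect x\<bar> \<le> 6 * (h * L)\<^sup>2 * l * N^3"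
proof -
  define a where "a = h * L"
  have a: "0 \<le> a" using a0 by (simp add: a_def)
  define d where "d = h * G x"
  have d: "\<bar>d\<bar> \<le> a" using hg(1)[of x] by (simp add: d_def a_def)
  have d2: "d\<^sup>2 \<le> a\<^sup>2" using power_mono[OF d abs_ge_zero, of 2] by simp
  have N1: "N \<le> N^3" "N^2 \<le> N^3" using N power_increasing[of 1 3 N] power_increasing[of 2 3 N] by simp_all
  have w: "0 \<le> a\<^sup>2 * l" using l0 by simp
  have t0: "\<bar>\<psi> (x + d) - \<psi> x - d * (deriv \<psi>) x\<bar> \<le> a\<^sup>2 * (l * N^2)"
    using Taylor_bound[OF D(1) D(2) psi_bounds(3), of x d] mult_right_mono[OF d2, of "l * N^2"] l0 by simp
  have t1: "\<bar>(deriv \<psi>) (x + d) - (deriv \<psi>) x - d * (deriv (deriv \<psi>)) x\<bar> \<le> a\<^sup>2 * (l * N^3)"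
    using Taylor_bound[OF D(2) D(3) psi_bounds(4), of x d] mult_right_mono[OF d2, of "l * N^3"] l0 N by simp
  have e0: "\<bar>\<psi> (x + d) - \<psi> x\<bar> \<le> a * (l * N)"
    using MVT_bound[OF D(1) psi_bounds(2), of x d] mult_right_mono[OF d, of "l * N"] l0 N by simp
  have e1: "\<bar>(deriv \<psi>) (x + d) - (deriv \<psi>) x\<bar> \<le> a * (l * N^2)"
    using MVT_bound[OF D(2) psi_bounds(3), of x d] mult_right_mono[OF d, of "l * N^2"] l0 by simp
  note hg' = hg[folded a_def]
  have "defect x = (\<psi> (x + d) - \<psi> x - d * (deriv \<psi>) x) + (- 2) * ((h * (deriv G) x) * (\<psi> (x + d) - \<psi> x))"
    by (simp add: defect_def transported_def generator_def d_def algebra_simps)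
  also have "\<bar>\<dots>\<bar> \<le> a\<^sup>2 * (l * N^2) + 2 * (a * (a * (l * N)))"
    by (intro abs_add_le abs_mult_le t0 e0 hg') simp
  also have "\<dots> = (a\<^sup>2 * l) * N^2 + 2 * ((a\<^sup>2 * l) * N)" by (simp add: power2_eq_square algebra_simps)
  also have "\<dots> \<le> (a\<^sup>2 * l) * N^3 + 2 * ((a\<^sup>2 * l) * N^3)"
    using mult_left_mono[OF N1(2) w] mult_left_mono[OF N1(1) w] by linarith
  finally show "\<bar>defect x\<bar> \<le> 3 * (h * L)\<^sup>2 * l * N^3" by (simp add: a_def algebra_simps)
  have "(generator G \<psi> has_real_derivative (deriv G) x * (deriv \<psi>) x + G x * (deriv (deriv \<psi>)) x - 2 * ((deriv (deriv G)) x * \<psi> x + (deriv G) x * (deriv \<psi>) x)) (at x)"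
    unfolding generator_def[abs_def] by (rule derivative_eq_intros D refl)+ (simp add: algebra_simps)
  moreover have "(transported h G \<psi> has_real_derivative c1 x * m0 x + \<psi> (X x) * (- 2 * h * (deriv (deriv G)) x)) (at x)"
    using smooth_DERIV[OF smooth_transported, of x] unfolding T1 .
  ultimately have "(defect has_real_derivative (c1 x * m0 x + \<psi> (X x) * (- 2 * h * (deriv (deriv G)) x)) - (deriv \<psi>) x - h * ((deriv G) x * (deriv \<psi>) x + G x * (deriv (deriv \<psi>)) x - 2 * ((deriv (deriv G)) x * \<psi> x + (deriv G) x * (deriv \<psi>) x))) (at x)"
    unfolding defect_def[abs_def] by (intro DERIV_diff DERIV_cmult D(1))
  then have "deriv defect x = (c1 x * m0 x + \<psi> (X x) * (- 2 * h * (deriv (deriv G)) x)) - (deriv \<psi>) x - h * ((deriv G) x * (deriv \<psi>) x + G x * (deriv (deriv \<psi>)) x - 2 * ((deriv (deriv G)) x * \<psi> x + (deriv G) x * (deriv \<psi>) x))"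
    by (rule DERIV_imp_deriv)
  also have "\<dots> = ((deriv \<psi>) (x + d) - (deriv \<psi>) x - d * (deriv (deriv \<psi>)) x) + (- 1) * ((h * (deriv G) x) * ((deriv \<psi>) (x + d) - (deriv \<psi>) x)) + (- 2) * ((h * (deriv G) x) * ((h * (deriv G) x) * (deriv \<psi>) (x + d))) + (- 2) * ((h * (deriv (deriv G)) x) * (\<psi> (x + d) - \<psi> x))"
    by (simp add: c1_def m0_def X_def X1_def d_def algebra_simps)
  also have "\<bar>\<dots>\<bar> \<le> a\<^sup>2 * (l * N^3) + 1 * (a * (a * (l * N^2))) + 2 * (a * (a * (l * N))) + 2 * ((a * N) * (a * (l * N)))"
    by (intro abs_add_le abs_mult_le t1 e0 e1 hg' psi_bounds) simp_all
  also have "\<dots> = (a\<^sup>2 * l) * N^3 + 3 * ((a\<^sup>2 * l) * N^2) + 2 * ((a\<^sup>2 * l) * N)" by (simp add: power2_eq_square algebra_simps)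
  also have "\<dots> \<le> (a\<^sup>2 * l) * N^3 + 3 * ((a\<^sup>2 * l) * N^3) + 2 * ((a\<^sup>2 * l) * N^3)"
    using mult_left_mono[OF N1(2) w] mult_left_mono[OF N1(1) w] by linarith
  finally show "\<bar>deriv defect x\<bar> \<le> 6 * (h * L)\<^sup>2 * l * N^3" by (simp add: a_def algebra_simps)
qed

end

section \<open>Persistence of the sign of the momentum\<close>

lemma L2_triple_bound:
  fixes f g \<psi> :: "real \<Rightarrow> real"
  assumes "f \<in> L2" "g \<in> L2" "\<psi> \<in> borel_measurable borel" "\<And>x. \<bar>\<psi> x\<bar> \<le> A"
  shows "integrable lborel (\<lambda>x. f x * g x * \<psi> x)" "\<bar>\<integral>x. f x * g x * \<psi> x \<partial>lborel\<bar> \<le> A * (l2 f * l2 g)"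
proof -
  note B = L2_mult_bdd[OF assms(1,3,4)]
  have e: "(\<lambda>x. f x * g x * \<psi> x) = (\<lambda>x. (\<psi> x * f x) * g x)" by (auto simp: fun_eq_iff)
  show "integrable lborel (\<lambda>x. f x * g x * \<psi> x)" unfolding e by (rule L2_mult_integrable[OF B(1) assms(2)])
  have "\<bar>\<integral>x. (\<psi> x * f x) * g x \<partial>lborel\<bar> \<le> l2 (\<lambda>x. \<psi> x * f x) * l2 g"
    using L2_Cauchy_Schwarz(2)[OF B(1) assms(2)] by simp
  also have "\<dots> \<le> (A * l2 f) * l2 g" by (intro mult_right_mono B(2)) simp
  finally show "\<bar>\<integral>x. f x * g x * \<psi> x \<partial>lborel\<bar> \<le> A * (l2 f * l2 g)" unfolding e by (simp add: mult.assoc)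
qed

lemma test_class_bounds:
  assumes "test_class N l R \<psi>"
  shows "\<And>x. \<bar>\<psi> x\<bar> \<le> l" "\<And>x. \<bar>deriv \<psi> x\<bar> \<le> l * N" "\<And>x. \<bar>deriv (deriv \<psi>) x\<bar> \<le> l * N^2" "smooth \<psi>" "\<And>x. 0 \<le> \<psi> x" "\<And>x. R < \<bar>x\<bar> \<Longrightarrow> \<psi> x = 0"
  using assms unfolding test_class_def by blast+

lemma Hs_norm_swap:
  assumes "f \<in> Hs \<sigma>" "g \<in> Hs \<sigma>" shows "Hs_norm \<sigma> (\<lambda>x. f x - g x) = Hs_norm \<sigma> (\<lambda>x. g x - f x)"
proof -
  have d: "(\<lambda>x. f x - g x) \<in> L2" "(\<lambda>x. g x - f x) \<in> L2" using Hs_diff[OF assms] Hs_diff[OF assms(2,1)] by (auto simp: Hs_iff)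
  have w: "weighted \<sigma> (\<lambda>x. f x - g x) \<in> L2" using Hs_diff[OF assms] by (auto simp: Hs_iff)
  have "AE \<xi> in lborel. weighted \<sigma> (\<lambda>x. g x - f x) \<xi> = - weighted \<sigma> (\<lambda>x. f x - g x) \<xi>"
    using weighted_linear[OF d(1) d(1), of \<sigma> "-1" 0] by simp
  moreover have "(\<lambda>\<xi>. - weighted \<sigma> (\<lambda>x. f x - g x) \<xi>) \<in> L2" using L2_cmult(1)[OF w, of "-1"] by simp
  moreover have "weighted \<sigma> (\<lambda>x. g x - f x) \<in> borel_measurable lborel" using fourier_measurable[OF d(2)] by (simp add: weighted_def[abs_def])
  ultimately have "l2 (weighted \<sigma> (\<lambda>x. g x - f x)) = l2 (\<lambda>\<xi>. - weighted \<sigma> (\<lambda>x. f x - g x) \<xi>)"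
    by (intro L2_cong_AE(2)) (auto elim: eventually_mono)
  then show ?thesis by (simp add: Hs_norm_eq l2_def)
qed

context dp_flow
begin

lemma Y_eq:
  assumes t: "0 \<le> t" and \<psi>: "test_function \<psi>"
  shows "integrable lborel (\<lambda>x. rep (u t) x * \<psi> x)" "integrable lborel (\<lambda>x. drep (u t) x * deriv \<psi> x)"
    "Y t \<psi> = (LBINT x. rep (u t) x * \<psi> x) + (LBINT x. drep (u t) x * deriv \<psi> x)"
proof -
  interpret profile "rep (u t)" "drep (u t)" "Cs \<sigma> * Hs_norm \<sigma> (u t)" using t by (intro prof) simp
  note t1 = test_function_deriv[OF \<psi>] and t2 = test_function_deriv[OF test_function_deriv[OF \<psi>]]
  show i: "integrable lborel (\<lambda>x. rep (u t) x * \<psi> x)" "integrable lborel (\<lambda>x. drep (u t) x * deriv \<psi> x)"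
    by (intro integrable_mult_test continuous_locally_integrable U_cont K_cont \<psi> t1)+
  have j: "integrable lborel (\<lambda>x. rep (u t) x * deriv (deriv \<psi>) x)"
    by (intro integrable_mult_test continuous_locally_integrable U_cont t2)
  have "Y t \<psi> = (LBINT x. rep (u t) x * \<psi> x) - (LBINT x. rep (u t) x * deriv (deriv \<psi>) x)"
    unfolding Y_def right_diff_distrib by (rule Bochner_Integration.integral_diff[OF i(1) j])
  then show "Y t \<psi> = (LBINT x. rep (u t) x * \<psi> x) + (LBINT x. drep (u t) x * deriv \<psi> x)"
    using integral_by_parts_test[OF U_der K_cont t1] by simp
qed

lemma Y_small:
  assumes t: "0 \<le> t" and \<psi>: "test_function \<psi>" and R: "\<And>x. R < \<bar>x\<bar> \<Longrightarrow> \<psi> x = 0" "0 \<le> R"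
    and A: "\<And>x. \<bar>\<psi> x\<bar> \<le> A" and B: "\<And>x. \<bar>deriv \<psi> x\<bar> \<le> B" and M: "Cs \<sigma> * Hs_norm \<sigma> (u t) \<le> M"
  shows "\<bar>Y t \<psi>\<bar> \<le> 2 * R * M * (A + B)"
proof -
  interpret profile "rep (u t)" "drep (u t)" "Cs \<sigma> * Hs_norm \<sigma> (u t)" using t by (intro prof) simp
  note y = Y_eq[OF t \<psi>]
  have bd: "\<bar>\<integral>x. f x * g x \<partial>lborel\<bar> \<le> 2 * R * M * C"
    if f: "\<And>x. \<bar>f x\<bar> \<le> M" and g: "\<And>x. \<bar>g x\<bar> \<le> C" "\<And>x. R < \<bar>x\<bar> \<Longrightarrow> g x = 0" and i: "integrable lborel (\<lambda>x. f x * g x)" for f g :: "real \<Rightarrow> real" and C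
  proof -
    have ii: "integrable lborel (\<lambda>x. indicator {-R..R} x * (M * C))" using R(2) by (simp add: emeasure_lborel_Icc_eq)
    have p: "\<bar>f x * g x\<bar> \<le> indicator {-R..R} x * (M * C)" for x
    proof (cases "R < \<bar>x\<bar>")
      case True
      then have "x \<notin> {-R..R}" by auto
      then show ?thesis using g(2)[OF True] by simp
    next
      case False
      then have "x \<in> {-R..R}" by (auto simp: abs_le_iff not_less)
      then show ?thesis using abs_mult_le[OF f g(1), of x x] by simp
    qed
    have "norm (LBINT x. f x * g x) \<le> (LBINT x. norm (f x * g x))" by (rule integral_norm_bound)
    also have "\<dots> \<le> (LBINT x. indicator {-R..R} x * (M * C))"
      by (rule integral_mono[OF integrable_norm[OF i] ii]) (use p in simp)
    also have "\<dots> = 2 * R * M * C" using R(2) by simp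
    finally show ?thesis by simp
  qed
  have "\<bar>\<integral>x. rep (u t) x * \<psi> x \<partial>lborel\<bar> \<le> 2 * R * M * A"
    by (rule bd[OF order_trans[OF U_bd M] A R(1) y(1)])
  moreover have "\<bar>\<integral>x. drep (u t) x * deriv \<psi> x \<partial>lborel\<bar> \<le> 2 * R * M * B"
    by (rule bd[OF order_trans[OF K_bd M] B deriv_eq_0_outside[OF R(1)] y(2)])
  ultimately have "\<bar>Y t \<psi>\<bar> \<le> 2 * R * M * A + 2 * R * M * B" unfolding y(3) by linarith
  then show ?thesis by (simp add: distrib_left)
qed

text \<open>The decisive estimate. With \<open>d = u - G\<close> and \<open>e = u\<^sub>x - G'\<close>, a direct bound would be linear in \<open>d\<close> and carry two derivatives
  of \<open>\<psi>\<close>, giving \<open>N\<^bsup>2 - \<sigma>\<^esup>\<close>. Integration by parts cancels all such terms: what remains contains two of the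
  factors \<open>d, e, G''\<close>, each controlled by the Sobolev norm with the appropriate power of \<open>N\<close>, or one of \<open>d, e\<close> with at most one
  derivative of \<open>\<psi>\<close>.\<close>

lemma linearization_error:
  assumes t: "0 \<le> t" and \<psi>: "test_function \<psi>" and G: "smooth G"
    and p0: "\<And>x. \<bar>\<psi> x\<bar> \<le> l" and p1: "\<And>x. \<bar>deriv \<psi> x\<bar> \<le> l1" and p2: "\<And>x. \<bar>deriv (deriv \<psi>) x\<bar> \<le> l2'"
    and d: "(\<lambda>x. rep (u t) x - G x) \<in> L2" and e: "(\<lambda>x. drep (u t) x - deriv G x) \<in> L2" and g: "deriv (deriv G) \<in> L2"
    and gen: "test_function (generator G \<psi>)"
  defines "nd \<equiv> l2 (\<lambda>x. rep (u t) x - G x)" and "ne \<equiv> l2 (\<lambda>x. drep (u t) x - deriv G x)" and "ng \<equiv> l2 (deriv (deriv G))" and "nu \<equiv> l2 (rep (u t))"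
  shows "\<bar>F t \<psi> - Y t (generator G \<psi>)\<bar> \<le> l2' * (ne * nd) + l1 * (ng * nd) + 2 * (l * (ne * ng)) + 2 * (l * (nu * ne)) + l1 * (nu * nd)"
proof -
  interpret profile "rep (u t)" "drep (u t)" "Cs \<sigma> * Hs_norm \<sigma> (u t)" using t by (intro prof) simp
  define U K where "U = rep (u t)" and "K = drep (u t)"
  note Uder = U_der[folded U_def K_def] and Kc = K_cont[folded K_def] and Uc = U_cont[folded U_def] and UL = U_L2[folded U_def]
  define p1 p2 g1 g2 where "p1 = deriv \<psi>" and "p2 = deriv p1" and "g1 = deriv G" and "g2 = deriv g1"
  have t1: "test_function p1" "test_function p2" unfolding p1_def p2_def by (intro test_function_deriv \<psi>)+
  have sm: "smooth \<psi>" "smooth p1" "smooth p2" "smooth g1" "smooth g2" using \<psi> t1 G by (auto simp: test_function_iff g1_def g2_def intro: smooth_deriv)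
  have meas: "\<psi> \<in> borel_measurable borel" "p1 \<in> borel_measurable borel" "p2 \<in> borel_measurable borel" by (intro test_function_measurable \<psi> t1)+
  define d where "d x = U x - G x" for x
  define e where "e x = K x - g1 x" for x
  have dL: "d \<in> L2" and eL: "e \<in> L2" and gL: "g2 \<in> L2" using assms by (simp_all add: d_def[abs_def] e_def[abs_def] U_def K_def g1_def g2_def)
  have nn: "nd = l2 d" "ne = l2 e" "ng = l2 g2" "nu = l2 U" by (simp_all add: nd_def ne_def ng_def nu_def d_def[abs_def] e_def[abs_def] U_def K_def g1_def g2_def)
  have cont: "continuous_on UNIV \<psi>" "continuous_on UNIV p1" "continuous_on UNIV p2" "continuous_on UNIV g1" "continuous_on UNIV g2" "continuous_on UNIV G"
    using sm G smooth_continuous by blast+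
  have it: "integrable lborel (\<lambda>x. c x * \<psi> x)" "integrable lborel (\<lambda>x. c x * p1 x)" "integrable lborel (\<lambda>x. c x * p2 x)" if "continuous_on UNIV c" for c
    by (intro integrable_mult_test continuous_locally_integrable that \<psi> t1)+
  note b0 = assms(4) and b1 = assms(5)[folded p1_def] and b2 = assms(6)[folded p1_def p2_def]
  note T1 = L2_triple_bound[OF eL dL meas(3) b2] and T2 = L2_triple_bound[OF gL dL meas(2) b1] and T3 = L2_triple_bound[OF eL gL meas(1) b0]
    and T4 = L2_triple_bound[OF UL eL meas(1) b0] and T5 = L2_triple_bound[OF UL dL meas(2) b1]
  \<comment> \<open>The terms that survive; the antiderivative that removes all others is given in the last step.\<close>
  define E where "E x = e x * d x * p2 x - g2 x * d x * p1 x + 2 * (e x * g2 x * \<psi> x) - 2 * (U x * e x * \<psi> x) + U x * d x * p1 x" for x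
  have iE: "integrable lborel E" unfolding E_def[abs_def] using T1(1) T2(1) T3(1) T4(1) T5(1) by simp
  have "(LBINT x. E x) = (LBINT x. e x * d x * p2 x) - (LBINT x. g2 x * d x * p1 x) + 2 * (LBINT x. e x * g2 x * \<psi> x) - 2 * (LBINT x. U x * e x * \<psi> x) + (LBINT x. U x * d x * p1 x)"
    unfolding E_def using T1(1) T2(1) T3(1) T4(1) T5(1) by simp
  then have EB: "\<bar>\<integral>x. E x \<partial>lborel\<bar> \<le> l2' * (ne * nd) + l1 * (ng * nd) + 2 * (l * (ne * ng)) + 2 * (l * (nu * ne)) + l1 * (nu * nd)"
    using T1(2) T2(2) T3(2) T4(2) T5(2) unfolding nn by linarith
  define w1 where "w1 = deriv (generator G \<psi>)"
  have w1: "w1 x = G x * p2 x - g1 x * p1 x - 2 * (g2 x * \<psi> x)" for x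
    unfolding w1_def
  proof (rule DERIV_imp_deriv)
    have "((\<lambda>x. G x * p1 x - 2 * g1 x * \<psi> x) has_real_derivative (g1 x * p1 x + p2 x * G x) - ((2 * g2 x) * \<psi> x + p1 x * (2 * g1 x))) (at x)"
      using smooth_DERIV[OF G, folded g1_def] smooth_DERIV[OF sm(1), folded p1_def] smooth_DERIV[OF sm(2), folded p2_def] smooth_DERIV[OF sm(4), folded g2_def]
      by (intro DERIV_diff DERIV_mult DERIV_cmult)
    then show "(generator G \<psi> has_real_derivative G x * p2 x - g1 x * p1 x - 2 * (g2 x * \<psi> x)) (at x)"
      unfolding generator_def[abs_def] p1_def[symmetric] g1_def[symmetric] by (rule DERIV_cong) (simp add: algebra_simps)
  qed
  define FY where "FY x = U x * K x * (p2 x - 4 * \<psi> x) - (U x * generator G \<psi> x + K x * w1 x)" for x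
  have i1: "integrable lborel (\<lambda>x. U x * K x * (p2 x - 4 * \<psi> x))"
    using it(3)[of "\<lambda>x. U x * K x"] it(1)[of "\<lambda>x. U x * K x"] Uc Kc
    by (simp add: right_diff_distrib continuous_on_mult mult.left_commute[of _ 4])
  note y = Y_eq[OF t gen, folded U_def K_def w1_def]
  have "F t \<psi> - Y t (generator G \<psi>) = (LBINT x. FY x)"
    unfolding F_def FY_def y(3) U_def[symmetric] K_def[symmetric] p1_def[symmetric] p2_def[symmetric] using i1 y(1,2) by simp
  moreover have "(LBINT x. FY x - E x) = 0"
  proof (rule integral_derivative_eq_0[where F="\<lambda>x. (g1 x * d x) * p1 x + (g1 x * g1 x) * \<psi> x - (U x * U x) * \<psi> x"])
    fix x
    have dd: "(d has_real_derivative e x) (at x)" unfolding d_def[abs_def] e_def g1_def by (intro DERIV_diff Uder smooth_DERIV[OF G])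
    have "((\<lambda>x. (g1 x * d x) * p1 x + (g1 x * g1 x) * \<psi> x - (U x * U x) * \<psi> x) has_real_derivative
       ((g2 x * d x + e x * g1 x) * p1 x + p2 x * (g1 x * d x)) + ((g2 x * g1 x + g2 x * g1 x) * \<psi> x + p1 x * (g1 x * g1 x)) - ((K x * U x + K x * U x) * \<psi> x + p1 x * (U x * U x))) (at x)"
      using smooth_DERIV[OF sm(1), folded p1_def] smooth_DERIV[OF sm(2), folded p2_def] smooth_DERIV[OF sm(4), folded g2_def] dd Uder
      by (intro DERIV_add DERIV_diff DERIV_mult)
    then show "((\<lambda>x. (g1 x * d x) * p1 x + (g1 x * g1 x) * \<psi> x - (U x * U x) * \<psi> x) has_real_derivative FY x - E x) (at x)"
      by (rule DERIV_cong) (simp add: FY_def E_def w1 generator_def p1_def[symmetric] g1_def[symmetric] d_def e_def algebra_simps)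
  next
    have gc: "continuous_on UNIV (generator G \<psi>)" "continuous_on UNIV w1" using gen test_function_deriv[OF gen] smooth_continuous by (auto simp: test_function_iff w1_def)
    show "continuous_on UNIV (\<lambda>x. FY x - E x)"
      unfolding FY_def E_def d_def e_def by (intro continuous_intros Uc Kc gc cont)
    show "integrable lborel (\<lambda>x. (g1 x * d x) * p1 x + (g1 x * g1 x) * \<psi> x - (U x * U x) * \<psi> x)"
      unfolding d_def by (intro Bochner_Integration.integrable_diff Bochner_Integration.integrable_add it continuous_intros cont Uc)
    show "integrable lborel (\<lambda>x. FY x - E x)" unfolding FY_def[abs_def] using i1 y(1,2) iE by simp
  qed
  moreover have "integrable lborel FY" unfolding FY_def[abs_def] using i1 y(1,2) by simp
  ultimately have "F t \<psi> - Y t (generator G \<psi>) = (LBINT x. E x)" using iE by simp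
  then show ?thesis using EB by simp
qed

lemma rep_l2_bounds:
  assumes "0 \<le> t" shows "l2 (rep (u t)) \<le> Hs_norm \<sigma> (u t)" "l2 (drep (u t)) \<le> Hs_norm \<sigma> (u t)"
  using rep_props(9,10)[OF uH[OF assms] s1] by auto

text \<open>Growth in \<open>N\<close> is harmless here: \<open>\<omega>\<close> is made small for fixed \<open>N\<close>, by taking short time steps.\<close>

lemma F_dist:
  assumes t: "0 \<le> t" "0 \<le> r" and cl: "test_class N l R \<psi>" and N: "1 \<le> N"
    and H: "Hs_norm \<sigma> (u t) \<le> H" "Hs_norm \<sigma> (u r) \<le> H" and w: "Hs_norm \<sigma> (\<lambda>x. u r x - u t x) \<le> \<omega>"
  shows "\<bar>F r \<psi> - F t \<psi>\<bar> \<le> 10 * l * N^2 * (H * \<omega>)"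
proof -
  interpret r: profile "rep (u r)" "drep (u r)" "Cs \<sigma> * Hs_norm \<sigma> (u r)" using t by (intro prof) simp
  interpret t: profile "rep (u t)" "drep (u t)" "Cs \<sigma> * Hs_norm \<sigma> (u t)" using t by (intro prof) simp
  note b = test_class_bounds[OF cl] and \<psi> = test_class_test[OF cl]
  have l0: "0 \<le> l" using b(1)[of 0] by linarith
  define \<theta> where "\<theta> x = deriv (deriv \<psi>) x - 4 * \<psi> x" for x
  have m: "\<theta> \<in> borel_measurable borel"
    using test_function_measurable[OF \<psi>] test_function_measurable[OF test_function_deriv[OF test_function_deriv[OF \<psi>]]] by (simp add: \<theta>_def[abs_def])
  have th: "\<bar>\<theta> x\<bar> \<le> 5 * l * N^2" for x
  proof -
    have "l * 1 \<le> l * N^2" using N l0 by (intro mult_left_mono) auto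
    then show ?thesis using b(1)[of x] b(3)[of x] unfolding \<theta>_def by linarith
  qed
  have d: "(\<lambda>x. rep (u r) x - rep (u t) x) \<in> L2" "(\<lambda>x. drep (u r) x - drep (u t) x) \<in> L2" by (intro L2_diff r.U_L2 t.U_L2 r.K_L2 t.K_L2)+
  note B1 = L2_triple_bound[OF d(1) r.K_L2 m th] and B2 = L2_triple_bound[OF t.U_L2 d(2) m th]
  have i: "integrable lborel (\<lambda>x. rep (u r) x * drep (u r) x * \<theta> x)" "integrable lborel (\<lambda>x. rep (u t) x * drep (u t) x * \<theta> x)"
    using L2_triple_bound(1)[OF r.U_L2 r.K_L2 m th] L2_triple_bound(1)[OF t.U_L2 t.K_L2 m th] by auto
  have "F r \<psi> - F t \<psi> = (LBINT x. rep (u r) x * drep (u r) x * \<theta> x - rep (u t) x * drep (u t) x * \<theta> x)"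
    unfolding F_def \<theta>_def[symmetric] using i by simp
  also have "\<dots> = (LBINT x. (rep (u r) x - rep (u t) x) * drep (u r) x * \<theta> x + rep (u t) x * (drep (u r) x - drep (u t) x) * \<theta> x)"
    by (rule Bochner_Integration.integral_cong) (auto simp: algebra_simps)
  also have "\<dots> = (LBINT x. (rep (u r) x - rep (u t) x) * drep (u r) x * \<theta> x) + (LBINT x. rep (u t) x * (drep (u r) x - drep (u t) x) * \<theta> x)"
    by (rule Bochner_Integration.integral_add[OF B1(1) B2(1)])
  finally have eq: "F r \<psi> - F t \<psi> = (LBINT x. (rep (u r) x - rep (u t) x) * drep (u r) x * \<theta> x) + (LBINT x. rep (u t) x * (drep (u r) x - drep (u t) x) * \<theta> x)" .
  have "\<bar>F r \<psi> - F t \<psi>\<bar> \<le> 5 * l * N^2 * (l2 (\<lambda>x. rep (u r) x - rep (u t) x) * l2 (drep (u r))) + 5 * l * N^2 * (l2 (rep (u t)) * l2 (\<lambda>x. drep (u r) x - drep (u t) x))"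
    unfolding eq by (rule abs_add_le[OF B1(2) B2(2)])
  also have "\<dots> \<le> 5 * l * N^2 * (\<omega> * H) + 5 * l * N^2 * (H * \<omega>)"
  proof -
    have *: "0 \<le> Hs_norm \<sigma> f" for f by (simp add: Hs_norm_eq)
    have w0: "0 \<le> \<omega>" using *[of "\<lambda>x. u r x - u t x"] w by linarith
    have H0: "0 \<le> H" using *[of "u t"] H(1) by linarith
    have w1: "l2 (\<lambda>x. rep (u r) x - rep (u t) x) \<le> \<omega>" "l2 (\<lambda>x. drep (u r) x - drep (u t) x) \<le> \<omega>" by (rule order_trans[OF l2_dist(1)[OF t] w] order_trans[OF l2_dist(2)[OF t] w])+
    have H1: "l2 (drep (u r)) \<le> H" "l2 (rep (u t)) \<le> H" by (rule order_trans[OF rep_l2_bounds(2)[OF t(2)] H(2)] order_trans[OF rep_l2_bounds(1)[OF t(1)] H(1)])+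
    have 1: "l2 (\<lambda>x. rep (u r) x - rep (u t) x) * l2 (drep (u r)) \<le> \<omega> * H" by (rule mult_mono[OF w1(1) H1(1) w0 l2_nonneg])
    have 2: "l2 (rep (u t)) * l2 (\<lambda>x. drep (u r) x - drep (u t) x) \<le> H * \<omega>" by (rule mult_mono[OF H1(2) w1(2) H0 l2_nonneg])
    have l: "0 \<le> 5 * l * N^2" using l0 by simp
    show ?thesis by (rule add_mono[OF mult_left_mono[OF 1 l] mult_left_mono[OF 2 l]])
  qed
  finally show ?thesis by (simp add: algebra_simps)
qed

lemma Y_time_step:
  assumes t: "0 \<le> t" and h: "0 < h" and cl: "test_class N l R \<psi>" and N: "1 \<le> N"
    and H: "\<And>r. t \<le> r \<Longrightarrow> r \<le> t + h \<Longrightarrow> Hs_norm \<sigma> (u r) \<le> H" and w: "\<And>r. t \<le> r \<Longrightarrow> r \<le> t + h \<Longrightarrow> Hs_norm \<sigma> (\<lambda>x. u r x - u t x) \<le> \<omega>"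
  shows "\<bar>Y (t + h) \<psi> - Y t \<psi> - h * F t \<psi>\<bar> \<le> h * (10 * l * N^2 * (H * \<omega>))"
proof -
  note \<psi> = test_class_test[OF cl]
  have "\<exists>l z. t < z \<and> z < t + h \<and> DERIV (\<lambda>r. Y r \<psi>) z :> l \<and> Y (t + h) \<psi> - Y t \<psi> = (t + h - t) * l"
  proof (rule MVT)
    show "continuous_on {t..t + h} (\<lambda>r. Y r \<psi>)" by (rule continuous_on_subset[OF Y_continuous[OF \<psi>]]) (use t in auto)
    show "(\<lambda>r. Y r \<psi>) differentiable (at z)" if "t < z" "z < t + h" for z
      using Y_derivative[of z, OF _ \<psi>] t that real_differentiable_def by force
  qed (use h in simp)
  then obtain l' z where z: "t < z" "z < t + h" "DERIV (\<lambda>r. Y r \<psi>) z :> l'" "Y (t + h) \<psi> - Y t \<psi> = h * l'" by auto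
  have "l' = F z \<psi>" using DERIV_unique[OF z(3) Y_derivative[OF _ \<psi>]] z t by simp
  then have "Y (t + h) \<psi> - Y t \<psi> - h * F t \<psi> = h * (F z \<psi> - F t \<psi>)" using z(4) by (simp add: algebra_simps)
  moreover have "\<bar>F z \<psi> - F t \<psi>\<bar> \<le> 10 * l * N^2 * (H * \<omega>)"
    by (rule F_dist[OF t _ cl N]) (use z t h H w in auto)
  ultimately show ?thesis using h by (simp add: abs_mult)
qed

text \<open>Three errors occur: freezing the time in the derivative of the pairing, replacing the velocity by its truncation, and
  the second order remainder of transport. All powers of \<open>N\<close> in the second one are at most \<open>3 - 2\<sigma>\<close>, as \<open>1 - \<sigma> \<le> 3 - 2\<sigma>\<close> for \<open>\<sigma> \<le> 2\<close>.\<close>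

lemma one_step:
  assumes t: "0 \<le> t" and h: "0 < h" and cl: "test_class N l R \<psi>" and N: "1 \<le> N" and R: "0 \<le> R"
    and H: "\<And>r. t \<le> r \<Longrightarrow> r \<le> t + h \<Longrightarrow> Hs_norm \<sigma> (u r) \<le> H" and w: "\<And>r. t \<le> r \<Longrightarrow> r \<le> t + h \<Longrightarrow> Hs_norm \<sigma> (\<lambda>x. u r x - u t x) \<le> \<omega>"
    and L: "L = Cs \<sigma> * H" "h * L \<le> 1/4"
  shows "\<exists>\<psi>'. test_class N (l * (1 + 40 * (h * L))) (R + h * L) \<psi>' \<and>
    Y t \<psi>' - h * (l * (7 * H\<^sup>2 * N powr (3 - 2 * \<sigma>) + 10 * N^2 * (H * \<omega>) + 18 * (R + 1) * L^3 * h * N^3)) \<le> Y (t + h) \<psi>"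
proof -
  note b = test_class_bounds[OF cl] and \<psi> = test_class_test[OF cl]
  have l0: "0 \<le> l" using b(1)[of 0] by linarith
  have Ht: "Hs_norm \<sigma> (u t) \<le> H" using H[of t] h by simp
  have H0: "0 \<le> H" using Ht by (rule order_trans[rotated]) (simp add: Hs_norm_eq)
  have CL: "Cs \<sigma> * Hs_norm \<sigma> (u t) \<le> L" unfolding L by (intro mult_left_mono Ht Cs_nonneg)
  have L0: "0 \<le> L" unfolding L using H0 Cs_nonneg by simp
  obtain G where G: "smooth G" "\<And>x. \<bar>G x\<bar> \<le> Cs \<sigma> * Hs_norm \<sigma> (u t)"
    "\<And>j x. \<bar>(deriv ^^ Suc j) G x\<bar> \<le> N ^ j * (Cs \<sigma> * Hs_norm \<sigma> (u t))"
    and d: "(\<lambda>x. rep (u t) x - G x) \<in> L2" "l2 (\<lambda>x. rep (u t) x - G x) \<le> N powr (- \<sigma>) * Hs_norm \<sigma> (u t)"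
    and e: "(\<lambda>x. drep (u t) x - deriv G x) \<in> L2" "l2 (\<lambda>x. drep (u t) x - deriv G x) \<le> N powr (1 - \<sigma>) * Hs_norm \<sigma> (u t)"
    and g: "deriv (deriv G) \<in> L2" "l2 (deriv (deriv G)) \<le> N powr (2 - \<sigma>) * Hs_norm \<sigma> (u t)"
    using Hs_truncation[OF uH[OF t] s1 s2 N] by blast
  have Gj: "\<bar>(deriv ^^ Suc j) G x\<bar> \<le> L * N ^ j" for j x
  proof -
    have "N ^ j * (Cs \<sigma> * Hs_norm \<sigma> (u t)) \<le> N ^ j * L" by (rule mult_left_mono[OF CL]) (use N in simp)
    then show ?thesis using G(3)[of j x] by (simp add: mult.commute)
  qed
  have G0: "\<bar>G x\<bar> \<le> L" for x using G(2)[of x] CL by linarith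
  have G1: "\<bar>deriv G x\<bar> \<le> L" "\<bar>deriv (deriv G) x\<bar> \<le> L * N" "\<bar>deriv (deriv (deriv G)) x\<bar> \<le> L * N^2" "\<bar>deriv (deriv (deriv (deriv G))) x\<bar> \<le> L * N^3" for x
    using Gj[of 0 x] Gj[of 1 x] Gj[of 2 x] Gj[of 3 x] by (simp_all add: numeral_2_eq_2 numeral_3_eq_3)
  note tr = G(1) cl less_imp_le[OF h] N L(2) G0 G1
  define \<psi>' where "\<psi>' = transported h G \<psi>"
  have cl': "test_class N (l * (1 + 40 * (h * L))) (R + h * L) \<psi>'" unfolding \<psi>'_def by (rule test_class_transported[OF tr])
  have gen: "test_function (generator G \<psi>)" by (rule generator_test[OF tr])
  define \<rho> where "\<rho> = defect G \<psi> h"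
  have rs: "smooth \<rho>" unfolding \<rho>_def by (rule smooth_defect[OF tr])
  have rsup: "R + h * L < \<bar>x\<bar> \<Longrightarrow> \<rho> x = 0" for x unfolding \<rho>_def by (rule defect_support[OF tr])
  have rtest: "test_function \<rho>" using rs rsup by (auto simp: test_function_iff)
  have rb: "\<bar>\<rho> x\<bar> \<le> 3 * (h * L)\<^sup>2 * l * N^3" "\<bar>deriv \<rho> x\<bar> \<le> 6 * (h * L)\<^sup>2 * l * N^3" for x unfolding \<rho>_def by (rule defect_bounds[OF tr])+
  have "\<bar>Y t \<rho>\<bar> \<le> 2 * (R + h * L) * L * (3 * (h * L)\<^sup>2 * l * N^3 + 6 * (h * L)\<^sup>2 * l * N^3)"
    by (rule Y_small[OF t rtest rsup _ rb CL]) (use R h L0 in auto)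
  also have "\<dots> \<le> 2 * (R + 1) * L * (3 * (h * L)\<^sup>2 * l * N^3 + 6 * (h * L)\<^sup>2 * l * N^3)"
    using L(2) L0 l0 N by (intro mult_right_mono) auto
  also have "\<dots> = h * (l * (18 * (R + 1) * L^3 * h * N^3))" by (simp add: power2_eq_square power3_eq_cube algebra_simps)
  finally have Yr: "\<bar>Y t \<rho>\<bar> \<le> h * (l * (18 * (R + 1) * L^3 * h * N^3))" .
  have split: "Y t \<psi>' = Y t \<psi> + h * Y t (generator G \<psi>) + Y t \<rho>"
  proof -
    interpret profile "rep (u t)" "drep (u t)" "Cs \<sigma> * Hs_norm \<sigma> (u t)" using t by (intro prof) simp
    have sm: "smooth \<psi>" "smooth (deriv \<psi>)" "smooth (generator G \<psi>)" "smooth (deriv (generator G \<psi>))" "smooth (deriv \<rho>)"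
      using \<psi> gen rs by (auto simp: test_function_iff intro: smooth_deriv)
    have e0: "\<psi>' = (\<lambda>x. \<psi> x + h * generator G \<psi> x + \<rho> x)" by (auto simp: \<psi>'_def \<rho>_def defect_def[OF tr] fun_eq_iff)
    have e1: "deriv \<psi>' = (\<lambda>x. deriv \<psi> x + h * deriv (generator G \<psi>) x + deriv \<rho> x)"
      unfolding e0 by (rule ext, rule DERIV_imp_deriv) (intro DERIV_add DERIV_cmult smooth_DERIV sm rs)
    have e2: "deriv (deriv \<psi>') = (\<lambda>x. deriv (deriv \<psi>) x + h * deriv (deriv (generator G \<psi>)) x + deriv (deriv \<rho>) x)"
      unfolding e1 by (rule ext, rule DERIV_imp_deriv) (intro DERIV_add DERIV_cmult smooth_DERIV sm rs)
    have i: "integrable lborel (\<lambda>x. rep (u t) x * (f x - deriv (deriv f) x))" if "test_function f" for f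
    proof -
      have "integrable lborel (\<lambda>x. rep (u t) x * f x)" "integrable lborel (\<lambda>x. rep (u t) x * deriv (deriv f) x)"
        by (intro integrable_mult_test continuous_locally_integrable U_cont that test_function_deriv)+
      then show ?thesis by (simp add: right_diff_distrib)
    qed
    have "Y t \<psi>' = (LBINT x. rep (u t) x * (\<psi> x - deriv (deriv \<psi>) x) + h * (rep (u t) x * (generator G \<psi> x - deriv (deriv (generator G \<psi>)) x)) + rep (u t) x * (\<rho> x - deriv (deriv \<rho>) x))"
      unfolding Y_def e2 unfolding e0 by (rule Bochner_Integration.integral_cong) (auto simp: algebra_simps)
    also have "\<dots> = Y t \<psi> + h * Y t (generator G \<psi>) + Y t \<rho>"
      unfolding Y_def using i[OF \<psi>] i[OF gen] i[OF rtest] by simp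
    finally show ?thesis .
  qed
  define P where "P a = N powr a" for a
  have Pm: "P a * P b = P (a + b)" for a b unfolding P_def by (rule powr_add[symmetric])
  have PN: "N = P 1" "N^2 = P 2" using N by (simp_all add: P_def)
  have P0: "0 \<le> P a" for a by (simp add: P_def)
  have nd: "l2 (\<lambda>x. rep (u t) x - G x) \<le> P (- \<sigma>) * H" and ne: "l2 (\<lambda>x. drep (u t) x - deriv G x) \<le> P (1 - \<sigma>) * H" and ng: "l2 (deriv (deriv G)) \<le> P (2 - \<sigma>) * H"
    and nu: "l2 (rep (u t)) \<le> H"
    using order_trans[OF d(2) mult_left_mono[OF Ht]] order_trans[OF e(2) mult_left_mono[OF Ht]] order_trans[OF g(2) mult_left_mono[OF Ht]] rep_l2_bounds(1)[OF t] Ht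
    by (simp_all add: P_def)
  have "\<bar>F t \<psi> - Y t (generator G \<psi>)\<bar> \<le> l * N^2 * (l2 (\<lambda>x. drep (u t) x - deriv G x) * l2 (\<lambda>x. rep (u t) x - G x)) + l * N * (l2 (deriv (deriv G)) * l2 (\<lambda>x. rep (u t) x - G x))
     + 2 * (l * (l2 (\<lambda>x. drep (u t) x - deriv G x) * l2 (deriv (deriv G)))) + 2 * (l * (l2 (rep (u t)) * l2 (\<lambda>x. drep (u t) x - deriv G x))) + l * N * (l2 (rep (u t)) * l2 (\<lambda>x. rep (u t) x - G x))"
    by (rule linearization_error[OF t \<psi> G(1) b(1-3) d(1) e(1) g(1) gen])
  also have "\<dots> \<le> l * N^2 * ((P (1 - \<sigma>) * H) * (P (- \<sigma>) * H)) + l * N * ((P (2 - \<sigma>) * H) * (P (- \<sigma>) * H))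
     + 2 * (l * ((P (1 - \<sigma>) * H) * (P (2 - \<sigma>) * H))) + 2 * (l * (H * (P (1 - \<sigma>) * H))) + l * N * (H * (P (- \<sigma>) * H))"
  proof -
    have PH: "0 \<le> P a * H" for a using P0 H0 by simp
    have q: "0 \<le> l * N^2" "0 \<le> l * N" using l0 N by simp_all
    have 1: "l2 (\<lambda>x. drep (u t) x - deriv G x) * l2 (\<lambda>x. rep (u t) x - G x) \<le> (P (1 - \<sigma>) * H) * (P (- \<sigma>) * H)" by (rule mult_mono[OF ne nd PH l2_nonneg])
    have 2: "l2 (deriv (deriv G)) * l2 (\<lambda>x. rep (u t) x - G x) \<le> (P (2 - \<sigma>) * H) * (P (- \<sigma>) * H)" by (rule mult_mono[OF ng nd PH l2_nonneg])
    have 3: "l2 (\<lambda>x. drep (u t) x - deriv G x) * l2 (deriv (deriv G)) \<le> (P (1 - \<sigma>) * H) * (P (2 - \<sigma>) * H)" by (rule mult_mono[OF ne ng PH l2_nonneg])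
    have 4: "l2 (rep (u t)) * l2 (\<lambda>x. drep (u t) x - deriv G x) \<le> H * (P (1 - \<sigma>) * H)" by (rule mult_mono[OF nu ne H0 l2_nonneg])
    have 5: "l2 (rep (u t)) * l2 (\<lambda>x. rep (u t) x - G x) \<le> H * (P (- \<sigma>) * H)" by (rule mult_mono[OF nu nd H0 l2_nonneg])
    show ?thesis
      using mult_left_mono[OF 1 q(1)] mult_left_mono[OF 2 q(2)] mult_left_mono[OF 3 l0] mult_left_mono[OF 4 l0] mult_left_mono[OF 5 q(2)] by linarith
  qed
  also have "\<dots> = l * H\<^sup>2 * ((P 2 * P (1 - \<sigma>)) * P (- \<sigma>) + (P 1 * P (2 - \<sigma>)) * P (- \<sigma>) + 2 * (P (1 - \<sigma>) * P (2 - \<sigma>)) + 2 * P (1 - \<sigma>) + P 1 * P (- \<sigma>))"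
    using Pm[of 1 1, symmetric] unfolding PN by (simp add: power2_eq_square algebra_simps)
  also have "\<dots> = l * H\<^sup>2 * (4 * P (3 - 2 * \<sigma>) + 3 * P (1 - \<sigma>))"
    unfolding Pm by (simp add: algebra_simps)
  also have "\<dots> \<le> l * H\<^sup>2 * (4 * P (3 - 2 * \<sigma>) + 3 * P (3 - 2 * \<sigma>))"
  proof (rule mult_left_mono)
    have "P (1 - \<sigma>) \<le> P (3 - 2 * \<sigma>)" unfolding P_def by (rule powr_mono) (use N s2 in auto)
    then show "4 * P (3 - 2 * \<sigma>) + 3 * P (1 - \<sigma>) \<le> 4 * P (3 - 2 * \<sigma>) + 3 * P (3 - 2 * \<sigma>)" by simp
  qed (use l0 in simp)
  finally have lin: "\<bar>F t \<psi> - Y t (generator G \<psi>)\<bar> \<le> l * (7 * H\<^sup>2 * N powr (3 - 2 * \<sigma>))" by (simp add: P_def algebra_simps)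
  have lin': "h * \<bar>F t \<psi> - Y t (generator G \<psi>)\<bar> \<le> h * (l * (7 * H\<^sup>2 * N powr (3 - 2 * \<sigma>)))" using h by (intro mult_left_mono lin) auto
  have "\<bar>Y (t + h) \<psi> - Y t \<psi> - h * F t \<psi>\<bar> \<le> h * (10 * l * N^2 * (H * \<omega>))" by (rule Y_time_step[OF t h cl N H w])
  moreover have "h * (F t \<psi> - Y t (generator G \<psi>)) \<ge> - (h * \<bar>F t \<psi> - Y t (generator G \<psi>)\<bar>)"
    using mult_left_mono[of "- \<bar>F t \<psi> - Y t (generator G \<psi>)\<bar>" "F t \<psi> - Y t (generator G \<psi>)" h] h by simp
  ultimately have "Y t \<psi>' - h * (l * (7 * H\<^sup>2 * N powr (3 - 2 * \<sigma>))) - h * (10 * l * N^2 * (H * \<omega>)) - h * (l * (18 * (R + 1) * L^3 * h * N^3)) \<le> Y (t + h) \<psi>"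
    unfolding split using lin' Yr by (simp add: right_diff_distrib)
  then have "Y t \<psi>' - h * (l * (7 * H\<^sup>2 * N powr (3 - 2 * \<sigma>) + 10 * N^2 * (H * \<omega>) + 18 * (R + 1) * L^3 * h * N^3)) \<le> Y (t + h) \<psi>"
    by (simp add: algebra_simps)
  then show ?thesis using cl' by blast
qed

end

context dp_flow
begin

lemma Hs_norm_zero: "0 \<le> t \<Longrightarrow> Hs_norm \<sigma> (\<lambda>x. u t x - u t x) = 0"
proof -
  assume t: "0 \<le> t"
  have L: "u t \<in> L2" "(\<lambda>x. u t x - u t x) \<in> L2" using uL[OF t] L2_diff(1)[OF uL[OF t] uL[OF t]] by auto
  have w: "weighted \<sigma> (\<lambda>x. u t x - u t x) \<in> L2" using Hs_diff[OF uH[OF t] uH[OF t]] by (simp add: Hs_iff)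
  have "AE \<xi> in lborel. weighted \<sigma> (\<lambda>x. u t x - u t x) \<xi> = 0"
    using weighted_linear[OF L(1) L(1), of \<sigma> 0 0] by simp
  then show ?thesis using l2_eq_0_iff[OF w] by (simp add: Hs_norm_eq)
qed

lemma Hs_norm_triangle:
  assumes "0 \<le> r" "0 \<le> t" "0 \<le> q"
  shows "Hs_norm \<sigma> (\<lambda>x. u r x - u q x) \<le> Hs_norm \<sigma> (\<lambda>x. u r x - u t x) + Hs_norm \<sigma> (\<lambda>x. u t x - u q x)"
  using Hs_norm_le_diff[OF Hs_diff[OF uH uH] Hs_diff[OF uH uH], of r q t q] assms by simp

lemma Hs_norm_bounded:
  assumes "0 \<le> T" obtains H where "0 \<le> H" "\<And>t. 0 \<le> t \<Longrightarrow> t \<le> T \<Longrightarrow> Hs_norm \<sigma> (u t) \<le> H"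
proof -
  have "continuous_on {0..T} (\<lambda>t. Hs_norm \<sigma> (u t))"
    unfolding continuous_on_def
  proof
    fix t assume t: "t \<in> {0..T}"
    have "((\<lambda>r. Hs_norm \<sigma> (u r) - Hs_norm \<sigma> (u t)) \<longlongrightarrow> 0) (at t within {0..})"
    proof (rule Lim_null_comparison[OF _ Hs_dist])
      show "\<forall>\<^sub>F r in at t within {0..}. norm (Hs_norm \<sigma> (u r) - Hs_norm \<sigma> (u t)) \<le> Hs_norm \<sigma> (\<lambda>x. u r x - u t x)"
        using ev
      proof eventually_elim
        case (elim r)
        then have r: "0 \<le> r" and t0: "0 \<le> t" using t by auto
        show ?case
          using Hs_norm_le_diff[OF uH[OF r] uH[OF t0]] Hs_norm_le_diff[OF uH[OF t0] uH[OF r]] Hs_norm_swap[OF uH[OF r] uH[OF t0]]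
          by (simp add: abs_le_iff)
      qed
    qed (use t in simp)
    then have "((\<lambda>r. Hs_norm \<sigma> (u r)) \<longlongrightarrow> Hs_norm \<sigma> (u t)) (at t within {0..})" by (simp add: LIM_zero_iff)
    then show "((\<lambda>r. Hs_norm \<sigma> (u r)) \<longlongrightarrow> Hs_norm \<sigma> (u t)) (at t within {0..T})"
      by (rule tendsto_within_subset) auto
  qed
  then have "compact ((\<lambda>t. Hs_norm \<sigma> (u t)) ` {0..T})" by (intro compact_continuous_image compact_Icc)
  then have "bounded ((\<lambda>t. Hs_norm \<sigma> (u t)) ` {0..T})" by (rule compact_imp_bounded)
  then obtain B where B: "\<forall>x \<in> (\<lambda>t. Hs_norm \<sigma> (u t)) ` {0..T}. norm x \<le> B" by (auto simp: bounded_iff)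
  show ?thesis
  proof (rule that[of "max B 0"])
    fix t assume "0 \<le> t" "t \<le> T"
    then have "norm (Hs_norm \<sigma> (u t)) \<le> B" using B by auto
    then show "Hs_norm \<sigma> (u t) \<le> max B 0" by (simp add: abs_le_iff)
  qed simp
qed

lemma Hs_uniformly_continuous:
  assumes T: "0 \<le> T" and w: "0 < \<omega>"
  obtains e where "0 < e" "\<And>r t. 0 \<le> r \<Longrightarrow> r \<le> T \<Longrightarrow> 0 \<le> t \<Longrightarrow> t \<le> T \<Longrightarrow> \<bar>r - t\<bar> < e \<Longrightarrow> Hs_norm \<sigma> (\<lambda>x. u r x - u t x) \<le> \<omega>"
proof -
  have "\<exists>d>0. \<forall>r\<ge>0. \<bar>r - t\<bar> < d \<longrightarrow> Hs_norm \<sigma> (\<lambda>x. u r x - u t x) < \<omega> / 2" if t: "0 \<le> t" for t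
  proof -
    have "\<forall>\<^sub>F r in at t within {0..}. Hs_norm \<sigma> (\<lambda>x. u r x - u t x) < \<omega> / 2"
      by (rule order_tendstoD(2)[OF Hs_dist[OF t]]) (use w in simp)
    then obtain d where d: "0 < d" "\<And>r. 0 \<le> r \<Longrightarrow> r \<noteq> t \<Longrightarrow> \<bar>r - t\<bar> < d \<Longrightarrow> Hs_norm \<sigma> (\<lambda>x. u r x - u t x) < \<omega> / 2"
      by (auto simp: eventually_at dist_real_def)
    have "Hs_norm \<sigma> (\<lambda>x. u r x - u t x) < \<omega> / 2" if "0 \<le> r" "\<bar>r - t\<bar> < d" for r
      using d(2)[OF that(1) _ that(2)] Hs_norm_zero[OF t] w by (cases "r = t") auto
    then show ?thesis using d(1) by blast
  qed
  then obtain d where d: "\<And>t. 0 \<le> t \<Longrightarrow> 0 < d t" "\<And>t r. 0 \<le> t \<Longrightarrow> 0 \<le> r \<Longrightarrow> \<bar>r - t\<bar> < d t \<Longrightarrow> Hs_norm \<sigma> (\<lambda>x. u r x - u t x) < \<omega> / 2"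
    by metis
  define CC where "CC = (\<lambda>t. ball t (d t)) ` {0..T}"
  have "\<exists>e>0. \<forall>x\<in>{0..T}. \<exists>B\<in>CC. ball x e \<subseteq> B"
  proof (rule Heine_Borel_lemma[of "{0..T}" CC])
    show "{0..T} \<subseteq> \<Union> CC" unfolding CC_def using d(1) by force
  qed (auto simp: CC_def)
  then obtain e where e: "0 < e" "\<And>x. x \<in> {0..T} \<Longrightarrow> \<exists>B\<in>CC. ball x e \<subseteq> B" by blast
  show ?thesis
  proof (rule that[OF e(1)])
    fix r t assume r: "0 \<le> r" "r \<le> T" and t: "0 \<le> t" "t \<le> T" and rt: "\<bar>r - t\<bar> < e"
    obtain q where q: "q \<in> {0..T}" "ball t e \<subseteq> ball q (d q)" using e(2)[of t] t by (auto simp: CC_def)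
    have b: "r \<in> ball t e" "t \<in> ball t e" using rt e(1) by (auto simp: dist_real_def abs_minus_commute)
    have "r \<in> ball q (d q)" "t \<in> ball q (d q)" by (rule subsetD[OF q(2) b(1)], rule subsetD[OF q(2) b(2)])
    then have "Hs_norm \<sigma> (\<lambda>x. u r x - u q x) < \<omega> / 2" "Hs_norm \<sigma> (\<lambda>x. u t x - u q x) < \<omega> / 2"
      using d(2)[of q r] d(2)[of q t] q(1) r t by (auto simp: dist_real_def abs_minus_commute)
    moreover have "Hs_norm \<sigma> (\<lambda>x. u r x - u t x) \<le> Hs_norm \<sigma> (\<lambda>x. u r x - u q x) + Hs_norm \<sigma> (\<lambda>x. u q x - u t x)"
      using Hs_norm_triangle[of r q t] r t q(1) by simp
    moreover have "Hs_norm \<sigma> (\<lambda>x. u q x - u t x) = Hs_norm \<sigma> (\<lambda>x. u t x - u q x)"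
      using q(1) t by (intro Hs_norm_swap uH) auto
    ultimately show "Hs_norm \<sigma> (\<lambda>x. u r x - u t x) \<le> \<omega>" by linarith
  qed
qed

text \<open>Going back from time \<open>T\<close> to time 0 in \<open>n\<close> steps, the bounds on the test function grow at most by \<open>exp (40 L T)\<close>,
  uniformly in \<open>n\<close> and \<open>N\<close>, so the errors add up to \<open>T\<close> times the error per unit of time.\<close>

lemma iterated_steps:
  assumes T: "0 < T" and n: "0 < n" and N: "1 \<le> N" and R: "0 \<le> R" and l: "0 \<le> l"
    and H: "\<And>t. 0 \<le> t \<Longrightarrow> t \<le> T \<Longrightarrow> Hs_norm \<sigma> (u t) \<le> H" and H0: "0 \<le> H" and w0: "0 \<le> \<omega>"
    and w: "\<And>r t. 0 \<le> r \<Longrightarrow> r \<le> T \<Longrightarrow> 0 \<le> t \<Longrightarrow> t \<le> T \<Longrightarrow> \<bar>r - t\<bar> < e \<Longrightarrow> Hs_norm \<sigma> (\<lambda>x. u r x - u t x) \<le> \<omega>"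
    and he: "T / real n < e" and L: "L = Cs \<sigma> * H" "T / real n * L \<le> 1/4"
    and init: "\<And>\<psi>. test_function \<psi> \<Longrightarrow> (\<And>x. 0 \<le> \<psi> x) \<Longrightarrow> 0 \<le> Y 0 \<psi>"
    and cl: "test_class N l R \<psi>"
  shows "- (T * (l * exp (40 * L * T) * (7 * H\<^sup>2 * N powr (3 - 2 * \<sigma>) + 10 * N^2 * (H * \<omega>) + 18 * (R + L * T + 1) * L^3 * (T / real n) * N^3))) \<le> Y T \<psi>"
proof -
  define h where "h = T / real n"
  have h: "0 < h" using T n by (simp add: h_def)
  have nh: "real n * h = T" using n by (simp add: h_def)
  have L0: "0 \<le> L" unfolding L using H0 Cs_nonneg by simp
  define l' where "l' = l * exp (40 * L * T)"
  define B where "B = l' * (7 * H\<^sup>2 * N powr (3 - 2 * \<sigma>) + 10 * N^2 * (H * \<omega>) + 18 * (R + L * T + 1) * L^3 * h * N^3)"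
  have "\<forall>\<psi>. test_class N (l * (1 + 40 * (h * L)) ^ (n - j)) (R + real (n - j) * (h * L)) \<psi> \<longrightarrow> - (real j * h * B) \<le> Y (real j * h) \<psi>" if "j \<le> n" for j
    using that
  proof (induction j)
    case 0
    show ?case using init test_class_test test_class_bounds(5) by fastforce
  next
    case (Suc j)
    show ?case
    proof (intro allI impI)
      fix \<psi> assume c: "test_class N (l * (1 + 40 * (h * L)) ^ (n - Suc j)) (R + real (n - Suc j) * (h * L)) \<psi>"
      define k where "k = n - Suc j"
      have nj: "n - j = Suc k" using Suc.prems by (simp add: k_def)
      define lk where "lk = l * (1 + 40 * (h * L)) ^ k"
      define Rk where "Rk = R + real k * (h * L)"
      have hL0: "0 \<le> h * L" using h L0 by simp
      have kh: "real k * h \<le> T" using h n unfolding nh[symmetric] by (intro mult_right_mono) (auto simp: k_def)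
      have khL: "real k * (h * L) \<le> L * T" using mult_right_mono[OF kh L0] by (simp add: mult_ac)
      have R0: "0 \<le> Rk" unfolding Rk_def using R hL0 by simp
      have RB: "Rk \<le> R + L * T" unfolding Rk_def using khL by simp
      have "(1 + 40 * (h * L)) ^ k \<le> exp (40 * (h * L)) ^ k"
        using hL0 by (intro power_mono exp_ge_add_one_self) auto
      also have "\<dots> = exp (40 * (real k * (h * L)))" by (simp add: exp_of_nat_mult[symmetric] mult_ac)
      also have "\<dots> \<le> exp (40 * L * T)" using khL by simp
      finally have lB: "lk \<le> l'" unfolding lk_def l'_def using l by (intro mult_left_mono)
      have lk0: "0 \<le> lk" unfolding lk_def using l hL0 by simp
      have jh: "0 \<le> real j * h" using h by simp
      have jT: "real j * h + h \<le> T"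
      proof -
        have "real (Suc j) * h \<le> real n * h" using Suc.prems h by (intro mult_right_mono) auto
        then show ?thesis unfolding nh by (simp add: algebra_simps)
      qed
      have "\<exists>\<psi>'. test_class N (lk * (1 + 40 * (h * L))) (Rk + h * L) \<psi>' \<and>
        Y (real j * h) \<psi>' - h * (lk * (7 * H\<^sup>2 * N powr (3 - 2 * \<sigma>) + 10 * N^2 * (H * \<omega>) + 18 * (Rk + 1) * L^3 * h * N^3)) \<le> Y (real j * h + h) \<psi>"
      proof (rule one_step[OF jh h _ N R0 _ _ L(1)])
        show "test_class N lk Rk \<psi>" using c by (simp add: lk_def Rk_def k_def)
        show "Hs_norm \<sigma> (u r) \<le> H" if "real j * h \<le> r" "r \<le> real j * h + h" for r using that jh jT by (intro H) linarith+
        show "Hs_norm \<sigma> (\<lambda>x. u r x - u (real j * h) x) \<le> \<omega>" if "real j * h \<le> r" "r \<le> real j * h + h" for r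
          using that jh jT he[folded h_def] h by (intro w) linarith+
        show "h * L \<le> 1/4" using L(2) by (simp add: h_def)
      qed
      then obtain \<psi>' where p: "test_class N (lk * (1 + 40 * (h * L))) (Rk + h * L) \<psi>'"
        "Y (real j * h) \<psi>' - h * (lk * (7 * H\<^sup>2 * N powr (3 - 2 * \<sigma>) + 10 * N^2 * (H * \<omega>) + 18 * (Rk + 1) * L^3 * h * N^3)) \<le> Y (real j * h + h) \<psi>" by blast
      have "lk * (1 + 40 * (h * L)) = l * (1 + 40 * (h * L)) ^ (n - j)" "Rk + h * L = R + real (n - j) * (h * L)"
        unfolding nj lk_def Rk_def by (simp_all add: algebra_simps)
      then have IH: "- (real j * h * B) \<le> Y (real j * h) \<psi>'" using Suc.IH Suc.prems p(1) by simp
      have "18 * (Rk + 1) * L^3 * h * N^3 \<le> 18 * (R + L * T + 1) * L^3 * h * N^3"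
        using RB L0 h N by (intro mult_right_mono) auto
      then have in_le: "7 * H\<^sup>2 * N powr (3 - 2 * \<sigma>) + 10 * N^2 * (H * \<omega>) + 18 * (Rk + 1) * L^3 * h * N^3 \<le> 7 * H\<^sup>2 * N powr (3 - 2 * \<sigma>) + 10 * N^2 * (H * \<omega>) + 18 * (R + L * T + 1) * L^3 * h * N^3"
        by simp
      have in0: "0 \<le> 7 * H\<^sup>2 * N powr (3 - 2 * \<sigma>) + 10 * N^2 * (H * \<omega>) + 18 * (Rk + 1) * L^3 * h * N^3"
        using R0 L0 h N H0 w0 by simp
      have "lk * (7 * H\<^sup>2 * N powr (3 - 2 * \<sigma>) + 10 * N^2 * (H * \<omega>) + 18 * (Rk + 1) * L^3 * h * N^3) \<le> B"
        unfolding B_def by (rule mult_mono[OF lB in_le order_trans[OF lk0 lB] in0])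
      then have "h * (lk * (7 * H\<^sup>2 * N powr (3 - 2 * \<sigma>) + 10 * N^2 * (H * \<omega>) + 18 * (Rk + 1) * L^3 * h * N^3)) \<le> h * B"
        using h by (intro mult_left_mono) auto
      moreover have "real (Suc j) * h = real j * h + h" "real (Suc j) * h * B = real j * h * B + h * B" by (simp_all add: algebra_simps)
      ultimately show "- (real (Suc j) * h * B) \<le> Y (real (Suc j) * h) \<psi>" using IH p(2) by simp
    qed
  qed
  from this[of n] have "- (real n * h * B) \<le> Y (real n * h) \<psi>" using cl by simp
  then show ?thesis unfolding nh unfolding B_def l'_def unfolding h_def .
qed

lemma test_class_exists:
  assumes \<psi>: "test_function \<psi>" "\<And>x. 0 \<le> \<psi> x"
  obtains l R where "0 \<le> l" "0 \<le> R" "\<And>N. 1 \<le> N \<Longrightarrow> test_class N l R \<psi>"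
proof -
  obtain R where R: "\<And>x. R < \<bar>x\<bar> \<Longrightarrow> \<psi> x = 0" using \<psi>(1) by (auto simp: test_function_iff)
  note t = test_function_deriv[OF \<psi>(1)]
  note t2 = test_function_deriv[OF t]
  note t3 = test_function_deriv[OF t2]
  obtain B0 where B0: "\<And>x. \<bar>\<psi> x\<bar> \<le> B0" using test_function_bounded[OF \<psi>(1)] by blast
  obtain B1 where B1: "\<And>x. \<bar>deriv \<psi> x\<bar> \<le> B1" using test_function_bounded[OF t] by blast
  obtain B2 where B2: "\<And>x. \<bar>deriv (deriv \<psi>) x\<bar> \<le> B2" using test_function_bounded[OF t2] by blast
  obtain B3 where B3: "\<And>x. \<bar>deriv (deriv (deriv \<psi>)) x\<bar> \<le> B3" using test_function_bounded[OF t3] by blast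
  define l where "l = \<bar>B0\<bar> + \<bar>B1\<bar> + \<bar>B2\<bar> + \<bar>B3\<bar>"
  have l0: "0 \<le> l" by (simp add: l_def)
  show ?thesis
  proof (rule that[OF l0, of "max R 0"])
    fix N :: real assume N: "1 \<le> N"
    have p: "l \<le> l * N ^ k" for k using mult_left_mono[OF one_le_power[OF N, of k] l0] by simp
    have "\<bar>\<psi> x\<bar> \<le> l \<and> \<bar>deriv \<psi> x\<bar> \<le> l * N \<and> \<bar>deriv (deriv \<psi>) x\<bar> \<le> l * N^2 \<and> \<bar>deriv (deriv (deriv \<psi>)) x\<bar> \<le> l * N^3" for x
      using B0[of x] B1[of x] B2[of x] B3[of x] p[of 1] p[of 2] p[of 3] unfolding l_def by (simp only: power_one_right) linarith
    then show "test_class N l (max R 0) \<psi>" unfolding test_class_def using \<psi> R by (auto simp: test_function_iff)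
  qed simp
qed

text \<open>The parameters are chosen in the order \<open>N\<close>, then \<open>\<omega>\<close>, then the number of steps: the truncation error is small for large
  \<open>N\<close>, and for this fixed \<open>N\<close> the other two vanish with the length of the steps.\<close>

theorem momentum_nonneg_persists:
  assumes init: "\<And>\<psi>. test_function \<psi> \<Longrightarrow> (\<And>x. 0 \<le> \<psi> x) \<Longrightarrow> 0 \<le> Y 0 \<psi>"
    and T: "0 \<le> T" and \<psi>: "test_function \<psi>" "\<And>x. 0 \<le> \<psi> x"
  shows "0 \<le> Y T \<psi>"
proof (cases "T = 0")
  case True then show ?thesis using init \<psi> by simp
next
  case False
  then have T0: "0 < T" using T by simp
  show ?thesis
  proof (rule ccontr)
    assume "\<not> 0 \<le> Y T \<psi>"
    define \<delta> where "\<delta> = - Y T \<psi>"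
    have d: "0 < \<delta>" using \<open>\<not> 0 \<le> Y T \<psi>\<close> by (simp add: \<delta>_def)
    obtain l R where lR: "0 \<le> l" "0 \<le> R" "\<And>N. 1 \<le> N \<Longrightarrow> test_class N l R \<psi>" using test_class_exists[OF \<psi>] by blast
    obtain H where H: "0 \<le> H" "\<And>t. 0 \<le> t \<Longrightarrow> t \<le> T \<Longrightarrow> Hs_norm \<sigma> (u t) \<le> H" using Hs_norm_bounded[OF T] by blast
    define L where "L = Cs \<sigma> * H"
    define K where "K = T * (l * exp (40 * L * T))"
    have K0: "0 \<le> K" using T0 lR by (simp add: K_def)
    have "((\<lambda>N::real. K * (7 * H\<^sup>2 * N powr (3 - 2 * \<sigma>))) \<longlongrightarrow> K * (7 * H\<^sup>2 * 0)) at_top"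
      by (intro tendsto_mult tendsto_const tendsto_neg_powr filterlim_ident) (use s1 in simp)
    then have "\<forall>\<^sub>F N in at_top. K * (7 * H\<^sup>2 * N powr (3 - 2 * \<sigma>)) < \<delta> / 4"
      by (rule order_tendstoD(2)) (use d in simp)
    then have "\<forall>\<^sub>F N in at_top. K * (7 * H\<^sup>2 * N powr (3 - 2 * \<sigma>)) < \<delta> / 4 \<and> 1 \<le> N"
      using eventually_ge_at_top by (rule eventually_conj)
    then obtain N :: real where N: "K * (7 * H\<^sup>2 * N powr (3 - 2 * \<sigma>)) < \<delta> / 4" "1 \<le> N"
      using eventually_happens'[OF trivial_limit_at_top_linorder] by blast
    define c where "c = K * (10 * N^2 * H)"
    have c0: "0 \<le> c" using K0 H by (simp add: c_def)
    \<comment> \<open>Each of the three errors is kept below \<open>\<delta>/4\<close>, where \<open>-\<delta>\<close> is the supposed negative value.\<close>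
    define \<omega> where "\<omega> = \<delta> / (4 * (1 + c))"
    have w: "0 < \<omega>" using d c0 by (simp add: \<omega>_def)
    have "c * \<omega> = (\<delta> / 4) * (c / (1 + c))" by (simp add: \<omega>_def)
    also have "\<dots> \<le> (\<delta> / 4) * 1" using d c0 by (intro mult_left_mono) auto
    finally have cw: "K * (10 * N^2 * (H * \<omega>)) \<le> \<delta> / 4" by (simp add: c_def mult_ac)
    obtain e where e: "0 < e" "\<And>r t. 0 \<le> r \<Longrightarrow> r \<le> T \<Longrightarrow> 0 \<le> t \<Longrightarrow> t \<le> T \<Longrightarrow> \<bar>r - t\<bar> < e \<Longrightarrow> Hs_norm \<sigma> (\<lambda>x. u r x - u t x) \<le> \<omega>"
      using Hs_uniformly_continuous[OF T w] by blast
    have hn: "(\<lambda>n. T / real n) \<longlonglongrightarrow> 0" by (rule lim_const_over_n)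
    have "(\<lambda>n. T / real n * L) \<longlonglongrightarrow> 0 * L" by (intro tendsto_mult hn tendsto_const)
    then have 1: "\<forall>\<^sub>F n in sequentially. T / real n * L < 1/4" by (rule order_tendstoD(2)) simp
    have "(\<lambda>n. K * (18 * (R + L * T + 1) * L^3 * (T / real n) * N^3)) \<longlonglongrightarrow> K * (18 * (R + L * T + 1) * L^3 * 0 * N^3)"
      by (intro tendsto_mult hn tendsto_const)
    then have 2: "\<forall>\<^sub>F n in sequentially. K * (18 * (R + L * T + 1) * L^3 * (T / real n) * N^3) < \<delta> / 4" by (rule order_tendstoD(2)) (use d in simp)
    have 3: "\<forall>\<^sub>F n in sequentially. T / real n < e" by (rule order_tendstoD(2)[OF hn e(1)])
    have "\<forall>\<^sub>F n in sequentially. T / real n * L < 1/4 \<and> K * (18 * (R + L * T + 1) * L^3 * (T / real n) * N^3) < \<delta> / 4 \<and> T / real n < e \<and> 0 < n"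
      using 1 2 3 eventually_gt_at_top[of 0] by eventually_elim simp
    then obtain n where n: "T / real n * L < 1/4" "K * (18 * (R + L * T + 1) * L^3 * (T / real n) * N^3) < \<delta> / 4" "T / real n < e" "0 < n"
      using eventually_happens'[OF sequentially_bot] by blast
    have "- (T * (l * exp (40 * L * T) * (7 * H\<^sup>2 * N powr (3 - 2 * \<sigma>) + 10 * N^2 * (H * \<omega>) + 18 * (R + L * T + 1) * L^3 * (T / real n) * N^3))) \<le> Y T \<psi>"
      by (rule iterated_steps[OF T0 n(4) N(2) lR(2) lR(1) H(2) H(1) less_imp_le[OF w] e(2) n(3) L_def less_imp_le[OF n(1)] init lR(3)[OF N(2)]])
    then have "- (K * (7 * H\<^sup>2 * N powr (3 - 2 * \<sigma>)) + K * (10 * N^2 * (H * \<omega>)) + K * (18 * (R + L * T + 1) * L^3 * (T / real n) * N^3)) \<le> - \<delta>"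
      by (simp only: K_def \<delta>_def mult.assoc[of T] distrib_left minus_minus)
    then show False using N(1) cw n(2) d by linarith
  qed
qed

end

section \<open>Consequences of a nonnegative momentum\<close>

lemma smooth_exp_scaled: "smooth (\<lambda>x. exp (c * x))"
proof (rule smooth_coinduct[where P="\<lambda>f. \<exists>k. f = (\<lambda>x. k * exp (c * x))"])
  show "\<exists>k. (\<lambda>x. exp (c * x)) = (\<lambda>x. k * exp (c * x))" by (rule exI[of _ 1]) simp
  fix g assume "\<exists>k. g = (\<lambda>x. k * exp (c * x))"
  then obtain k where k: "g = (\<lambda>x. k * exp (c * x))" by blast
  have "(g has_real_derivative (k * c) * exp (c * x)) (at x)" for x
    unfolding k by (auto intro!: derivative_eq_intros)
  then show "\<exists>g'. (\<exists>k. g' = (\<lambda>x. k * exp (c * x))) \<and> (\<forall>x. (g has_real_derivative g' x) (at x))"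
    by (intro exI[of _ "\<lambda>x. (k * c) * exp (c * x)"]) auto
qed

text \<open>A smooth step: the primitive of a bump.\<close>

definition step :: "real \<Rightarrow> real" where
  "step x = (LBINT y. indicator {..x} y * bump (-1) 1 0 y)"

lemma bump0_cont: "continuous_on UNIV (bump (-1) 1 0)"
  using bump_test smooth_continuous by (auto simp: test_function_iff)

lemma bump0_integrable: "integrable lborel (bump (-1) 1 0)"
  by (rule integrable_compact_support[OF bump0_cont, of 1]) (auto intro!: bump_outside)

lemma step_deriv: "(step has_real_derivative bump (-1) 1 0 x) (at x)"
  unfolding step_def
  by (rule tail_integral_deriv[OF bump0_cont]) (use integrable_mult_indicator[OF _ bump0_integrable] in simp)

lemma smooth_step: "smooth step"
proof (rule smooth_coinduct[where P="\<lambda>f. f = step \<or> smooth f"])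
  fix g assume "g = step \<or> smooth g"
  then show "\<exists>g'. (g' = step \<or> smooth g') \<and> (\<forall>x. (g has_real_derivative g' x) (at x))"
  proof
    assume "g = step"
    then show ?thesis using step_deriv bump_test[of "-1" 1 0] by (auto simp: test_function_iff)
  next
    assume "smooth g"
    then show ?thesis using smooth_DERIV smooth_deriv by blast
  qed
qed simp

lemma step_mono: "x \<le> y \<Longrightarrow> step x \<le> step y"
  by (rule DERIV_nonneg_imp_nondecreasing) (use step_deriv bump_bounds in blast)+

lemma step_outside: "x \<le> -1 \<Longrightarrow> step x = 0" "1 \<le> x \<Longrightarrow> step x = step 1"
proof -
  assume "x \<le> -1"
  then have "(\<lambda>y. indicator {..x} y * bump (-1) 1 0 y) = (\<lambda>y. 0)" by (auto simp: fun_eq_iff indicator_def intro!: bump_outside)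
  then show "step x = 0" by (simp add: step_def)
next
  assume "1 \<le> x"
  then have "(\<lambda>y. indicator {..x} y * bump (-1) 1 0 y) = (\<lambda>y. indicator {..1} y * bump (-1) 1 0 y)"
    by (auto simp: fun_eq_iff indicator_def intro!: bump_outside)
  then show "step x = step 1" by (simp add: step_def)
qed

lemma bump0_integral_pos: "0 < (LBINT y. bump (-1) 1 0 y)"
proof -
  have [measurable]: "bump (-1) 1 0 \<in> borel_measurable borel" by (rule test_function_measurable[OF bump_test])
  have "(LBINT y. bump (-1) 1 0 y) \<noteq> 0"
  proof
    assume "(LBINT y. bump (-1) 1 0 y) = 0"
    then have ae: "AE y in lborel. bump (-1) 1 0 y = 0"
      using integral_nonneg_eq_0_iff_AE[OF bump0_integrable] bump_bounds by auto
    have "bump (-1) 1 0 y \<noteq> 0" if "y \<in> {0..1/2}" for y using that by (auto simp: bump_def flat_def)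
    then have sub: "{0..1/2} \<subseteq> {y \<in> space lborel. \<not> bump (-1) 1 0 y = 0}" by auto
    have null: "{y \<in> space lborel. \<not> bump (-1) 1 0 y = 0} \<in> null_sets lborel"
      by (rule AE_E2[OF ae, THEN null_setsI]) measurable
    have "{0..1/2::real} \<in> null_sets lborel" by (rule null_sets_subset[OF null _ sub]) simp
    then show False by (simp add: null_sets_def emeasure_lborel_Icc_eq)
  qed
  moreover have "0 \<le> (LBINT y. bump (-1) 1 0 y)" by (rule Bochner_Integration.integral_nonneg) (rule bump_bounds)
  ultimately show ?thesis by simp
qed

text \<open>The test functions are smoothed indicators of \<open>[a, b]\<close>: their derivative is a bump at \<open>a\<close> minus a bump at \<open>b\<close>, and
  concentrating the bumps leaves \<open>w a - w b\<close>.\<close>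

lemma antimono_if_weak_derivative_nonpos:
  assumes w: "continuous_on UNIV (w :: real \<Rightarrow> real)"
    and pos: "\<And>\<eta>. test_function \<eta> \<Longrightarrow> (\<And>x. 0 \<le> \<eta> x) \<Longrightarrow> 0 \<le> (LBINT x. w x * deriv \<eta> x)"
    and ab: "a < b"
  shows "w b \<le> w a"
proof -
  have [measurable]: "w \<in> borel_measurable borel" using w by (rule borel_measurable_continuous_onI)
  have [measurable]: "bump (-1) 1 0 \<in> borel_measurable borel" by (rule test_function_measurable[OF bump_test])
  define J where "J p n = (LBINT y. w (p + y / real (Suc n)) * bump (-1) 1 0 y)" for p n
  have lim: "(\<lambda>n. J p n) \<longlonglongrightarrow> w p * (LBINT y. bump (-1) 1 0 y)" for p
  proof -
    have "compact (w ` {p - 1..p + 1})" by (intro compact_continuous_image continuous_on_subset[OF w] compact_Icc) auto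
    from compact_imp_bounded[OF this] obtain B where "\<forall>x\<in>{p - 1..p + 1}. \<bar>w x\<bar> \<le> B" by (auto simp: bounded_iff)
    then have B: "\<And>x. x \<in> {p - 1..p + 1} \<Longrightarrow> \<bar>w x\<bar> \<le> B" by blast
    have "(\<lambda>n. J p n) \<longlonglongrightarrow> (LBINT y. w p * bump (-1) 1 0 y)" unfolding J_def
    proof (rule integral_dominated_convergence)
      show "integrable lborel (\<lambda>y. B * bump (-1) 1 0 y)" using bump0_integrable by simp
      show "AE y in lborel. (\<lambda>n. w (p + y / real (Suc n)) * bump (-1) 1 0 y) \<longlonglongrightarrow> w p * bump (-1) 1 0 y"
      proof (rule AE_I2, rule tendsto_mult[OF _ tendsto_const])
        fix y
        have "(\<lambda>n. p + y * inverse (real (Suc n))) \<longlonglongrightarrow> p + y * 0" by (intro tendsto_intros LIMSEQ_inverse_real_of_nat)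
        then have "(\<lambda>n. p + y / real (Suc n)) \<longlonglongrightarrow> p" by (simp add: divide_inverse)
        moreover have "isCont w p" using w by (simp add: continuous_on_eq_continuous_at)
        ultimately show "(\<lambda>n. w (p + y / real (Suc n))) \<longlonglongrightarrow> w p" using isCont_tendsto_compose by blast
      qed
      show "AE y in lborel. norm (w (p + y / real (Suc n)) * bump (-1) 1 0 y) \<le> B * bump (-1) 1 0 y" for n
      proof (rule AE_I2)
        fix y
        show "norm (w (p + y / real (Suc n)) * bump (-1) 1 0 y) \<le> B * bump (-1) 1 0 y"
        proof (cases "y \<in> {-1<..<1}")
          case True
          have "\<bar>y / real (Suc n)\<bar> \<le> \<bar>y\<bar> / 1" unfolding abs_divide by (rule divide_left_mono) auto
          then have "\<bar>y / real (Suc n)\<bar> \<le> 1" using True by (simp only: greaterThanLessThan_iff) linarith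
          then have "p + y / real (Suc n) \<in> {p - 1..p + 1}" by (simp only: atLeastAtMost_iff abs_le_iff) linarith
          then show ?thesis using B bump_bounds(1)[of "-1" 1 0 y] by (simp add: abs_mult mult_right_mono del: of_nat_Suc)
        qed (simp add: bump_outside)
      qed
    qed auto
    then show ?thesis by simp
  qed
  have ge: "J b n \<le> J a n" for n
  proof -
    define m where "m = real (Suc n)"
    have m: "0 < m" by (simp add: m_def)
    define \<eta> where "\<eta> x = step (m * (x - a)) - step (m * (x - b))" for x
    have sm: "smooth \<eta>" unfolding \<eta>_def by (intro smooth_diff smooth_comp[OF smooth_step] smooth_mult smooth_const smooth_ident)
    have out: "\<eta> x = 0" if "\<bar>a\<bar> + \<bar>b\<bar> + 1 / m < \<bar>x\<bar>" for x
    proof (cases "0 \<le> x")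
      case True
      then have "1 / m \<le> x - a" "1 / m \<le> x - b" using that by linarith+
      then have "1 \<le> m * (x - a)" "1 \<le> m * (x - b)" using m by (auto simp: pos_divide_le_eq mult.commute)
      then have "step (m * (x - a)) = step 1" "step (m * (x - b)) = step 1" using step_outside(2)[of "m * (x - a)"] step_outside(2)[of "m * (x - b)"] by blast+
      then show ?thesis unfolding \<eta>_def by simp
    next
      case False
      then have "1 / m \<le> - (x - a)" "1 / m \<le> - (x - b)" using that by linarith+
      then have "1 \<le> m * - (x - a)" "1 \<le> m * - (x - b)" using m by (auto simp: pos_divide_le_eq mult.commute)
      then have "m * (x - a) \<le> -1" "m * (x - b) \<le> -1" by (simp_all only: mult_minus_right)
      then show ?thesis unfolding \<eta>_def by (simp add: step_outside(1))
    qed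
    have nn: "0 \<le> \<eta> x" for x
      unfolding \<eta>_def using step_mono[of "m * (x - b)" "m * (x - a)"] ab m by simp
    have dd: "deriv \<eta> x = m * bump (-1) 1 0 (m * (x - a)) - m * bump (-1) 1 0 (m * (x - b))" for x
    proof (rule DERIV_imp_deriv)
      have "((\<lambda>x. step (m * (x - p))) has_real_derivative bump (-1) 1 0 (m * (x - p)) * m) (at x)" for p
        by (rule DERIV_chain2[OF step_deriv]) (auto intro!: derivative_eq_intros)
      from DERIV_diff[OF this[of a] this[of b]]
      show "(\<eta> has_real_derivative m * bump (-1) 1 0 (m * (x - a)) - m * bump (-1) 1 0 (m * (x - b))) (at x)"
        unfolding \<eta>_def[abs_def] by (simp add: mult.commute)
    qed
    have sub: "integrable lborel (\<lambda>x. w x * (m * bump (-1) 1 0 (m * (x - p))))" "(LBINT x. w x * (m * bump (-1) 1 0 (m * (x - p)))) = J p n" for p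
    proof -
      show "integrable lborel (\<lambda>x. w x * (m * bump (-1) 1 0 (m * (x - p))))"
      proof (rule integrable_compact_support[of _ "\<bar>p\<bar> + 1 / m"])
        show "continuous_on UNIV (\<lambda>x. w x * (m * bump (-1) 1 0 (m * (x - p))))"
          by (intro continuous_intros w continuous_on_compose2[OF bump0_cont]) auto
        fix x assume "\<bar>p\<bar> + 1 / m < \<bar>x\<bar>"
        then have "1 / m \<le> \<bar>x - p\<bar>" by linarith
        then have "1 \<le> \<bar>m * (x - p)\<bar>" using m by (simp add: pos_divide_le_eq abs_mult mult.commute)
        then have "m * (x - p) \<notin> {-1<..<1}" by (auto simp: abs_if split: if_splits)
        then show "w x * (m * bump (-1) 1 0 (m * (x - p))) = 0" by (simp add: bump_outside)
      qed
      have "J p n = m * (LBINT x. w (p + (- m * p + m * x) / m) * bump (-1) 1 0 (- m * p + m * x))"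
        unfolding J_def m_def[symmetric] using lborel_integral_real_affine[of m "\<lambda>y. w (p + y / m) * bump (-1) 1 0 y" "- m * p"] m by simp
      also have "\<dots> = (LBINT x. w x * (m * bump (-1) 1 0 (m * (x - p))))"
      proof -
        have e: "p + (- m * p + m * x) / m = x" "- m * p + m * x = m * (x - p)" for x using m by (simp_all add: field_simps)
        show ?thesis unfolding integral_mult_right_zero[symmetric] e(1) unfolding e(2)
          by (rule Bochner_Integration.integral_cong) (auto simp: mult_ac)
      qed
      finally show "(LBINT x. w x * (m * bump (-1) 1 0 (m * (x - p)))) = J p n" by simp
    qed
    have "0 \<le> (LBINT x. w x * deriv \<eta> x)" using sm out by (intro pos nn) (auto simp: test_function_iff)
    also have "\<dots> = J a n - J b n" unfolding dd right_diff_distrib[of "w _"] sub(2)[symmetric] by (rule Bochner_Integration.integral_diff[OF sub(1) sub(1)])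
    finally show ?thesis by simp
  qed
  have "w b * (LBINT y. bump (-1) 1 0 y) \<le> w a * (LBINT y. bump (-1) 1 0 y)"
    by (rule LIMSEQ_le[OF lim lim]) (use ge in auto)
  then show ?thesis using bump0_integral_pos by simp
qed

lemma ltail_one: assumes "0 < b" shows "ltail b (\<lambda>y. 1) x = 1 / b"
proof -
  have c: "ltail b (\<lambda>y. 1) z = (LBINT y. indicator {0..} y * exp (- b * y))" for z
    unfolding ltail_def using integral_translate(2)[of "\<lambda>y. indicator {0..} y * exp (- b * y)" z]
    by (simp add: indicator_def cong: if_cong)
  have "(LBINT y. exp (- b * \<bar>y\<bar>)) = (LBINT y. exp (- b * \<bar>0 - y\<bar>) * 1)" by simp
  also have "\<dots> = ltail b (\<lambda>y. 1) 0 + rtail b (\<lambda>y. 1) 0" by (rule exp_convolution_eq_tails[OF assms, of _ 1]) auto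
  also have "\<dots> = 2 * ltail b (\<lambda>y. 1) x" using c[of 0] c[of x] by (simp add: rtail_def)
  finally show ?thesis using exp_kernel_integral(2)[OF assms] by simp
qed

context profile
begin

definition momentum_nonneg :: bool where
  "momentum_nonneg \<longleftrightarrow> (\<forall>\<psi>. test_function \<psi> \<longrightarrow> (\<forall>x. 0 \<le> \<psi> x) \<longrightarrow> 0 \<le> (LBINT x. U x * (\<psi> x - deriv (deriv \<psi>) x)))"

text \<open>Nonnegativity of \<open>u - u''\<close> says that \<open>e\<^bsup>-x\<^esup> (u + u')\<close> is nonincreasing. Were it negative somewhere, \<open>u + u'\<close> would tend to
  \<open>-\<infinity>\<close> exponentially fast, against boundedness.\<close>

lemma slope_bound:
  assumes pos: momentum_nonneg shows "0 \<le> U x + K x"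
proof -
  define w where "w x = exp (- x) * (U x + K x)" for x
  have wc: "continuous_on UNIV w" unfolding w_def by (intro continuous_intros U_cont K_cont)
  have anti: "w b \<le> w a" if "a < b" for a b
  proof (rule antimono_if_weak_derivative_nonpos[OF wc _ that])
    fix \<eta> assume t: "test_function \<eta>" and nn: "\<And>x. 0 \<le> \<eta> x"
    have sm: "smooth \<eta>" "smooth (deriv \<eta>)" using t test_function_deriv[OF t] by (auto simp: test_function_iff)
    define \<psi> where "\<psi> x = exp (-1 * x) * \<eta> x" for x
    have tp: "test_function \<psi>" using t smooth_mult[OF smooth_exp_scaled[of "-1"] sm(1)] by (auto simp: test_function_iff \<psi>_def[abs_def])
    have d\<psi>: "deriv \<psi> x = exp (- x) * (deriv \<eta> x - \<eta> x)" for x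
      by (rule DERIV_imp_deriv, unfold \<psi>_def[abs_def], rule DERIV_cong[OF DERIV_mult[OF DERIV_chain2[OF DERIV_exp DERIV_cmult[OF DERIV_ident]] smooth_DERIV[OF sm(1)]]])
        (simp add: algebra_simps)
    have it: "integrable lborel (\<lambda>x. c x * \<eta> x)" "integrable lborel (\<lambda>x. c x * deriv \<eta> x)" if "continuous_on UNIV c" for c
      by (intro integrable_mult_test continuous_locally_integrable that t test_function_deriv)+
    have ip: "integrable lborel (\<lambda>x. U x * \<psi> x)" "integrable lborel (\<lambda>x. U x * deriv (deriv \<psi>) x)" "integrable lborel (\<lambda>x. K x * deriv \<psi> x)"
      by (intro integrable_mult_test continuous_locally_integrable U_cont K_cont tp test_function_deriv)+
    have "\<And>x. 0 \<le> \<psi> x" using nn by (simp add: \<psi>_def)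
    then have "0 \<le> (LBINT x. U x * (\<psi> x - deriv (deriv \<psi>) x))"
      by (rule pos[unfolded momentum_nonneg_def, rule_format, OF tp])
    also have "\<dots> = (LBINT x. U x * \<psi> x) - (LBINT x. U x * deriv (deriv \<psi>) x)"
      unfolding right_diff_distrib by (rule Bochner_Integration.integral_diff[OF ip(1,2)])
    also have "\<dots> = (LBINT x. U x * \<psi> x + K x * deriv \<psi> x)"
      using integral_by_parts_test[OF U_der K_cont test_function_deriv[OF tp]] ip by simp
    also have "\<dots> = (LBINT x. w x * deriv \<eta> x)"
    proof -
      have i1: "integrable lborel (\<lambda>x. U x * \<psi> x + K x * deriv \<psi> x)" using ip by simp
      have i2: "integrable lborel (\<lambda>x. w x * deriv \<eta> x)" by (rule it(2)[OF wc])
      have "(LBINT x. w x * deriv \<eta> x - (U x * \<psi> x + K x * deriv \<psi> x)) = 0"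
      proof (rule integral_derivative_eq_0[where F="\<lambda>x. (exp (- x) * U x) * \<eta> x"])
        show "((\<lambda>x. (exp (- x) * U x) * \<eta> x) has_real_derivative w x * deriv \<eta> x - (U x * \<psi> x + K x * deriv \<psi> x)) (at x)" for x
          unfolding d\<psi> by (auto intro!: derivative_eq_intros U_der smooth_DERIV[OF sm(1)] simp: w_def \<psi>_def algebra_simps)
        show "continuous_on UNIV (\<lambda>x. w x * deriv \<eta> x - (U x * \<psi> x + K x * deriv \<psi> x))"
          unfolding d\<psi> \<psi>_def by (intro continuous_intros wc U_cont K_cont smooth_continuous sm)
        show "integrable lborel (\<lambda>x. (exp (- x) * U x) * \<eta> x)" by (intro it continuous_intros U_cont)
      qed (use i1 i2 in simp)
      then show ?thesis using i1 i2 by simp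
    qed
    finally show "0 \<le> (LBINT x. w x * deriv \<eta> x)" .
  qed
  show ?thesis
  proof (rule ccontr)
    assume "\<not> 0 \<le> U x + K x"
    then have neg: "w x < 0" by (simp add: w_def mult_pos_neg)
    \<comment> \<open>Far enough to the right for \<open>e\<^sup>y w x\<close> to fall below \<open>-2M - 1\<close>, using \<open>e\<^bsup>y - x\<^esup> \<ge> y - x\<close>.\<close>
    define y where "y = x + 1 + (2 * M + 1) / (- w x) * exp (- x)"
    have c0: "0 \<le> (2 * M + 1) / (- w x) * exp (- x)" using neg M_nonneg by (intro mult_nonneg_nonneg divide_nonneg_pos) auto
    have "x < y" using c0 by (simp add: y_def)
    have "(2 * M + 1) / (- w x) * exp (- x) \<le> exp (y - x)"
      using exp_ge_add_one_self[of "y - x"] by (simp add: y_def)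
    then have "exp x * ((2 * M + 1) / (- w x) * exp (- x)) \<le> exp x * exp (y - x)" by (rule mult_left_mono) simp
    also have "\<dots> = exp y" by (simp add: exp_add[symmetric])
    finally have ey: "exp x * ((2 * M + 1) / (- w x) * exp (- x)) \<le> exp y" .
    have "U y + K y = exp y * w y" by (simp add: w_def exp_minus)
    also have "\<dots> \<le> exp y * w x" using anti[OF \<open>x < y\<close>] by simp
    also have "\<dots> \<le> exp x * ((2 * M + 1) / (- w x) * exp (- x)) * w x"
      by (rule mult_right_mono_neg[OF ey]) (use neg in simp)
    also have "\<dots> = - (2 * M + 1)" using neg exp_not_eq_zero[of x] by (simp add: exp_minus field_simps)
    finally show False using U_bd[of y] K_bd[of y] by linarith
  qed
qed

text \<open>As \<open>e\<^sup>x u\<close> is nondecreasing, \<open>u(s) \<ge> e\<^bsup>x - s\<^esup> u(x)\<close> to the right of \<open>x\<close>; integration against \<open>e\<^bsup>-2(s - x)\<^esup>\<close> gives the factor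
  \<open>\<integral> e\<^bsup>-3s\<^esup> = 1/3\<close>.\<close>

lemma U_le_rtail:
  assumes pos: momentum_nonneg and Unn: "\<And>x. 0 \<le> U x" shows "U x \<le> 3 * rtail 2 U x"
proof -
  have mono: "exp x * U x \<le> exp s * U s" if "x \<le> s" for s
  proof (rule DERIV_nonneg_imp_nondecreasing[OF that])
    fix z
    have "((\<lambda>z. exp z * U z) has_real_derivative exp z * (U z + K z)) (at z)"
      by (auto intro!: derivative_eq_intros U_der simp: algebra_simps)
    then show "\<exists>y. ((\<lambda>z. exp z * U z) has_real_derivative y) (at z) \<and> 0 \<le> y" using slope_bound[OF pos, of z] by (intro exI[of _ "exp z * (U z + K z)"]) simp
  qed
  have m: "(\<lambda>y. U (- y)) \<in> borel_measurable borel" by simp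
  have "U x * (1 / 3) = (LBINT y. U x * (indicator {..- x} y * (exp (- 3 * (- x - y)) * 1)))"
    using ltail_one[of 3 "-x"] by (simp add: ltail_def)
  also have "\<dots> \<le> rtail 2 U x" unfolding rtail_def ltail_def
  proof (rule integral_mono)
    show "integrable lborel (\<lambda>y. U x * (indicator {..- x} y * (exp (- 3 * (- x - y)) * 1)))"
      using ltail_integrand_integrable(1)[of 3 "\<lambda>y. 1" 1 "-x"] by simp
    show "integrable lborel (\<lambda>y. indicator {..- x} y * (exp (- 2 * (- x - y)) * U (- y)))"
      using ltail_integrand_integrable(1)[of 2 "\<lambda>y. U (- y)" M "-x"] m U_bd by simp
    fix y
    show "U x * (indicator {..- x} y * (exp (- 3 * (- x - y)) * 1)) \<le> indicator {..- x} y * (exp (- 2 * (- x - y)) * U (- y))"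
    proof (cases "y \<le> - x")
      case True
      have "exp (x + y) * U x = exp y * (exp x * U x)" by (simp add: exp_add)
      also have "\<dots> \<le> exp y * (exp (- y) * U (- y))" using mono[of "- y"] True by (intro mult_left_mono) auto
      also have "\<dots> = U (- y)" by (simp add: exp_minus)
      finally have "exp (- 2 * (- x - y)) * (exp (x + y) * U x) \<le> exp (- 2 * (- x - y)) * U (- y)" by (intro mult_left_mono) auto
      moreover have "exp (- 3 * (- x - y)) = exp (- 2 * (- x - y)) * exp (x + y)" by (simp add: exp_add[symmetric])
      ultimately show ?thesis using True by (simp add: mult_ac)
    qed simp
  qed
  finally show ?thesis by simp
qed

lemma reflected: "profile (\<lambda>x. U (- x)) (\<lambda>x. - K (- x)) M"
proof
  show "((\<lambda>x. U (- x)) has_real_derivative - K (- x)) (at x)" for x using U_der[of "- x"] by (simp add: DERIV_mirror)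
  show "continuous_on UNIV (\<lambda>x. - K (- x))" by (intro continuous_intros continuous_on_compose2[OF K_cont]) auto
  show "(\<lambda>x. U (- x)) \<in> L2" "(\<lambda>x. - K (- x)) \<in> L2" using L2_reflect(1)[OF U_L2] L2_cmult(1)[OF L2_reflect(1)[OF K_L2], of "-1"] by auto
qed (use U_bd K_bd in auto)

lemma reflected_momentum:
  assumes pos: momentum_nonneg shows "profile.momentum_nonneg (\<lambda>x. U (- x))"
  unfolding profile.momentum_nonneg_def[OF reflected]
proof (intro allI impI)
  fix \<psi> :: "real \<Rightarrow> real" assume t: "test_function \<psi>" and nn: "\<forall>x. 0 \<le> \<psi> x"
  have sm: "smooth \<psi>" "smooth (deriv \<psi>)" using t test_function_deriv[OF t] by (auto simp: test_function_iff)
  define \<phi> where "\<phi> x = \<psi> (- x)" for x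
  have "smooth (\<lambda>x. \<psi> ((-1) * x))" by (intro smooth_comp[OF sm(1)] smooth_mult smooth_const smooth_ident)
  moreover obtain R where "\<forall>x. R < \<bar>x\<bar> \<longrightarrow> \<psi> x = 0" using t by (auto simp: test_function_iff)
  then have "\<forall>x. R < \<bar>x\<bar> \<longrightarrow> \<psi> (- x) = 0" by simp
  ultimately have tp: "test_function \<phi>" by (auto simp: test_function_iff \<phi>_def[abs_def])
  have d1: "deriv \<phi> = (\<lambda>x. - deriv \<psi> (- x))" unfolding \<phi>_def[abs_def]
    by (rule ext, rule DERIV_imp_deriv) (use smooth_DERIV[OF sm(1)] in \<open>simp add: DERIV_mirror[symmetric]\<close>)
  have dm: "((\<lambda>x. deriv \<psi> (- x)) has_real_derivative - deriv (deriv \<psi>) (- x)) (at x)" for x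
    using smooth_DERIV[OF sm(2), of "- x"] by (simp add: DERIV_mirror)
  have d2: "deriv (deriv \<phi>) = (\<lambda>x. deriv (deriv \<psi>) (- x))" unfolding d1
    by (rule ext, rule DERIV_imp_deriv) (use DERIV_minus[OF dm] in simp)
  have "0 \<le> (LBINT x. U x * (\<phi> x - deriv (deriv \<phi>) x))" using nn by (intro pos[unfolded momentum_nonneg_def, rule_format, OF tp]) (simp add: \<phi>_def)
  also have "\<dots> = (LBINT x. U (- x) * (\<psi> x - deriv (deriv \<psi>) x))"
    unfolding d2 \<phi>_def by (subst integral_reflect[symmetric]) simp
  finally show "0 \<le> (LBINT x. U (- x) * (\<psi> x - deriv (deriv \<psi>) x))" .
qed

lemma U_nonneg: assumes pos: momentum_nonneg shows "0 \<le> U x"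
  using slope_bound[OF pos, of x] profile.slope_bound[OF reflected reflected_momentum[OF pos], of "- x"] by simp

text \<open>The right-hand side is three times the smaller one of the two tails that make up \<open>V\<close> and \<open>W\<close>.\<close>

theorem U_le_V_W:
  assumes pos: momentum_nonneg shows "U x \<le> 6 * V x - 3 * \<bar>W x\<bar>" "0 \<le> V x"
proof -
  have 1: "U x \<le> 3 * rtail 2 U x" by (rule U_le_rtail[OF pos U_nonneg[OF pos]])
  have "U (- (- x)) \<le> 3 * rtail 2 (\<lambda>x. U (- x)) (- x)"
    by (rule profile.U_le_rtail[OF reflected reflected_momentum[OF pos]]) (rule U_nonneg[OF pos])
  then have 2: "U x \<le> 3 * ltail 2 U x" by (simp add: rtail_def)
  have 3: "V x = (ltail 2 U x + rtail 2 U x) / 4" "W x = (rtail 2 U x - ltail 2 U x) / 2" by (simp_all add: V_def W_def res_def dres_def)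
  show "U x \<le> 6 * V x - 3 * \<bar>W x\<bar>" using 1 2 unfolding 3 abs_if by (auto simp: field_simps)
  show "0 \<le> V x" using 1 2 U_nonneg[OF pos, of x] unfolding 3 by simp
qed

end

section \<open>The maximum of the smoothed profile\<close>

lemma DERIV_mult_abs: "((\<lambda>x::real. x * \<bar>x\<bar>) has_real_derivative 2 * \<bar>x\<bar>) (at x)"
proof (cases "x = 0")
  case True
  have "((\<lambda>h. \<bar>h\<bar>) \<longlongrightarrow> (0::real)) (at 0)" by (auto intro!: tendsto_eq_intros)
  then have "((\<lambda>h::real. h * \<bar>h\<bar> / h) \<longlongrightarrow> 0) (at 0)"
    by (rule Lim_transform_eventually) (auto simp: eventually_at_filter)
  then show ?thesis using True by (simp add: DERIV_def)
next
  case False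
  have pos: "((\<lambda>x::real. x * \<bar>x\<bar>) has_real_derivative 2 * y) (at y)" if "0 < y" for y
    by (rule has_field_derivative_transform_within_open[of "\<lambda>x. x * x" _ _ "{0<..}"])
      (use that in \<open>auto intro!: derivative_eq_intros\<close>)
  have neg: "((\<lambda>x::real. x * \<bar>x\<bar>) has_real_derivative - 2 * y) (at y)" if "y < 0" for y
    by (rule has_field_derivative_transform_within_open[of "\<lambda>x. - (x * x)" _ _ "{..<0}"])
      (use that in \<open>auto intro!: derivative_eq_intros\<close>)
  show ?thesis using False pos[of x] neg[of x] by (cases "0 < x") auto
qed

text \<open>On each interval between consecutive points, and on the two half-lines, the integral of \<open>|f|\<close> is at least the change of \<open>F\<close>;
  as \<open>F\<close> vanishes at infinity every value is counted twice.\<close>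

lemma total_variation_ge_alternating_sum:
  fixes F f :: "real \<Rightarrow> real"
  assumes der: "\<And>x. (F has_real_derivative f x) (at x)" and cf: "continuous_on UNIV f"
    and iF: "integrable lborel F" and i_f: "integrable lborel f"
    and alt: "\<And>i. i < n \<Longrightarrow> a i < b i \<and> b i < a (Suc i)"
  shows "2 * ((\<Sum>i\<le>n. F (a i)) - (\<Sum>i<n. F (b i))) \<le> (LBINT x. \<bar>f x\<bar>)"
proof -
  define I where "I y = (LBINT x. indicator {..y} x * \<bar>f x\<bar>)" for y :: real
  note bot = integral_derivative_at_bot(2)[OF der cf iF i_f] and top = integral_derivative_at_top(2)[OF der cf iF i_f]
  have i1: "integrable lborel (\<lambda>x. indicator {..y} x * f x)" "integrable lborel (\<lambda>x. indicator {y..} x * f x)"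
    "integrable lborel (\<lambda>x. indicator {..y} x * \<bar>f x\<bar>)" "integrable lborel (\<lambda>x. indicator {y..} x * \<bar>f x\<bar>)" for y
    using integrable_mult_indicator[OF _ i_f] integrable_mult_indicator[OF _ integrable_abs[OF i_f]] by auto
  have start: "F y \<le> I y" for y
    unfolding bot[of y, symmetric] I_def by (rule integral_mono[OF i1(1,3)]) (auto split: split_indicator)
  have step: "\<bar>F z - F y\<bar> \<le> I z - I y" if "y \<le> z" for y z
  proof -
    have d: "F z - F y = (LBINT x. indicator {..z} x * f x - indicator {..y} x * f x)"
      unfolding bot[symmetric] by (rule Bochner_Integration.integral_diff[symmetric, OF i1(1) i1(1)])
    have e: "I z - I y = (LBINT x. indicator {..z} x * \<bar>f x\<bar> - indicator {..y} x * \<bar>f x\<bar>)"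
      unfolding I_def by (rule Bochner_Integration.integral_diff[symmetric, OF i1(3) i1(3)])
    have j: "integrable lborel (\<lambda>x. indicator {..z} x * f x - indicator {..y} x * f x)"
      "integrable lborel (\<lambda>x. indicator {..z} x * \<bar>f x\<bar> - indicator {..y} x * \<bar>f x\<bar>)" using i1 by simp_all
    have "\<bar>F z - F y\<bar> \<le> (LBINT x. \<bar>indicator {..z} x * f x - indicator {..y} x * f x\<bar>)"
      unfolding d by (rule integral_abs_bound)
    also have "\<dots> \<le> I z - I y" unfolding e
      by (rule integral_mono[OF integrable_abs[OF j(1)] j(2)]) (use that in \<open>auto split: split_indicator\<close>)
    finally show ?thesis .
  qed
  have "2 * ((\<Sum>i<k. F (a i)) - (\<Sum>i<k. F (b i))) + F (a k) \<le> I (a k)" if "k \<le> n" for k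
    using that
  proof (induction k)
    case 0 then show ?case using start by simp
  next
    case (Suc k)
    then have IH: "2 * ((\<Sum>i<k. F (a i)) - (\<Sum>i<k. F (b i))) + F (a k) \<le> I (a k)" by simp
    have "a k < b k" "b k < a (Suc k)" using alt[of k] Suc.prems by auto
    then show ?case using IH step[of "a k" "b k"] step[of "b k" "a (Suc k)"] by simp
  qed
  from this[of n] have 1: "2 * ((\<Sum>i<n. F (a i)) - (\<Sum>i<n. F (b i))) + F (a n) \<le> I (a n)" by simp
  have "F (a n) = (LBINT x. - (indicator {a n..} x * f x))" using top[of "a n"] by simp
  also have "\<dots> \<le> (LBINT x. indicator {a n..} x * \<bar>f x\<bar>)"
    by (rule integral_mono) (use i1(2,4)[of "a n"] in \<open>auto split: split_indicator\<close>)
  finally have "I (a n) + F (a n) \<le> (LBINT x. \<bar>f x\<bar>)"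
    using integral_eq_sum_half_lines[OF integrable_abs[OF i_f], of "a n"] by (simp add: I_def)
  then show ?thesis using 1 by (simp add: lessThan_Suc_atMost[symmetric])
qed

context profile
begin

lemma V_attains_max:
  assumes nn: "\<And>x. 0 \<le> V x" shows "\<exists>\<xi>. \<forall>x. V x \<le> V \<xi>"
proof (cases "\<forall>x. V x = 0")
  case False
  then obtain x0 where x0: "0 < V x0" using nn less_eq_real_def by metis
  have d: "((\<lambda>x. V x * V x) has_real_derivative 2 * (V x * W x)) (at x)" for x
    by (rule DERIV_cong[OF DERIV_mult[OF V_der V_der]]) simp
  have c: "continuous_on UNIV (\<lambda>x. 2 * (V x * W x))" by (intro continuous_intros VW_cont)
  have i: "integrable lborel (\<lambda>x. V x * V x)" "integrable lborel (\<lambda>x. 2 * (V x * W x))" using ib1[of V V] ib1[of V W] by auto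
  have p: "0 < V x0 * V x0" using x0 by simp
  have less: "V x < V x0" if "V x * V x < V x0 * V x0" for x
    using that power_less_imp_less_base[of "V x" 2 "V x0"] x0 by (simp add: power2_eq_square)
  obtain r where r: "\<And>x. r \<le> x \<Longrightarrow> V x * V x < V x0 * V x0"
    using order_tendstoD(2)[OF integral_derivative_at_top(1)[OF d c i] p] by (auto simp: eventually_at_top_linorder)
  obtain l where l: "\<And>x. x \<le> l \<Longrightarrow> V x * V x < V x0 * V x0"
    using order_tendstoD(2)[OF integral_derivative_at_bot(1)[OF d c i] p] by (auto simp: eventually_at_bot_linorder)
  have lx: "l < x0" "x0 < r" using l[of x0] r[of x0] by (auto simp: not_le[symmetric])
  obtain z where z: "z \<in> {l..r}" "\<And>x. x \<in> {l..r} \<Longrightarrow> V x \<le> V z"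
    using continuous_attains_sup[of "{l..r}" V] lx continuous_on_subset[OF VW_cont(1)] by auto
  have "V x \<le> V z" for x
  proof (cases "x \<in> {l..r}")
    case False
    then have "V x < V x0" using l[of x] r[of x] by (intro less) auto
    then show ?thesis using z(2)[of x0] lx by simp
  qed (rule z(2))
  then show ?thesis by blast
qed auto

lemma V_abs_W_integrable:
  "integrable lborel (\<lambda>x. V x * \<bar>W x\<bar>)" "integrable lborel (\<lambda>x. V x * (V x * \<bar>W x\<bar>))"
proof -
  have "integrable lborel (\<lambda>x. \<bar>W x * V x\<bar>)" using ib1[of W V] by simp
  then have i: "integrable lborel (\<lambda>x. V x * W x)" using ib1[of V W] by simp
  show 1: "integrable lborel (\<lambda>x. V x * \<bar>W x\<bar>)"
    by (rule Bochner_Integration.integrable_bound[OF i]) (auto simp: abs_mult)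
  have j: "integrable lborel (\<lambda>x. V x * V x * W x)" using ib2[of V M V W, OF PQVW_meas(3) VW_bd(1)] by simp
  show "integrable lborel (\<lambda>x. V x * (V x * \<bar>W x\<bar>))"
    by (rule Bochner_Integration.integrable_bound[OF j]) (auto simp: abs_mult)
qed

lemma energy_controls_alternating_sum:
  assumes nn: "\<And>x. 0 \<le> V x" and alt: "\<And>i. i < n \<Longrightarrow> a i < b i \<and> b i < a (Suc i)"
  shows "(\<Sum>i\<le>n. (V (a i))\<^sup>2) - (\<Sum>i<n. (V (b i))\<^sup>2) \<le> (LBINT x. V x * \<bar>W x\<bar>)"
proof -
  have "2 * ((\<Sum>i\<le>n. 1/2 * (V (a i))\<^sup>2) - (\<Sum>i<n. 1/2 * (V (b i))\<^sup>2)) \<le> (LBINT x. \<bar>V x * W x\<bar>)"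
  proof (rule total_variation_ge_alternating_sum[where F="\<lambda>x. 1/2 * (V x)\<^sup>2"])
    show "((\<lambda>x. 1/2 * (V x)\<^sup>2) has_real_derivative V x * W x) (at x)" for x
      by (rule derivative_eq_intros V_der refl)+ simp
    show "continuous_on UNIV (\<lambda>x. V x * W x)" by (intro continuous_intros VW_cont)
    show "integrable lborel (\<lambda>x. 1/2 * (V x)\<^sup>2)" using ib1[of V V] by (simp add: power2_eq_square)
  qed (use ib1[of V W] alt in auto)
  then show ?thesis using nn unfolding sum_distrib_left[symmetric] by (simp add: abs_mult)
qed

text \<open>For the peakon \<open>U = e\<^bsup>-|x|\<^esup>\<close> one has \<open>V = e\<^bsup>-|x|\<^esup>/3 - e\<^bsup>-2|x|\<^esup>/6\<close>, and then \<open>peak_dev\<close> vanishes identically; its weighted squares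
  measure the distance from the peakon. Again \<open>4V - U\<close> stands for \<open>V''\<close>.\<close>

definition peak_dev where "peak_dev x = 2 * V x + (4 * V x - U x) - 3 * \<bar>W x\<bar>"
definition peak_wt where "peak_wt x = 16 * V x - (4 * V x - U x) - 6 * \<bar>W x\<bar>"

lemma peak_dev_integrable: "integrable lborel (\<lambda>x. (peak_dev x)\<^sup>2)"
proof -
  have "(\<lambda>x. \<bar>W x\<bar>) \<in> L2" using L2_dominated(1)[OF VW_L2(2), of "\<lambda>x. \<bar>W x\<bar>"] by simp
  then have "(\<lambda>x. 2 * V x + (4 * V x - U x) - 3 * \<bar>W x\<bar>) \<in> L2" by (intro L2_diff L2_add L2_cmult VW_L2 U_L2)
  then show ?thesis by (simp add: L2_def peak_dev_def)
qed

lemma peak_wt_bounded: "\<bar>peak_wt x\<bar> \<le> 19 * M"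
  using VW_bd[of x] U_bd[of x] unfolding peak_wt_def by linarith

lemma peak_measurable[measurable]: "peak_dev \<in> borel_measurable borel" "peak_wt \<in> borel_measurable borel"
  unfolding peak_dev_def[abs_def] peak_wt_def[abs_def] by measurable

lemma weighted_peak_dev_integrable: "integrable lborel (\<lambda>x. peak_wt x * (peak_dev x)\<^sup>2)"
proof (rule Bochner_Integration.integrable_bound[where f="\<lambda>x. 19 * M * (peak_dev x)\<^sup>2"])
  show "AE x in lborel. norm (peak_wt x * (peak_dev x)\<^sup>2) \<le> norm (19 * M * (peak_dev x)\<^sup>2)"
    using peak_wt_bounded M_nonneg by (intro AE_I2) (auto simp: abs_mult intro!: mult_right_mono)
qed (use peak_dev_integrable in auto)

lemma integral_peak_dev:
  "(LBINT x. (peak_dev x)\<^sup>2) = (LBINT x. U x * (U x - 3 * V x)) - 12 * (LBINT x. V x * \<bar>W x\<bar>)"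
proof -
  define e where "e x = 4 * (V x)\<^sup>2 + 5 * (W x)\<^sup>2 + (4 * V x - U x)\<^sup>2" for x
  have je: "integrable lborel e"
    using ib1[of V V] ib1[of W W] L2_mult_integrable[OF L2_diff(1)[OF L2_cmult(1)[OF VW_L2(1), of 4] U_L2] L2_diff(1)[OF L2_cmult(1)[OF VW_L2(1), of 4] U_L2]]
    by (simp add: power2_eq_square e_def[abs_def])
  have sq: "\<bar>w\<bar> * \<bar>w\<bar> = w * w" for w :: real by (simp add: abs_mult[symmetric])
  have "(LBINT x. (peak_dev x)\<^sup>2 - (e x - 12 * (V x * \<bar>W x\<bar>))) = 0"
  proof (rule integral_derivative_eq_0[where F="\<lambda>x. 4 * (V x * W x) - 3 * (W x * \<bar>W x\<bar>)"])
    show "((\<lambda>x. 4 * (V x * W x) - 3 * (W x * \<bar>W x\<bar>)) has_real_derivative (peak_dev x)\<^sup>2 - (e x - 12 * (V x * \<bar>W x\<bar>))) (at x)" for x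
      by (rule DERIV_cong[OF DERIV_diff[OF DERIV_cmult[OF DERIV_mult[OF V_der W_der]] DERIV_cmult[OF DERIV_chain2[OF DERIV_mult_abs W_der]]]])
        (simp add: peak_dev_def e_def power2_eq_square algebra_simps sq)
    show "continuous_on UNIV (\<lambda>x. (peak_dev x)\<^sup>2 - (e x - 12 * (V x * \<bar>W x\<bar>)))"
      unfolding peak_dev_def e_def by (intro continuous_intros U_cont VW_cont)
    have "integrable lborel (\<lambda>x. W x * \<bar>W x\<bar>)"
      by (rule Bochner_Integration.integrable_bound[OF ib1[of W W]]) (auto simp: abs_mult)
    then show "integrable lborel (\<lambda>x. 4 * (V x * W x) - 3 * (W x * \<bar>W x\<bar>))" using ib1[of V W] by simp
  qed (use peak_dev_integrable je V_abs_W_integrable(1) in simp)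
  then show ?thesis unfolding energy_identity e_def[symmetric] using peak_dev_integrable je V_abs_W_integrable(1) by simp
qed

lemma integral_weighted_peak_dev:
  "(LBINT x. peak_wt x * (peak_dev x)\<^sup>2) = (LBINT x. (U x)^3) - 216 * (LBINT x. V x * (V x * \<bar>W x\<bar>))"
proof -
  have iU: "integrable lborel (\<lambda>x. (U x)^3)" using ib2[of U M U U, OF UK_meas(1) U_bd] by (simp add: power3_eq_cube)
  have sq: "\<bar>w\<bar> * \<bar>w\<bar> = w * w" "\<bar>w\<bar> * (\<bar>w\<bar> * z) = w * (w * z)" for w z :: real by (simp_all add: abs_mult[symmetric] mult.assoc[symmetric])
  have "(LBINT x. peak_wt x * (peak_dev x)\<^sup>2 - ((U x)^3 - 216 * (V x * (V x * \<bar>W x\<bar>)))) = 0"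
  proof (rule integral_derivative_eq_0[where F="\<lambda>x. 108 * (V x * V x * W x) - 54 * (V x * (W x * \<bar>W x\<bar>)) + 9 * (W x * W x * W x)"])
    have eq: "108 * ((V x * W x + W x * V x) * W x + w * (V x * V x)) - 54 * (W x * (W x * \<bar>W x\<bar>) + (2 * \<bar>W x\<bar> * w) * V x) + 9 * ((W x * w + w * W x) * W x + w * (W x * W x))
        = (16 * V x - w - 6 * \<bar>W x\<bar>) * (2 * V x + w - 3 * \<bar>W x\<bar>)\<^sup>2 - ((4 * V x - w) ^ 3 - 216 * (V x * (V x * \<bar>W x\<bar>)))" for x w
      by (cases "0 \<le> W x") (simp_all add: power2_eq_square power3_eq_cube algebra_simps)
    show "((\<lambda>x. 108 * (V x * V x * W x) - 54 * (V x * (W x * \<bar>W x\<bar>)) + 9 * (W x * W x * W x)) has_real_derivative peak_wt x * (peak_dev x)\<^sup>2 - ((U x)^3 - 216 * (V x * (V x * \<bar>W x\<bar>)))) (at x)" for x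
      by (rule DERIV_cong[OF DERIV_add[OF DERIV_diff[OF DERIV_cmult[OF DERIV_mult[OF DERIV_mult[OF V_der V_der] W_der]]
          DERIV_cmult[OF DERIV_mult[OF V_der DERIV_chain2[OF DERIV_mult_abs W_der]]]] DERIV_cmult[OF DERIV_mult[OF DERIV_mult[OF W_der W_der] W_der]]]])
        (use eq[of x "4 * V x - U x"] in \<open>simp add: peak_wt_def peak_dev_def algebra_simps\<close>)
    show "continuous_on UNIV (\<lambda>x. peak_wt x * (peak_dev x)\<^sup>2 - ((U x)^3 - 216 * (V x * (V x * \<bar>W x\<bar>))))"
      unfolding peak_dev_def peak_wt_def by (intro continuous_intros U_cont VW_cont)
    have "integrable lborel (\<lambda>x. \<bar>W x\<bar> * V x * W x)"
      by (rule ib2[of "\<lambda>x. \<bar>W x\<bar>" M]) (use VW_bd in auto)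
    then have 1: "integrable lborel (\<lambda>x. V x * (W x * \<bar>W x\<bar>))" by (simp add: mult_ac)
    show "integrable lborel (\<lambda>x. 108 * (V x * V x * W x) - 54 * (V x * (W x * \<bar>W x\<bar>)) + 9 * (W x * W x * W x))"
      using 1 ib2[of V M V W, OF PQVW_meas(3) VW_bd(1)] ib2[of W M W W, OF PQVW_meas(4) VW_bd(2)] by simp
  qed (use weighted_peak_dev_integrable iU V_abs_W_integrable(2) in simp)
  then show ?thesis using weighted_peak_dev_integrable iU V_abs_W_integrable(2) by simp
qed

text \<open>The squared deviation has a nonnegative integral, so that \<open>12 \<integral> V|W|\<close> is at most the energy.\<close>

theorem alternating_sum_le_energy:
  assumes "\<And>x. 0 \<le> V x" "\<And>i. i < n \<Longrightarrow> a i < b i \<and> b i < a (Suc i)"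
  shows "(\<Sum>i\<le>n. (V (a i))\<^sup>2) - (\<Sum>i<n. (V (b i))\<^sup>2) \<le> (LBINT x. U x * (U x - 3 * V x)) / 12"
proof -
  have "0 \<le> (LBINT x. (peak_dev x)\<^sup>2)" by simp
  then show ?thesis using energy_controls_alternating_sum[of n a b, OF assms] unfolding integral_peak_dev by simp
qed

text \<open>The pointwise bound on \<open>U\<close> gives \<open>peak_wt \<le> 18 V(\<xi>)\<close>. After inserting the two integral identities there remains
  \<open>216 \<integral> V|W|(V(\<xi>) - V)\<close>. This integral is the total variation of \<open>V(\<xi>) V\<^sup>2/2 - V\<^sup>3/3\<close>, hence at least twice
  the value \<open>V(\<xi>)\<^sup>3/6\<close> of that function at \<open>\<xi>\<close>.\<close>

theorem cubic_le_energy_max: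
  assumes key: "\<And>x. U x \<le> 6 * V x - 3 * \<bar>W x\<bar>" and nn: "\<And>x. 0 \<le> V x" and mx: "\<And>x. V x \<le> V \<xi>"
  shows "(LBINT x. (U x)^3) \<le> 18 * V \<xi> * (LBINT x. U x * (U x - 3 * V x)) - 72 * V \<xi> ^ 3"
proof -
  define m where "m = V \<xi>"
  note i = V_abs_W_integrable
  have hm: "peak_wt x \<le> 18 * m" for x using key[of x] mx[of x] unfolding peak_wt_def m_def by linarith
  have "(LBINT x. peak_wt x * (peak_dev x)\<^sup>2) \<le> (LBINT x. 18 * m * (peak_dev x)\<^sup>2)"
    by (rule integral_mono[OF weighted_peak_dev_integrable]) (use peak_dev_integrable hm in \<open>auto intro!: mult_right_mono\<close>)
  then have 1: "(LBINT x. (U x)^3) - 216 * (LBINT x. V x * (V x * \<bar>W x\<bar>)) \<le> 18 * m * ((LBINT x. U x * (U x - 3 * V x)) - 12 * (LBINT x. V x * \<bar>W x\<bar>))"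
    using peak_dev_integrable integral_weighted_peak_dev integral_peak_dev by simp
  have "2 * ((\<Sum>i\<le>(0::nat). 1/2 * m * (V \<xi>)\<^sup>2 - 1/3 * (V \<xi>)^3) - (\<Sum>i<(0::nat). 1/2 * m * (V \<xi>)\<^sup>2 - 1/3 * (V \<xi>)^3)) \<le> (LBINT x. \<bar>m * (V x * W x) - V x * (V x * W x)\<bar>)"
  proof (rule total_variation_ge_alternating_sum[where F="\<lambda>x. 1/2 * m * (V x)\<^sup>2 - 1/3 * (V x)^3"])
    show "((\<lambda>x. 1/2 * m * (V x)\<^sup>2 - 1/3 * (V x)^3) has_real_derivative m * (V x * W x) - V x * (V x * W x)) (at x)" for x
      by (rule derivative_eq_intros V_der refl)+ (simp add: power2_eq_square algebra_simps)
    show "continuous_on UNIV (\<lambda>x. m * (V x * W x) - V x * (V x * W x))" by (intro continuous_intros VW_cont)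
    show "integrable lborel (\<lambda>x. 1/2 * m * (V x)\<^sup>2 - 1/3 * (V x)^3)"
      using ib1[of V V] ib2[of V M V V, OF PQVW_meas(3) VW_bd(1)] by (simp add: power2_eq_square power3_eq_cube)
    show "integrable lborel (\<lambda>x. m * (V x * W x) - V x * (V x * W x))"
      using ib1[of V W] ib2[of V M V W, OF PQVW_meas(3) VW_bd(1)] by (simp add: mult.assoc)
  qed simp
  then have "m ^ 3 / 3 \<le> (LBINT x. \<bar>m * (V x * W x) - V x * (V x * W x)\<bar>)"
    by (simp add: m_def power2_eq_square power3_eq_cube)
  also have "\<dots> = (LBINT x. m * (V x * \<bar>W x\<bar>) - V x * (V x * \<bar>W x\<bar>))"
  proof (rule Bochner_Integration.integral_cong[OF refl])
    fix x
    have "\<bar>m * (V x * W x) - V x * (V x * W x)\<bar> = \<bar>(m - V x) * V x * W x\<bar>" by (simp add: algebra_simps)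
    also have "\<dots> = (m - V x) * V x * \<bar>W x\<bar>" using mx[of x] nn[of x] by (simp add: abs_mult m_def)
    finally show "\<bar>m * (V x * W x) - V x * (V x * W x)\<bar> = m * (V x * \<bar>W x\<bar>) - V x * (V x * \<bar>W x\<bar>)" by (simp add: algebra_simps)
  qed
  also have "\<dots> = m * (LBINT x. V x * \<bar>W x\<bar>) - (LBINT x. V x * (V x * \<bar>W x\<bar>))" using i by simp
  finally show ?thesis using 1 unfolding m_def[symmetric] by (simp add: algebra_simps)
qed

end

section \<open>Ordered values and numerical bounds\<close>

lemma sum_ordered_values:
  shows "(\<Sum>i=1..length ys. (ordered_value f ys i)\<^sup>2) = (\<Sum>i<length ys. (f (ys ! i))\<^sup>2)"
proof -
  define l where "l = rev (sort (map f ys))"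
  have len: "length l = length ys" by (simp add: l_def)
  have "mset (map (\<lambda>v. v\<^sup>2) l) = mset (map (\<lambda>v. v\<^sup>2) (map f ys))" by (simp only: l_def mset_map mset_rev mset_sort)
  then have eq: "sum_list (map (\<lambda>v. v\<^sup>2) l) = sum_list (map (\<lambda>v. v\<^sup>2) (map f ys))" by (metis sum_mset_sum_list)
  have "(\<Sum>i=1..length ys. (ordered_value f ys i)\<^sup>2) = (\<Sum>i<length ys. (l ! i)\<^sup>2)"
    unfolding ordered_value_def l_def[symmetric] by (rule sum.reindex_bij_witness[where i=Suc and j="\<lambda>i. i - 1"]) auto
  also have "\<dots> = sum_list (map (\<lambda>v. v\<^sup>2) l)" using len by (simp add: sum_list_sum_nth atLeast0LessThan)
  also have "\<dots> = (\<Sum>i<length ys. (f (ys ! i))\<^sup>2)" unfolding eq by (simp add: sum_list_sum_nth atLeast0LessThan)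
  finally show ?thesis .
qed

lemma first_ordered_value:
  assumes "x \<in> set xs" "\<And>y. f y \<le> f x" shows "ordered_value f xs 1 = f x"
proof -
  have ne: "xs \<noteq> []" using assms(1) by auto
  have sn: "sort (map f xs) \<noteq> []" using ne by (metis length_0_conv length_map length_sort)
  have "ordered_value f xs 1 = last (sort (map f xs))"
    unfolding ordered_value_def using sn hd_conv_nth[of "rev (sort (map f xs))"] by (simp add: hd_rev)
  also have "\<dots> = Max (set (map f xs))"
  proof (rule Max_eqI[symmetric])
    show "last (sort (map f xs)) \<in> set (map f xs)" using last_in_set[OF sn] by simp
    fix y assume "y \<in> set (map f xs)"
    then obtain i where i: "i < length (sort (map f xs))" "sort (map f xs) ! i = y" by (metis in_set_conv_nth set_sort)
    have "sort (map f xs) ! i \<le> sort (map f xs) ! (length xs - 1)" using i(1) by (intro sorted_nth_mono) auto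
    then show "y \<le> last (sort (map f xs))" using i sn by (simp add: last_conv_nth)
  qed simp
  also have "\<dots> = f x" by (rule Max_eqI) (use assms in auto)
  finally show ?thesis .
qed

text \<open>With the exact values of the peakon the hypothesis \<open>main\<close> is \<open>(m - c/6)\<^sup>2 (m + c/3) \<le> 0\<close>; the excess of the energies is
  of order \<open>c\<^sup>2 \<epsilon> (m + c/3)\<close>, and the common factor cancels.\<close>

lemma maximum_near_peakon_value:
  fixes c \<epsilon> m e2 e3 :: real
  assumes c: "0 < c" and e: "0 < \<epsilon>" and m: "0 \<le> m"
    and e2: "e2 \<le> c\<^sup>2 / 3 + 17/10 * c\<^sup>2 * \<epsilon>" and e3: "2 * c ^ 3 / 3 - c ^ 3 * \<epsilon> \<le> e3"
    and main: "e3 \<le> 18 * m * e2 - 72 * m ^ 3"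
  shows "\<bar>m - c / 6\<bar> \<le> c * sqrt \<epsilon>"
proof -
  have me: "18 * m * e2 \<le> 18 * m * (c\<^sup>2 / 3 + 17/10 * c\<^sup>2 * \<epsilon>)" using m e2 by (intro mult_left_mono) auto
  have "72 * ((m - c / 6)\<^sup>2 * (m + c / 3)) \<le> 306/10 * m * (c\<^sup>2 * \<epsilon>) + c ^ 3 * \<epsilon>"
  proof -
    have "72 * ((m - c / 6)\<^sup>2 * (m + c / 3)) = 72 * m ^ 3 - 6 * (m * c\<^sup>2) + 2 / 3 * c ^ 3"
      by (simp add: power2_eq_square power3_eq_cube field_simps)
    moreover have "18 * m * (c\<^sup>2 / 3 + 17/10 * c\<^sup>2 * \<epsilon>) = 6 * (m * c\<^sup>2) + 306/10 * m * (c\<^sup>2 * \<epsilon>)"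
      by (simp add: field_simps)
    ultimately show ?thesis using me main e3 by linarith
  qed
  also have "\<dots> \<le> 72 * (c\<^sup>2 * \<epsilon> * (m + c / 3))"
  proof -
    have "0 \<le> m * (c\<^sup>2 * \<epsilon>)" "0 \<le> c ^ 3 * \<epsilon>" using m c e by simp_all
    moreover have "72 * (c\<^sup>2 * \<epsilon> * (m + c / 3)) = 72 * (m * (c\<^sup>2 * \<epsilon>)) + 24 * (c ^ 3 * \<epsilon>)" by (simp add: power2_eq_square power3_eq_cube algebra_simps)
    ultimately show ?thesis by linarith
  qed
  finally have "(m - c / 6)\<^sup>2 * (m + c / 3) \<le> c\<^sup>2 * \<epsilon> * (m + c / 3)" by simp
  then have "(m - c / 6)\<^sup>2 \<le> c\<^sup>2 * \<epsilon>" using m c by (simp add: mult_le_cancel_right)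
  then have "(m - c / 6)\<^sup>2 \<le> (c * sqrt \<epsilon>)\<^sup>2" using e by (simp add: power_mult_distrib)
  then have "\<bar>m - c / 6\<bar> \<le> \<bar>c * sqrt \<epsilon>\<bar>" by (simp only: abs_le_square_iff)
  then show ?thesis using c e by simp
qed

section \<open>Solutions of the Degasperis-Procesi equation\<close>

text \<open>More than half a derivative makes the transform integrable, so that the inversion formula and the inequality \<open>\<parallel>Ff\<parallel> \<le> \<parallel>f\<parallel>\<close> apply, the
  latter to the inverse transform.\<close>

lemma l2_le_Hs_norm:
  assumes f: "f \<in> Hs \<sigma>" and s: "1 / 2 < \<sigma>"
  shows "l2 f \<le> Hs_norm \<sigma> f"
proof -
  have fL: "f \<in> L2" and L: "weighted \<sigma> f \<in> L2" using f by (auto simp: Hs_iff)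
  define k where "k \<xi> = complex_of_real ((1 + \<xi>\<^sup>2) powr (- \<sigma> / 2))" for \<xi> :: real
  have "(norm (k \<xi>))\<^sup>2 = (1 + \<xi>\<^sup>2) powr (- \<sigma>)" for \<xi>
    by (simp add: k_def power2_eq_square powr_add[symmetric])
  moreover have "k \<in> borel_measurable lborel" unfolding k_def by measurable
  ultimately have K: "k \<in> L2" using integrable_weight[OF s] by (simp add: L2_def)
  have e: "k \<xi> * weighted \<sigma> f \<xi> = fourier f \<xi>" for \<xi>
  proof -
    have "(1 + \<xi>\<^sup>2) powr (- \<sigma> / 2) * (1 + \<xi>\<^sup>2) powr (\<sigma> / 2) = (1 + \<xi>\<^sup>2) powr (- \<sigma> / 2 + \<sigma> / 2)" by (rule powr_add[symmetric])
    also have "\<dots> = 1" using add_pos_nonneg[OF zero_less_one zero_le_power2[of \<xi>]] by simp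
    finally show ?thesis by (simp add: k_def weighted_def mult.assoc[symmetric] of_real_mult[symmetric] del: of_real_mult)
  qed
  have i: "integrable lborel (fourier f)" using L2_mult_integrable[OF K L] unfolding e .
  have "l2 f = l2 (\<lambda>x. Re (IFT (fourier f) x))"
  proof (rule L2_cong_AE(2)[OF Re_IFT_L2(1)[OF i fourier_L2[OF fL]]])
    show "AE x in lborel. Re (IFT (fourier f) x) = f x"
      using fourier_inversion[OF fL i] by eventually_elim (metis Re_complex_of_real)
  qed (use fL in \<open>auto simp: L2_def\<close>)
  also have "\<dots> \<le> l2 (fourier f)" by (rule Re_IFT_L2(2)[OF i fourier_L2[OF fL]])
  also have "\<dots> \<le> Hs_norm \<sigma> f" by (rule l2_fourier_le[OF f]) (use s in simp)
  finally show ?thesis .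
qed

lemma Hs_continuous_mono:
  assumes "Hs_continuous s u" "\<sigma> \<le> s" shows "Hs_continuous \<sigma> u"
  unfolding Hs_continuous_def
proof (intro allI impI conjI)
  fix t :: real assume t: "0 \<le> t"
  have H: "u r \<in> Hs s" if "0 \<le> r" for r using assms(1) that by (auto simp: Hs_continuous_def)
  show "u t \<in> Hs \<sigma>" by (rule Hs_mono(1)[OF H[OF t] assms(2)])
  have lim: "((\<lambda>r. Hs_norm s (\<lambda>x. u r x - u t x)) \<longlongrightarrow> 0) (at t within {0..})" using assms(1) t by (auto simp: Hs_continuous_def)
  have ev: "\<forall>\<^sub>F r in at t within {0..}. 0 \<le> r" by (auto simp: eventually_at_filter)
  show "((\<lambda>r. Hs_norm \<sigma> (\<lambda>x. u r x - u t x)) \<longlongrightarrow> 0) (at t within {0..})"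
  proof (rule tendsto_sandwich[OF _ _ tendsto_const lim])
    show "\<forall>\<^sub>F r in at t within {0..}. Hs_norm \<sigma> (\<lambda>x. u r x - u t x) \<le> Hs_norm s (\<lambda>x. u r x - u t x)"
      using ev by eventually_elim (rule Hs_mono(2)[OF Hs_diff[OF H H[OF t]] assms(2)])
  qed (simp add: Hs_norm_eq)
qed

lemma Hs_time_derivative_l2:
  assumes d: "Hs_time_derivative \<sigma> u u'" and s: "1 / 2 < \<sigma>" and t: "0 \<le> t"
  shows "((\<lambda>r. l2 (\<lambda>x. (u r x - u t x) / (r - t) - u' t x)) \<longlongrightarrow> 0) (at t within {0..})"
proof -
  have H: "u r \<in> Hs \<sigma>" "u' r \<in> Hs \<sigma>" if "0 \<le> r" for r using d that by (auto simp: Hs_time_derivative_def)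
  have lim: "((\<lambda>r. Hs_norm \<sigma> (\<lambda>x. (u r x - u t x) / (r - t) - u' t x)) \<longlongrightarrow> 0) (at t within {0..})"
    using d t by (auto simp: Hs_time_derivative_def)
  have ev: "\<forall>\<^sub>F r in at t within {0..}. 0 \<le> r" by (auto simp: eventually_at_filter)
  show ?thesis
  proof (rule tendsto_sandwich[OF _ _ tendsto_const lim])
    show "\<forall>\<^sub>F r in at t within {0..}. l2 (\<lambda>x. (u r x - u t x) / (r - t) - u' t x) \<le> Hs_norm \<sigma> (\<lambda>x. (u r x - u t x) / (r - t) - u' t x)"
      using ev
    proof eventually_elim
      case (elim r)
      have "(\<lambda>x. 1 / (r - t) * (u r x - u t x) + (-1) * u' t x) \<in> Hs \<sigma>"
        by (rule Hs_linear[OF Hs_diff[OF H(1)[OF elim] H(1)[OF t]] H(2)[OF t]])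
      then show ?case by (intro l2_le_Hs_norm[OF _ s]) simp
    qed
  qed simp
qed

lemma DP_solution_flow:
  assumes sol: "DP_solution s u\<^sub>0 u" and s: "3 / 2 < s"
  obtains ut where "dp_flow (min s 2) u ut"
proof -
  define \<sigma> where "\<sigma> = min s 2"
  have s1: "3 / 2 < \<sigma>" and s2: "\<sigma> \<le> 2" and ss: "\<sigma> \<le> s" using s by (auto simp: \<sigma>_def)
  obtain u' where Hc: "Hs_continuous s u" and d: "Hs_time_derivative (s - 1) u u'"
    and eqn: "\<And>t. 0 < t \<Longrightarrow> \<exists>w q. has_weak_derivative (u t) w \<and> has_weak_derivative (conv (\<lambda>x. 1/2 * exp (- \<bar>x\<bar>)) (\<lambda>x. 3/2 * (u t x)\<^sup>2)) q \<and> (AE x in lborel. u' t x + u t x * w x + q x = 0)"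
    using sol unfolding DP_solution_def by blast
  have "dp_flow \<sigma> u u'"
  proof
    show c: "Hs_continuous \<sigma> u" by (rule Hs_continuous_mono[OF Hc ss])
    show "u' t \<in> L2" if "0 \<le> t" for t using d that by (auto simp: Hs_time_derivative_def Hs_iff)
    show "((\<lambda>r. l2 (\<lambda>x. (u r x - u t x) / (r - t) - u' t x)) \<longlongrightarrow> 0) (at t within {0..})" if "0 \<le> t" for t
      by (rule Hs_time_derivative_l2[OF d _ that]) (use s in simp)
    fix t :: real assume t: "0 < t"
    have f: "u t \<in> Hs \<sigma>" using c t by (auto simp: Hs_continuous_def)
    have m: "u t \<in> borel_measurable borel" using f by (auto simp: Hs_iff L2_def)
    interpret profile "rep (u t)" "drep (u t)" "Cs \<sigma> * Hs_norm \<sigma> (u t)" by (rule profile_rep[OF f s1])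
    obtain w q where w: "has_weak_derivative (u t) w"
      and q: "has_weak_derivative (conv (\<lambda>x. 1/2 * exp (- \<bar>x\<bar>)) (\<lambda>x. 3/2 * (u t x)\<^sup>2)) q"
      and e: "AE x in lborel. u' t x + u t x * w x + q x = 0" using eqn[OF t] by blast
    have ae: "AE x in lborel. u t x = rep (u t) x" by (rule rep_props(1)[OF f s1])
    have wd: "AE x in lborel. w x = drep (u t) x" by (rule weak_derivative_eq[OF w ae m U_der K_cont])
    have ae2: "AE x in lborel. 3/2 * (u t x)\<^sup>2 = f2 x" using ae by eventually_elim (simp add: f2_def)
    have "conv (\<lambda>x. 1/2 * exp (- \<bar>x\<bar>)) (\<lambda>x. 3/2 * (u t x)\<^sup>2) x = P x" for x
    proof -
      have "conv (\<lambda>x. 1/2 * exp (- \<bar>x\<bar>)) (\<lambda>x. 3/2 * (u t x)\<^sup>2) x = conv (\<lambda>x. 1/2 * exp (- \<bar>x\<bar>)) f2 x"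
        by (rule conv_cong_AE[OF ae2]) (use m in auto)
      also have "\<dots> = P x" using conv_exp_eq_res[of 1 f2 _ x, OF _ UK_meas(3) f2_bd] by (simp add: P_def)
      finally show ?thesis .
    qed
    then have cv: "conv (\<lambda>x. 1/2 * exp (- \<bar>x\<bar>)) (\<lambda>x. 3/2 * (u t x)\<^sup>2) = P" by (rule ext)
    have "AE x in lborel. q x = Q x"
      by (rule weak_derivative_eq[OF q[unfolded cv] _ PQVW_meas(1) P_der PQ_cont(2)]) simp
    then have "AE x in lborel. u' t x = - (rep (u t) x * drep (u t) x + Q x)" using e wd ae by eventually_elim simp
    then show "AE x in lborel. u' t x = - (rep (u t) x * drep (u t) x + dres 1 (\<lambda>x. 3/2 * (rep (u t) x)\<^sup>2) x)"
      by (simp add: Q_def f2_def[abs_def])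
  qed (use s1 s2 in auto)
  then show ?thesis using that by (simp add: \<sigma>_def)
qed

context dp_flow
begin

lemma momentum_nonneg_at:
  assumes f: "momentum_nonneg_finite_measure f" and ae: "AE x in lborel. u 0 x = f x" and fm: "f \<in> L2" and t: "0 \<le> t"
  shows "profile.momentum_nonneg (rep (u t))"
  unfolding profile.momentum_nonneg_def[OF prof[OF t]]
proof (intro allI impI)
  fix \<psi> :: "real \<Rightarrow> real" assume \<psi>: "test_function \<psi>" "\<forall>x. 0 \<le> \<psi> x"
  have init: "0 \<le> Y 0 \<eta>" if \<eta>: "test_function \<eta>" "\<And>x. 0 \<le> \<eta> x" for \<eta>
  proof -
    obtain \<mu> :: "real measure" where \<mu>: "\<And>\<phi>. test_function \<phi> \<Longrightarrow> (LBINT x. f x * (\<phi> x - (deriv ^^ 2) \<phi> x)) = (\<integral>x. \<phi> x \<partial>\<mu>)"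
      using f unfolding momentum_nonneg_finite_measure_def by blast
    have [measurable]: "\<eta> \<in> borel_measurable borel" "deriv (deriv \<eta>) \<in> borel_measurable borel"
      by (intro test_function_measurable test_function_deriv \<eta>)+
    have r: "AE x in lborel. rep (u 0) x = f x" using rep_props(1)[OF uH s1, of 0] ae by auto
    have "Y 0 \<eta> = (LBINT x. f x * (\<eta> x - deriv (deriv \<eta>) x))" unfolding Y_def
      by (rule L2_integral_cong_AE[OF r]) (use fm rep_L2[of 0] in \<open>auto simp: L2_def\<close>)
    also have "\<dots> = (\<integral>x. \<eta> x \<partial>\<mu>)" using \<mu>[OF \<eta>(1)] by (simp add: numeral_2_eq_2)
    also have "0 \<le> \<dots>" using \<eta>(2) by (intro Bochner_Integration.integral_nonneg) auto
    finally show ?thesis .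
  qed
  have "0 \<le> Y t \<psi>" by (rule momentum_nonneg_persists[OF init t \<psi>(1) \<psi>(2)[rule_format]])
  then show "0 \<le> (LBINT x. rep (u t) x * (\<psi> x - deriv (deriv \<psi>) x))" by (simp add: Y_def)
qed

end

lemma powr_quarter: assumes "0 < (\<epsilon>::real)" shows "(\<epsilon> powr (1/4))\<^sup>2 = sqrt \<epsilon>"
  using assms by (simp add: powr_half_sqrt[symmetric] power2_eq_square powr_add[symmetric])

lemma orbit_distance_bounds:
  fixes c \<epsilon> m e2 :: real
  assumes c: "0 < c" and e: "0 < \<epsilon>" "\<epsilon> < 1/2"
    and e2: "e2 \<le> c\<^sup>2 / 3 + 17/10 * c\<^sup>2 * \<epsilon>" and mc: "\<bar>m - c / 6\<bar> \<le> c * sqrt \<epsilon>"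
  shows "sqrt (e2 - 4 * c * m + c\<^sup>2 / 3) \<le> 5/2 * c * \<epsilon> powr (1/4)" and "e2 / 12 - m\<^sup>2 < 2 * c\<^sup>2 * sqrt \<epsilon>"
proof -
  define q where "q = c\<^sup>2 * sqrt \<epsilon>"
  have q0: "0 < q" using c e by (simp add: q_def)
  have "\<epsilon> = sqrt \<epsilon> * sqrt \<epsilon>" using e by simp
  also have "\<dots> \<le> sqrt \<epsilon> * 1" using e by (intro mult_left_mono) auto
  finally have "c\<^sup>2 * \<epsilon> \<le> q" unfolding q_def by (intro mult_left_mono) auto
  then have e2': "e2 \<le> c\<^sup>2 / 3 + 17/10 * q" using e2 by simp
  have "c * (c / 6 - m) \<le> c * (c * sqrt \<epsilon>)" using mc c by (intro mult_left_mono) auto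
  then have cm: "c\<^sup>2 / 6 - c * m \<le> q" by (simp add: q_def power2_eq_square algebra_simps)
  have "e2 - 4 * c * m + c\<^sup>2 / 3 \<le> 25/4 * q" using e2' cm q0 by simp
  also have "25/4 * q = (5/2 * c * \<epsilon> powr (1/4))\<^sup>2" unfolding power_mult_distrib powr_quarter[OF e(1)] q_def by (simp add: power2_eq_square)
  finally show "sqrt (e2 - 4 * c * m + c\<^sup>2 / 3) \<le> 5/2 * c * \<epsilon> powr (1/4)"
    using c e by (intro real_le_lsqrt) auto
  have "0 \<le> (m - c / 6)\<^sup>2" by simp
  then have "c * m / 3 - c\<^sup>2 / 36 \<le> m\<^sup>2" by (simp add: power2_eq_square field_simps)
  then show "e2 / 12 - m\<^sup>2 < 2 * c\<^sup>2 * sqrt \<epsilon>" using e2' cm q0 unfolding mult.assoc q_def[symmetric] by simp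
qed

theorem theorem1:
  fixes c \<epsilon> s :: real
    and u\<^sub>0 :: "real \<Rightarrow> real"
    and u v :: "real \<Rightarrow> real \<Rightarrow> real"
  assumes "0 < c"
    and "0 < \<epsilon>" and "\<epsilon> < 1/2"
    and "s > 3/2" and "u\<^sub>0 \<in> Hs s"
    and "momentum_nonneg_finite_measure u\<^sub>0"
    and "normX (\<lambda>x. u\<^sub>0 x - c * peakon x) < c * \<epsilon>"
    and "\<bar>E3 u\<^sub>0 - E3 (\<lambda>x. c * peakon x)\<bar> < c ^ 3 * \<epsilon>"
    and "DP_solution s u\<^sub>0 u"
    and "\<And>t. v t = resolvent4 (u t)"
  shows "(\<forall>t\<ge>0. \<exists>\<xi>. \<forall>x. v t x \<le> v t \<xi>) \<and>
    (\<forall>\<xi>\<^sub>1 :: real \<Rightarrow> real. (\<forall>t\<ge>0. \<forall>x. v t x \<le> v t (\<xi>\<^sub>1 t)) \<longrightarrow>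
       (SUP t\<in>{0..}. ereal (normX (\<lambda>x. u t x - c * peakon (x - \<xi>\<^sub>1 t))))
         < ereal (3 * c * \<epsilon> powr (1/4)) \<and>
       (\<forall>t\<ge>0. \<bar>v t (\<xi>\<^sub>1 t) - c / 6\<bar> \<le> c * sqrt (2 * \<epsilon>)) \<and>
       (\<forall>t\<ge>0. \<forall>xs ys. alternating_extrema (v t) xs ys \<longrightarrow>
          (\<Sum>i=2..length xs. (ordered_value (v t) xs i)\<^sup>2 - (ordered_value (v t) ys (i - 1))\<^sup>2)
            < 2 * c\<^sup>2 * sqrt \<epsilon>))"
proof -
  note c = \<open>0 < c\<close> and e = \<open>0 < \<epsilon>\<close> \<open>\<epsilon> < 1/2\<close>
  obtain ut where "dp_flow (min s 2) u ut" by (rule DP_solution_flow[OF \<open>DP_solution s u\<^sub>0 u\<close> \<open>s > 3/2\<close>])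
  then interpret dp_flow "min s 2" u ut .
  have u0L: "u\<^sub>0 \<in> L2" using \<open>u\<^sub>0 \<in> Hs s\<close> by (simp add: Hs_iff)
  have [measurable]: "u\<^sub>0 \<in> borel_measurable borel" "u 0 \<in> borel_measurable borel" using u0L uL[of 0] by (auto simp: L2_def)
  have ae0: "AE x in lborel. u 0 x = u\<^sub>0 x" using \<open>DP_solution s u\<^sub>0 u\<close> by (simp add: DP_solution_def)
  have "E2 (u 0) = E2 u\<^sub>0"
    unfolding E2_alt[of u\<^sub>0] by (rule E2_cong_fourier[OF fourier_cong_AE[OF ae0]]) (use u0L uL[of 0] fourier_measurable in auto)
  moreover have "E3 (u 0) = E3 u\<^sub>0" unfolding E3_def by (rule integral_cong_AE) (use ae0 in auto)
  ultimately have E: "E2 (u t) = E2 u\<^sub>0" "E3 (u t) = E3 u\<^sub>0" if "0 \<le> t" for t using E2_conserved[OF that] E3_conserved[OF that] by simp_all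
  \<comment> \<open>The excess of the energy is at most \<open>c\<^sup>2 \<epsilon> (2/\<surd>3 + \<epsilon>)\<close>, and \<open>6/5 + 1/2 = 17/10\<close>.\<close>
  have sqrt3: "6/5 \<ge> 2 / sqrt 3"
  proof -
    have "5/3 \<le> sqrt 3" by (rule real_le_rsqrt) (simp add: power2_eq_square)
    then show ?thesis by (simp add: pos_divide_le_eq)
  qed
  have "c\<^sup>2 * \<epsilon> * (2 / sqrt 3 + \<epsilon>) \<le> c\<^sup>2 * \<epsilon> * (17/10)" using c e sqrt3 by (intro mult_left_mono) auto
  then have e2: "E2 u\<^sub>0 \<le> c\<^sup>2 / 3 + 17/10 * c\<^sup>2 * \<epsilon>"
    using E2_le_near_peakon[OF u0L c \<open>normX (\<lambda>x. u\<^sub>0 x - c * peakon x) < c * \<epsilon>\<close> e(1)] by simp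
  have e3: "2 * c ^ 3 / 3 - c ^ 3 * \<epsilon> \<le> E3 u\<^sub>0"
    using \<open>\<bar>E3 u\<^sub>0 - E3 (\<lambda>x. c * peakon x)\<bar> < c ^ 3 * \<epsilon>\<close> unfolding E3_scaled_peakon by linarith
  have key: "(\<exists>\<xi>. \<forall>x. v t x \<le> v t \<xi>) \<and> (\<forall>\<xi>. (\<forall>x. v t x \<le> v t \<xi>) \<longrightarrow>
      normX (\<lambda>x. u t x - c * peakon (x - \<xi>)) \<le> 5/2 * c * \<epsilon> powr (1/4) \<and> \<bar>v t \<xi> - c / 6\<bar> \<le> c * sqrt \<epsilon> \<and>
      (\<forall>xs ys. alternating_extrema (v t) xs ys \<longrightarrow>
        (\<Sum>i=2..length xs. (ordered_value (v t) xs i)\<^sup>2 - (ordered_value (v t) ys (i - 1))\<^sup>2) < 2 * c\<^sup>2 * sqrt \<epsilon>))"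
    if t: "0 \<le> t" for t
  proof -
    interpret p: profile "rep (u t)" "drep (u t)" "Cs (min s 2) * Hs_norm (min s 2) (u t)" by (rule prof[OF t])
    have pos: "p.momentum_nonneg" by (rule momentum_nonneg_at[OF \<open>momentum_nonneg_finite_measure u\<^sub>0\<close> ae0 u0L t])
    note UV = p.U_le_V_W[OF pos]
    have v: "v t = p.V" unfolding \<open>\<And>t. v t = resolvent4 (u t)\<close> p.V_def by (rule resolvent4_rep[OF uH[OF t] s1])
    have E2p: "(LBINT x. rep (u t) x * (rep (u t) x - 3 * p.V x)) = E2 u\<^sub>0"
      unfolding E(1)[OF t, symmetric] E2_eq_rep[OF t] Z_rep[OF uH[OF t] s1] p.V_def ..
    have E3p: "(LBINT x. (rep (u t) x)^3) = E3 u\<^sub>0"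
      unfolding E(2)[OF t, symmetric] unfolding E3_def
      by (rule integral_cong_AE) (use rep_props(1)[OF uH[OF t] s1] uL[OF t] in \<open>auto simp: L2_def elim: eventually_mono\<close>)
    have "normX (\<lambda>x. u t x - c * peakon (x - \<xi>)) \<le> 5/2 * c * \<epsilon> powr (1/4) \<and> \<bar>v t \<xi> - c / 6\<bar> \<le> c * sqrt \<epsilon> \<and>
      (\<forall>xs ys. alternating_extrema (v t) xs ys \<longrightarrow>
        (\<Sum>i=2..length xs. (ordered_value (v t) xs i)\<^sup>2 - (ordered_value (v t) ys (i - 1))\<^sup>2) < 2 * c\<^sup>2 * sqrt \<epsilon>)"
      if mx: "\<forall>x. v t x \<le> v t \<xi>" for \<xi>
    proof -
      have main: "E3 u\<^sub>0 \<le> 18 * v t \<xi> * E2 u\<^sub>0 - 72 * v t \<xi> ^ 3"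
        using p.cubic_le_energy_max[of \<xi>, OF UV] mx unfolding E2p E3p v by simp
      have m0: "0 \<le> v t \<xi>" unfolding v by (rule UV(2))
      have mc: "\<bar>v t \<xi> - c / 6\<bar> \<le> c * sqrt \<epsilon>" by (rule maximum_near_peakon_value[OF c e(1) m0 e2 e3 main])
      note B = orbit_distance_bounds[OF c e e2 mc]
      have "normX (\<lambda>x. u t x - c * peakon (x - \<xi>)) \<le> 5/2 * c * \<epsilon> powr (1/4)"
        using B(1) unfolding normX_def E2_diff_peakon[OF uL[OF t] Hs_fourier_integrable(1)[OF uH[OF t] s1]] E(1)[OF t] \<open>\<And>t. v t = resolvent4 (u t)\<close> .
      moreover have "(\<Sum>i=2..length xs. (ordered_value (v t) xs i)\<^sup>2 - (ordered_value (v t) ys (i - 1))\<^sup>2) < 2 * c\<^sup>2 * sqrt \<epsilon>"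
        if ex: "alternating_extrema (v t) xs ys" for xs ys
      proof -
        have len: "length xs = Suc (length ys)" and alt: "\<And>i. i < length ys \<Longrightarrow> xs ! i < ys ! i \<and> ys ! i < xs ! Suc i"
          and mem: "\<xi> \<in> set xs"
          using ex mx by (auto simp: alternating_extrema_def local_max_point_def)
        have "(\<Sum>i=2..length xs. (ordered_value (v t) ys (i - 1))\<^sup>2) = (\<Sum>i=1..length ys. (ordered_value (v t) ys i)\<^sup>2)"
          unfolding len by (rule sum.reindex_bij_witness[where i=Suc and j="\<lambda>i. i - 1"]) auto
        also have "\<dots> = (\<Sum>i<length ys. (v t (ys ! i))\<^sup>2)" by (rule sum_ordered_values)
        finally have sy: "(\<Sum>i=2..length xs. (ordered_value (v t) ys (i - 1))\<^sup>2) = (\<Sum>i<length ys. (v t (ys ! i))\<^sup>2)" .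
        have "(\<Sum>i=1..length xs. (ordered_value (v t) xs i)\<^sup>2) = (v t \<xi>)\<^sup>2 + (\<Sum>i=2..length xs. (ordered_value (v t) xs i)\<^sup>2)"
        proof -
          have split: "{1..length xs} = insert 1 {2..length xs}" using len by auto
          have "ordered_value (v t) xs 1 = v t \<xi>" by (rule first_ordered_value[OF mem]) (use mx in simp)
          then show ?thesis unfolding split by simp
        qed
        then have sx: "(\<Sum>i=2..length xs. (ordered_value (v t) xs i)\<^sup>2) = (\<Sum>i\<le>length ys. (v t (xs ! i))\<^sup>2) - (v t \<xi>)\<^sup>2"
          unfolding sum_ordered_values by (simp add: len lessThan_Suc_atMost)
        have "(\<Sum>i\<le>length ys. (v t (xs ! i))\<^sup>2) - (\<Sum>i<length ys. (v t (ys ! i))\<^sup>2) \<le> E2 u\<^sub>0 / 12"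
          using p.alternating_sum_le_energy[of "length ys" "\<lambda>i. xs ! i" "\<lambda>i. ys ! i", OF UV(2) alt] unfolding E2p v .
        then show ?thesis unfolding sum_subtractf sx sy using B(2) by linarith
      qed
      ultimately show ?thesis using mc by blast
    qed
    then show ?thesis using p.V_attains_max[OF UV(2)] unfolding v by blast
  qed
  show ?thesis
  proof (intro conjI allI impI)
    fix t :: real assume "0 \<le> t"
    then show "\<exists>\<xi>. \<forall>x. v t x \<le> v t \<xi>" using key by blast
  next
    fix \<xi>\<^sub>1 :: "real \<Rightarrow> real" assume mx: "\<forall>t\<ge>0. \<forall>x. v t x \<le> v t (\<xi>\<^sub>1 t)"
    \<comment> \<open>A constant below 3 for each time keeps the inequality strict for the supremum.\<close>
    have "(SUP t\<in>{0..}. ereal (normX (\<lambda>x. u t x - c * peakon (x - \<xi>\<^sub>1 t)))) \<le> ereal (5/2 * c * \<epsilon> powr (1/4))"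
    proof (rule SUP_least)
      fix t :: real assume "t \<in> {0..}"
      then have t: "0 \<le> t" by simp
      have "normX (\<lambda>x. u t x - c * peakon (x - \<xi>\<^sub>1 t)) \<le> 5/2 * c * \<epsilon> powr (1/4)" using key[OF t] mx t by blast
      then show "ereal (normX (\<lambda>x. u t x - c * peakon (x - \<xi>\<^sub>1 t))) \<le> ereal (5/2 * c * \<epsilon> powr (1/4))" by (simp only: ereal_less_eq)
    qed
    also have "ereal (5/2 * c * \<epsilon> powr (1/4)) < ereal (3 * c * \<epsilon> powr (1/4))" using c e by simp
    finally show "(SUP t\<in>{0..}. ereal (normX (\<lambda>x. u t x - c * peakon (x - \<xi>\<^sub>1 t)))) < ereal (3 * c * \<epsilon> powr (1/4))" .
    fix t :: real assume t: "0 \<le> t"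
    have "sqrt \<epsilon> \<le> sqrt (2 * \<epsilon>)" using e by simp
    then have "c * sqrt \<epsilon> \<le> c * sqrt (2 * \<epsilon>)" using c by (intro mult_left_mono) auto
    moreover have "\<bar>v t (\<xi>\<^sub>1 t) - c / 6\<bar> \<le> c * sqrt \<epsilon>" using key[OF t] mx t by blast
    ultimately show "\<bar>v t (\<xi>\<^sub>1 t) - c / 6\<bar> \<le> c * sqrt (2 * \<epsilon>)" by linarith
    fix xs ys assume "alternating_extrema (v t) xs ys"
    then show "(\<Sum>i=2..length xs. (ordered_value (v t) xs i)\<^sup>2 - (ordered_value (v t) ys (i - 1))\<^sup>2) < 2 * c\<^sup>2 * sqrt \<epsilon>"
      using key[OF t] mx t by blast
  qed
qed

end
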